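(* Let $d\ge 1$ be an integer and let $0<\beta<+\infty$. For a real exponent $q>0$ set $$m_{\beta,q}=\inf\big\{\lambda_\beta(\Omega)\,T_\beta(\Omega)^q\ :\ \Omega\subset\mathbb{R}^d \text{ bounded open set with Lipschitz boundary},\ |\Omega|=1\big\}.$$ Then: \begin{itemize} \item for every $q>\frac{1}{d+1}$ we have $m_{\beta,q}=0$; \item for every $0<q\le\frac{1}{d+1}$ we have $m_{\beta,q}>0$. \end{itemize}
   Context: $|\Omega|$ denotes the Lebesgue measure of $\Omega$ and $\mathcal{H}^{d-1}$ the $(d-1)$-dimensional Hausdorff measure. Admissible sets $\Omega$ are bounded open subsets of $\mathbb{R}^d$ with Lipschitz boundary; they are not required to be connected (for $d=1$: finite unions of bounded open intervals with disjoint closures). For $u\in H^1(\Omega)$, the values of $u$ on $\partial\Omega$ are understood in the sense of traces. For $0<\beta<+\infty$, the first Robin eigenvalue of $\Omega$ is $$\lambda_\beta(\Omega)=\min\left\{\frac{\int_\Omega|\nabla u|^2\,dx+\beta\int_{\partial\Omega}u^2\,d\mathcal{H}^{d-1}}{\int_\Omega u^2\,dx}\ :\ u\in H^1(\Omega)\setminus\{0\}\right\},$$ i.e. the smallest $\lambda$ for which $-\Delta u=\lambda u$ in $\Omega$, $\partial_\nu u+\beta u=0$ on $\partial\Omega$ ($\nu$ the outward unit normal) has a nontrivial solution. The Robin torsional rigidity of $\Omega$ is $T_\beta(\Omega)=\int_\Omega w_\beta\,dx$, where $w_\beta\in H^1(\Omega)$ is the unique weak solution of $-\Delta w=1$ in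 $\Omega$, $\partial_\nu w+\beta w=0$ on $\partial\Omega$; equivalently $$T_\beta(\Omega)=\max\left\{\frac{\big(\int_\Omega u\,dx\big)^2}{\int_\Omega|\nabla u|^2\,dx+\beta\int_{\partial\Omega}u^2\,d\mathcal{H}^{d-1}}\ :\ u\in H^1(\Omega)\setminus\{0\}\right\}.$$ *)

theory Defs
  imports "HOL-Analysis.Analysis"
begin

section \<open>Hausdorff measure\<close>

text \<open>
  The \<^term>\<open>k\<close>-dimensional Hausdorff measure for an integer \<^term>\<open>k\<close>, with the usual normalisation
  by the volume of the unit ball of dimension \<^term>\<open>k\<close>. A nonempty set of diameter zero has weight 1
  for \<^term>\<open>k = 0\<close>, which gives the counting measure, so the empty set has to be treated
  separately. Covering sets are required to be bounded, since \<^const>\<open>diameter\<close> is meaningless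
  otherwise.
\<close>

definition hausdorff_weight :: "nat \<Rightarrow> 'a::metric_space set \<Rightarrow> ennreal" where
  "hausdorff_weight k C =
     (if C = {} then 0 else ennreal (unit_ball_vol (real k) * (diameter C / 2) ^ k))"

definition hausdorff_pre :: "nat \<Rightarrow> real \<Rightarrow> 'a::metric_space set \<Rightarrow> ennreal" where
  "hausdorff_pre k \<delta> A =
     (INF C \<in> {C :: nat \<Rightarrow> 'a set. A \<subseteq> (\<Union>i. C i) \<and> (\<forall>i. bounded (C i) \<and> diameter (C i) \<le> \<delta>)}.
        \<Sum>i. hausdorff_weight k (C i))"

definition hausdorff_outer :: "nat \<Rightarrow> 'a::metric_space set \<Rightarrow> ennreal" where
  "hausdorff_outer k A = (SUP \<delta>\<in>{0<..}. hausdorff_pre k \<delta> A)"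

definition hausdorff :: "nat \<Rightarrow> 'a::metric_space measure" where
  "hausdorff k = measure_of UNIV (sets borel) (hausdorff_outer k)"

lemma hausdorff_weight_empty [simp]: "hausdorff_weight k {} = 0"
  by (simp add: hausdorff_weight_def)

lemma hausdorff_pre_le:
  assumes "A \<subseteq> (\<Union>i. C i)" "\<And>i. bounded (C i)" "\<And>i. diameter (C i) \<le> \<delta>"
  shows "hausdorff_pre k \<delta> A \<le> (\<Sum>i. hausdorff_weight k (C i))"
  unfolding hausdorff_pre_def by (rule INF_lower) (use assms in auto)

lemma hausdorff_pre_empty: "0 \<le> \<delta> \<Longrightarrow> hausdorff_pre k \<delta> {} = 0"
  using hausdorff_pre_le[of "{}" "\<lambda>_. {}" \<delta> k] by simp

lemma hausdorff_pre_mono: "A \<subseteq> B \<Longrightarrow> hausdorff_pre k \<delta> A \<le> hausdorff_pre k \<delta> B"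
  unfolding hausdorff_pre_def by (rule INF_superset_mono) auto

lemma hausdorff_pre_antimono: "\<delta> \<le> \<epsilon> \<Longrightarrow> hausdorff_pre k \<epsilon> A \<le> hausdorff_pre k \<delta> A"
  unfolding hausdorff_pre_def by (rule INF_superset_mono) (auto intro: order_trans)

lemma hausdorff_pre_close:
  assumes "hausdorff_pre k \<delta> A < e"
  shows "\<exists>C. A \<subseteq> (\<Union>i. C i) \<and> (\<forall>i. bounded (C i) \<and> diameter (C i) \<le> \<delta>) \<and>
           (\<Sum>i. hausdorff_weight k (C i)) < e"
  using assms unfolding hausdorff_pre_def INF_less_iff by auto

lemma hausdorff_pre_UN_le: "hausdorff_pre k \<delta> (\<Union>n. A n) \<le> (\<Sum>n. hausdorff_pre k \<delta> (A n))"
proof (rule ennreal_le_epsilon)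
  let ?O = "hausdorff_pre k \<delta>"
  fix e :: real assume e: "0 < e" and fin: "(\<Sum>n. ?O (A n)) < top"
  then have *: "\<And>n. ?O (A n) < ?O (A n) + e * (1/2)^Suc n"
    by (auto simp add: less_top dest!: ennreal_suminf_lessD)
  have "\<forall>n. \<exists>C. A n \<subseteq> (\<Union>i. C i) \<and> (\<forall>i. bounded (C i) \<and> diameter (C i) \<le> \<delta>) \<and>
           (\<Sum>i. hausdorff_weight k (C i)) < ?O (A n) + e * (1/2)^Suc n"
    using hausdorff_pre_close[OF *] by blast
  then obtain B where B: "\<And>n. A n \<subseteq> (\<Union>i. B n i)"
    "\<And>n i. bounded (B n i)" "\<And>n i. diameter (B n i) \<le> \<delta>"
    "\<And>n. (\<Sum>i. hausdorff_weight k (B n i)) < ?O (A n) + e * (1/2)^Suc n"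
    by metis
  define C where "C = case_prod B o prod_decode"
  have "(\<Union>n. A n) \<subseteq> (\<Union>i. C i)"
    using B(1) by (auto simp add: C_def subset_eq) (metis prod.case prod_encode_inverse)
  then have "?O (\<Union>n. A n) \<le> (\<Sum>i. hausdorff_weight k (C i))"
    by (rule hausdorff_pre_le) (use B in \<open>auto simp: C_def split: prod.split\<close>)
  also have "\<dots> = (\<Sum>n. \<Sum>i. hausdorff_weight k (B n i))"
    using suminf_ennreal_2dimen[of "\<lambda>m. \<Sum>i. hausdorff_weight k (B m i)"
        "\<lambda>p. hausdorff_weight k (case_prod B p)"]
    by (simp add: C_def)
  also have "\<dots> \<le> (\<Sum>n. ?O (A n) + e * (1/2) ^ Suc n)"
    using B(4) by (intro suminf_le allI less_imp_le) auto
  also have "... = (\<Sum>n. ?O (A n)) + (\<Sum>n. ennreal e * ennreal ((1/2) ^ Suc n))"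
    using e by (subst suminf_add[symmetric])
      (auto simp del: ennreal_suminf_cmult simp add: ennreal_mult[symmetric])
  also have "\<dots> = (\<Sum>n. ?O (A n)) + e"
    unfolding ennreal_suminf_cmult
    by (subst suminf_ennreal_eq[OF zero_le_power power_half_series]) auto
  finally show "?O (\<Union>n. A n) \<le> (\<Sum>n. ?O (A n)) + e" .
qed

lemma hausdorff_pre_separated:
  fixes A B :: "'a::metric_space set"
  assumes sep: "\<And>x y. x \<in> A \<Longrightarrow> y \<in> B \<Longrightarrow> \<delta> < dist x y" and \<delta>: "0 \<le> \<delta>"
  shows "hausdorff_pre k \<delta> A + hausdorff_pre k \<delta> B \<le> hausdorff_pre k \<delta> (A \<union> B)"
  unfolding hausdorff_pre_def[of k \<delta> "A \<union> B"]
proof (rule INF_greatest, clarify)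
  fix C :: "nat \<Rightarrow> 'a set"
  assume C: "A \<union> B \<subseteq> (\<Union>i. C i)" "\<forall>i. bounded (C i) \<and> diameter (C i) \<le> \<delta>"
  define CA where "CA i = (if C i \<inter> A = {} then {} else C i)" for i
  define CB where "CB i = (if C i \<inter> B = {} then {} else C i)" for i
  have not_both: "C i \<inter> A = {} \<or> C i \<inter> B = {}" for i
  proof (rule ccontr)
    assume "\<not> ?thesis"
    then obtain x y where "x \<in> C i" "x \<in> A" "y \<in> C i" "y \<in> B" by auto
    then show False
      using sep[of x y] diameter_bounded_bound[of "C i" x y] C(2)[rule_format, of i] by linarith
  qed
  have "hausdorff_pre k \<delta> A \<le> (\<Sum>i. hausdorff_weight k (CA i))"
  proof (rule hausdorff_pre_le)
    show "A \<subseteq> (\<Union>i. CA i)" using C(1) by (force simp: CA_def)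
  qed (use C(2) \<delta> in \<open>auto simp: CA_def\<close>)
  moreover have "hausdorff_pre k \<delta> B \<le> (\<Sum>i. hausdorff_weight k (CB i))"
  proof (rule hausdorff_pre_le)
    show "B \<subseteq> (\<Union>i. CB i)" using C(1) by (force simp: CB_def)
  qed (use C(2) \<delta> in \<open>auto simp: CB_def\<close>)
  ultimately have "hausdorff_pre k \<delta> A + hausdorff_pre k \<delta> B \<le>
      (\<Sum>i. hausdorff_weight k (CA i)) + (\<Sum>i. hausdorff_weight k (CB i))"
    by (rule add_mono)
  also have "\<dots> = (\<Sum>i. hausdorff_weight k (CA i) + hausdorff_weight k (CB i))"
    by (rule suminf_add) auto
  also have "\<dots> \<le> (\<Sum>i. hausdorff_weight k (C i))"
    by (rule suminf_le) (use not_both in \<open>auto simp: CA_def CB_def\<close>)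
  finally show "hausdorff_pre k \<delta> A + hausdorff_pre k \<delta> B \<le> (\<Sum>i. hausdorff_weight k (C i))" .
qed

lemma outer_measure_space_hausdorff: "outer_measure_space (Pow UNIV) (hausdorff_outer k :: 'a::metric_space set \<Rightarrow> ennreal)"
  unfolding outer_measure_space_def
proof (intro conjI)
  show "positive (Pow UNIV) (hausdorff_outer k :: 'a set \<Rightarrow> ennreal)"
    by (simp add: positive_def hausdorff_outer_def hausdorff_pre_empty)
  show "increasing (Pow UNIV) (hausdorff_outer k :: 'a set \<Rightarrow> ennreal)"
    by (auto simp: increasing_def hausdorff_outer_def intro!: SUP_mono hausdorff_pre_mono)
  show "countably_subadditive (Pow UNIV) (hausdorff_outer k :: 'a set \<Rightarrow> ennreal)"
    unfolding countably_subadditive_def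
  proof (intro allI impI)
    fix A :: "nat \<Rightarrow> 'a set"
    show "hausdorff_outer k (\<Union>i. A i) \<le> (\<Sum>i. hausdorff_outer k (A i))"
      unfolding hausdorff_outer_def[of k "\<Union>i. A i"]
    proof (rule SUP_least)
      fix \<delta> :: real assume "\<delta> \<in> {0<..}"
      then show "hausdorff_pre k \<delta> (\<Union>i. A i) \<le> (\<Sum>i. hausdorff_outer k (A i))"
        by (intro order_trans[OF hausdorff_pre_UN_le] suminf_le)
          (auto simp: hausdorff_outer_def intro: SUP_upper)
    qed
  qed
qed

lemma hausdorff_outer_separated:
  assumes e: "0 < e" and sep: "\<And>x y. x \<in> A \<Longrightarrow> y \<in> B \<Longrightarrow> e \<le> dist x y"
  shows "hausdorff_outer k A + hausdorff_outer k B \<le> hausdorff_outer k (A \<union> B)"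
proof -
  have "hausdorff_outer k A + hausdorff_outer k B =
      (SUP \<delta>\<in>{0<..}. hausdorff_pre k \<delta> A + hausdorff_pre k \<delta> B)"
    unfolding hausdorff_outer_def
  proof (rule SUP_add_directed_ennreal[symmetric])
    fix i j :: real assume "i \<in> {0<..}" "j \<in> {0<..}"
    then show "\<exists>l\<in>{0<..}. hausdorff_pre k i A + hausdorff_pre k j B
        \<le> hausdorff_pre k l A + hausdorff_pre k l B"
      by (intro bexI[of _ "min i j"] add_mono hausdorff_pre_antimono) auto
  qed
  also have "\<dots> \<le> hausdorff_outer k (A \<union> B)"
  proof (rule SUP_least)
    fix \<delta> :: real assume \<delta>: "\<delta> \<in> {0<..}"
    define \<eta> where "\<eta> = min \<delta> (e/2)"
    have \<eta>: "0 < \<eta>" "\<eta> \<le> \<delta>" "\<eta> < e" using \<delta> e by (auto simp: \<eta>_def)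
    have "hausdorff_pre k \<delta> A + hausdorff_pre k \<delta> B \<le> hausdorff_pre k \<eta> A + hausdorff_pre k \<eta> B"
      using \<eta> by (intro add_mono hausdorff_pre_antimono)
    also have "\<dots> \<le> hausdorff_pre k \<eta> (A \<union> B)"
    proof (rule hausdorff_pre_separated)
      show "\<eta> < dist x y" if "x \<in> A" "y \<in> B" for x y
        using sep[OF that] \<eta> by linarith
    qed (use \<eta> in auto)
    also have "\<dots> \<le> hausdorff_outer k (A \<union> B)"
      unfolding hausdorff_outer_def by (rule SUP_upper) (use \<eta> in auto)
    finally show "hausdorff_pre k \<delta> A + hausdorff_pre k \<delta> B \<le> hausdorff_outer k (A \<union> B)" .
  qed
  finally show ?thesis .
qed

lemma metric_outer_measure_closed:
  fixes f :: "'a::metric_space set \<Rightarrow> ennreal"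
  assumes oms: "outer_measure_space (Pow UNIV) f"
    and sep: "\<And>A B e. 0 < e \<Longrightarrow> (\<And>x y. x \<in> A \<Longrightarrow> y \<in> B \<Longrightarrow> e \<le> dist x y) \<Longrightarrow> f A + f B \<le> f (A \<union> B)"
    and F: "closed F"
  shows "f (X \<inter> F) + f (X - F) \<le> f X"
proof (cases "F = {} \<or> f X = top")
  case True
  then show ?thesis
    using oms by (auto simp: outer_measure_space_def positive_def)
next
  case False
  then have Fne: "F \<noteq> {}" and fin: "f X \<noteq> top" by auto
  have f0: "f {} = 0" and mono: "\<And>A B. A \<subseteq> B \<Longrightarrow> f A \<le> f B"
    using oms by (auto simp: outer_measure_space_def positive_def increasing_def)
  have csa: "countably_subadditive (Pow UNIV) f"
    using oms by (simp add: outer_measure_space_def)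
  have sub: "f (A \<union> B) \<le> f A + f B" for A B
  proof -
    have "subadditive (Pow UNIV) f"
      by (rule ring_of_sets.countably_subadditive_subadditive [OF ring_of_sets_Pow _ csa])
        (simp add: positive_def f0)
    then have "f (A \<union> (B - A)) \<le> f A + f (B - A)"
      by (intro subadditiveD) auto
    also have "\<dots> \<le> f A + f B" by (intro add_left_mono mono) auto
    finally show ?thesis by simp
  qed
  define Y where "Y n = {x \<in> X. inverse (real (Suc n)) \<le> infdist x F}" for n
  define R where "R n = Y (Suc n) - Y n" for n
  have Y_mono: "Y m \<subseteq> Y n" if "m \<le> n" for m n
  proof -
    have "inverse (real (Suc n)) \<le> inverse (real (Suc m))"
      using that by (simp add: field_simps)
    then show ?thesis unfolding Y_def using order_trans by blast
  qed
  have UN_Y: "X - F = (\<Union>n. Y n)"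
  proof (intro equalityI subsetI)
    fix x assume x: "x \<in> X - F"
    then have "infdist x F > 0"
      using infdist_pos_not_in_closed[OF F Fne] by auto
    then obtain n where "inverse (real (Suc n)) < infdist x F"
      using reals_Archimedean by blast
    then show "x \<in> (\<Union>n. Y n)" using x by (auto simp: Y_def intro!: exI[of _ n])
  next
    fix x assume "x \<in> (\<Union>n. Y n)"
    then obtain n where n: "x \<in> X" "inverse (real (Suc n)) \<le> infdist x F"
      by (auto simp: Y_def)
    moreover have "inverse (real (Suc n)) > 0" by simp
    ultimately have "infdist x F \<noteq> 0" by linarith
    then show "x \<in> X - F" using n by auto
  qed
  have fY: "f (X \<inter> F) + f (Y n) \<le> f X" for n
  proof -
    have "f (X \<inter> F) + f (Y n) \<le> f (X \<inter> F \<union> Y n)"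
    proof (rule sep[of "inverse (real (Suc n))"])
      fix x y assume "x \<in> X \<inter> F" "y \<in> Y n"
      then show "inverse (real (Suc n)) \<le> dist x y"
        using infdist_le[of x F y] by (auto simp: Y_def dist_commute)
    qed simp
    also have "\<dots> \<le> f X" by (rule mono) (auto simp: Y_def)
    finally show ?thesis .
  qed
  have R_sep: "f (Y n) + f (R (Suc n)) \<le> f (Y n \<union> R (Suc n))" for n
  proof (rule sep)
    show "0 < inverse (real (Suc n)) - inverse (real (Suc (Suc n)))"
      by (simp add: field_simps add_pos_nonneg)
    fix x y assume "x \<in> Y n" "y \<in> R (Suc n)"
    then have "inverse (real (Suc n)) \<le> infdist x F" "infdist y F < inverse (real (Suc (Suc n)))"
      by (auto simp: Y_def R_def)
    then show "inverse (real (Suc n)) - inverse (real (Suc (Suc n))) \<le> dist x y"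
      using infdist_triangle[of x F y] by linarith
  qed
  have step: "f (Y n) + f (R (Suc n)) \<le> f (Y (Suc (Suc n)))" for n
  proof -
    have "Y n \<union> R (Suc n) \<subseteq> Y (Suc (Suc n))"
      using Y_mono[of n "Suc (Suc n)"] by (auto simp: R_def)
    then show ?thesis using R_sep[of n] mono order_trans by blast
  qed
  have sum_le: "(\<Sum>j<Suc n. f (R j)) \<le> f (Y n) + f (Y (Suc n))" for n
  proof (induction n)
    case 0
    have "f (R 0) \<le> f (Y (Suc 0))" by (rule mono) (auto simp: R_def)
    then show ?case by (simp add: add_increasing)
  next
    case (Suc n)
    have "(\<Sum>j<Suc (Suc n). f (R j)) \<le> f (Y n) + f (Y (Suc n)) + f (R (Suc n))"
      using add_right_mono[OF Suc.IH, of "f (R (Suc n))"] by simp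
    also have "\<dots> = f (Y (Suc n)) + (f (Y n) + f (R (Suc n)))"
      by (simp add: ac_simps)
    also have "\<dots> \<le> f (Y (Suc n)) + f (Y (Suc (Suc n)))"
      by (rule add_left_mono[OF step])
    finally show ?case .
  qed
  define S where "S = (\<Sum>j. f (R j))"
  define P where "P n = (\<Sum>j<n. f (R j))" for n
  have "S \<le> f X + f X"
    unfolding S_def
  proof (rule suminf_le_const[OF summableI])
    fix n
    have "(\<Sum>j<n. f (R j)) \<le> (\<Sum>j<Suc n. f (R j))" by simp
    also have "\<dots> \<le> f (Y n) + f (Y (Suc n))" by (rule sum_le)
    also have "\<dots> \<le> f X + f X" by (intro add_mono mono) (auto simp: Y_def)
    finally show "(\<Sum>j<n. f (R j)) \<le> f X + f X" .
  qed
  then have S: "S < top"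
    using fin by (metis ennreal_add_less_top less_top order_le_less_trans)
  have bound: "f (X \<inter> F) + f (X - F) \<le> f X + (S - P n)" for n
  proof -
    have "X - F \<subseteq> Y n \<union> (\<Union>j. R (j + n))"
    proof
      fix x assume "x \<in> X - F"
      then obtain m where m: "x \<in> Y m" using UN_Y by auto
      show "x \<in> Y n \<union> (\<Union>j. R (j + n))"
      proof (cases "x \<in> Y n")
        case False
        define l where "l = (LEAST l. x \<in> Y l)"
        have l: "x \<in> Y l" unfolding l_def using m by (rule LeastI)
        with False Y_mono[of l n] have "n < l" by (meson leI subsetD)
        moreover have "x \<notin> Y (l - 1)"
          using \<open>n < l\<close> not_less_Least[of "l - 1" "\<lambda>l. x \<in> Y l"] by (simp add: l_def)
        ultimately have "x \<in> R ((l - 1 - n) + n)" using l by (auto simp: R_def)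
        then show ?thesis by blast
      qed simp
    qed
    then have "f (X - F) \<le> f (Y n) + f (\<Union>j. R (j + n))"
      using mono sub order_trans by blast
    also have "\<dots> \<le> f (Y n) + (\<Sum>j. f (R (j + n)))"
    proof (intro add_left_mono)
      have "disjoint_family (\<lambda>j. R (j + n))"
        unfolding disjoint_family_on_def
      proof (intro ballI impI)
        fix i j :: nat assume "i \<noteq> j"
        then have "Suc (i + n) \<le> j + n \<or> Suc (j + n) \<le> i + n" by auto
        then show "R (i + n) \<inter> R (j + n) = {}"
          using Y_mono[of "Suc (i + n)" "j + n"] Y_mono[of "Suc (j + n)" "i + n"]
          by (auto simp: R_def)
      qed
      then show "f (\<Union>j. R (j + n)) \<le> (\<Sum>j. f (R (j + n)))"
        using csa unfolding countably_subadditive_def by blast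
    qed
    also have "(\<Sum>j. f (R (j + n))) = S - P n"
    proof -
      have "S = (\<Sum>j. f (R (j + n))) + P n"
        unfolding S_def P_def by (rule suminf_offset) (rule summableI)
      moreover have "P n \<noteq> top" using S calculation by auto
      ultimately show ?thesis by simp
    qed
    finally have "f (X - F) \<le> f (Y n) + (S - P n)" .
    then have "f (X \<inter> F) + f (X - F) \<le> (f (X \<inter> F) + f (Y n)) + (S - P n)"
      by (metis add.assoc add_left_mono)
    also have "\<dots> \<le> f X + (S - P n)" by (rule add_right_mono[OF fY])
    finally show ?thesis .
  qed
  have "P \<longlonglongrightarrow> S"
    unfolding P_def S_def by (rule summable_LIMSEQ[OF summableI])
  then have "(\<lambda>n. f X + (S - P n)) \<longlonglongrightarrow> f X + (S - S)"
    using S by (intro tendsto_add tendsto_const tendsto_diff_ennreal) auto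
  then show ?thesis
    using S bound by (intro LIMSEQ_le_const[of _ "f X"]) auto
qed

lemma space_hausdorff [simp]: "space (hausdorff k) = UNIV"
  and sets_hausdorff [simp, measurable_cong]: "sets (hausdorff k) = sets borel"
  using sets.sigma_sets_eq[of borel]
  by (auto simp: hausdorff_def space_measure_of_conv sets_measure_of_conv)

text \<open>
  Borel sets are Caratheodory measurable for the Hausdorff outer measure, so that \<^const>\<open>hausdorff\<close> is
  indeed a measure with the expected values.
\<close>

lemma emeasure_hausdorff:
  fixes A :: "'a::metric_space set"
  assumes "A \<in> sets borel"
  shows "emeasure (hausdorff k) A = hausdorff_outer k A"
proof -
  let ?f = "hausdorff_outer k :: 'a set \<Rightarrow> ennreal"
  let ?L = "lambda_system UNIV (Pow UNIV) ?f"
  have oms: "outer_measure_space (Pow UNIV) ?f" by (rule outer_measure_space_hausdorff)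
  have ms: "measure_space UNIV ?L ?f"
    using sigma_algebra.caratheodory_lemma[OF sigma_algebra_Pow oms] .
  have closed_L: "F \<in> ?L" if "closed F" for F
    unfolding algebra.lambda_system_eq[OF algebra_Pow]
  proof (clarsimp, rule antisym)
    fix X
    show "?f (X \<inter> F) + ?f (X - F) \<le> ?f X"
      using oms hausdorff_outer_separated that by (rule metric_outer_measure_closed)
    have "subadditive (Pow UNIV) ?f"
      using oms by (intro ring_of_sets.countably_subadditive_subadditive [OF ring_of_sets_Pow])
        (auto simp: outer_measure_space_def)
    then have "?f ((X \<inter> F) \<union> (X - F)) \<le> ?f (X \<inter> F) + ?f (X - F)"
      by (rule subadditiveD) auto
    then show "?f X \<le> ?f (X \<inter> F) + ?f (X - F)" by (simp add: Int_Diff_Un)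
  qed
  have "sigma_algebra UNIV ?L" using ms by (simp add: measure_space_def)
  then have "sigma_sets UNIV (Collect closed) \<subseteq> ?L"
    by (rule sigma_algebra.sigma_sets_subset) (use closed_L in auto)
  then have "sets borel \<subseteq> ?L" by (simp add: borel_eq_closed)
  then have "measure_space UNIV (sets borel) ?f"
    using measure_down[OF ms] sets.sigma_algebra_axioms[of borel] by simp
  then show ?thesis
    unfolding hausdorff_def using assms
    by (intro emeasure_measure_of_sigma) (auto simp: measure_space_def)
qed


section \<open>Bounded open sets with Lipschitz boundary\<close>

text \<open>
  Near each boundary point the set is, for a suitable unit vector \<^term>\<open>\<nu>\<close>, the strict subgraph in
  direction \<^term>\<open>\<nu>\<close> of a Lipschitz function on the hyperplane orthogonal to \<^term>\<open>\<nu>\<close>. In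
  dimension one that hyperplane is a point, and the bounded open sets with this property are the
  finite unions of bounded open intervals with disjoint closures.
\<close>

definition lipschitz_boundary :: "'a::euclidean_space set \<Rightarrow> bool" where
  "lipschitz_boundary \<Omega> \<longleftrightarrow>
     (\<forall>p \<in> frontier \<Omega>. \<exists>U \<nu> \<gamma> L.
        open U \<and> p \<in> U \<and> norm \<nu> = 1 \<and> L-lipschitz_on {y. y \<bullet> \<nu> = 0} \<gamma> \<and>
        \<Omega> \<inter> U = {x \<in> U. x \<bullet> \<nu> < \<gamma> (x - (x \<bullet> \<nu>) *\<^sub>R \<nu>)})"

definition lipschitz_domain :: "'a::euclidean_space set \<Rightarrow> bool" where
  "lipschitz_domain \<Omega> \<longleftrightarrow> open \<Omega> \<and> bounded \<Omega> \<and> lipschitz_boundary \<Omega>"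


section \<open>The Sobolev space $H^1$ and traces\<close>

primrec Ck :: "nat \<Rightarrow> ('a::euclidean_space \<Rightarrow> real) \<Rightarrow> bool" where
  "Ck 0 f \<longleftrightarrow> continuous_on UNIV f"
| "Ck (Suc k) f \<longleftrightarrow>
     (\<forall>x. f differentiable (at x)) \<and> (\<forall>v. Ck k (\<lambda>x. frechet_derivative f (at x) v))"

definition smooth :: "('a::euclidean_space \<Rightarrow> real) \<Rightarrow> bool" where
  "smooth f \<longleftrightarrow> (\<forall>k. Ck k f)"

definition grad :: "('a::euclidean_space \<Rightarrow> real) \<Rightarrow> 'a \<Rightarrow> 'a" where
  "grad f x = (\<Sum>b\<in>Basis. frechet_derivative f (at x) b *\<^sub>R b)"

definition test_function :: "'a::euclidean_space set \<Rightarrow> ('a \<Rightarrow> real) \<Rightarrow> bool" where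
  "test_function \<Omega> \<phi> \<longleftrightarrow>
     smooth \<phi> \<and> compact (closure {x. \<phi> x \<noteq> 0}) \<and> closure {x. \<phi> x \<noteq> 0} \<subseteq> \<Omega>"

definition square_integrable :: "'a measure \<Rightarrow> 'a set \<Rightarrow> ('a \<Rightarrow> 'b::euclidean_space) \<Rightarrow> bool" where
  "square_integrable M A f \<longleftrightarrow>
     set_borel_measurable M A f \<and> set_integrable M A (\<lambda>x. (norm (f x))\<^sup>2)"

definition has_weak_gradient ::
    "'a::euclidean_space set \<Rightarrow> ('a \<Rightarrow> real) \<Rightarrow> ('a \<Rightarrow> 'a) \<Rightarrow> bool" where
  "has_weak_gradient \<Omega> u g \<longleftrightarrow>
     square_integrable lebesgue \<Omega> g \<and>
     (\<forall>\<phi>. test_function \<Omega> \<phi> \<longrightarrow>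
        (LINT x:\<Omega>|lebesgue. u x *\<^sub>R grad \<phi> x) = - (LINT x:\<Omega>|lebesgue. \<phi> x *\<^sub>R g x))"

text \<open>
  Elements of $H^1$ and $L^2$ are represented by functions on the whole space; only their values
  almost everywhere on the relevant set matter. Weak gradients, and on Lipschitz domains traces, are
  unique almost everywhere, so that the choice of a representative is immaterial under the integrals
  below.
\<close>

definition H1 :: "'a::euclidean_space set \<Rightarrow> ('a \<Rightarrow> real) set" where
  "H1 \<Omega> = {u. square_integrable lebesgue \<Omega> u \<and> (\<exists>g. has_weak_gradient \<Omega> u g)}"

definition weak_grad :: "'a::euclidean_space set \<Rightarrow> ('a \<Rightarrow> real) \<Rightarrow> 'a \<Rightarrow> 'a" where
  "weak_grad \<Omega> u = (SOME g. has_weak_gradient \<Omega> u g)"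

abbreviation surface_measure :: "'a::euclidean_space measure" where
  "surface_measure \<equiv> hausdorff (DIM('a) - 1)"

text \<open>
  The trace operator is the continuous extension to $H^1(\Omega)$ of the restriction to the boundary of
  functions smooth up to the boundary, which are dense in $H^1(\Omega)$.
\<close>

definition is_trace :: "'a::euclidean_space set \<Rightarrow> ('a \<Rightarrow> real) \<Rightarrow> ('a \<Rightarrow> real) \<Rightarrow> bool" where
  "is_trace \<Omega> u t \<longleftrightarrow>
     square_integrable surface_measure (frontier \<Omega>) t \<and>
     (\<exists>\<phi> :: nat \<Rightarrow> 'a \<Rightarrow> real. (\<forall>n. smooth (\<phi> n)) \<and>
        (\<lambda>n. LINT x:\<Omega>|lebesgue. (\<phi> n x - u x)\<^sup>2 + (norm (grad (\<phi> n) x - weak_grad \<Omega> u x))\<^sup>2)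
          \<longlonglongrightarrow> 0 \<and>
        (\<lambda>n. LINT x:frontier \<Omega>|surface_measure. (\<phi> n x - t x)\<^sup>2) \<longlonglongrightarrow> 0)"

definition boundary_trace :: "'a::euclidean_space set \<Rightarrow> ('a \<Rightarrow> real) \<Rightarrow> 'a \<Rightarrow> real" where
  "boundary_trace \<Omega> u = (SOME t. is_trace \<Omega> u t)"


section \<open>First Robin eigenvalue and Robin torsional rigidity\<close>

definition robin_form ::
    "real \<Rightarrow> 'a::euclidean_space set \<Rightarrow> ('a \<Rightarrow> real) \<Rightarrow> ('a \<Rightarrow> real) \<Rightarrow> real" where
  "robin_form \<beta> \<Omega> u v =
     (LINT x:\<Omega>|lebesgue. weak_grad \<Omega> u x \<bullet> weak_grad \<Omega> v x) +
     \<beta> * (LINT x:frontier \<Omega>|surface_measure. boundary_trace \<Omega> u x * boundary_trace \<Omega> v x)"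

text \<open>For \<^term>\<open>0 < \<beta>\<close> and a nonempty Lipschitz domain, the infimum is attained.\<close>

definition robin_eigenvalue :: "real \<Rightarrow> 'a::euclidean_space set \<Rightarrow> real" where
  "robin_eigenvalue \<beta> \<Omega> =
     Inf {robin_form \<beta> \<Omega> u u / (LINT x:\<Omega>|lebesgue. (u x)\<^sup>2) | u.
            u \<in> H1 \<Omega> \<and> \<not> (AE x\<in>\<Omega> in lebesgue. u x = 0)}"

text \<open>
  Weak formulation of $-\Delta w = 1$ in $\Omega$, $\partial_\nu w + \beta w = 0$ on the boundary. For
  \<^term>\<open>0 < \<beta>\<close> and a Lipschitz domain, the solution exists and is unique almost everywhere.
\<close>

definition robin_torsion_function ::
    "real \<Rightarrow> 'a::euclidean_space set \<Rightarrow> ('a \<Rightarrow> real) \<Rightarrow> bool" where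
  "robin_torsion_function \<beta> \<Omega> w \<longleftrightarrow>
     w \<in> H1 \<Omega> \<and> (\<forall>v \<in> H1 \<Omega>. robin_form \<beta> \<Omega> w v = (LINT x:\<Omega>|lebesgue. v x))"

definition robin_torsion :: "real \<Rightarrow> 'a::euclidean_space set \<Rightarrow> real" where
  "robin_torsion \<beta> \<Omega> = (LINT x:\<Omega>|lebesgue. (SOME w. robin_torsion_function \<beta> \<Omega> w) x)"

definition robin_product_inf :: "'a::euclidean_space itself \<Rightarrow> real \<Rightarrow> real \<Rightarrow> real" where
  "robin_product_inf _ \<beta> q =
     Inf {robin_eigenvalue \<beta> \<Omega> * robin_torsion \<beta> \<Omega> powr q | \<Omega> :: 'a set.
            lipschitz_domain \<Omega> \<and> measure lebesgue \<Omega> = 1}"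

end

theory Submission
  imports Defs
begin

text \<open>
  If \<open>v\<close> and \<open>u\<close> are nonnegative functions with \<open>v = u\<^sup>2\<close>, then \<open>v x \<le> \<bar>v x - v y\<bar> + u x * u y\<close>. Averaging this over
  \<open>dist x y < r\<close>, with \<open>u\<close> extended by zero across the boundary, bounds the integral of \<open>u\<^sup>2\<close> by \<open>r\<close>
  times the total variation of the extended \<open>u\<^sup>2\<close>, which the Robin energy controls, plus
  \<open>(\<integral> u)\<^sup>2 / (V * r ^ d)\<close> with \<open>V\<close> the volume of the unit ball. For an almost minimiser \<open>u\<close> of the Rayleigh
  quotient and \<open>r\<close> of order \<open>1 / \<lambda>\<close>, and since \<open>(\<integral> u)\<^sup>2\<close> is at most \<open>T\<close> times the energy, this gives
  \<open>\<lambda> ^ (d + 1) * T \<ge> c\<close>. As \<open>\<lambda>\<close> is bounded below on sets of measure one, the infimum is positive for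
  \<open>q \<le> 1 / (d + 1)\<close>. For larger \<open>q\<close>, a ball of small radius \<open>R\<close> together with many much smaller balls has
  \<open>\<lambda>\<close> of order \<open>1 / R\<close> and \<open>T\<close> of order \<open>R ^ (d + 1)\<close>, so that \<open>\<lambda> * T ^ q\<close> tends to zero.
\<close>

section \<open>Square integrable functions\<close>

text \<open>Squares are used because the boundary term of the Robin energy is quadratic: the zero
  extension of the square jumps across the frontier by exactly the boundary density. The bound on
  its variation holds for every bounded open set of finite boundary measure, with a constant
  depending only on the dimension, which is what makes the lower bound uniform. It rests on one
  geometric estimate: the segments with direction \<open>h\<close> that hit a set \<open>E\<close>
  start in a set of volume at most a constant times \<open>norm h\<close> times the Hausdorff
  measure of \<open>E\<close>. The reverse estimate needs the Lipschitz property and has constants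
  depending on the domain; it enters only through the finiteness of the boundary measure and the
  trace inequality, which give sense to the definitions. Once functions smooth up to the boundary
  are known to be dense in \<open>H1\<close>, all estimates are made for smooth functions with
  classical gradients and boundary values. Only positivity or vanishing of the infimum is at stake,
  so crude constants suffice, and coverings with integration over superlevel sets replace the area,
  coarea and divergence formulas.\<close>

lemma quadratic_nonneg_discriminant:
  fixes a b c :: real
  assumes q: "\<And>s. 0 \<le> a + 2 * b * s + c * s\<^sup>2" and "0 \<le> c"
  shows "b\<^sup>2 \<le> a * c"
proof (cases "c = 0")
  case True
  have "b = 0"
  proof (rule ccontr)
    assume "b \<noteq> 0"
    \<comment> \<open>At this \<open>s\<close> the affine function \<open>a + 2 * b * s\<close>
      equals -1.\<close>
    then show False using q[of "- (a + 1) / (2 * b)"] True by (simp add: field_simps)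
  qed
  with True show ?thesis by simp
next
  case False
  then have "c > 0" using \<open>0 \<le> c\<close> by simp
  with q[of "- b / c"] show ?thesis
    by (simp add: field_simps power2_eq_square)
qed

text \<open>Functions rather than classes, over an arbitrary measure: the same facts then serve
  \<open>lebesgue_on \<Omega>\<close>, the boundary measure and \<open>lborel\<close>.\<close>

definition L2 :: "'a measure \<Rightarrow> ('a \<Rightarrow> 'b::euclidean_space) \<Rightarrow> bool" where
  "L2 M f \<longleftrightarrow> f \<in> borel_measurable M \<and> integrable M (\<lambda>x. (norm (f x))\<^sup>2)"

lemma L2_measurable [measurable_dest]: "L2 M f \<Longrightarrow> f \<in> borel_measurable M"
  by (simp add: L2_def)

lemma L2_integrable_sq: "L2 M f \<Longrightarrow> integrable M (\<lambda>x. (norm (f x))\<^sup>2)"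
  by (simp add: L2_def)

lemma L2_integrable_sq_real: "L2 M f \<Longrightarrow> integrable M (\<lambda>x. (f x)\<^sup>2)" for f :: "'a \<Rightarrow> real"
  by (simp add: L2_def)

lemma L2_bound:
  assumes "L2 M f" "g \<in> borel_measurable M" "\<And>x. x \<in> space M \<Longrightarrow> norm (g x) \<le> norm (f x)"
  shows "L2 M g"
  unfolding L2_def
proof
  show "integrable M (\<lambda>x. (norm (g x))\<^sup>2)"
    by (rule Bochner_Integration.integrable_bound[OF L2_integrable_sq[OF assms(1)]])
      (use assms in \<open>auto intro!: power_mono\<close>)
qed (fact assms(2))

lemma L2_norm: "L2 M f \<Longrightarrow> L2 M (\<lambda>x. norm (f x))"
  by (auto simp: L2_def)

lemma L2_scaleR_left: "L2 M f \<Longrightarrow> L2 M (\<lambda>x. c *\<^sub>R f x)"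
  by (auto simp: L2_def power_mult_distrib)

lemma L2_mult_left: "L2 M f \<Longrightarrow> L2 M (\<lambda>x. c * f x)" for f :: "'a \<Rightarrow> real"
  by (auto simp: L2_def power_mult_distrib)

lemma norm_add_sq_le: "(norm (a + b))\<^sup>2 \<le> 2 * (norm a)\<^sup>2 + 2 * (norm b)\<^sup>2" for a b :: "'b::real_inner"
proof -
  have "(norm (a + b))\<^sup>2 \<le> (norm a + norm b)\<^sup>2"
    by (intro power_mono norm_triangle_ineq) auto
  then show ?thesis
    using sum_squares_bound[of "norm a" "norm b"] by (simp add: power2_sum)
qed

lemma L2_add:
  assumes "L2 M f" "L2 M g"
  shows "L2 M (\<lambda>x. f x + g x)"
  unfolding L2_def
proof
  show "integrable M (\<lambda>x. (norm (f x + g x))\<^sup>2)"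
    by (rule Bochner_Integration.integrable_bound
        [where f = "\<lambda>x. 2 * (norm (f x))\<^sup>2 + 2 * (norm (g x))\<^sup>2"])
      (use assms norm_add_sq_le in \<open>auto simp: L2_def\<close>)
qed (use assms in \<open>auto simp: L2_def\<close>)

lemma L2_diff: "L2 M f \<Longrightarrow> L2 M g \<Longrightarrow> L2 M (\<lambda>x. f x - g x)"
  using L2_add[of M f "\<lambda>x. (-1) *\<^sub>R g x"] L2_scaleR_left[of M g "-1"] by simp

lemma L2_integrable_mult_norm:
  assumes "L2 M f" "L2 M g"
  shows "integrable M (\<lambda>x. norm (f x) * norm (g x))"
proof (rule Bochner_Integration.integrable_bound
    [where f = "\<lambda>x. (norm (f x))\<^sup>2 + (norm (g x))\<^sup>2"])
  show "AE x in M. norm (norm (f x) * norm (g x)) \<le> norm ((norm (f x))\<^sup>2 + (norm (g x))\<^sup>2)"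
  proof (rule AE_I2)
    fix x
    have "2 * (norm (f x) * norm (g x)) \<le> (norm (f x))\<^sup>2 + (norm (g x))\<^sup>2"
      using sum_squares_bound[of "norm (f x)" "norm (g x)"] by simp
    moreover have "0 \<le> norm (f x) * norm (g x)" by simp
    ultimately have "norm (f x) * norm (g x) \<le> (norm (f x))\<^sup>2 + (norm (g x))\<^sup>2" by linarith
    then show "norm (norm (f x) * norm (g x)) \<le> norm ((norm (f x))\<^sup>2 + (norm (g x))\<^sup>2)"
      by (simp add: abs_mult)
  qed
qed (use assms in \<open>auto simp: L2_def\<close>)

lemma L2_integrable_inner:
  assumes "L2 M f" "L2 M g"
  shows "integrable M (\<lambda>x. f x \<bullet> g x)"
  by (rule Bochner_Integration.integrable_bound[OF L2_integrable_mult_norm[OF assms]])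
    (use assms Cauchy_Schwarz_ineq2 in \<open>auto simp: L2_def abs_mult\<close>)

lemma L2_integrable_scaleR:
  fixes f :: "'a \<Rightarrow> real"
  assumes "L2 M f" "L2 M g"
  shows "integrable M (\<lambda>x. f x *\<^sub>R g x)"
  by (rule Bochner_Integration.integrable_bound[OF L2_integrable_mult_norm[OF assms]])
    (use assms in \<open>auto simp: L2_def abs_mult\<close>)

lemma (in finite_measure) L2_const: "L2 M (\<lambda>_. c)"
  by (simp add: L2_def)

lemma (in finite_measure) L2_integrable: "L2 M f \<Longrightarrow> integrable M f"
  using L2_integrable_scaleR[OF L2_const[of "1::real"], of f] by simp

text \<open>The quadratic in \<open>s\<close> is the integral of the square of
  \<open>norm (f x) + s * norm (g x)\<close>. The version for norms yields those for inner products
  and scalar multiples.\<close>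

lemma Cauchy_Schwarz_L2_norm:
  assumes f: "L2 M f" and g: "L2 M g"
  shows "(LINT x|M. norm (f x) * norm (g x))\<^sup>2 \<le> (LINT x|M. (norm (f x))\<^sup>2) * (LINT x|M. (norm (g x))\<^sup>2)"
proof (rule quadratic_nonneg_discriminant)
  fix s :: real
  note int = L2_integrable_sq[OF f] L2_integrable_sq[OF g] L2_integrable_mult_norm[OF f g]
  have "0 \<le> (LINT x|M. (norm (f x) + s * norm (g x))\<^sup>2)"
    by simp
  also have "\<dots> = (LINT x|M. (norm (f x))\<^sup>2 + (2 * s) * (norm (f x) * norm (g x)) + s\<^sup>2 * (norm (g x))\<^sup>2)"
    by (simp add: power2_sum power_mult_distrib algebra_simps)
  also have "\<dots> = (LINT x|M. (norm (f x))\<^sup>2) + 2 * (LINT x|M. norm (f x) * norm (g x)) * s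
      + (LINT x|M. (norm (g x))\<^sup>2) * s\<^sup>2"
    using int by simp
  finally show "0 \<le> (LINT x|M. (norm (f x))\<^sup>2) + 2 * (LINT x|M. norm (f x) * norm (g x)) * s
      + (LINT x|M. (norm (g x))\<^sup>2) * s\<^sup>2" .
qed simp

lemma Cauchy_Schwarz_L2_inner:
  assumes f: "L2 M f" and g: "L2 M g"
  shows "(LINT x|M. f x \<bullet> g x)\<^sup>2 \<le> (LINT x|M. (norm (f x))\<^sup>2) * (LINT x|M. (norm (g x))\<^sup>2)"
proof -
  have "\<bar>LINT x|M. f x \<bullet> g x\<bar> \<le> (LINT x|M. norm (f x) * norm (g x))"
    using L2_integrable_inner[OF f g] L2_integrable_mult_norm[OF f g]
    by (intro order_trans[OF integral_abs_bound] integral_mono) (auto simp: Cauchy_Schwarz_ineq2)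
  then have "(LINT x|M. f x \<bullet> g x)\<^sup>2 \<le> (LINT x|M. norm (f x) * norm (g x))\<^sup>2"
    by (metis abs_ge_zero power2_abs power_mono)
  with Cauchy_Schwarz_L2_norm[OF f g] show ?thesis by linarith
qed

lemma Cauchy_Schwarz_L2_scaleR:
  fixes f :: "'a \<Rightarrow> real"
  assumes f: "L2 M f" and g: "L2 M g"
  shows "(norm (LINT x|M. f x *\<^sub>R g x))\<^sup>2 \<le> (LINT x|M. (f x)\<^sup>2) * (LINT x|M. (norm (g x))\<^sup>2)"
proof -
  have "norm (LINT x|M. f x *\<^sub>R g x) \<le> (LINT x|M. norm (f x) * norm (g x))"
    using integral_norm_bound[of M "\<lambda>x. f x *\<^sub>R g x"] by simp
  then have "(norm (LINT x|M. f x *\<^sub>R g x))\<^sup>2 \<le> (LINT x|M. norm (f x) * norm (g x))\<^sup>2"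
    by (simp add: power_mono)
  also have "\<dots> \<le> (LINT x|M. (norm (f x))\<^sup>2) * (LINT x|M. (norm (g x))\<^sup>2)"
    by (rule Cauchy_Schwarz_L2_norm[OF f g])
  finally show ?thesis by simp
qed

text \<open>Membership in \<open>L2\<close> is part of the notion because the Bochner integral of a
  nonintegrable function is 0 by convention, so vanishing integrals alone would say nothing.\<close>

definition L2_lim :: "'a measure \<Rightarrow> (nat \<Rightarrow> 'a \<Rightarrow> 'b::euclidean_space) \<Rightarrow> ('a \<Rightarrow> 'b) \<Rightarrow> bool" where
  "L2_lim M f g \<longleftrightarrow> (\<forall>n. L2 M (f n)) \<and> L2 M g \<and> (\<lambda>n. LINT x|M. (norm (f n x - g x))\<^sup>2) \<longlonglongrightarrow> 0"

lemma tendsto_zero_of_sq_le: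
  fixes a b :: "nat \<Rightarrow> real"
  assumes "\<And>n. (a n)\<^sup>2 \<le> b n" "b \<longlonglongrightarrow> 0"
  shows "a \<longlonglongrightarrow> 0"
proof -
  have "(\<lambda>n. (a n)\<^sup>2) \<longlonglongrightarrow> 0"
    by (rule tendsto_sandwich[OF _ _ tendsto_const assms(2)]) (use assms(1) in auto)
  then have "(\<lambda>n. sqrt ((a n)\<^sup>2)) \<longlonglongrightarrow> 0"
    using tendsto_real_sqrt by fastforce
  then show ?thesis by (simp add: tendsto_rabs_zero_iff)
qed

text \<open>Both factors are split into limit plus error; Cauchy-Schwarz sends the error-error
  integral and the two mixed ones to zero.\<close>

lemma L2_lim_inner:
  assumes f: "L2_lim M f f'" and g: "L2_lim M g g'"
  shows "(\<lambda>n. LINT x|M. f n x \<bullet> g n x) \<longlonglongrightarrow> (LINT x|M. f' x \<bullet> g' x)"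
proof -
  have L: "L2 M (f n)" "L2 M f'" "L2 M (g n)" "L2 M g'" for n
    using f g by (auto simp: L2_lim_def)
  have fd: "(\<lambda>n. LINT x|M. (norm (f n x - f' x))\<^sup>2) \<longlonglongrightarrow> 0"
    and gd: "(\<lambda>n. LINT x|M. (norm (g n x - g' x))\<^sup>2) \<longlonglongrightarrow> 0"
    using f g by (auto simp: L2_lim_def)
  have "(\<lambda>n. LINT x|M. (f n x - f' x) \<bullet> (g n x - g' x)) \<longlonglongrightarrow> 0"
    by (rule tendsto_zero_of_sq_le[OF Cauchy_Schwarz_L2_inner])
      (use L tendsto_mult[OF fd gd] in \<open>auto intro: L2_diff\<close>)
  moreover have "(\<lambda>n. LINT x|M. (f n x - f' x) \<bullet> g' x) \<longlonglongrightarrow> 0"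
    by (rule tendsto_zero_of_sq_le[OF Cauchy_Schwarz_L2_inner])
      (use L tendsto_mult[OF fd tendsto_const] in \<open>auto intro: L2_diff\<close>)
  moreover have "(\<lambda>n. LINT x|M. f' x \<bullet> (g n x - g' x)) \<longlonglongrightarrow> 0"
    by (rule tendsto_zero_of_sq_le[OF Cauchy_Schwarz_L2_inner])
      (use L tendsto_mult[OF tendsto_const gd] in \<open>auto intro: L2_diff\<close>)
  ultimately have "(\<lambda>n. (LINT x|M. (f n x - f' x) \<bullet> (g n x - g' x)) + (LINT x|M. (f n x - f' x) \<bullet> g' x)
       + (LINT x|M. f' x \<bullet> (g n x - g' x)) + (LINT x|M. f' x \<bullet> g' x))
      \<longlonglongrightarrow> 0 + 0 + 0 + (LINT x|M. f' x \<bullet> g' x)"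
    by (intro tendsto_add tendsto_const)
  moreover have "(LINT x|M. (f n x - f' x) \<bullet> (g n x - g' x)) + (LINT x|M. (f n x - f' x) \<bullet> g' x)
       + (LINT x|M. f' x \<bullet> (g n x - g' x)) + (LINT x|M. f' x \<bullet> g' x) = (LINT x|M. f n x \<bullet> g n x)" for n
  proof -
    have "integrable M (\<lambda>x. (f n x - f' x) \<bullet> (g n x - g' x))" "integrable M (\<lambda>x. (f n x - f' x) \<bullet> g' x)"
      "integrable M (\<lambda>x. f' x \<bullet> (g n x - g' x))" "integrable M (\<lambda>x. f' x \<bullet> g' x)"
      using L by (auto intro!: L2_integrable_inner L2_diff)
    then show ?thesis
      by (subst Bochner_Integration.integral_add[symmetric], simp, simp)+
        (auto intro!: Bochner_Integration.integral_cong simp: inner_diff_left inner_diff_right)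
  qed
  ultimately show ?thesis by simp
qed

lemma L2_lim_const: "L2 M g \<Longrightarrow> L2_lim M (\<lambda>_. g) g"
  by (simp add: L2_lim_def)

lemma L2_lim_sq:
  assumes "L2_lim M f f'"
  shows "(\<lambda>n. LINT x|M. (norm (f n x))\<^sup>2) \<longlonglongrightarrow> (LINT x|M. (norm (f' x))\<^sup>2)"
  using L2_lim_inner[OF assms assms] by (simp add: dot_square_norm)

lemma (in finite_measure) L2_lim_integral:
  fixes f :: "nat \<Rightarrow> 'a \<Rightarrow> real"
  assumes "L2_lim M f f'"
  shows "(\<lambda>n. LINT x|M. f n x) \<longlonglongrightarrow> (LINT x|M. f' x)"
  using L2_lim_inner[OF assms L2_lim_const[OF L2_const[of 1]]] by simp

lemma L2_lim_scaleR:
  fixes f :: "nat \<Rightarrow> 'a \<Rightarrow> real"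
  assumes f: "L2_lim M f f'" and g: "L2 M g"
  shows "(\<lambda>n. LINT x|M. f n x *\<^sub>R g x) \<longlonglongrightarrow> (LINT x|M. f' x *\<^sub>R g x)"
proof -
  have L: "L2 M (f n)" "L2 M f'" "(\<lambda>n. LINT x|M. (f n x - f' x)\<^sup>2) \<longlonglongrightarrow> 0" for n
    using f by (auto simp: L2_lim_def)
  have "(\<lambda>n. norm (LINT x|M. (f n x - f' x) *\<^sub>R g x)) \<longlonglongrightarrow> 0"
    by (rule tendsto_zero_of_sq_le[OF Cauchy_Schwarz_L2_scaleR])
      (use L g tendsto_mult[OF L(3) tendsto_const] in \<open>auto intro: L2_diff\<close>)
  moreover have "(LINT x|M. (f n x - f' x) *\<^sub>R g x) = (LINT x|M. f n x *\<^sub>R g x) - (LINT x|M. f' x *\<^sub>R g x)" for n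
    using L g by (simp add: scaleR_diff_left L2_integrable_scaleR)
  ultimately show ?thesis
    by (simp add: tendsto_norm_zero_iff LIM_zero_iff)
qed

lemma L2_lim_scaleR2:
  fixes f :: "'a \<Rightarrow> real"
  assumes g: "L2_lim M g g'" and f: "L2 M f"
  shows "(\<lambda>n. LINT x|M. f x *\<^sub>R g n x) \<longlonglongrightarrow> (LINT x|M. f x *\<^sub>R g' x)"
proof -
  have L: "L2 M (g n)" "L2 M g'" "(\<lambda>n. LINT x|M. (norm (g n x - g' x))\<^sup>2) \<longlonglongrightarrow> 0" for n
    using g by (auto simp: L2_lim_def)
  have "(\<lambda>n. norm (LINT x|M. f x *\<^sub>R (g n x - g' x))) \<longlonglongrightarrow> 0"
    by (rule tendsto_zero_of_sq_le[OF Cauchy_Schwarz_L2_scaleR])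
      (use L f tendsto_mult[OF tendsto_const L(3)] in \<open>auto intro: L2_diff\<close>)
  moreover have "(LINT x|M. f x *\<^sub>R (g n x - g' x)) = (LINT x|M. f x *\<^sub>R g n x) - (LINT x|M. f x *\<^sub>R g' x)" for n
    using L f by (simp add: scaleR_diff_right L2_integrable_scaleR)
  ultimately show ?thesis
    by (simp add: tendsto_norm_zero_iff LIM_zero_iff)
qed

text \<open>Squared distances satisfy the triangle inequality up to a factor 2, which avoids square
  roots in all later convergence arguments.\<close>

lemma L2_dist_triangle:
  assumes "L2 M f" "L2 M g" "L2 M h"
  shows "(LINT x|M. (norm (f x - h x))\<^sup>2) \<le> 2 * (LINT x|M. (norm (f x - g x))\<^sup>2) + 2 * (LINT x|M. (norm (g x - h x))\<^sup>2)"
proof -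
  have i: "integrable M (\<lambda>x. (norm (f x - h x))\<^sup>2)" "integrable M (\<lambda>x. (norm (f x - g x))\<^sup>2)"
    "integrable M (\<lambda>x. (norm (g x - h x))\<^sup>2)"
    using assms by (auto intro!: L2_integrable_sq L2_diff)
  have "(LINT x|M. (norm (f x - h x))\<^sup>2) \<le> (LINT x|M. 2 * (norm (f x - g x))\<^sup>2 + 2 * (norm (g x - h x))\<^sup>2)"
    using i norm_add_sq_le[of "f x - g x" "g x - h x" for x] by (intro integral_mono) auto
  also have "\<dots> = 2 * (LINT x|M. (norm (f x - g x))\<^sup>2) + 2 * (LINT x|M. (norm (g x - h x))\<^sup>2)"
    using i by simp
  finally show ?thesis .
qed

text \<open>Riesz-Fischer. Finiteness of the measure turns an \<open>L2\<close> Cauchy sequence into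
  an \<open>L1\<close> one, which has an almost everywhere Cauchy subsequence; Fatou's lemma along
  it bounds the \<open>L2\<close> distance to the pointwise limit.\<close>

lemma (in finite_measure) L2_complete:
  fixes f :: "nat \<Rightarrow> 'a \<Rightarrow> 'b::euclidean_space"
  assumes L: "\<And>n. L2 M (f n)"
    and C: "\<And>e. e > 0 \<Longrightarrow> \<exists>N. \<forall>m\<ge>N. \<forall>n\<ge>N. (LINT x|M. (norm (f m x - f n x))\<^sup>2) < e"
  shows "\<exists>g. L2_lim M f g"
proof -
  have Ld: "L2 M (\<lambda>x. f m x - f n x)" for m n
    by (intro L2_diff L)
  have L1: "(LINT x|M. norm (f m x - f n x))\<^sup>2 \<le> (LINT x|M. (norm (f m x - f n x))\<^sup>2) * measure M (space M)" for m n
    using Cauchy_Schwarz_L2_norm[OF Ld[of m n] L2_const[of "1::real"]] by simp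
  have C1: "\<exists>N. \<forall>i\<ge>N. \<forall>j\<ge>N. LINT x|M. norm (f i x - f j x) < e" if "e > 0" for e
  proof -
    have "e\<^sup>2 / (measure M (space M) + 1) > 0"
      using that by (simp add: add_nonneg_pos)
    from C[OF this] obtain N where N: "\<And>m n. m \<ge> N \<Longrightarrow> n \<ge> N \<Longrightarrow>
        (LINT x|M. (norm (f m x - f n x))\<^sup>2) < e\<^sup>2 / (measure M (space M) + 1)"
      by blast
    have "LINT x|M. norm (f i x - f j x) < e" if "i \<ge> N" "j \<ge> N" for i j
    proof -
      have "(LINT x|M. norm (f i x - f j x))\<^sup>2 \<le> (LINT x|M. (norm (f i x - f j x))\<^sup>2) * (measure M (space M) + 1)"
        using L1[of i j] by (rule order_trans) (auto intro!: mult_left_mono)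
      also have "\<dots> < e\<^sup>2"
        using N[OF that] by (subst (asm) pos_less_divide_eq) (auto intro: add_nonneg_pos)
      finally show ?thesis
        using \<open>e > 0\<close> by (simp add: power2_less_imp_less)
    qed
    then show ?thesis by blast
  qed
  obtain r where r: "strict_mono r" "AE x in M. Cauchy (\<lambda>i. f (r i) x)"
    by (rule cauchy_L1_AE_cauchy_subseq[of M f, OF L2_integrable[OF L] C1]) auto
  define g where "g x = lim (\<lambda>i. f (r i) x)" for x
  have [measurable]: "f n \<in> borel_measurable M" for n using L by (rule L2_measurable)
  have g [measurable]: "g \<in> borel_measurable M"
    unfolding g_def by measurable
  have lim: "AE x in M. (\<lambda>i. f (r i) x) \<longlonglongrightarrow> g x"
    using r(2) by eventually_elim (simp add: g_def Cauchy_convergent_iff convergent_LIMSEQ_iff)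
  have key: "(\<integral>\<^sup>+x. ennreal ((norm (f n x - g x))\<^sup>2) \<partial>M) \<le> ennreal e"
    if "e > 0" "\<forall>m\<ge>N. \<forall>n\<ge>N. (LINT x|M. (norm (f m x - f n x))\<^sup>2) < e" "n \<ge> N" for e n N
  proof -
    have "(\<integral>\<^sup>+x. ennreal ((norm (f n x - g x))\<^sup>2) \<partial>M)
        = (\<integral>\<^sup>+x. liminf (\<lambda>i. ennreal ((norm (f n x - f (r i) x))\<^sup>2)) \<partial>M)"
    proof (rule nn_integral_cong_AE, use lim in eventually_elim)
      fix x assume "(\<lambda>i. f (r i) x) \<longlonglongrightarrow> g x"
      then have "(\<lambda>i. ennreal ((norm (f n x - f (r i) x))\<^sup>2)) \<longlonglongrightarrow> ennreal ((norm (f n x - g x))\<^sup>2)"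
        by (intro tendsto_intros tendsto_ennrealI)
      then show "ennreal ((norm (f n x - g x))\<^sup>2) = liminf (\<lambda>i. ennreal ((norm (f n x - f (r i) x))\<^sup>2))"
        by (rule lim_imp_Liminf[OF trivial_limit_sequentially, symmetric])
    qed
    also have "\<dots> \<le> liminf (\<lambda>i. \<integral>\<^sup>+x. ennreal ((norm (f n x - f (r i) x))\<^sup>2) \<partial>M)"
      by (rule nn_integral_liminf) measurable
    also have "\<dots> \<le> ennreal e"
    proof (rule order_trans[OF Liminf_le_Limsup Limsup_bounded], simp, rule eventually_sequentiallyI)
      fix i assume "N \<le> i"
      then have "N \<le> r i" using seq_suble[OF r(1), of i] by simp
      then have "(LINT x|M. (norm (f n x - f (r i) x))\<^sup>2) \<le> e"
        using that by (simp add: less_imp_le)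
      moreover have "(\<integral>\<^sup>+x. ennreal ((norm (f n x - f (r i) x))\<^sup>2) \<partial>M) = ennreal (LINT x|M. (norm (f n x - f (r i) x))\<^sup>2)"
        by (rule nn_integral_eq_integral) (use L2_integrable_sq[OF Ld] in auto)
      ultimately show "(\<integral>\<^sup>+x. ennreal ((norm (f n x - f (r i) x))\<^sup>2) \<partial>M) \<le> ennreal e"
        by (simp add: ennreal_leI)
    qed
    finally show ?thesis .
  qed
  \<comment> \<open>The Fatou bound with \<open>e = 1\<close> makes one difference square
    integrable, and with it \<open>g\<close> itself.\<close>
  have L2d: "L2 M (\<lambda>x. f n x - g x)" if "\<forall>m\<ge>N. \<forall>n\<ge>N. (LINT x|M. (norm (f m x - f n x))\<^sup>2) < 1" "n \<ge> N" for n N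
    unfolding L2_def
    by (intro conjI integrableI_bounded)
      (use key[OF zero_less_one that] in \<open>auto simp: less_top[symmetric] top_unique\<close>)
  obtain N1 where N1: "\<forall>m\<ge>N1. \<forall>n\<ge>N1. (LINT x|M. (norm (f m x - f n x))\<^sup>2) < 1"
    using C[of 1] by auto
  have Lg: "L2 M g"
    using L2_diff[OF L[of N1] L2d[OF N1 order_refl]] by simp
  have "(\<lambda>n. LINT x|M. (norm (f n x - g x))\<^sup>2) \<longlonglongrightarrow> 0"
  proof (rule LIMSEQ_I)
    fix e :: real assume "0 < e"
    then obtain N where N: "\<forall>m\<ge>N. \<forall>n\<ge>N. (LINT x|M. (norm (f m x - f n x))\<^sup>2) < e / 2"
      using C[of "e/2"] by auto
    have "norm ((LINT x|M. (norm (f n x - g x))\<^sup>2) - 0) < e" if "n \<ge> N" for n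
    proof -
      have "ennreal (LINT x|M. (norm (f n x - g x))\<^sup>2) \<le> ennreal (e / 2)"
        using key[of "e/2" N n] N that \<open>0 < e\<close> L2_integrable_sq[OF L2_diff[OF L Lg]]
        by (subst nn_integral_eq_integral[symmetric]) auto
      then have "(LINT x|M. (norm (f n x - g x))\<^sup>2) \<le> e / 2"
        using \<open>0 < e\<close> by (simp add: ennreal_le_iff)
      then show ?thesis using \<open>0 < e\<close> by simp
    qed
    then show "\<exists>no. \<forall>n\<ge>no. norm ((LINT x|M. (norm (f n x - g x))\<^sup>2) - 0) < e" by blast
  qed
  with L Lg show ?thesis by (auto simp: L2_lim_def)
qed

section \<open>Smooth functions\<close>

lemma Ck_SucI:
  assumes "\<And>x. (f has_derivative D x) (at x)" "\<And>v. Ck k (\<lambda>x. D x v)"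
  shows "Ck (Suc k) f"
proof -
  have "frechet_derivative f (at x) = D x" for x
    using frechet_derivative_at[OF assms(1)] by simp
  with assms show ?thesis by (auto simp: differentiable_def)
qed

lemma Ck_SucD: "Ck (Suc k) f \<Longrightarrow> (f has_derivative frechet_derivative f (at x)) (at x)"
  by (simp add: frechet_derivative_works)

lemma Ck_Suc_le: "Ck (Suc k) f \<Longrightarrow> Ck k f"
proof (induction k arbitrary: f)
  case 0
  then show ?case
    by (auto simp: continuous_on_eq_continuous_at differentiable_imp_continuous_within)
next
  case (Suc k)
  then show ?case by (metis Ck.simps(2))
qed

lemma Ck_const: "Ck k (\<lambda>_. c)"
proof (induction k arbitrary: c)
  case (Suc k)
  show ?case by (rule Ck_SucI[where D = "\<lambda>_ _. 0"]) (auto intro: Suc)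
qed simp

lemma Ck_add: "Ck k f \<Longrightarrow> Ck k g \<Longrightarrow> Ck k (\<lambda>x. f x + g x)"
proof (induction k arbitrary: f g)
  case (Suc k)
  show ?case
    by (rule Ck_SucI[where D = "\<lambda>x v. frechet_derivative f (at x) v + frechet_derivative g (at x) v"])
      (use Suc in \<open>auto intro!: derivative_intros simp flip: frechet_derivative_works\<close>)
qed (auto intro: continuous_intros)

lemma Ck_mult: "Ck k f \<Longrightarrow> Ck k g \<Longrightarrow> Ck k (\<lambda>x. f x * g x)"
proof (induction k arbitrary: f g)
  case (Suc k)
  note le = Suc.prems[THEN Ck_Suc_le]
  show ?case
  proof (rule Ck_SucI[where D = "\<lambda>x v. f x * frechet_derivative g (at x) v + frechet_derivative f (at x) v * g x"])
    show "((\<lambda>x. f x * g x) has_derivative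
        (\<lambda>v. f x * frechet_derivative g (at x) v + frechet_derivative f (at x) v * g x)) (at x)" for x
      by (rule has_derivative_mult) (rule Suc.prems[THEN Ck_SucD])+
    show "Ck k (\<lambda>x. f x * frechet_derivative g (at x) v + frechet_derivative f (at x) v * g x)" for v
      using Suc.prems by (intro Ck_add Suc.IH le) auto
  qed
qed (auto intro: continuous_intros)

lemma Ck_sum: "(\<And>i. i \<in> I \<Longrightarrow> Ck k (f i)) \<Longrightarrow> Ck k (\<lambda>x. \<Sum>i\<in>I. f i x)"
  by (induction I rule: infinite_finite_induct) (auto intro: Ck_const Ck_add)

lemma Ck_inner: "Ck k (\<lambda>x. x \<bullet> b)"
proof (cases k)
  case (Suc n)
  show ?thesis unfolding Suc
    by (rule Ck_SucI[where D = "\<lambda>_ v. v \<bullet> b"]) (auto intro!: derivative_eq_intros Ck_const)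
qed (auto intro: continuous_intros)

text \<open>The induction runs over all \<open>f\<close> because the derivative in direction
  \<open>v\<close> is the directional derivative of \<open>f\<close> along
  \<open>c *\<^sub>R v\<close>, composed with the same affine map.\<close>

lemma Ck_affine: "Ck k f \<Longrightarrow> Ck k (\<lambda>x. f (c *\<^sub>R x + a))"
proof (induction k arbitrary: f)
  case 0
  then show ?case
    by (auto intro!: continuous_on_compose2[of UNIV f] continuous_intros)
next
  case (Suc k)
  show ?case
  proof (rule Ck_SucI[where D = "\<lambda>x v. frechet_derivative f (at (c *\<^sub>R x + a)) (c *\<^sub>R v)"])
    show "((\<lambda>x. f (c *\<^sub>R x + a)) has_derivative (\<lambda>v. frechet_derivative f (at (c *\<^sub>R x + a)) (c *\<^sub>R v))) (at x)" for x
      by (rule has_derivative_compose[of "\<lambda>x. c *\<^sub>R x + a" "\<lambda>v. c *\<^sub>R v" x UNIV f, OF _ Ck_SucD[OF Suc.prems]])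
        (auto intro!: derivative_eq_intros)
    show "Ck k (\<lambda>x. frechet_derivative f (at (c *\<^sub>R x + a)) (c *\<^sub>R v))" for v
      using Suc by auto
  qed
qed

text \<open>
  The outer functions form a family whose derivatives are finite linear combinations of members of the
  family, as is the case for powers and for the functions \<open>(1 / y) ^ n * exp (- 1 / y)\<close>.
\<close>

lemma Ck_compose_family:
  fixes G :: "'i \<Rightarrow> real \<Rightarrow> real"
  assumes G: "\<And>i y. y \<in> S \<Longrightarrow> (G i has_real_derivative (\<Sum>j\<in>J i. c i j * G j y)) (at y)"
    and S: "\<And>x. f x \<in> S" and f: "Ck k f"
  shows "Ck k (\<lambda>x. G i (f x))"
  using f
proof (induction k arbitrary: i)
  case 0
  have "isCont (\<lambda>x. G i (f x)) x" for x
    using 0 by (intro isCont_o2[of x f "G i"] DERIV_isCont[OF G[OF S]])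
      (auto simp: continuous_on_eq_continuous_at)
  then show ?case by (simp add: continuous_on_eq_continuous_at)
next
  case (Suc k)
  show ?case
  proof (rule Ck_SucI[where D = "\<lambda>x v. (\<Sum>j\<in>J i. c i j * G j (f x)) * frechet_derivative f (at x) v"])
    show "((\<lambda>x. G i (f x)) has_derivative
        (\<lambda>v. (\<Sum>j\<in>J i. c i j * G j (f x)) * frechet_derivative f (at x) v)) (at x)" for x
      by (rule has_derivative_compose[OF Ck_SucD[OF Suc.prems]])
        (use G[OF S, of i x] in \<open>simp add: has_field_derivative_def\<close>)
    show "Ck k (\<lambda>x. (\<Sum>j\<in>J i. c i j * G j (f x)) * frechet_derivative f (at x) v)" for v
      using Suc.prems by (intro Ck_mult Ck_sum Ck_const Suc.IH Ck_Suc_le[OF Suc.prems]) auto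
  qed
qed

lemma smooth_Ck: "smooth f \<Longrightarrow> Ck k f" by (simp add: smooth_def)

lemma smooth_const: "smooth (\<lambda>_. c)" by (simp add: smooth_def Ck_const)
lemma smooth_add: "smooth f \<Longrightarrow> smooth g \<Longrightarrow> smooth (\<lambda>x. f x + g x)" by (simp add: smooth_def Ck_add)
lemma smooth_mult: "smooth f \<Longrightarrow> smooth g \<Longrightarrow> smooth (\<lambda>x. f x * g x)" by (simp add: smooth_def Ck_mult)
lemma smooth_sum: "(\<And>i. i \<in> I \<Longrightarrow> smooth (f i)) \<Longrightarrow> smooth (\<lambda>x. \<Sum>i\<in>I. f i x)" by (simp add: smooth_def Ck_sum)
lemma smooth_inner: "smooth (\<lambda>x. x \<bullet> b)" by (simp add: smooth_def Ck_inner)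
lemma smooth_affine: "smooth f \<Longrightarrow> smooth (\<lambda>x. f (c *\<^sub>R x + a))" by (simp add: smooth_def Ck_affine)

lemma smooth_diff:
  assumes "smooth f" "smooth g" shows "smooth (\<lambda>x. f x - g x)"
  using smooth_add[OF assms(1) smooth_mult[OF smooth_const[of "-1"] assms(2)]] by simp

lemma smooth_power2: "smooth f \<Longrightarrow> smooth (\<lambda>x. (f x)\<^sup>2)"
  by (simp add: power2_eq_square smooth_mult)

lemma smooth_norm_sq: "smooth (\<lambda>x. (norm (x - a))\<^sup>2)"
proof -
  have "(norm (x - a))\<^sup>2 = (\<Sum>b\<in>Basis. (x \<bullet> b - a \<bullet> b) * (x \<bullet> b - a \<bullet> b))" for x
    by (subst power2_norm_eq_inner, subst euclidean_inner) (simp add: inner_diff_left)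
  then show ?thesis
    by (auto intro!: smooth_sum smooth_mult smooth_diff smooth_inner smooth_const)
qed

lemma smooth_differentiable: "smooth f \<Longrightarrow> f differentiable (at x)"
  using smooth_Ck[of f "Suc 0"] by simp

lemma smooth_frechet: "smooth f \<Longrightarrow> smooth (\<lambda>x. frechet_derivative f (at x) v)"
  unfolding smooth_def by (metis Ck.simps(2))

lemma smooth_continuous: "smooth f \<Longrightarrow> continuous_on UNIV f"
  using smooth_Ck[of f 0] by simp

lemma smooth_continuous_on: "smooth f \<Longrightarrow> continuous_on S f"
  by (meson continuous_on_subset smooth_continuous subset_UNIV)

lemma smooth_borel_measurable [measurable_dest]: "smooth f \<Longrightarrow> f \<in> borel_measurable borel"
  by (simp add: smooth_continuous borel_measurable_continuous_onI)

lemma smooth_sqrt: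
  assumes "smooth f" "\<And>x. f x > 0"
  shows "smooth (\<lambda>x. sqrt (f x))"
proof -
  have "Ck k (\<lambda>x. f x powr (1/2 - real 0))" for k
  proof (rule Ck_compose_family[where G = "\<lambda>n y. y powr (1/2 - real n)" and S = "{0<..}"
        and J = "\<lambda>n. {Suc n}" and c = "\<lambda>n _. 1/2 - real n"])
    fix n and y :: real assume "y \<in> {0<..}"
    then show "((\<lambda>y. y powr (1/2 - real n)) has_real_derivative
        (\<Sum>j\<in>{Suc n}. (1/2 - real n) * y powr (1/2 - real j))) (at y)"
      by (auto intro!: derivative_eq_intros simp: algebra_simps)
  qed (use assms in \<open>auto simp: smooth_def\<close>)
  then show ?thesis
    using assms(2) by (simp add: smooth_def powr_half_sqrt less_imp_le)
qed

lemma smooth_inverse: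
  assumes "smooth f" "\<And>x. f x > 0"
  shows "smooth (\<lambda>x. 1 / f x)"
proof -
  have "Ck k (\<lambda>x. f x powr (- 1 - real 0))" for k
  proof (rule Ck_compose_family[where G = "\<lambda>n y. y powr (- 1 - real n)" and S = "{0<..}"
        and J = "\<lambda>n. {Suc n}" and c = "\<lambda>n _. - 1 - real n"])
    fix n and y :: real assume "y \<in> {0<..}"
    then show "((\<lambda>y. y powr (- 1 - real n)) has_real_derivative
        (\<Sum>j\<in>{Suc n}. (- 1 - real n) * y powr (- 1 - real j))) (at y)"
      by (auto intro!: derivative_eq_intros simp: algebra_simps)
  qed (use assms in \<open>auto simp: smooth_def\<close>)
  then show ?thesis
    using assms(2) by (simp add: smooth_def powr_minus_divide less_imp_le)
qed

definition bump_monomial :: "nat \<Rightarrow> real \<Rightarrow> real" where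
  "bump_monomial n x = (if x > 0 then (1 / x) ^ n * exp (- (1 / x)) else 0)"

lemma bump_monomial_deriv:
  "(bump_monomial n has_real_derivative
      - real n * bump_monomial (Suc n) x + bump_monomial (Suc (Suc n)) x) (at x)"
proof -
  consider "x > 0" | "x < 0" | "x = 0" by linarith
  then show ?thesis
  proof cases
    case 1
    have "((\<lambda>x. (1 / x) ^ n * exp (- (1 / x))) has_real_derivative
        - real n * ((1 / x) ^ Suc n * exp (- (1 / x))) + ((1 / x) ^ Suc (Suc n) * exp (- (1 / x)))) (at x)"
    proof -
      have P: "x ^ m = x * x ^ (m - Suc 0)" if "m \<noteq> 0" for m
        using that by (cases m) auto
      show ?thesis
        using 1 by (cases n) (auto intro!: derivative_eq_intros simp: field_simps power2_eq_square, metis P)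
    qed
    then have "(bump_monomial n has_real_derivative
        - real n * ((1 / x) ^ Suc n * exp (- (1 / x))) + ((1 / x) ^ Suc (Suc n) * exp (- (1 / x)))) (at x)"
      by (rule has_field_derivative_transform_within_open[where S = "{0<..}"])
        (use 1 in \<open>auto simp: bump_monomial_def\<close>)
    then show ?thesis using 1 by (simp add: bump_monomial_def)
  next
    case 2
    have "(bump_monomial n has_real_derivative 0) (at x)"
      by (rule has_field_derivative_transform_within_open[where S = "{..<0}" and f = "\<lambda>_. 0"])
        (use 2 in \<open>auto simp: bump_monomial_def\<close>)
    then show ?thesis using 2 by (simp add: bump_monomial_def)
  next
    case 3
    have "((\<lambda>h. (bump_monomial n (0 + h) - bump_monomial n 0) / h) \<longlongrightarrow> 0) (at 0)"
    proof (rule filterlim_split_at)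
      show "((\<lambda>h. (bump_monomial n (0 + h) - bump_monomial n 0) / h) \<longlongrightarrow> 0) (at_left 0)"
        by (rule tendsto_eventually)
          (auto simp: eventually_at_filter bump_monomial_def)
      \<comment> \<open>As \<open>h\<close> decreases to 0, \<open>exp (1 / h)\<close> beats every
        power of \<open>1 / h\<close>; the extra power in \<open>Suc n\<close> comes from the
        difference quotient.\<close>
      have "((\<lambda>h::real. (inverse h) ^ Suc n / exp (inverse h)) \<longlongrightarrow> 0) (at_right 0)"
        by (rule filterlim_compose[OF tendsto_power_div_exp_0 filterlim_inverse_at_top_right])
      then show "((\<lambda>h. (bump_monomial n (0 + h) - bump_monomial n 0) / h) \<longlongrightarrow> 0) (at_right 0)"
        by (rule Lim_transform_eventually)
          (auto simp: eventually_at_filter bump_monomial_def exp_minus divide_simps)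
    qed
    then show ?thesis using 3 by (simp add: has_field_derivative_iff bump_monomial_def)
  qed
qed

definition bump :: "real \<Rightarrow> real" where
  "bump x = (if x > 0 then exp (- (1 / x)) else 0)"

lemma bump_pos: "x > 0 \<Longrightarrow> bump x > 0" and bump_nonpos: "x \<le> 0 \<Longrightarrow> bump x = 0" and bump_nonneg: "0 \<le> bump x"
  by (auto simp: bump_def)

lemma smooth_bump:
  assumes "smooth f"
  shows "smooth (\<lambda>x. bump (f x))"
proof -
  have "Ck k (\<lambda>x. bump_monomial 0 (f x))" for k
  proof (rule Ck_compose_family[where G = bump_monomial and S = UNIV and J = "\<lambda>n. {Suc n, Suc (Suc n)}"
        and c = "\<lambda>n j. if j = Suc n then - real n else 1"])
    show "(bump_monomial i has_real_derivative
        (\<Sum>j\<in>{Suc i, Suc (Suc i)}. (if j = Suc i then - real i else 1) * bump_monomial j y)) (at y)" for i y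
      using bump_monomial_deriv[of i y] by simp
  qed (use assms in \<open>auto simp: smooth_def\<close>)
  moreover have "bump_monomial 0 = bump" by (auto simp: bump_monomial_def bump_def)
  ultimately show ?thesis by (simp add: smooth_def)
qed

subsection \<open>Gradients\<close>

lemma grad_eqI:
  assumes "(f has_derivative (\<lambda>v. g \<bullet> v)) (at x)"
  shows "grad f x = g"
  unfolding grad_def frechet_derivative_at[OF assms, symmetric]
  by (simp add: euclidean_representation)

lemma has_derivative_grad:
  assumes "f differentiable (at x)"
  shows "(f has_derivative (\<lambda>v. grad f x \<bullet> v)) (at x)"
proof -
  let ?D = "frechet_derivative f (at x)"
  have D: "(f has_derivative ?D) (at x)" using assms by (simp add: frechet_derivative_works)
  then interpret D: bounded_linear ?D by (rule has_derivative_bounded_linear)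
  have "?D v = grad f x \<bullet> v" for v
  proof -
    have "?D v = ?D (\<Sum>b\<in>Basis. (v \<bullet> b) *\<^sub>R b)" by (simp add: euclidean_representation)
    also have "\<dots> = grad f x \<bullet> v"
      by (simp add: D.sum D.scaleR grad_def inner_sum_left inner_sum_right inner_commute mult.commute)
    finally show ?thesis .
  qed
  then have "?D = (\<lambda>v. grad f x \<bullet> v)" by auto
  with D show ?thesis by simp
qed

lemma smooth_has_derivative: "smooth f \<Longrightarrow> (f has_derivative (\<lambda>v. grad f x \<bullet> v)) (at x)"
  by (simp add: has_derivative_grad smooth_differentiable)

lemma frechet_eq_grad: "smooth f \<Longrightarrow> frechet_derivative f (at x) v = grad f x \<bullet> v"
  using frechet_derivative_at[OF smooth_has_derivative, of f x] by metis

lemma continuous_grad: "smooth f \<Longrightarrow> continuous_on S (grad f)"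
  unfolding grad_def by (intro continuous_intros smooth_continuous_on smooth_frechet)

lemma grad_borel_measurable [measurable_dest]: "smooth f \<Longrightarrow> grad f \<in> borel_measurable borel"
  by (simp add: continuous_grad borel_measurable_continuous_onI)

lemma grad_const [simp]: "grad (\<lambda>_. c) x = 0"
  by (rule grad_eqI) simp

lemma grad_add: "smooth f \<Longrightarrow> smooth g \<Longrightarrow> grad (\<lambda>x. f x + g x) x = grad f x + grad g x"
  by (rule grad_eqI) (auto intro!: derivative_eq_intros smooth_has_derivative simp: inner_add_left)

lemma grad_diff: "smooth f \<Longrightarrow> smooth g \<Longrightarrow> grad (\<lambda>x. f x - g x) x = grad f x - grad g x"
  by (rule grad_eqI) (auto intro!: derivative_eq_intros smooth_has_derivative simp: inner_diff_left)

lemma grad_mult: "smooth f \<Longrightarrow> smooth g \<Longrightarrow> grad (\<lambda>x. f x * g x) x = f x *\<^sub>R grad g x + g x *\<^sub>R grad f x"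
  by (rule grad_eqI) (auto intro!: derivative_eq_intros smooth_has_derivative simp: inner_add_left)

lemma grad_cmult: "smooth f \<Longrightarrow> grad (\<lambda>x. c * f x) x = c *\<^sub>R grad f x"
  using grad_mult[OF smooth_const[of c]] by simp

lemma grad_sum:
  assumes "\<And>i. i \<in> I \<Longrightarrow> smooth (f i)"
  shows "grad (\<lambda>x. \<Sum>i\<in>I. f i x) x = (\<Sum>i\<in>I. grad (f i) x)"
  using assms
  by (induction I rule: infinite_finite_induct) (auto simp: grad_add smooth_sum)

lemma grad_compose_real:
  assumes "smooth f" "(G has_real_derivative d) (at (f x))"
  shows "grad (\<lambda>x. G (f x)) x = d *\<^sub>R grad f x"
  using has_derivative_compose[OF smooth_has_derivative[OF assms(1), of x], of G "\<lambda>y. d * y"] assms(2)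
  by (intro grad_eqI) (auto simp: has_field_derivative_def)

lemma grad_affine:
  assumes "smooth f"
  shows "grad (\<lambda>x. f (c *\<^sub>R x + a)) x = c *\<^sub>R grad f (c *\<^sub>R x + a)"
proof (rule grad_eqI)
  show "((\<lambda>x. f (c *\<^sub>R x + a)) has_derivative (\<lambda>v. (c *\<^sub>R grad f (c *\<^sub>R x + a)) \<bullet> v)) (at x)"
    by (rule has_derivative_eq_rhs[OF has_derivative_compose[of "\<lambda>x. c *\<^sub>R x + a" "\<lambda>v. c *\<^sub>R v" x UNIV f,
          OF _ smooth_has_derivative[OF assms]]])
      (auto intro!: derivative_eq_intros)
qed

lemma grad_zero_on_open:
  assumes "open S" "x \<in> S" "\<And>y. y \<in> S \<Longrightarrow> f y = c"
  shows "grad f x = 0"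
proof (rule grad_eqI)
  show "(f has_derivative (\<lambda>v. 0 \<bullet> v)) (at x)"
    by (rule has_derivative_transform_within_open[OF _ assms(1,2), of "\<lambda>_. c"]) (use assms in auto)
qed

lemma grad_zero_outside:
  assumes "\<And>y. norm y > R \<Longrightarrow> f y = 0" "norm x > R"
  shows "grad f x = 0"
  by (rule grad_zero_on_open[of "- cball 0 R"]) (use assms in \<open>auto simp: not_le\<close>)

section \<open>Mollification\<close>

lemma uniformly_continuous_compact_support:
  fixes f :: "'a::euclidean_space \<Rightarrow> 'b::real_normed_vector"
  assumes c: "continuous_on UNIV f" and z: "\<And>x. norm x > R \<Longrightarrow> f x = 0" and e: "e > 0"
  shows "\<exists>d>0. \<forall>x y. dist x y < d \<longrightarrow> dist (f x) (f y) < e"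
proof -
  have "uniformly_continuous_on (cball 0 (R + 1)) f"
    by (intro compact_uniformly_continuous continuous_on_subset[OF c]) auto
  then obtain d where d: "d > 0"
    "\<And>x y. x \<in> cball 0 (R + 1) \<Longrightarrow> y \<in> cball 0 (R + 1) \<Longrightarrow> dist y x < d \<Longrightarrow> dist (f y) (f x) < e"
    unfolding uniformly_continuous_on_def using e by metis
  have "dist (f x) (f y) < e" if "dist x y < min d 1" for x y
  proof (cases "x \<in> cball 0 (R + 1) \<and> y \<in> cball 0 (R + 1)")
    case True
    then show ?thesis using d(2)[of y x] that by simp
  next
    \<comment> \<open>If one point leaves the ball of radius \<open>R + 1\<close>, the other is
      within distance 1 of it and still beyond radius \<open>R\<close>, so both values
      vanish.\<close>
    case False
    then have "norm x > R \<and> norm y > R"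
      using that norm_triangle_ineq3[of x y] by (auto simp: dist_norm)
    then show ?thesis using e by (simp add: z)
  qed
  then show ?thesis using d(1) by (intro exI[of _ "min d 1"]) auto
qed

lemma bounded_compact_support:
  fixes f :: "'a::euclidean_space \<Rightarrow> 'b::real_normed_vector"
  assumes c: "continuous_on UNIV f" and z: "\<And>x. norm x > R \<Longrightarrow> f x = 0"
  shows "\<exists>B\<ge>0. \<forall>x. norm (f x) \<le> B"
proof -
  have "bounded (f ` cball 0 R)"
    by (intro compact_imp_bounded compact_continuous_image continuous_on_subset[OF c]) auto
  then obtain B where B: "B > 0" "\<And>x. x \<in> cball 0 R \<Longrightarrow> norm (f x) \<le> B"
    by (force simp: bounded_pos)
  then have "norm (f x) \<le> B" for x
    using z[of x] by (cases "norm x \<le> R") auto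
  then show ?thesis using B(1) by (intro exI[of _ B]) auto
qed

text \<open>Mean value estimate with uniform continuity of the gradient. An error uniform in
  \<open>x\<close> allows differentiation under the integral sign, and later the computation of
  integrals of gradients, by a single norm estimate.\<close>

lemma smooth_taylor_uniform:
  fixes f :: "'a::euclidean_space \<Rightarrow> real"
  assumes s: "smooth f" and z: "\<And>x. norm x > R \<Longrightarrow> f x = 0" and e: "e > 0"
  shows "\<exists>d>0. \<forall>x h. norm h < d \<longrightarrow> \<bar>f (x + h) - f x - grad f x \<bullet> h\<bar> \<le> e * norm h"
proof -
  obtain d where d: "d > 0" "\<And>x y. dist x y < d \<Longrightarrow> dist (grad f x) (grad f y) < e"
    using uniformly_continuous_compact_support[OF continuous_grad[OF s] grad_zero_outside[of R f, OF z] e] by metis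
  have "\<bar>f (x + h) - f x - grad f x \<bullet> h\<bar> \<le> e * norm h" if h: "norm h < d" for x h
  proof -
    have "norm (f (x + h) - f x - grad f x \<bullet> ((x + h) - x)) \<le> norm ((x + h) - x) * e"
    proof (rule differentiable_bound_linearization[where S = "ball x d" and f' = "\<lambda>x v. grad f x \<bullet> v"])
      show "x + t *\<^sub>R (x + h - x) \<in> ball x d" if "t \<in> {0..1}" for t
      proof -
        have "norm (t *\<^sub>R h) \<le> norm h" using that by (simp add: mult_left_le_one_le)
        then show ?thesis using h by (simp add: dist_norm)
      qed
      show "(f has_derivative (\<lambda>v. grad f y \<bullet> v)) (at y within ball x d)" for y
        using smooth_has_derivative[OF s] by (rule has_derivative_at_withinI)
      show "onorm ((\<lambda>v::'a. grad f y \<bullet> v) - (\<lambda>v. grad f x \<bullet> v)) \<le> e" if "y \<in> ball x d" for y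
      proof (rule onorm_le)
        fix v :: 'a
        have "norm (grad f y - grad f x) \<le> e"
          using d(2)[of y x] that by (simp add: dist_norm norm_minus_commute)
        then have "norm (grad f y - grad f x) * norm v \<le> e * norm v"
          by (rule mult_right_mono) simp
        then show "norm (((\<lambda>v. grad f y \<bullet> v) - (\<lambda>v. grad f x \<bullet> v)) v) \<le> e * norm v"
          using Cauchy_Schwarz_ineq2[of "grad f y - grad f x" v] by (simp add: inner_diff_left)
      qed
      show "x \<in> ball x d" using d(1) by simp
    qed
    then show ?thesis by (simp add: mult.commute)
  qed
  with d(1) show ?thesis by blast
qed

lemma integrable_bounded_mult:
  fixes f :: "'a \<Rightarrow> real" and g :: "'a \<Rightarrow> 'b::euclidean_space"
  assumes "integrable M g" "f \<in> borel_measurable M" "\<And>x. \<bar>f x\<bar> \<le> B"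
  shows "integrable M (\<lambda>x. f x *\<^sub>R g x)"
proof (rule Bochner_Integration.integrable_bound[where f = "\<lambda>x. B *\<^sub>R g x"])
  have "\<bar>f x\<bar> * norm (g x) \<le> \<bar>B\<bar> * norm (g x)" for x
    using assms(3)[of x] by (intro mult_right_mono) auto
  then show "AE x in M. norm (f x *\<^sub>R g x) \<le> norm (B *\<^sub>R g x)" by simp
qed (use assms in auto)

lemma integrable_mult_bounded:
  fixes f :: "'a \<Rightarrow> real" and g :: "'a \<Rightarrow> 'b::euclidean_space"
  assumes "integrable M f" "g \<in> borel_measurable M" "\<And>x. norm (g x) \<le> B"
  shows "integrable M (\<lambda>x. f x *\<^sub>R g x)"
proof (rule Bochner_Integration.integrable_bound[where f = "\<lambda>x. B * f x"])
  have "\<bar>f x\<bar> * norm (g x) \<le> \<bar>f x\<bar> * \<bar>B\<bar>" for x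
    using assms(3)[of x] by (intro mult_left_mono) auto
  then show "AE x in M. norm (f x *\<^sub>R g x) \<le> norm (B * f x)" by (simp add: abs_mult mult.commute)
qed (use assms in auto)

definition convolution :: "('a::euclidean_space \<Rightarrow> real) \<Rightarrow> ('a \<Rightarrow> real) \<Rightarrow> 'a \<Rightarrow> real" where
  "convolution F \<eta> x = (LINT y|lborel. F y * \<eta> (x - y))"

text \<open>The remainder of the uniform first order expansion of \<open>\<eta>\<close> is
  integrated against \<open>F\<close>.\<close>

lemma convolution_has_derivative:
  assumes F: "integrable lborel F" and s: "smooth \<eta>" and z: "\<And>x. norm x > R \<Longrightarrow> \<eta> x = 0"
  shows "(convolution F \<eta> has_derivative (\<lambda>v. (LINT y|lborel. F y *\<^sub>R grad \<eta> (x - y)) \<bullet> v)) (at x)"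
  unfolding has_derivative_at_alt
proof (intro conjI allI impI)
  have [measurable]: "\<eta> \<in> borel_measurable borel" "grad \<eta> \<in> borel_measurable borel" "F \<in> borel_measurable borel"
    using s F by (auto simp: smooth_borel_measurable grad_borel_measurable dest: borel_measurable_integrable)
  obtain B where B: "\<And>x. norm (\<eta> x) \<le> B"
    using bounded_compact_support[OF smooth_continuous[OF s], of R] z by metis
  obtain B' where B': "\<And>x. norm (grad \<eta> x) \<le> B'"
    using bounded_compact_support[OF continuous_grad[OF s] grad_zero_outside[of R \<eta>, OF z]] by metis
  have i1: "integrable lborel (\<lambda>y. F y * \<eta> (x - y))" for x
    using integrable_mult_bounded[OF F, of "\<lambda>y. \<eta> (x - y)" B] B by simp
  have i2: "integrable lborel (\<lambda>y. F y *\<^sub>R grad \<eta> (x - y))" for x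
    using integrable_mult_bounded[OF F, of "\<lambda>y. grad \<eta> (x - y)" B'] B' by simp
  fix e :: real assume "e > 0"
  define I where "I = (LINT y|lborel. \<bar>F y\<bar>)"
  have I: "0 \<le> I" by (simp add: I_def)
  \<comment> \<open>The denominator is \<open>I + 1\<close> because \<open>I\<close> vanishes when
    \<open>F\<close> is zero almost everywhere; the resulting factor \<open>I / (I + 1)\<close> is
    at most 1.\<close>
  then have "e / (I + 1) > 0" using \<open>e > 0\<close> by simp
  from smooth_taylor_uniform[OF s z this] obtain d where d: "d > 0"
    "\<And>x h. norm h < d \<Longrightarrow> \<bar>\<eta> (x + h) - \<eta> x - grad \<eta> x \<bullet> h\<bar> \<le> e / (I + 1) * norm h"
    by metis
  have "norm (convolution F \<eta> y - convolution F \<eta> x - (LINT z|lborel. F z *\<^sub>R grad \<eta> (x - z)) \<bullet> (y - x))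
      \<le> e * norm (y - x)" if y: "norm (y - x) < d" for y
  proof -
    let ?g = "\<lambda>z. F z * \<eta> (y - z) - F z * \<eta> (x - z) - F z *\<^sub>R grad \<eta> (x - z) \<bullet> (y - x)"
    have ig: "integrable lborel ?g"
      using i1 i2 by (intro Bochner_Integration.integrable_diff integrable_inner_left) auto
    have "convolution F \<eta> y - convolution F \<eta> x - (LINT z|lborel. F z *\<^sub>R grad \<eta> (x - z)) \<bullet> (y - x)
        = (LINT z|lborel. ?g z)"
    proof -
      have "(LINT z|lborel. F z *\<^sub>R grad \<eta> (x - z) \<bullet> (y - x)) = (LINT z|lborel. F z *\<^sub>R grad \<eta> (x - z)) \<bullet> (y - x)"
        by (rule integral_inner_left) (rule i2)
      moreover have "integrable lborel (\<lambda>z. F z *\<^sub>R grad \<eta> (x - z) \<bullet> (y - x))"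
        by (rule integrable_inner_left) (rule i2)
      ultimately show ?thesis
        using i1 unfolding convolution_def by (simp del: inner_scaleR_left)
    qed
    moreover have "norm (LINT z|lborel. ?g z) \<le> (LINT z|lborel. \<bar>F z\<bar> * (e / (I + 1) * norm (y - x)))"
    proof (rule Bochner_Integration.integral_norm_bound_integral[OF ig])
      fix z
      have "\<bar>\<eta> (y - z) - \<eta> (x - z) - grad \<eta> (x - z) \<bullet> (y - x)\<bar> \<le> e / (I + 1) * norm (y - x)"
        using d(2)[OF y, of "x - z"] by simp
      then have "\<bar>F z\<bar> * \<bar>\<eta> (y - z) - \<eta> (x - z) - grad \<eta> (x - z) \<bullet> (y - x)\<bar> \<le> \<bar>F z\<bar> * (e / (I + 1) * norm (y - x))"
        by (intro mult_left_mono) auto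
      then show "norm (?g z) \<le> \<bar>F z\<bar> * (e / (I + 1) * norm (y - x))"
        by (simp add: abs_mult[symmetric] right_diff_distrib)
    qed (use F in auto)
    also have "\<dots> = I / (I + 1) * (e * norm (y - x))"
      by (simp add: I_def)
    also have "\<dots> \<le> 1 * (e * norm (y - x))"
      using I \<open>e > 0\<close> by (intro mult_right_mono) (auto simp: divide_simps)
    ultimately show ?thesis by simp
  qed
  with d(1) show "\<exists>d>0. \<forall>y. norm (y - x) < d \<longrightarrow>
      norm (convolution F \<eta> y - convolution F \<eta> x - (LINT z|lborel. F z *\<^sub>R grad \<eta> (x - z)) \<bullet> (y - x)) \<le> e * norm (y - x)"
    by blast
qed (rule bounded_linear_inner_right)

lemma grad_convolution:
  assumes "integrable lborel F" "smooth \<eta>" "\<And>x. norm x > R \<Longrightarrow> \<eta> x = 0"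
  shows "grad (convolution F \<eta>) x = (LINT y|lborel. F y *\<^sub>R grad \<eta> (x - y))"
  by (rule grad_eqI, rule convolution_has_derivative) (use assms in auto)

text \<open>\<open>\<eta>\<close> is generalised in the induction: a directional derivative of the
  convolution is the convolution with that derivative of \<open>\<eta>\<close>, again smooth and
  supported in the same ball.\<close>

lemma smooth_convolution:
  assumes F: "integrable lborel F" and "smooth \<eta>" "\<And>x. norm x > R \<Longrightarrow> \<eta> x = 0"
  shows "smooth (convolution F \<eta>)"
  unfolding smooth_def
proof
  fix k show "Ck k (convolution F \<eta>)"
    using assms(2,3)
  proof (induction k arbitrary: \<eta>)
    case 0
    have "continuous (at x) (convolution F \<eta>)" for x
      using convolution_has_derivative[OF F 0] by (rule has_derivative_continuous)
    then show ?case by (simp add: continuous_on_eq_continuous_at)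
  next
    case (Suc k)
    show ?case
    proof (rule Ck_SucI[OF convolution_has_derivative[OF F Suc.prems]])
      fix v
      have s: "smooth (\<lambda>x. grad \<eta> x \<bullet> v)"
        using smooth_frechet[OF Suc.prems(1), of v] by (simp add: frechet_eq_grad[OF Suc.prems(1)])
      have [measurable]: "grad \<eta> \<in> borel_measurable borel"
        by (rule grad_borel_measurable[OF Suc.prems(1)])
      obtain B' where B': "\<And>x. norm (grad \<eta> x) \<le> B'"
        using bounded_compact_support[OF continuous_grad[OF Suc.prems(1)] grad_zero_outside[of R \<eta>, OF Suc.prems(2)]] by metis
      have i2: "integrable lborel (\<lambda>y. F y *\<^sub>R grad \<eta> (x - y))" for x
        using integrable_mult_bounded[OF F, of "\<lambda>y. grad \<eta> (x - y)" B'] B' by simp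
      have "(LINT y|lborel. F y *\<^sub>R grad \<eta> (x - y)) \<bullet> v = convolution F (\<lambda>x. grad \<eta> x \<bullet> v) x" for x
        using i2[of x] unfolding convolution_def by (subst integral_inner_left[symmetric]) auto
      moreover have "Ck k (convolution F (\<lambda>x. grad \<eta> x \<bullet> v))"
        by (rule Suc.IH[OF s]) (simp add: grad_zero_outside[of R \<eta>, OF Suc.prems(2)])
      ultimately show "Ck k (\<lambda>x. (LINT y|lborel. F y *\<^sub>R grad \<eta> (x - y)) \<bullet> v)" by simp
    qed
  qed
qed

section \<open>Mollifiers and partitions of unity\<close>

lemma exists_mollifier:
  assumes "\<delta> > 0"
  shows "\<exists>\<eta> :: 'a::euclidean_space \<Rightarrow> real. smooth \<eta> \<and> (\<forall>x. 0 \<le> \<eta> x) \<and> (\<forall>x. norm x \<ge> \<delta> \<longrightarrow> \<eta> x = 0) \<and>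
    integrable lborel \<eta> \<and> (LINT x|lborel. \<eta> x) = 1"
proof -
  define f :: "'a \<Rightarrow> real" where "f x = bump (\<delta>\<^sup>2 - (norm (x - 0))\<^sup>2)" for x
  have s: "smooth f"
    unfolding f_def by (intro smooth_bump smooth_diff smooth_const smooth_norm_sq)
  have z: "f x = 0" if "norm x \<ge> \<delta>" for x
    using that assms by (simp add: f_def bump_nonpos power_mono)
  have f0: "0 \<le> f x" for x by (simp add: f_def bump_nonneg)
  have [measurable]: "f \<in> borel_measurable borel" by (rule smooth_borel_measurable[OF s])
  have "integrable lborel (\<lambda>x. indicator (cball 0 \<delta>) x *\<^sub>R f x)"
    by (rule borel_integrable_compact) (auto intro: smooth_continuous_on[OF s])
  moreover have "(\<lambda>x. indicator (cball 0 \<delta>) x *\<^sub>R f x) = f"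
    using z by (auto simp: fun_eq_iff indicator_def)
  ultimately have i: "integrable lborel f" by simp
  \<comment> \<open>The value of \<open>f\<close> at \<open>norm x = \<delta> / 2\<close>, as
    \<open>\<delta>\<^sup>2 - (\<delta> / 2)\<^sup>2 = 3/4 * \<delta>\<^sup>2\<close>. It bounds
    \<open>f\<close> from below on the half ball and makes the integral positive.\<close>
  define c where "c = bump (3/4 * \<delta>\<^sup>2)"
  have "bump x \<le> bump y" if "x \<le> y" for x y
    using that by (auto simp: bump_def divide_simps)
  then have ge: "c * indicator (cball 0 (\<delta>/2)) x \<le> f x" for x
  proof (cases "x \<in> cball 0 (\<delta>/2)")
    case True
    then have "(norm x)\<^sup>2 \<le> (\<delta>/2)\<^sup>2" by (intro power_mono) auto
    then have "3/4 * \<delta>\<^sup>2 \<le> \<delta>\<^sup>2 - (norm x)\<^sup>2" by (simp add: power2_eq_square)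
    then show ?thesis
      using True \<open>\<And>x y. x \<le> y \<Longrightarrow> bump x \<le> bump y\<close> by (simp add: c_def f_def)
  qed (simp add: f_def bump_nonneg)
  have "0 < c * measure lborel (cball (0::'a) (\<delta>/2))"
    using assms by (simp add: c_def bump_pos content_cball_pos)
  also have "\<dots> = (LINT x|lborel. c * indicator (cball (0::'a) (\<delta>/2)) x)"
    by simp
  also have "\<dots> \<le> (LINT x|lborel. f x)"
  proof (rule integral_mono)
    show "integrable lborel (\<lambda>x. c * indicat_real (cball (0::'a) (\<delta>/2)) x)"
      by (intro integrable_mult_right integrable_real_indicator emeasure_bounded_finite) auto
  qed (use i ge in auto)
  finally have pos: "0 < (LINT x|lborel. f x)" .
  show ?thesis
  proof (intro exI[of _ "\<lambda>x. 1 / (LINT x|lborel. f x) * f x"] conjI allI impI)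
    show "smooth (\<lambda>x. 1 / (LINT x|lborel. f x) * f x)"
      by (intro smooth_mult smooth_const s)
  qed (use pos i z f0 in auto)
qed

lemma exists_partition_of_unity:
  fixes K :: "'a::euclidean_space set"
  assumes K: "compact K" and r: "\<And>p. p \<in> K \<Longrightarrow> r p > 0"
  shows "\<exists>P \<zeta>. finite P \<and> P \<subseteq> K \<and> (\<forall>p\<in>P. smooth (\<zeta> p) \<and> (\<forall>x. norm (x - p) \<ge> r p \<longrightarrow> \<zeta> p x = 0)) \<and>
    (\<forall>x\<in>K. (\<Sum>p\<in>P. \<zeta> p x) = 1)"
proof (cases "K = {}")
  case True
  then show ?thesis by (intro exI[of _ "{}"]) auto
next
  case False
  have "K \<subseteq> (\<Union>p\<in>K. ball p (r p))" using r by auto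
  then obtain P where P: "P \<subseteq> K" "finite P" "K \<subseteq> (\<Union>p\<in>P. ball p (r p))"
    by (rule compactE_image[OF K, rotated]) auto
  define b where "b p x = bump ((r p)\<^sup>2 - (norm (x - p))\<^sup>2)" for p x
  have b: "smooth (b p)" for p
    unfolding b_def by (intro smooth_bump smooth_diff smooth_const smooth_norm_sq)
  define B where "B x = (\<Sum>p\<in>P. b p x)" for x
  have B: "smooth B" unfolding B_def by (intro smooth_sum b)
  have B0: "0 \<le> B x" for x by (simp add: B_def b_def bump_nonneg sum_nonneg)
  have Bpos: "B x > 0" if "x \<in> K" for x
  proof -
    have "x \<in> (\<Union>p\<in>P. ball p (r p))" using P(3) that by blast
    then obtain p where p: "p \<in> P" "x \<in> ball p (r p)" by blast
    then have "(norm (x - p))\<^sup>2 < (r p)\<^sup>2"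
      by (intro power_strict_mono) (auto simp: dist_norm norm_minus_commute)
    then have "0 < b p x" by (simp add: b_def bump_pos)
    then show ?thesis
      unfolding B_def using p P by (intro sum_pos2[of P p]) (auto simp: b_def bump_nonneg)
  qed
  obtain x0 where x0: "x0 \<in> K" "\<And>x. x \<in> K \<Longrightarrow> B x0 \<le> B x"
    using continuous_attains_inf[OF K False smooth_continuous_on[OF B]] by auto
  \<comment> \<open>\<open>B\<close> is positive on \<open>K\<close> but may vanish elsewhere. The
    added bump is active exactly where \<open>B\<close> falls below its minimum on \<open>K\<close>,
    so \<open>D\<close> is positive everywhere and equals \<open>B\<close> on
    \<open>K\<close>.\<close>
  define D where "D x = B x + bump (B x0 - B x)" for x
  have D: "smooth D" unfolding D_def by (intro smooth_add B smooth_bump smooth_diff smooth_const)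
  have Dpos: "D x > 0" for x
  proof (cases "B x < B x0")
    case True
    then show ?thesis using B0[of x] by (simp add: D_def bump_pos add_nonneg_pos)
  next
    case False
    then show ?thesis using Bpos[OF x0(1)] bump_nonneg by (simp add: D_def add_pos_nonneg)
  qed
  show ?thesis
  proof (intro exI[of _ P] exI[of _ "\<lambda>p x. b p x * (1 / D x)"] conjI ballI allI impI)
    show "smooth (\<lambda>x. b p x * (1 / D x))" for p
      by (intro smooth_mult b smooth_inverse D Dpos)
    show "b p x * (1 / D x) = 0" if "p \<in> P" "norm (x - p) \<ge> r p" for p x
      using that r[of p] P by (auto simp: b_def bump_nonpos power_mono)
    show "(\<Sum>p\<in>P. b p x * (1 / D x)) = 1" if "x \<in> K" for x
    proof -
      have "D x = B x" using x0(2)[OF that] by (simp add: D_def bump_nonpos)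
      then show ?thesis using Bpos[OF that] by (simp add: B_def sum_divide_distrib[symmetric])
    qed
  qed (use P in auto)
qed

section \<open>Continuity of translations in L2\<close>

lemma lborel_distr_shift: "distr lborel borel (\<lambda>x. x + c) = (lborel :: 'a::euclidean_space measure)"
proof -
  have "(\<lambda>x. x + c) = (+) c" by (auto simp: add.commute)
  then show ?thesis by (simp only: lborel_distr_plus)
qed

lemma lborel_distr_reflect: "distr lborel borel (\<lambda>x. c - x) = (lborel :: 'a::euclidean_space measure)"
  using lborel_affine[of "-1" c] by (simp add: density_1)

lemma nn_integral_lborel_shift:
  fixes f :: "'a::euclidean_space \<Rightarrow> ennreal"
  assumes [measurable]: "f \<in> borel_measurable borel"
  shows "(\<integral>\<^sup>+x. f (x + c) \<partial>lborel) = (\<integral>\<^sup>+x. f x \<partial>lborel)"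
  by (subst (2) lborel_distr_shift[of c, symmetric], subst nn_integral_distr) auto

lemma integrable_lborel_shift:
  fixes f :: "'a::euclidean_space \<Rightarrow> 'b::{banach, second_countable_topology}"
  assumes "integrable lborel f"
  shows "integrable lborel (\<lambda>x. f (x + c))"
proof -
  have "integrable (distr lborel borel (\<lambda>x. x + c)) f" using assms by (simp add: lborel_distr_shift)
  then show ?thesis
    using assms by (subst (asm) integrable_distr_eq) (auto dest: borel_measurable_integrable)
qed

lemma integral_lborel_shift:
  fixes f :: "'a::euclidean_space \<Rightarrow> 'b::{banach, second_countable_topology}"
  assumes [measurable]: "f \<in> borel_measurable borel"
  shows "(LINT x|lborel. f (x + c)) = (LINT x|lborel. f x)"
  by (subst (2) lborel_distr_shift[of c, symmetric], subst integral_distr) auto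

lemma integral_lborel_reflect:
  fixes f :: "'a::euclidean_space \<Rightarrow> 'b::{banach, second_countable_topology}"
  assumes [measurable]: "f \<in> borel_measurable borel"
  shows "(LINT x|lborel. f (c - x)) = (LINT x|lborel. f x)"
  by (subst (2) lborel_distr_reflect[of c, symmetric], subst integral_distr) auto

lemma L2_shift:
  assumes "L2 lborel F"
  shows "L2 lborel (\<lambda>x. F (x + c))"
proof -
  have [measurable]: "F \<in> borel_measurable borel" using L2_measurable[OF assms] by simp
  show ?thesis
    using integrable_lborel_shift[OF L2_integrable_sq[OF assms], of c] by (simp add: L2_def)
qed

definition translation_dist :: "('a::euclidean_space \<Rightarrow> 'b::euclidean_space) \<Rightarrow> 'a \<Rightarrow> real" where
  "translation_dist F h = (LINT x|lborel. (norm (F (x + h) - F x))\<^sup>2)"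

definition translation_continuous :: "('a::euclidean_space \<Rightarrow> 'b::euclidean_space) \<Rightarrow> bool" where
  "translation_continuous F \<longleftrightarrow> (\<forall>e>0. \<exists>d>0. \<forall>h. norm h < d \<longrightarrow> translation_dist F h < e)"

lemma translation_continuous_add:
  assumes F: "L2 lborel F" "translation_continuous F" and G: "L2 lborel G" "translation_continuous G"
  shows "translation_continuous (\<lambda>x. F x + G x)"
  unfolding translation_continuous_def
proof (intro allI impI)
  fix e :: real assume "e > 0"
  then have "e / 4 > 0" by simp
  then obtain d1 d2 where d: "d1 > 0" "\<And>h. norm h < d1 \<Longrightarrow> translation_dist F h < e / 4"
    "d2 > 0" "\<And>h. norm h < d2 \<Longrightarrow> translation_dist G h < e / 4"
    using F(2) G(2) unfolding translation_continuous_def by metis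
  have "translation_dist (\<lambda>x. F x + G x) h < e" if "norm h < min d1 d2" for h
  proof -
    have i: "integrable lborel (\<lambda>x. (norm (F (x + h) - F x))\<^sup>2)" "integrable lborel (\<lambda>x. (norm (G (x + h) - G x))\<^sup>2)"
      "integrable lborel (\<lambda>x. (norm (F (x + h) + G (x + h) - (F x + G x)))\<^sup>2)"
      using F(1) G(1) by (auto intro!: L2_integrable_sq L2_diff L2_add L2_shift)
    have "translation_dist (\<lambda>x. F x + G x) h
        \<le> (LINT x|lborel. 2 * (norm (F (x + h) - F x))\<^sup>2 + 2 * (norm (G (x + h) - G x))\<^sup>2)"
      unfolding translation_dist_def
    proof (rule integral_mono)
      show "(norm (F (x + h) + G (x + h) - (F x + G x)))\<^sup>2 \<le> 2 * (norm (F (x + h) - F x))\<^sup>2 + 2 * (norm (G (x + h) - G x))\<^sup>2" for x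
        using norm_add_sq_le[of "F (x + h) - F x" "G (x + h) - G x"] by (simp add: algebra_simps)
    qed (use i in auto)
    also have "\<dots> = 2 * translation_dist F h + 2 * translation_dist G h"
      using i by (simp add: translation_dist_def)
    also have "\<dots> < e" using d(2)[of h] d(4)[of h] that by simp
    finally show ?thesis .
  qed
  then show "\<exists>d>0. \<forall>h. norm h < d \<longrightarrow> translation_dist (\<lambda>x. F x + G x) h < e"
    using d(1,3) by (intro exI[of _ "min d1 d2"]) auto
qed

lemma translation_continuous_zero: "translation_continuous (\<lambda>_. 0)"
  by (auto simp: translation_continuous_def translation_dist_def intro: exI[of _ 1])

lemma translation_continuous_sum:
  assumes "\<And>i. i \<in> I \<Longrightarrow> L2 lborel (F i) \<and> translation_continuous (F i)"
  shows "L2 lborel (\<lambda>x. \<Sum>i\<in>I. F i x) \<and> translation_continuous (\<lambda>x. \<Sum>i\<in>I. F i x)"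
  using assms
proof (induction I rule: infinite_finite_induct)
  case (insert i I)
  then show ?case by (auto intro: L2_add translation_continuous_add)
qed (auto simp: translation_continuous_zero L2_def)

lemma translation_continuous_approx:
  assumes F: "L2 lborel F"
    and A: "\<And>e. e > 0 \<Longrightarrow> \<exists>G. L2 lborel G \<and> translation_continuous G \<and> (LINT x|lborel. (norm (F x - G x))\<^sup>2) < e"
  shows "translation_continuous F"
  unfolding translation_continuous_def
proof (intro allI impI)
  fix e :: real assume "e > 0"
  \<comment> \<open>Two uses of the triangle inequality with factor 2 give
    \<open>2 + 4 + 4 = 10\<close> sixteenths of \<open>e\<close>.\<close>
  then have e: "e / 16 > 0" by simp
  obtain G where G: "L2 lborel G" "translation_continuous G" "(LINT x|lborel. (norm (F x - G x))\<^sup>2) < e / 16"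
    using A[OF e] by auto
  obtain d where d: "d > 0" "\<And>h. norm h < d \<Longrightarrow> translation_dist G h < e / 16"
    using G(2) e unfolding translation_continuous_def by metis
  have [measurable]: "F \<in> borel_measurable borel" "G \<in> borel_measurable borel"
    using L2_measurable[OF F] L2_measurable[OF G(1)] by auto
  have "translation_dist F h < e" if "norm h < d" for h
  proof -
    note S = L2_shift[OF F, of h] L2_shift[OF G(1), of h]
    have "translation_dist F h \<le> 2 * (LINT x|lborel. (norm (F (x + h) - G (x + h)))\<^sup>2)
        + 2 * (LINT x|lborel. (norm (G (x + h) - F x))\<^sup>2)"
      unfolding translation_dist_def by (rule L2_dist_triangle) (use S F in auto)
    moreover have "(LINT x|lborel. (norm (G (x + h) - F x))\<^sup>2)
        \<le> 2 * translation_dist G h + 2 * (LINT x|lborel. (norm (G x - F x))\<^sup>2)"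
      unfolding translation_dist_def by (rule L2_dist_triangle) (use S F G in auto)
    moreover have "(LINT x|lborel. (norm (F (x + h) - G (x + h)))\<^sup>2) = (LINT x|lborel. (norm (F x - G x))\<^sup>2)"
      by (rule integral_lborel_shift) measurable
    ultimately show ?thesis using d(2)[OF that] G(3) \<open>e > 0\<close> by (simp add: norm_minus_commute)
  qed
  with d(1) show "\<exists>d>0. \<forall>h. norm h < d \<longrightarrow> translation_dist F h < e" by blast
qed

text \<open>Regularity of Lebesgue measure gives a compact \<open>T\<close> inside and an open
  \<open>U\<close> around \<open>A\<close> with \<open>U - T\<close> small. A translation shorter
  than the distance from \<open>T\<close> to the complement of \<open>U\<close> changes the
  indicator only where \<open>x\<close> or \<open>x + h\<close> lies in
  \<open>U - T\<close>.\<close>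

lemma translation_continuous_indicator:
  fixes c :: "'b::euclidean_space" and A :: "'a::euclidean_space set"
  assumes A: "A \<in> sets borel" and b: "bounded A"
  shows "L2 lborel (\<lambda>x. indicat_real A x *\<^sub>R c) \<and> translation_continuous (\<lambda>x. indicat_real A x *\<^sub>R c)"
proof
  have fin: "emeasure lborel A < \<infinity>" using b by (rule emeasure_bounded_finite)
  have "(norm (indicat_real A x *\<^sub>R c))\<^sup>2 = indicat_real A x * (norm c)\<^sup>2" for x
    by (auto simp: indicator_def)
  then show L: "L2 lborel (\<lambda>x. indicat_real A x *\<^sub>R c)"
    using A fin by (auto simp: L2_def)
  show "translation_continuous (\<lambda>x. indicat_real A x *\<^sub>R c)"
    unfolding translation_continuous_def
  proof (intro allI impI)
    fix e :: real assume "e > 0"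
    \<comment> \<open>Chosen so that \<open>4 * e' * ((norm c)\<^sup>2 + 1) = e\<close>; each of the
      two shifted copies of \<open>U - T\<close> has measure below \<open>2 * e'\<close>.\<close>
    define e' where "e' = e / (4 * ((norm c)\<^sup>2 + 1))"
    have e': "e' > 0" using \<open>e > 0\<close> by (simp add: e'_def add_nonneg_pos)
    have AL: "A \<in> sets lebesgue" using A by simp
    obtain U where U: "open U" "A \<subseteq> U" "U - A \<in> lmeasurable" "emeasure lebesgue (U - A) < ennreal e'"
      using sets_lebesgue_outer_open[OF AL e'] .
    obtain T where T: "closed T" "T \<subseteq> A" "A - T \<in> lmeasurable" "emeasure lebesgue (A - T) < ennreal e'"
      using sets_lebesgue_inner_closed[OF AL e'] by blast
    have "compact T" using T(1,2) b by (meson bounded_subset compact_eq_bounded_closed)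
    then obtain d where d: "d > 0" "\<And>x y. x \<in> T \<Longrightarrow> y \<in> - U \<Longrightarrow> d \<le> dist x y"
    proof -
      have "T \<inter> - U = {}" using U(2) T(2) by blast
      then show ?thesis
        using separate_compact_closed[OF \<open>compact T\<close>, of "- U"] U(1) that by (auto simp: closed_Compl)
    qed
    define D where "D = U - T"
    have [measurable]: "D \<in> sets borel" "A \<in> sets borel" using U T A by (auto simp: D_def)
    have Dm: "D \<in> lmeasurable" "measure lebesgue D < 2 * e'"
    proof -
      have eq: "D = (U - A) \<union> (A - T)" using U T by (auto simp: D_def)
      show "D \<in> lmeasurable" unfolding eq using U T by auto
      have "measure lebesgue D \<le> measure lebesgue (U - A) + measure lebesgue (A - T)"
        unfolding eq using U(3) T(3) by (rule measure_Un_le[OF fmeasurableD fmeasurableD])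
      moreover have "measure lebesgue (U - A) < e'" "measure lebesgue (A - T) < e'"
        using U T e' by (auto simp: emeasure_eq_measure2 ennreal_less_iff)
      ultimately show "measure lebesgue D < 2 * e'" by simp
    qed
    have Dfin: "emeasure lborel D < \<infinity>" and Dme: "measure lborel D < 2 * e'"
      using Dm by (auto simp: fmeasurable_def)
    have "translation_dist (\<lambda>x. indicat_real A x *\<^sub>R c) h < e" if h: "norm h < d" for h
    proof -
      have iD: "integrable lborel (indicat_real D)" using Dfin by simp
      have "translation_dist (\<lambda>x. indicat_real A x *\<^sub>R c) h
          \<le> (LINT x|lborel. (indicat_real D (x + h) + indicat_real D x) * (norm c)\<^sup>2)"
        unfolding translation_dist_def
      proof (rule integral_mono)
        show "integrable lborel (\<lambda>x. (norm (indicat_real A (x + h) *\<^sub>R c - indicat_real A x *\<^sub>R c))\<^sup>2)"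
          by (intro L2_integrable_sq L2_diff L L2_shift[OF L])
        show "integrable lborel (\<lambda>x. (indicat_real D (x + h) + indicat_real D x) * (norm c)\<^sup>2)"
          by (intro integrable_mult_left Bochner_Integration.integrable_add integrable_lborel_shift[OF iD] iD)
        fix x
        have *: "x + h \<in> U" if "x \<in> T" using d(2)[OF that, of "x + h"] h by (auto simp: dist_norm)
        have **: "x \<in> U" if "x + h \<in> T" using d(2)[OF that, of x] h by (auto simp: dist_norm)
        show "(norm (indicat_real A (x + h) *\<^sub>R c - indicat_real A x *\<^sub>R c))\<^sup>2
            \<le> (indicat_real D (x + h) + indicat_real D x) * (norm c)\<^sup>2"
          using * ** T(2) U(2) by (auto simp: indicator_def D_def)
      qed
      also have "\<dots> = 2 * measure lborel D * (norm c)\<^sup>2"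
        using integrable_lborel_shift[OF iD, of h] iD integral_lborel_shift[of "indicat_real D" h] by simp
      also have "\<dots> \<le> 2 * (2 * e') * (norm c)\<^sup>2"
        using Dme by (intro mult_right_mono mult_left_mono) auto
      also have "\<dots> < 4 * e' * ((norm c)\<^sup>2 + 1)" using e' by (simp add: algebra_simps)
      also have "\<dots> = e" by (simp add: e'_def field_simps add_nonneg_eq_0_iff)
      finally show ?thesis .
    qed
    with d(1) show "\<exists>d>0. \<forall>h. norm h < d \<longrightarrow> translation_dist (\<lambda>x. indicat_real A x *\<^sub>R c) h < e" by blast
  qed
qed

text \<open>Approximation by simple functions dominated by \<open>2 * norm (F x)\<close>. The
  bounded support of \<open>F\<close> makes the level set of every nonzero value bounded, as the
  indicator case requires.\<close>

lemma L2_translation_continuous: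
  fixes F :: "'a::euclidean_space \<Rightarrow> 'b::euclidean_space"
  assumes F: "L2 lborel F" and z: "\<And>x. norm x > R \<Longrightarrow> F x = 0"
  shows "translation_continuous F"
proof -
  have Fm [measurable]: "F \<in> borel_measurable borel" using L2_measurable[OF F] by simp
  from borel_measurable_implies_sequence_metric[OF L2_measurable[OF F], of 0]
  obtain s where s: "\<And>i. simple_function lborel (s i)" "\<And>x. (\<lambda>i. s i x) \<longlonglongrightarrow> F x"
    "\<And>i x. norm (s i x) \<le> 2 * norm (F x)"
    by (auto simp: dist_norm)
  have sm [measurable]: "s i \<in> borel_measurable borel" for i
    using borel_measurable_simple_function[OF s(1)[of i]] by simp
  have S: "L2 lborel (s i) \<and> translation_continuous (s i)" for i
  proof -
    have fin: "finite (range (s i))" using s(1)[of i] by (simp add: simple_function_def)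
    define I where "I = range (s i) - {0}"
    have "(\<lambda>x. \<Sum>y\<in>I. indicat_real (s i -` {y}) x *\<^sub>R y) = s i"
    proof
      fix x
      have "(\<Sum>y\<in>I. indicat_real (s i -` {y}) x *\<^sub>R y) = (\<Sum>y\<in>I. if y = s i x then y else 0)"
        by (rule sum.cong) (auto simp: indicator_def)
      also have "\<dots> = s i x" using fin by (auto simp: I_def sum.delta)
      finally show "(\<Sum>y\<in>I. indicat_real (s i -` {y}) x *\<^sub>R y) = s i x" .
    qed
    moreover have "L2 lborel (\<lambda>x. indicat_real (s i -` {y}) x *\<^sub>R y) \<and>
        translation_continuous (\<lambda>x. indicat_real (s i -` {y}) x *\<^sub>R y)" if "y \<in> I" for y
    proof (rule translation_continuous_indicator)
      show "s i -` {y} \<in> sets borel" using measurable_sets[OF sm, of "{y}"] by simp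
      have "norm x \<le> R" if "x \<in> s i -` {y}" for x
        using that s(3)[of i x] z[of x] \<open>y \<in> I\<close> by (force simp: I_def)
      then show "bounded (s i -` {y})" by (auto simp: bounded_iff)
    qed
    ultimately show ?thesis
      using translation_continuous_sum[of I "\<lambda>y x. indicat_real (s i -` {y}) x *\<^sub>R y"] by simp
  qed
  have "(\<lambda>i. LINT x|lborel. (norm (F x - s i x))\<^sup>2) \<longlonglongrightarrow> (LINT x|(lborel::'a measure). 0)"
  proof (rule integral_dominated_convergence[where w = "\<lambda>x. 9 * (norm (F x))\<^sup>2"])
    show "integrable lborel (\<lambda>x. 9 * (norm (F x))\<^sup>2)" using L2_integrable_sq[OF F] by simp
    show "AE x in lborel. (\<lambda>i. (norm (F x - s i x))\<^sup>2) \<longlonglongrightarrow> 0"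
    proof (rule AE_I2)
      fix x
      have "(\<lambda>i. (norm (F x - s i x))\<^sup>2) \<longlonglongrightarrow> (norm (F x - F x))\<^sup>2"
        by (intro tendsto_intros s(2))
      then show "(\<lambda>i. (norm (F x - s i x))\<^sup>2) \<longlonglongrightarrow> 0" by simp
    qed
    show "AE x in lborel. norm ((norm (F x - s i x))\<^sup>2) \<le> 9 * (norm (F x))\<^sup>2" for i
    proof (rule AE_I2)
      fix x
      have "norm (F x - s i x) \<le> 3 * norm (F x)"
        using norm_triangle_ineq4[of "F x" "s i x"] s(3)[of i x] by simp
      then have "(norm (F x - s i x))\<^sup>2 \<le> (3 * norm (F x))\<^sup>2" by (rule power_mono) simp
      then show "norm ((norm (F x - s i x))\<^sup>2) \<le> 9 * (norm (F x))\<^sup>2" by (simp add: power_mult_distrib)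
    qed
  qed auto
  then have lim: "(\<lambda>i. LINT x|lborel. (norm (F x - s i x))\<^sup>2) \<longlonglongrightarrow> 0" by simp
  show ?thesis
  proof (rule translation_continuous_approx[OF F])
    fix e :: real assume "e > 0"
    then have "eventually (\<lambda>i. (LINT x|lborel. (norm (F x - s i x))\<^sup>2) < e) sequentially"
      using lim by (rule order_tendstoD(2)[rotated])
    then obtain i where "(LINT x|lborel. (norm (F x - s i x))\<^sup>2) < e"
      by (auto simp: eventually_sequentially)
    with S show "\<exists>G. L2 lborel G \<and> translation_continuous G \<and> (LINT x|lborel. (norm (F x - G x))\<^sup>2) < e" by blast
  qed
qed

text \<open>Jensen's inequality for the square, from Cauchy-Schwarz with the weight split into two
  square roots. The right side is an extended integral so that an infinite value is covered.\<close>

lemma norm_weighted_average_sq_le: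
  fixes \<Phi> :: "'a \<Rightarrow> 'b::euclidean_space"
  assumes \<eta>: "integrable M \<eta>" "\<And>x. 0 \<le> \<eta> x" "(LINT x|M. \<eta> x) = 1" and [measurable]: "\<Phi> \<in> borel_measurable M"
  shows "ennreal ((norm (LINT x|M. \<eta> x *\<^sub>R \<Phi> x))\<^sup>2) \<le> (\<integral>\<^sup>+x. ennreal (\<eta> x * (norm (\<Phi> x))\<^sup>2) \<partial>M)"
proof (cases "(\<integral>\<^sup>+x. ennreal (\<eta> x * (norm (\<Phi> x))\<^sup>2) \<partial>M) = \<infinity>")
  case False
  have [measurable]: "\<eta> \<in> borel_measurable M" using \<eta>(1) by simp
  have i: "integrable M (\<lambda>x. \<eta> x * (norm (\<Phi> x))\<^sup>2)"
    by (rule integrableI_bounded) (use False \<eta>(2) in \<open>auto simp: less_top[symmetric] abs_mult\<close>)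
  have L: "L2 M (\<lambda>x. sqrt (\<eta> x))" "L2 M (\<lambda>x. sqrt (\<eta> x) *\<^sub>R \<Phi> x)"
    using \<eta> i by (auto simp: L2_def power_mult_distrib)
  have "(norm (LINT x|M. sqrt (\<eta> x) *\<^sub>R sqrt (\<eta> x) *\<^sub>R \<Phi> x))\<^sup>2
      \<le> (LINT x|M. (sqrt (\<eta> x))\<^sup>2) * (LINT x|M. (norm (sqrt (\<eta> x) *\<^sub>R \<Phi> x))\<^sup>2)"
    by (rule Cauchy_Schwarz_L2_scaleR[OF L])
  then have "(norm (LINT x|M. \<eta> x *\<^sub>R \<Phi> x))\<^sup>2 \<le> (LINT x|M. \<eta> x * (norm (\<Phi> x))\<^sup>2)"
    using \<eta> by (simp add: power_mult_distrib)
  then show ?thesis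
    using i \<eta>(2) by (subst nn_integral_eq_integral) (auto intro: ennreal_leI)
qed auto

text \<open>\<open>G x\<close> averages \<open>F\<close> over the ball of radius
  \<open>\<delta>\<close> about \<open>x - a\<close>. By Jensen and Fubini the squared error is at
  most an average of translation distances of \<open>F\<close> along vectors shorter than
  \<open>\<delta> + norm a\<close>. The offset \<open>a\<close> later moves the sampling ball into
  the domain.\<close>

lemma mollify_L2:
  fixes F :: "'a::euclidean_space \<Rightarrow> 'b::euclidean_space"
  assumes F: "L2 lborel F" "integrable lborel F"
    and \<eta>: "integrable lborel \<eta>" "\<And>x. 0 \<le> \<eta> x" "(LINT x|lborel. \<eta> x) = 1" "\<And>x. \<eta> x \<le> B"
      "\<And>x. norm x \<ge> \<delta> \<Longrightarrow> \<eta> x = 0"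
    and d: "\<delta> + norm a \<le> d" "\<And>h. norm h < d \<Longrightarrow> translation_dist F h \<le> e" and "e \<ge> 0"
  defines "G \<equiv> (\<lambda>x. LINT y|lborel. \<eta> (x - a - y) *\<^sub>R F y)"
  shows "L2 lborel (\<lambda>x. G x - F x)" "(LINT x|lborel. (norm (G x - F x))\<^sup>2) \<le> e"
proof -
  have [measurable]: "F \<in> borel_measurable borel" "\<eta> \<in> borel_measurable borel"
    using F \<eta> by (auto dest: borel_measurable_integrable)
  have Gm [measurable]: "G \<in> borel_measurable borel"
    unfolding G_def by (rule lborel.borel_measurable_lebesgue_integral[where N = lborel, simplified]) measurable
  have Geq: "G x - F x = (LINT z|lborel. \<eta> z *\<^sub>R (F (x - a - z) - F x))" for x
  proof -
    have "G x = (LINT z|lborel. \<eta> (x - a - (x - a - z)) *\<^sub>R F (x - a - z))"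
      unfolding G_def by (rule integral_lborel_reflect[symmetric]) measurable
    then have 1: "G x = (LINT z|lborel. \<eta> z *\<^sub>R F (x - a - z))" by simp
    have B: "\<bar>\<eta> z\<bar> \<le> B" for z using \<eta> by simp
    have "integrable lborel (\<lambda>y. \<eta> (x - a - y) *\<^sub>R F y)"
      by (rule integrable_bounded_mult[OF F(2)]) (use B in auto)
    then have "integrable (distr lborel borel (\<lambda>z. x - a - z)) (\<lambda>y. \<eta> (x - a - y) *\<^sub>R F y)"
      by (simp add: lborel_distr_reflect)
    then have "integrable lborel (\<lambda>z. \<eta> (x - a - (x - a - z)) *\<^sub>R F (x - a - z))"
      by (subst (asm) integrable_distr_eq) auto
    then have 2: "integrable lborel (\<lambda>z. \<eta> z *\<^sub>R F (x - a - z))" by simp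
    show ?thesis
      unfolding 1 using 2 \<eta>(1,3) by (simp add: scaleR_diff_right)
  qed
  have "(\<integral>\<^sup>+x. ennreal ((norm (G x - F x))\<^sup>2) \<partial>lborel)
      \<le> (\<integral>\<^sup>+x. \<integral>\<^sup>+z. ennreal (\<eta> z * (norm (F (x - a - z) - F x))\<^sup>2) \<partial>lborel \<partial>lborel)"
    unfolding Geq by (intro nn_integral_mono norm_weighted_average_sq_le \<eta>) measurable
  also have "\<dots> = (\<integral>\<^sup>+z. \<integral>\<^sup>+x. ennreal (\<eta> z * (norm (F (x - a - z) - F x))\<^sup>2) \<partial>lborel \<partial>lborel)"
    by (rule lborel_pair.Fubini') measurable
  also have "\<dots> \<le> (\<integral>\<^sup>+z. ennreal (\<eta> z) * ennreal e \<partial>lborel)"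
  proof (rule nn_integral_mono)
    fix z
    show "(\<integral>\<^sup>+x. ennreal (\<eta> z * (norm (F (x - a - z) - F x))\<^sup>2) \<partial>lborel) \<le> ennreal (\<eta> z) * ennreal e"
    proof (cases "norm z \<ge> \<delta>")
      case False
      have "norm (- a - z) < d"
        using norm_triangle_ineq4[of "- a" z] False d(1) by simp
      then have "translation_dist F (- a - z) \<le> e" by (rule d(2))
      moreover have "integrable lborel (\<lambda>x. (norm (F (x + (- a - z)) - F x))\<^sup>2)"
        by (intro L2_integrable_sq L2_diff L2_shift F)
      ultimately have "(\<integral>\<^sup>+x. ennreal ((norm (F (x + (- a - z)) - F x))\<^sup>2) \<partial>lborel) \<le> ennreal e"
        by (subst nn_integral_eq_integral) (auto simp: translation_dist_def intro: ennreal_leI)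
      then have "ennreal (\<eta> z) * (\<integral>\<^sup>+x. ennreal ((norm (F (x + (- a - z)) - F x))\<^sup>2) \<partial>lborel) \<le> ennreal (\<eta> z) * ennreal e"
        by (rule mult_left_mono) simp
      then show ?thesis
        using \<eta>(2)[of z] by (subst (asm) nn_integral_cmult[symmetric]) (auto simp: ennreal_mult'[symmetric] algebra_simps)
    qed (simp add: \<eta>(5))
  qed
  also have "\<dots> = ennreal e"
    using \<eta> by (subst nn_integral_multc) (auto simp: nn_integral_eq_integral)
  finally have le: "(\<integral>\<^sup>+x. ennreal ((norm (G x - F x))\<^sup>2) \<partial>lborel) \<le> ennreal e" .
  show L: "L2 lborel (\<lambda>x. G x - F x)"
    unfolding L2_def
    by (intro conjI integrableI_bounded) (use le in \<open>auto simp: less_top[symmetric] top_unique\<close>)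
  have "ennreal (LINT x|lborel. (norm (G x - F x))\<^sup>2) \<le> ennreal e"
    using le by (subst (asm) nn_integral_eq_integral[OF L2_integrable_sq[OF L]]) auto
  then show "(LINT x|lborel. (norm (G x - F x))\<^sup>2) \<le> e" using \<open>e \<ge> 0\<close> by simp
qed

section \<open>Hausdorff measure and volume\<close>

text \<open>The finite family is enumerated and padded with empty sets, whose weight is 0 in every
  dimension.\<close>

lemma hausdorff_pre_finite_cover:
  assumes P: "finite P" "E \<subseteq> (\<Union>p\<in>P. C p)" and "0 \<le> \<delta>"
    and C: "\<And>p. p \<in> P \<Longrightarrow> bounded (C p) \<and> diameter (C p) \<le> \<delta> \<and> hausdorff_weight k (C p) \<le> w"
  shows "hausdorff_pre k \<delta> E \<le> of_nat (card P) * w"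
proof -
  obtain h where h: "bij_betw h {0..<card P} P" using ex_bij_betw_nat_finite[OF P(1)] by blast
  then have hP: "h i \<in> P" if "i < card P" for i using that by (auto simp: bij_betw_def)
  define D where "D i = (if i < card P then C (h i) else {})" for i
  have "E \<subseteq> (\<Union>i. D i)"
  proof
    fix x assume "x \<in> E"
    then obtain p where "p \<in> P" "x \<in> C p" using P(2) by blast
    moreover from \<open>p \<in> P\<close> have "p \<in> h ` {0..<card P}" using h by (simp add: bij_betw_def)
    then obtain i where "i < card P" "h i = p" by auto
    ultimately show "x \<in> (\<Union>i. D i)" by (auto simp: D_def intro!: exI[of _ i])
  qed
  then have "hausdorff_pre k \<delta> E \<le> (\<Sum>i. hausdorff_weight k (D i))"
    by (rule hausdorff_pre_le) (use C hP \<open>0 \<le> \<delta>\<close> in \<open>auto simp: D_def\<close>)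
  also have "\<dots> = (\<Sum>i<card P. hausdorff_weight k (D i))"
    by (rule suminf_finite) (auto simp: D_def)
  also have "\<dots> \<le> (\<Sum>i<card P. w)"
    by (rule sum_mono) (use C hP in \<open>auto simp: D_def\<close>)
  finally show ?thesis by simp
qed

text \<open>Packing \<open>n\<close> balls of radius \<open>\<rho>\<close> into volume
  \<open>2 * B * \<rho>\<close> gives \<open>n * V * \<rho> ^ d \<le> 2 * B * \<rho>\<close>;
  covering by \<open>n\<close> balls of radius \<open>5 * \<rho>\<close> costs
  \<open>n * W * (5 * \<rho>) ^ (d - 1)\<close>, where \<open>V\<close> and \<open>W\<close> are the
  unit ball volumes in dimensions \<open>d\<close> and \<open>d - 1\<close>. Eliminating
  \<open>n\<close> leaves this factor in front of \<open>B\<close>.\<close>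

definition minkowski_const :: "'a::euclidean_space itself \<Rightarrow> real" where
  "minkowski_const _ = 2 * 5 ^ (DIM('a) - 1) * unit_ball_vol (real (DIM('a) - 1)) / unit_ball_vol (real DIM('a))"

lemma minkowski_const_pos: "minkowski_const TYPE('a::euclidean_space) > 0"
  by (simp add: minkowski_const_def)

text \<open>Minkowski content bounds Hausdorff measure. A Vitali family of disjoint balls centred in
  \<open>E\<close> fits into a neighbourhood of \<open>E\<close>, which bounds their number, and the
  balls of five times the radius cover \<open>E\<close>.\<close>

lemma hausdorff_outer_le_minkowski:
  fixes E :: "'a::euclidean_space set"
  assumes B: "0 \<le> B" and \<eta>0: "0 < \<eta>0"
    and le: "\<And>\<eta>. 0 < \<eta> \<Longrightarrow> \<eta> < \<eta>0 \<Longrightarrow> emeasure lborel (\<Union>p\<in>E. ball p \<eta>) \<le> ennreal (B * \<eta>)"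
  shows "hausdorff_outer (DIM('a) - 1) E \<le> ennreal (minkowski_const TYPE('a) * B)"
  unfolding hausdorff_outer_def
proof (rule SUP_least)
  define k where "k = DIM('a) - 1"
  have dk: "DIM('a) = Suc k" by (simp add: k_def)
  define V where "V = unit_ball_vol (real DIM('a))"
  define Vk where "Vk = unit_ball_vol (real k)"
  have V: "V > 0" "Vk > 0" by (auto simp: V_def Vk_def)
  fix \<delta> :: real assume "\<delta> \<in> {0<..}"
  then have \<delta>: "\<delta> > 0" by simp
  \<comment> \<open>The covering balls of radius \<open>5 * \<rho>\<close> need diameter at most
    \<open>\<delta>\<close>, and the disjoint balls must fit into the neighbourhood of width
    \<open>2 * \<rho> < \<eta>0\<close>, to which the volume hypothesis applies.\<close>
  define \<rho> where "\<rho> = min (\<delta> / 10) (\<eta>0 / 4)"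
  have \<rho>: "\<rho> > 0" "10 * \<rho> \<le> \<delta>" "2 * \<rho> < \<eta>0" using \<delta> \<eta>0 by (auto simp: \<rho>_def)
  have cov: "E \<subseteq> (\<Union>i\<in>E. cball i \<rho>)" using \<rho>(1) by auto
  obtain P where P: "countable P" "P \<subseteq> E" "pairwise (\<lambda>i j. disjnt (cball i \<rho>) (cball j \<rho>)) P"
    "E \<subseteq> (\<Union>i\<in>P. cball i (5 * \<rho>))"
    by (rule Vitali_covering_lemma_cballs[OF cov, of \<rho>]) (use \<rho>(1) in auto)
  have card: "real (card F) * (V * \<rho> ^ DIM('a)) \<le> B * (2 * \<rho>)" if F: "F \<subseteq> P" "finite F" for F
  proof -
    have "ennreal (real (card F) * (V * \<rho> ^ DIM('a))) = (\<Sum>p\<in>F. emeasure lborel (cball p \<rho>))"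
      using \<rho>(1) V(1) by (simp add: emeasure_cball V_def ennreal_mult ennreal_of_nat_eq_real_of_nat)
    also have "\<dots> = emeasure lborel (\<Union>p\<in>F. cball p \<rho>)"
    proof (rule sum_emeasure)
      show "disjoint_family_on (\<lambda>p. cball p \<rho>) F"
        using P(3) F(1) by (force simp: disjoint_family_on_def pairwise_def disjnt_def)
    qed (use F in auto)
    also have "\<dots> \<le> emeasure lborel (\<Union>p\<in>E. ball p (2 * \<rho>))"
    proof (rule emeasure_mono)
      have "cball p \<rho> \<subseteq> ball p (2 * \<rho>)" for p :: 'a using \<rho>(1) by auto
      then show "(\<Union>p\<in>F. cball p \<rho>) \<subseteq> (\<Union>p\<in>E. ball p (2 * \<rho>))" using F(1) P(2) by blast
    qed (auto intro!: borel_open)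
    also have "\<dots> \<le> ennreal (B * (2 * \<rho>))" by (rule le) (use \<rho> in auto)
    finally show ?thesis using B \<rho>(1) by (subst (asm) ennreal_le_iff) auto
  qed
  have fin: "finite P"
  proof (rule ccontr)
    assume inf: "infinite P"
    have v: "V * \<rho> ^ DIM('a) > 0" using V \<rho> by simp
    define n where "n = Suc (nat \<lceil>B * (2 * \<rho>) / (V * \<rho> ^ DIM('a))\<rceil>)"
    obtain F where F: "F \<subseteq> P" "finite F" "card F = n"
      using infinite_arbitrarily_large[OF inf, of n] by auto
    have "B * (2 * \<rho>) / (V * \<rho> ^ DIM('a)) < real n" unfolding n_def by linarith
    then have "B * (2 * \<rho>) < real n * (V * \<rho> ^ DIM('a))" using v by (simp add: pos_divide_less_eq)
    with card[OF F(1,2)] F(3) show False by simp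
  qed
  have "hausdorff_pre k \<delta> E \<le> of_nat (card P) * ennreal (Vk * (5 * \<rho>) ^ k)"
  proof (rule hausdorff_pre_finite_cover[OF fin P(4)])
    fix p assume "p \<in> P"
    show "bounded (cball p (5 * \<rho>)) \<and> diameter (cball p (5 * \<rho>)) \<le> \<delta> \<and>
        hausdorff_weight k (cball p (5 * \<rho>)) \<le> ennreal (Vk * (5 * \<rho>) ^ k)"
      using \<rho> by (auto simp: hausdorff_weight_def Vk_def)
  qed (use \<delta> in simp)
  also have "\<dots> = ennreal (real (card P) * (Vk * (5 * \<rho>) ^ k))"
    using V \<rho> by (simp add: ennreal_mult ennreal_of_nat_eq_real_of_nat)
  also have "\<dots> \<le> ennreal (minkowski_const TYPE('a) * B)"
  proof (rule ennreal_leI)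
    have "(real (card P) * (V * \<rho> ^ k)) * \<rho> \<le> (B * 2) * \<rho>"
      using card[OF subset_refl fin] by (simp add: dk algebra_simps)
    then have "real (card P) * (V * \<rho> ^ k) \<le> B * 2" using \<rho>(1) by (rule mult_right_le_imp_le)
    then have "real (card P) * \<rho> ^ k \<le> B * 2 / V" using V by (simp add: field_simps)
    then have "(Vk * 5 ^ k) * (real (card P) * \<rho> ^ k) \<le> (Vk * 5 ^ k) * (B * 2 / V)"
      using V by (intro mult_left_mono) auto
    then show "real (card P) * (Vk * (5 * \<rho>) ^ k) \<le> minkowski_const TYPE('a) * B"
      by (simp add: minkowski_const_def V_def Vk_def k_def power_mult_distrib algebra_simps)
  qed
  finally show "hausdorff_pre (DIM('a) - 1) \<delta> E \<le> ennreal (minkowski_const TYPE('a) * B)"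
    by (simp add: k_def)
qed

text \<open>The starting points of the segments with displacement \<open>h\<close> that hit
  \<open>E\<close>, that is, the Minkowski sum of \<open>E\<close> and the segment from 0 to
  \<open>- h\<close>. A jump between \<open>x\<close> and \<open>x + h\<close> caused by
  \<open>E\<close> forces \<open>x\<close> into this set.\<close>

definition sweep :: "'a::real_vector set \<Rightarrow> 'a \<Rightarrow> 'a set" where
  "sweep E h = {x. \<exists>s\<in>{0..1}. x + s *\<^sub>R h \<in> E}"

lemma compact_sweep:
  fixes E :: "'a::euclidean_space set"
  assumes "compact E"
  shows "compact (sweep E h)"
proof -
  have "sweep E h = (\<lambda>(x, s). x - s *\<^sub>R h) ` (E \<times> {0..1})"
  proof (intro equalityI subsetI)
    fix x assume "x \<in> sweep E h"
    then obtain s where "s \<in> {0..1}" "x + s *\<^sub>R h \<in> E" by (auto simp: sweep_def)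
    then show "x \<in> (\<lambda>(x, s). x - s *\<^sub>R h) ` (E \<times> {0..1})"
      by (intro image_eqI[of _ _ "(x + s *\<^sub>R h, s)"]) auto
  next
    fix x assume "x \<in> (\<lambda>(x, s). x - s *\<^sub>R h) ` (E \<times> {0..1})"
    then obtain y s where "y \<in> E" "s \<in> {0..1}" "x = y - s *\<^sub>R h" by auto
    then show "x \<in> sweep E h" unfolding sweep_def by (auto intro!: bexI[of _ s])
  qed
  moreover have "compact ((\<lambda>(x, s). x - s *\<^sub>R h) ` (E \<times> {0..1::real}))"
    by (intro compact_continuous_image compact_Times assms)
      (auto simp: case_prod_beta intro!: continuous_intros)
  ultimately show ?thesis by simp
qed

text \<open>The sweep of a small set lies in a tube about a segment of length \<open>norm h\<close>,
  covered by about \<open>norm h / \<rho>\<close> balls of radius \<open>2 * \<rho>\<close>. Taking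
  \<open>\<rho>\<close> strictly above the diameter includes sets of diameter zero.\<close>

lemma emeasure_sweep_small:
  fixes C :: "'a::euclidean_space set"
  assumes C: "bounded C" "c \<in> C" and \<rho>: "diameter C < \<rho>"
  shows "emeasure lborel (sweep (closure C) h)
    \<le> ennreal (unit_ball_vol (real DIM('a)) * 2 ^ DIM('a) * \<rho> ^ (DIM('a) - 1) * (norm h + 2 * \<rho>))"
proof -
  define V where "V = unit_ball_vol (real DIM('a))"
  have V: "V > 0" by (simp add: V_def)
  obtain k where dk: "DIM('a) = Suc k" using DIM_positive[where 'a='a] by (metis Suc_pred)
  have \<rho>0: "\<rho> > 0" using diameter_ge_0[OF C(1)] \<rho> by simp
  \<comment> \<open>The spacing \<open>norm h / n\<close> is at most \<open>\<rho>\<close> while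
    \<open>n \<le> norm h / \<rho> + 2\<close>; the added 1 keeps \<open>n\<close> positive for
    \<open>h = 0\<close>.\<close>
  define n where "n = nat \<lceil>norm h / \<rho>\<rceil> + 1"
  have n: "n \<ge> 1" "real n \<le> norm h / \<rho> + 2" and n2: "norm h / real n \<le> \<rho>"
  proof -
    have 0: "0 \<le> norm h / \<rho>" using \<rho>0 by simp
    have 1: "norm h / \<rho> \<le> real n" "real n \<le> norm h / \<rho> + 2" using 0 unfolding n_def by linarith+
    show "n \<ge> 1" by (simp add: n_def)
    show "real n \<le> norm h / \<rho> + 2" by fact
    show "norm h / real n \<le> \<rho>" using 1(1) \<rho>0 \<open>n \<ge> 1\<close> by (simp add: field_simps)
  qed
  have "sweep (closure C) h \<subseteq> (\<Union>i<n. ball (c - (real i / real n) *\<^sub>R h) (2 * \<rho>))"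
  proof
    fix x assume "x \<in> sweep (closure C) h"
    then obtain s where s: "0 \<le> s" "s \<le> 1" "x + s *\<^sub>R h \<in> closure C" by (auto simp: sweep_def)
    \<comment> \<open>The index of the subinterval containing \<open>s\<close>, capped at
      \<open>n - 1\<close> because \<open>s = 1\<close> would give \<open>n\<close>.\<close>
    define i where "i = min (n - 1) (nat \<lfloor>s * real n\<rfloor>)"
    have i: "i < n" using n by (auto simp: i_def)
    have "\<bar>s * real n - real i\<bar> \<le> 1"
    proof (cases "nat \<lfloor>s * real n\<rfloor> \<le> n - 1")
      case True
      then have "i = nat \<lfloor>s * real n\<rfloor>" by (simp add: i_def)
      moreover have "0 \<le> s * real n" using s by simp
      ultimately show ?thesis by linarith
    next
      case False
      then have "i = n - 1" "n \<le> nat \<lfloor>s * real n\<rfloor>" using n by (auto simp: i_def)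
      moreover from this(2) n(1) have "real n \<le> s * real n" by linarith
      moreover have "s * real n \<le> real n" using s n by (simp add: mult_left_le_one_le)
      ultimately show ?thesis using n by (simp add: of_nat_diff)
    qed
    then have "\<bar>s - real i / real n\<bar> \<le> 1 / real n" using n by (simp add: abs_le_iff field_simps)
    then have "\<bar>s - real i / real n\<bar> * norm h \<le> 1 / real n * norm h" by (rule mult_right_mono) simp
    then have 1: "norm ((s - real i / real n) *\<^sub>R h) \<le> \<rho>" using n2 by simp
    have "c \<in> closure C" using C closure_subset by blast
    then have "dist c (x + s *\<^sub>R h) \<le> diameter C"
      using diameter_bounded_bound[of "closure C" c "x + s *\<^sub>R h"] s C
      by (simp add: diameter_closure bounded_closure)
    then have 2: "norm (c - (x + s *\<^sub>R h)) < \<rho>" using \<rho> by (simp add: dist_norm)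
    have "norm ((c - (x + s *\<^sub>R h)) + (s - real i / real n) *\<^sub>R h) < 2 * \<rho>"
      using norm_triangle_ineq[of "c - (x + s *\<^sub>R h)" "(s - real i / real n) *\<^sub>R h"] 1 2 by linarith
    then have "x \<in> ball (c - (real i / real n) *\<^sub>R h) (2 * \<rho>)"
      by (simp add: dist_norm algebra_simps)
    then show "x \<in> (\<Union>i<n. ball (c - (real i / real n) *\<^sub>R h) (2 * \<rho>))" using i by blast
  qed
  then have "emeasure lborel (sweep (closure C) h) \<le> emeasure lborel (\<Union>i<n. ball (c - (real i / real n) *\<^sub>R h) (2 * \<rho>))"
    by (rule emeasure_mono) auto
  also have "\<dots> \<le> (\<Sum>i<n. emeasure lborel (ball (c - (real i / real n) *\<^sub>R h) (2 * \<rho>)))"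
    by (rule emeasure_subadditive_finite) auto
  also have "\<dots> = ennreal (real n * (V * (2 * \<rho>) ^ DIM('a)))"
    using \<rho>0 V by (simp add: emeasure_ball V_def ennreal_mult ennreal_of_nat_eq_real_of_nat)
  also have "\<dots> \<le> ennreal (V * 2 ^ DIM('a) * \<rho> ^ k * (norm h + 2 * \<rho>))"
  proof (rule ennreal_leI)
    have "real n * (V * (2 * \<rho>) ^ DIM('a)) \<le> (norm h / \<rho> + 2) * (V * (2 * \<rho>) ^ DIM('a))"
      using n V \<rho>0 by (intro mult_right_mono) auto
    also have "\<dots> = V * 2 ^ DIM('a) * \<rho> ^ k * (norm h + 2 * \<rho>)"
      using \<rho>0 by (simp add: dk power_mult_distrib field_simps)
    finally show "real n * (V * (2 * \<rho>) ^ DIM('a)) \<le> V * 2 ^ DIM('a) * \<rho> ^ k * (norm h + 2 * \<rho>)" .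
  qed
  finally show ?thesis by (simp add: V_def dk)
qed

text \<open>The ratio of the tube volume per unit length,
  \<open>unit_ball_vol d * 2 ^ d * \<rho> ^ (d - 1)\<close>, to the Hausdorff weight
  \<open>unit_ball_vol (d - 1) * (\<rho> / 2) ^ (d - 1)\<close> of a set of diameter
  \<open>\<rho>\<close>.\<close>

definition sweep_const :: "'a::euclidean_space itself \<Rightarrow> real" where
  "sweep_const _ = unit_ball_vol (real DIM('a)) * 2 ^ DIM('a) * 2 ^ (DIM('a) - 1) / unit_ball_vol (real (DIM('a) - 1))"

lemma sweep_const_pos: "sweep_const TYPE('a::euclidean_space) > 0"
  by (simp add: sweep_const_def)

lemma emeasure_sweep_weight:
  fixes C :: "'a::euclidean_space set"
  assumes C: "bounded C" "diameter C \<le> \<delta>"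
  shows "emeasure lborel (sweep (closure C) h)
    \<le> ennreal (sweep_const TYPE('a) * (norm h + 2 * \<delta>)) * hausdorff_weight (DIM('a) - 1) C"
proof (cases "C = {}")
  case False
  then obtain c where c: "c \<in> C" by blast
  define D where "D = diameter C"
  define k where "k = DIM('a) - 1"
  define V where "V = unit_ball_vol (real DIM('a))"
  define W where "W = unit_ball_vol (real k)"
  have W: "W > 0" "V > 0" by (auto simp: W_def V_def)
  have D: "0 \<le> D" "D \<le> \<delta>" using C diameter_ge_0 by (auto simp: D_def)
  define f where "f \<rho> = V * 2 ^ DIM('a) * \<rho> ^ k * (norm h + 2 * \<rho>)" for \<rho> :: real
  have fin: "emeasure lborel (sweep (closure C) h) < \<infinity>"
    by (rule emeasure_bounded_finite, rule compact_imp_bounded, rule compact_sweep) (use C in simp)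
  then obtain m where m: "0 \<le> m" "emeasure lborel (sweep (closure C) h) = ennreal m"
    by (metis ennreal_cases less_irrefl infinity_ennreal_def)
  have le: "m \<le> f \<rho>" if "D < \<rho>" for \<rho>
  proof -
    have "\<rho> \<ge> 0" using that D(1) by simp
    then show ?thesis
      using emeasure_sweep_small[OF C(1) c, of \<rho> h] that
      unfolding m f_def V_def k_def D_def
      by (subst (asm) ennreal_le_iff) (auto intro!: mult_nonneg_nonneg add_nonneg_nonneg)
  qed
  have "(f \<longlongrightarrow> f D) (at_right D)"
    unfolding f_def by (intro tendsto_intros)
  \<comment> \<open>The tube estimate holds for every radius above the diameter; by continuity it
    persists at the diameter itself, which may be zero.\<close>
  then have "m \<le> f D"
    by (rule tendsto_lowerbound) (auto simp: eventually_at_filter le)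
  also have "f D \<le> (V * 2 ^ DIM('a) * 2 ^ k / W) * (norm h + 2 * \<delta>) * (W * (D / 2) ^ k)"
  proof -
    have "f D \<le> V * 2 ^ DIM('a) * D ^ k * (norm h + 2 * \<delta>)"
      unfolding f_def using D W by (intro mult_left_mono) auto
    also have "\<dots> = (V * 2 ^ DIM('a) * 2 ^ k / W) * (norm h + 2 * \<delta>) * (W * (D / 2) ^ k)"
      using W by (simp add: power_divide field_simps)
    finally show ?thesis .
  qed
  finally have "ennreal m \<le> ennreal ((V * 2 ^ DIM('a) * 2 ^ k / W) * (norm h + 2 * \<delta>) * (W * (D / 2) ^ k))"
    by (rule ennreal_leI)
  also have "\<dots> = ennreal ((V * 2 ^ DIM('a) * 2 ^ k / W) * (norm h + 2 * \<delta>)) * ennreal (W * (D / 2) ^ k)"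
    using W D by (intro ennreal_mult) auto
  also have "\<dots> = ennreal (sweep_const TYPE('a) * (norm h + 2 * \<delta>)) * hausdorff_weight k C"
    using False by (simp only: hausdorff_weight_def sweep_const_def V_def W_def k_def D_def if_False)
  finally show ?thesis using m by (simp add: k_def)
qed (simp add: sweep_def)

text \<open>A countable cover of \<open>E\<close> is swept set by set, with closures taken to keep
  the pieces measurable; letting the mesh \<open>t\<close> tend to 0 removes the thickness
  \<open>2 * t\<close>. The swept volume is thus linear in the length of \<open>h\<close>.\<close>

lemma emeasure_sweep_le:
  fixes E :: "'a::euclidean_space set"
  assumes H: "hausdorff_outer (DIM('a) - 1) E \<le> ennreal H" "0 \<le> H"
  shows "emeasure lborel (sweep E h) \<le> ennreal (sweep_const TYPE('a) * norm h * H)"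
proof -
  define K where "K = sweep_const TYPE('a)"
  have K: "K > 0" by (simp add: K_def sweep_const_pos)
  define g where "g t = K * (norm h + 2 * t) * (H + t)" for t :: real
  have bound: "emeasure lborel (sweep E h) \<le> ennreal (g t)" if t: "t > 0" for t
  \<comment> \<open>A nonmeasurable sweep has \<open>emeasure\<close> 0 by convention.\<close>
  proof (cases "sweep E h \<in> sets lborel")
    case True
    have "hausdorff_pre (DIM('a) - 1) t E \<le> hausdorff_outer (DIM('a) - 1) E"
      unfolding hausdorff_outer_def by (rule SUP_upper) (use t in auto)
    also have "\<dots> < ennreal (H + t)" using H t by (intro order_le_less_trans[OF H(1)]) (simp add: ennreal_less_iff)
    finally obtain C where C: "E \<subseteq> (\<Union>i. C i)" "\<And>i. bounded (C i)" "\<And>i. diameter (C i) \<le> t"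
      "(\<Sum>i. hausdorff_weight (DIM('a) - 1) (C i)) < ennreal (H + t)"
      using hausdorff_pre_close by metis
    have "sweep E h \<subseteq> (\<Union>i. sweep (closure (C i)) h)"
      using C(1) closure_subset unfolding sweep_def by blast
    moreover have m: "sweep (closure (C i)) h \<in> sets lborel" for i
      using compact_sweep[of "closure (C i)" h] C(2)[of i] by (auto intro: borel_compact)
    ultimately have "emeasure lborel (sweep E h) \<le> emeasure lborel (\<Union>i. sweep (closure (C i)) h)"
      by (intro emeasure_mono) auto
    also have "\<dots> \<le> (\<Sum>i. emeasure lborel (sweep (closure (C i)) h))"
      by (rule emeasure_subadditive_countably) (use m in auto)
    also have "\<dots> \<le> (\<Sum>i. ennreal (K * (norm h + 2 * t)) * hausdorff_weight (DIM('a) - 1) (C i))"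
      unfolding K_def by (intro suminf_le emeasure_sweep_weight C) auto
    also have "\<dots> = ennreal (K * (norm h + 2 * t)) * (\<Sum>i. hausdorff_weight (DIM('a) - 1) (C i))"
      by (rule ennreal_suminf_cmult)
    also have "\<dots> \<le> ennreal (K * (norm h + 2 * t)) * ennreal (H + t)"
      using C(4) by (intro mult_left_mono) auto
    also have "\<dots> = ennreal (g t)" using K t H by (simp add: g_def ennreal_mult)
    finally show ?thesis .
  qed (simp add: emeasure_notin_sets)
  have g0: "(g \<longlongrightarrow> g 0) (at_right 0)"
    unfolding g_def by (intro tendsto_intros)
  have "((\<lambda>t. ennreal (g t)) \<longlongrightarrow> ennreal (g 0)) (at_right 0)"
    using g0 by (rule tendsto_ennrealI)
  then have "emeasure lborel (sweep E h) \<le> ennreal (g 0)"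
    by (rule tendsto_lowerbound) (auto simp: eventually_at_filter bound)
  then show ?thesis by (simp add: g_def K_def)
qed

text \<open>The half-open interval \<open>{0<..f x}\<close> leads to superlevel sets of the form
  \<open>t \<le> f x\<close>, which are closed for continuous \<open>f\<close>, and discards
  negative values exactly as \<open>ennreal\<close> does.\<close>

lemma nn_integral_layer_cake:
  fixes f :: "'a \<Rightarrow> real"
  assumes "sigma_finite_measure M" and [measurable]: "f \<in> borel_measurable M"
  shows "(\<integral>\<^sup>+x. ennreal (f x) \<partial>M) = (\<integral>\<^sup>+t. (\<integral>\<^sup>+x. indicator {0<..f x} t \<partial>M) \<partial>lborel)"
    and "(\<lambda>t. \<integral>\<^sup>+x. indicator {0<..f x} t \<partial>M) \<in> borel_measurable lborel"
proof -
  interpret M: sigma_finite_measure M by fact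
  interpret P: pair_sigma_finite M lborel by unfold_locales
  have [measurable]: "(\<lambda>(x, t). indicator {0<..f x} t :: ennreal) \<in> borel_measurable (M \<Otimes>\<^sub>M lborel)"
  proof -
    have "(\<lambda>p. if 0 < snd p \<and> snd p \<le> f (fst p) then 1 else 0 :: ennreal) \<in> borel_measurable (M \<Otimes>\<^sub>M lborel)"
      by measurable
    then show ?thesis by (simp add: indicator_def case_prod_beta')
  qed
  have "ennreal (f x) = (\<integral>\<^sup>+t. indicator {0<..f x} t \<partial>lborel)" for x
    by (cases "f x \<ge> 0") (auto simp: ennreal_neg)
  then have "(\<integral>\<^sup>+x. ennreal (f x) \<partial>M) = (\<integral>\<^sup>+x. (\<integral>\<^sup>+t. indicator {0<..f x} t \<partial>lborel) \<partial>M)" by simp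
  also have "\<dots> = (\<integral>\<^sup>+t. (\<integral>\<^sup>+x. indicator {0<..f x} t \<partial>M) \<partial>lborel)"
    by (rule P.Fubini'[symmetric]) measurable
  finally show "(\<integral>\<^sup>+x. ennreal (f x) \<partial>M) = (\<integral>\<^sup>+t. (\<integral>\<^sup>+x. indicator {0<..f x} t \<partial>M) \<partial>lborel)" .
  have "(\<lambda>(t, x). indicator {0<..f x} t :: ennreal) \<in> borel_measurable (lborel \<Otimes>\<^sub>M M)"
    using measurable_pair_swap[of "\<lambda>(x, t). indicator {0<..f x} t :: ennreal" M lborel borel]
    by (simp add: case_prod_beta')
  then show "(\<lambda>t. \<integral>\<^sup>+x. indicator {0<..f x} t \<partial>M) \<in> borel_measurable lborel"
    using M.borel_measurable_nn_integral[of "\<lambda>t x. indicator {0<..f x} t" lborel] by simp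
qed

lemma nn_integral_superlevel_indicator:
  fixes f :: "'a \<Rightarrow> real"
  assumes "f \<in> borel_measurable M" "t > 0"
  shows "(\<integral>\<^sup>+x. indicator {0<..f x} t \<partial>M) = emeasure M {x \<in> space M. t \<le> f x}"
proof -
  have "(\<integral>\<^sup>+x. indicator {0<..f x} t \<partial>M) = (\<integral>\<^sup>+x. indicator {x \<in> space M. t \<le> f x} x \<partial>M)"
    by (rule nn_integral_cong) (use assms(2) in \<open>auto simp: indicator_def\<close>)
  also have "\<dots> = emeasure M {x \<in> space M. t \<le> f x}"
    using assms(1) by (intro nn_integral_indicator) (simp add: borel_measurable_iff_ge)
  finally show ?thesis .
qed

text \<open>This takes the place of the coarea formula: estimates between Hausdorff measure and
  volume of sets, in either direction, become estimates between boundary and volume integrals of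
  functions.\<close>

lemma nn_integral_le_of_superlevel_sets:
  fixes f :: "'a \<Rightarrow> real" and g :: "'b \<Rightarrow> real"
  assumes M: "sigma_finite_measure M" "f \<in> borel_measurable M"
    and N: "sigma_finite_measure N" "g \<in> borel_measurable N"
    and le: "\<And>t. t > 0 \<Longrightarrow> emeasure M {x \<in> space M. t \<le> f x} \<le> c * emeasure N {x \<in> space N. t \<le> g x}"
  shows "(\<integral>\<^sup>+x. ennreal (f x) \<partial>M) \<le> c * (\<integral>\<^sup>+x. ennreal (g x) \<partial>N)"
proof -
  have "(\<integral>\<^sup>+x. ennreal (f x) \<partial>M) \<le> (\<integral>\<^sup>+t. c * (\<integral>\<^sup>+x. indicator {0<..g x} t \<partial>N) \<partial>lborel)"
    unfolding nn_integral_layer_cake(1)[OF M]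
  proof (rule nn_integral_mono)
    fix t :: real
    show "(\<integral>\<^sup>+x. indicator {0<..f x} t \<partial>M) \<le> c * (\<integral>\<^sup>+x. indicator {0<..g x} t \<partial>N)"
      using le[of t] M N by (cases "t > 0") (auto simp: nn_integral_superlevel_indicator)
  qed
  also have "\<dots> = c * (\<integral>\<^sup>+x. ennreal (g x) \<partial>N)"
    unfolding nn_integral_layer_cake(1)[OF N]
    by (rule nn_integral_cmult) (rule nn_integral_layer_cake(2)[OF N])
  finally show ?thesis .
qed

section \<open>Functions of bounded variation on a domain\<close>

definition boundary_measure :: "'a::euclidean_space set \<Rightarrow> 'a measure" where
  "boundary_measure \<Omega> = restrict_space surface_measure (frontier \<Omega>)"

lemma space_boundary_measure [simp]: "space (boundary_measure \<Omega>) = frontier \<Omega>"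
  by (simp add: boundary_measure_def space_restrict_space)

lemma borel_measurable_boundary:
  assumes "f \<in> borel_measurable borel"
  shows "f \<in> borel_measurable (boundary_measure \<Omega>)"
  unfolding boundary_measure_def using assms
  by (intro measurable_restrict_space1) (simp cong: measurable_cong_sets)

lemma emeasure_boundary_measure:
  assumes "A \<in> sets borel" "A \<subseteq> frontier \<Omega>"
  shows "emeasure (boundary_measure \<Omega>) A = hausdorff_outer (DIM('a) - 1) (A :: 'a::euclidean_space set)"
  unfolding boundary_measure_def using assms
  by (subst emeasure_restrict_space) (auto simp: emeasure_hausdorff)

text \<open>The bounded open sets for which the boundary integrals of bounded Borel functions make sense.\<close>

locale finite_boundary =
  fixes \<Omega> :: "'a::euclidean_space set"
  assumes open_domain: "open \<Omega>" and bounded_domain: "bounded \<Omega>"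
    and hausdorff_finite: "hausdorff_outer (DIM('a) - 1) (frontier \<Omega>) < \<infinity>"
begin

abbreviation "vol \<equiv> lebesgue_on \<Omega>"
abbreviation "bd \<equiv> boundary_measure \<Omega>"

lemma compact_frontier_domain: "compact (frontier \<Omega>)"
  using bounded_domain by (rule compact_frontier_bounded)

lemma domain_sets [measurable, simp]: "\<Omega> \<in> sets borel" "\<Omega> \<in> sets lebesgue" "\<Omega> \<in> lmeasurable"
  using open_domain bounded_domain lmeasurable_open by auto

lemma frontier_sets [simp]: "frontier \<Omega> \<in> sets borel"
  by (simp add: borel_closed)

sublocale vol: finite_measure "lebesgue_on \<Omega>"
  by (rule finite_measure_lebesgue_on) simp

sublocale bd: finite_measure "boundary_measure \<Omega>"
proof
  show "emeasure bd (space bd) \<noteq> \<infinity>"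
    using hausdorff_finite by (simp add: emeasure_boundary_measure)
qed

lemma measurable_vol: "f \<in> borel_measurable borel \<Longrightarrow> f \<in> borel_measurable vol"
  by (intro measurable_restrict_space1 measurable_completion) simp

lemma continuous_bounded_on_closure:
  fixes f :: "'a \<Rightarrow> 'b::real_normed_vector"
  assumes "continuous_on UNIV f"
  obtains B where "B \<ge> 0" "\<And>x. x \<in> closure \<Omega> \<Longrightarrow> norm (f x) \<le> B"
proof -
  have "compact (closure \<Omega>)" using bounded_domain by (simp add: compact_closure)
  then have "bounded (f ` closure \<Omega>)"
    by (intro compact_imp_bounded compact_continuous_image continuous_on_subset[OF assms]) auto
  then show ?thesis using that by (auto simp: bounded_pos) (metis less_imp_le)
qed

lemma integrable_vol_continuous:
  fixes f :: "'a \<Rightarrow> 'b::{banach, second_countable_topology}"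
  assumes "continuous_on UNIV f"
  shows "integrable vol f"
proof -
  obtain B where "\<And>x. x \<in> closure \<Omega> \<Longrightarrow> norm (f x) \<le> B"
    using continuous_bounded_on_closure[OF assms] by metis
  then have "\<And>x. x \<in> \<Omega> \<Longrightarrow> norm (f x) \<le> B" using closure_subset by blast
  then show ?thesis
    using assms by (intro vol.integrable_const_bound[where B = B] measurable_vol borel_measurable_continuous_onI)
      (auto simp: space_restrict_space intro!: AE_I2)
qed

lemma integrable_bd_continuous:
  fixes f :: "'a \<Rightarrow> 'b::{banach, second_countable_topology}"
  assumes "continuous_on UNIV f"
  shows "integrable bd f"
proof -
  obtain B where B: "\<And>x. x \<in> closure \<Omega> \<Longrightarrow> norm (f x) \<le> B"
    using continuous_bounded_on_closure[OF assms] by metis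
  have "\<And>x. x \<in> frontier \<Omega> \<Longrightarrow> norm (f x) \<le> B" using B by (auto simp: frontier_def)
  then show ?thesis
    using assms by (intro bd.integrable_const_bound[where B = B] borel_measurable_boundary borel_measurable_continuous_onI)
      (auto intro!: AE_I2)
qed

lemma L2_vol_continuous: "continuous_on UNIV f \<Longrightarrow> L2 vol f"
  unfolding L2_def
  by (intro conjI integrable_vol_continuous measurable_vol borel_measurable_continuous_onI continuous_intros)

lemma L2_bd_continuous: "continuous_on UNIV f \<Longrightarrow> L2 bd f"
  unfolding L2_def
  by (intro conjI integrable_bd_continuous borel_measurable_boundary borel_measurable_continuous_onI continuous_intros)

text \<open>Passage from \<open>lebesgue_on \<Omega>\<close> to \<open>lborel\<close>, the measure
  for which translation invariance and Fubini are applied.\<close>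

lemma nn_integral_lborel_vol:
  fixes f :: "'a \<Rightarrow> real"
  assumes f: "continuous_on UNIV f" "\<And>x. 0 \<le> f x"
  shows "(\<integral>\<^sup>+x. ennreal (indicat_real \<Omega> x * f x) \<partial>lborel) = ennreal (LINT x|vol. f x)"
proof -
  have "(\<integral>\<^sup>+x. ennreal (indicat_real \<Omega> x * f x) \<partial>lborel) = (\<integral>\<^sup>+x. ennreal (f x) * indicator \<Omega> x \<partial>lebesgue)"
    unfolding nn_integral_completion by (rule nn_integral_cong) (auto simp: indicator_def)
  also have "\<dots> = (\<integral>\<^sup>+x. ennreal (f x) \<partial>vol)"
    by (simp add: nn_integral_restrict_space)
  also have "\<dots> = ennreal (LINT x|vol. f x)"
    by (rule nn_integral_eq_integral) (use f integrable_vol_continuous in auto)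
  finally show ?thesis .
qed

end

subsection \<open>Translations\<close>

text \<open>The least parameter outside \<open>\<Omega>\<close> exists by compactness; it is a limit
  of parameters inside, so its point lies in the closure but not in the open set.\<close>

lemma first_exit:
  fixes \<Omega> :: "'a::euclidean_space set"
  assumes \<Omega>: "open \<Omega>" and x: "x \<in> \<Omega>" and s: "s \<in> {0..1}" "x + s *\<^sub>R h \<notin> \<Omega>"
  obtains s' where "s' \<in> {0..1}" "x + s' *\<^sub>R h \<in> frontier \<Omega>" "\<And>r. 0 \<le> r \<Longrightarrow> r < s' \<Longrightarrow> x + r *\<^sub>R h \<in> \<Omega>"
proof -
  let ?p = "\<lambda>r. x + r *\<^sub>R h"
  define Z where "Z = {0..1::real} \<inter> ?p -` (- \<Omega>)"
  have "closed Z" unfolding Z_def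
    by (intro continuous_closed_preimage continuous_intros) (use \<Omega> in auto)
  moreover have "bounded Z" by (rule bounded_subset[of "{0..1}"]) (auto simp: Z_def)
  ultimately have "compact Z" by (simp add: compact_eq_bounded_closed)
  moreover have "Z \<noteq> {}" using s by (auto simp: Z_def)
  ultimately obtain s' where s': "s' \<in> Z" "\<And>r. r \<in> Z \<Longrightarrow> s' \<le> r"
    by (meson compact_attains_inf)
  have in\<Omega>: "?p r \<in> \<Omega>" if "0 \<le> r" "r < s'" for r
  proof (rule ccontr)
    assume "?p r \<notin> \<Omega>"
    then have "r \<in> Z" using that s'(1) by (auto simp: Z_def)
    then show False using s'(2) that by force
  qed
  have "s' \<noteq> 0" using s'(1) x by (auto simp: Z_def)
  then have "s' > 0" using s'(1) by (auto simp: Z_def)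
  then have "s' \<in> closure {0..<s'}" by simp
  then have "?p s' \<in> ?p ` closure {0..<s'}" by (rule imageI)
  moreover have "?p ` closure {0..<s'} \<subseteq> closure \<Omega>"
    by (rule image_closure_subset) (use in\<Omega> closure_subset[of \<Omega>] in \<open>auto intro!: continuous_intros\<close>)
  ultimately have "?p s' \<in> closure \<Omega>" by blast
  then have "?p s' \<in> frontier \<Omega>" using s'(1) \<Omega> by (auto simp: frontier_def Z_def interior_open)
  then show ?thesis using that[of s'] s'(1) in\<Omega> by (auto simp: Z_def)
qed

context finite_boundary
begin

text \<open>A bound for the variation of \<open>v\<close> on the part of the segment from
  \<open>x\<close> to \<open>x + h\<close> that lies inside \<open>\<Omega>\<close>; the factor
  \<open>norm h\<close> is the speed of the parametrisation.\<close>

definition variation_along :: "('a \<Rightarrow> real) \<Rightarrow> 'a \<Rightarrow> 'a \<Rightarrow> real" where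
  "variation_along v h x =
     (LINT s|lborel. indicator {0..1} s * (indicator \<Omega> (x + s *\<^sub>R h) * norm (grad v (x + s *\<^sub>R h)) * norm h))"

lemma variation_integrable:
  assumes v: "smooth v"
  shows "integrable lborel (\<lambda>s::real. indicator {0..1} s * (indicator \<Omega> (x + s *\<^sub>R h) * norm (grad v (x + s *\<^sub>R h)) * norm h))"
proof -
  have [measurable]: "grad v \<in> borel_measurable borel" by (rule grad_borel_measurable[OF v])
  obtain B where B: "B \<ge> 0" "\<And>x. x \<in> closure \<Omega> \<Longrightarrow> norm (grad v x) \<le> B"
    using continuous_bounded_on_closure[OF continuous_grad[OF v]] by metis
  have le: "indicator \<Omega> y * norm (grad v y) \<le> B" for y
    using B closure_subset[of \<Omega>] by (auto simp: indicator_def)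
  show ?thesis
  proof (rule integrableI_bounded_set[where A = "{0..1}" and B = "B * norm h"])
    show "AE s in lborel. s \<in> {0..1} \<longrightarrow>
        norm (indicator {0..1} s * (indicator \<Omega> (x + s *\<^sub>R h) * norm (grad v (x + s *\<^sub>R h)) * norm h)) \<le> B * norm h"
      using le by (intro AE_I2) (auto simp: abs_mult intro!: mult_right_mono)
  qed auto
qed

lemma variation_nonneg: "0 \<le> variation_along v h x"
  unfolding variation_along_def by (intro integral_nonneg_AE) auto

text \<open>The fundamental theorem of calculus along the segment. Only the open parameter interval
  has to map into \<open>\<Omega>\<close>, so the end points may lie on the frontier, where
  \<open>v\<close> is still smooth; they are a null set for the line integral.\<close>

lemma segment_difference_le_variation:
  assumes v: "smooth v" and s: "0 \<le> a" "a \<le> b" "b \<le> 1"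
    and in\<Omega>: "\<And>r. a < r \<Longrightarrow> r < b \<Longrightarrow> x + r *\<^sub>R h \<in> \<Omega>"
  shows "\<bar>v (x + b *\<^sub>R h) - v (x + a *\<^sub>R h)\<bar> \<le> variation_along v h x"
proof -
  let ?p = "\<lambda>r. x + r *\<^sub>R h"
  define f where "f r = grad v (?p r) \<bullet> h" for r
  have "((\<lambda>r. v (?p r)) has_vector_derivative f r) (at r within {a..b})" for r
  proof -
    have "((\<lambda>r. v (?p r)) has_derivative (\<lambda>t. grad v (?p r) \<bullet> (t *\<^sub>R h))) (at r)"
      by (rule has_derivative_compose[OF _ smooth_has_derivative[OF v]])
        (auto intro!: derivative_eq_intros)
    then have "((\<lambda>r. v (?p r)) has_vector_derivative f r) (at r)"
      by (simp add: has_vector_derivative_def f_def)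
    then show ?thesis by (rule has_vector_derivative_at_within)
  qed
  moreover have fc: "continuous_on {a..b} f"
    unfolding f_def
    by (intro continuous_intros continuous_on_compose2[OF continuous_grad[OF v, of UNIV]]) auto
  ultimately have eq: "(LINT r|lborel. indicator {a..b} r *\<^sub>R f r) = v (?p b) - v (?p a)"
    using integral_FTC_atLeastAtMost[OF s(2), of "\<lambda>r. v (?p r)" f] by simp
  have i: "integrable lborel (\<lambda>r. indicator {a..b} r *\<^sub>R f r)"
    using fc by (intro borel_integrable_compact) auto
  have "\<bar>v (?p b) - v (?p a)\<bar> \<le> (LINT r|lborel. norm (indicator {a..b} r *\<^sub>R f r))"
    unfolding eq[symmetric] using integral_norm_bound[of lborel "\<lambda>r. indicator {a..b} r *\<^sub>R f r"] by simp
  also have "\<dots> \<le> variation_along v h x"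
    unfolding variation_along_def
  proof (rule integral_mono_AE)
    have "AE r in lborel. r \<noteq> a \<and> r \<noteq> b" by (intro AE_conjI AE_lborel_singleton)
    then show "AE r in lborel. norm (indicator {a..b} r *\<^sub>R f r)
        \<le> indicator {0..1} r * (indicator \<Omega> (?p r) * norm (grad v (?p r)) * norm h)"
    proof eventually_elim
      case (elim r)
      show ?case
        using elim in\<Omega>[of r] s Cauchy_Schwarz_ineq2[of "grad v (?p r)" h]
        by (auto simp: indicator_def f_def)
    qed
  qed (use i variation_integrable[OF v] in auto)
  finally show ?thesis .
qed

text \<open>A segment inside \<open>\<Omega>\<close> has difference at most the variation, so this
  one leaves \<open>\<Omega>\<close>. One end point lies in \<open>\<Omega>\<close> with a value
  exceeding the variation by \<open>t\<close>; from there to the first exit the value drops by at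
  most the variation, so at least \<open>t\<close> is left at the frontier point reached.\<close>

lemma zero_extension_difference:
  assumes v: "smooth v" "\<And>x. 0 \<le> v x" and t: "0 < t"
    and le: "t \<le> \<bar>indicator \<Omega> (x + h) * v (x + h) - indicator \<Omega> x * v x\<bar> - variation_along v h x"
  shows "x \<in> sweep {p \<in> frontier \<Omega>. t \<le> v p} h"
proof -
  let ?p = "\<lambda>r. x + r *\<^sub>R h" and ?a = "variation_along v h x"
  have a: "0 \<le> ?a" by (rule variation_nonneg)
  have "\<exists>s\<in>{0..1}. ?p s \<notin> \<Omega>"
  proof (rule ccontr)
    assume "\<not> ?thesis"
    then have all: "?p s \<in> \<Omega>" if "0 \<le> s" "s \<le> 1" for s using that by auto
    have "\<bar>v (?p 1) - v (?p 0)\<bar> \<le> ?a"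
      by (rule segment_difference_le_variation[OF v(1)]) (use all in auto)
    then show False using le t all[of 0] all[of 1] by simp
  qed
  then obtain s where s: "s \<in> {0..1}" "?p s \<notin> \<Omega>" by blast
  have v0: "0 \<le> indicat_real \<Omega> y * v y" for y using v(2) by simp
  have "t + ?a \<le> indicator \<Omega> x * v x \<or> t + ?a \<le> indicator \<Omega> (x + h) * v (x + h)"
    using le v0[of x] v0[of "x + h"] by linarith
  then show ?thesis
  proof
    assume *: "t + ?a \<le> indicator \<Omega> x * v x"
    then have x: "x \<in> \<Omega>" using t a by (cases "x \<in> \<Omega>") auto
    obtain s' where s': "s' \<in> {0..1}" "?p s' \<in> frontier \<Omega>" "\<And>r. 0 \<le> r \<Longrightarrow> r < s' \<Longrightarrow> ?p r \<in> \<Omega>"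
      using first_exit[OF open_domain x s] by metis
    have "\<bar>v (?p s') - v (?p 0)\<bar> \<le> ?a"
      by (rule segment_difference_le_variation[OF v(1)]) (use s' in auto)
    then have "t \<le> v (?p s')" using * x by simp
    then show ?thesis using s' by (auto simp: sweep_def)
  next
    assume *: "t + ?a \<le> indicator \<Omega> (x + h) * v (x + h)"
    then have x: "x + h \<in> \<Omega>" using t a by (cases "x + h \<in> \<Omega>") auto
    \<comment> \<open>The segment is traversed backwards, from \<open>x + h\<close> to
      \<open>x\<close>.\<close>
    have s1: "1 - s \<in> {0..1}" "(x + h) + (1 - s) *\<^sub>R (- h) \<notin> \<Omega>" using s by (auto simp: algebra_simps)
    obtain s' where s': "s' \<in> {0..1}" "(x + h) + s' *\<^sub>R (- h) \<in> frontier \<Omega>"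
      "\<And>r. 0 \<le> r \<Longrightarrow> r < s' \<Longrightarrow> (x + h) + r *\<^sub>R (- h) \<in> \<Omega>"
      using first_exit[OF open_domain x s1] by metis
    have eq: "(x + h) + r *\<^sub>R (- h) = ?p (1 - r)" for r by (simp add: algebra_simps)
    have "\<bar>v (?p 1) - v (?p (1 - s'))\<bar> \<le> ?a"
    proof (rule segment_difference_le_variation[OF v(1)])
      show "?p r \<in> \<Omega>" if "1 - s' < r" "r < 1" for r
        using s'(3)[of "1 - r"] that unfolding eq by simp
    qed (use s' in auto)
    then have "t \<le> v (?p (1 - s'))" using * x by simp
    then show ?thesis using s' unfolding eq by (auto simp: sweep_def intro!: bexI[of _ "1 - s'"])
  qed
qed

text \<open>Bounded variation of the zero extension, in translation form. The excess
  \<open>D\<close> over the interior variation has superlevel sets inside sweeps of boundary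
  superlevel sets, which yields the boundary term; the interior variation integrates by Fubini to
  \<open>norm h\<close> times the gradient integral.\<close>

lemma nn_integral_translation_le:
  assumes v: "smooth v" "\<And>x. 0 \<le> v x"
  shows "(\<integral>\<^sup>+x. ennreal \<bar>indicator \<Omega> (x + h) * v (x + h) - indicator \<Omega> x * v x\<bar> \<partial>lborel)
    \<le> ennreal (norm h * ((LINT x|vol. norm (grad v x)) + sweep_const TYPE('a) * (LINT x|bd. v x)))"
proof -
  have [measurable]: "grad v \<in> borel_measurable borel" "v \<in> borel_measurable borel"
    by (rule grad_borel_measurable[OF v(1)], rule smooth_borel_measurable[OF v(1)])
  define a where "a = variation_along v h"
  define D where "D x = \<bar>indicator \<Omega> (x + h) * v (x + h) - indicator \<Omega> x * v x\<bar> - a x" for x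
  have am [measurable]: "a \<in> borel_measurable borel"
    unfolding a_def variation_along_def
    by (rule lborel.borel_measurable_lebesgue_integral[where N = borel, simplified]) measurable
  have Dm [measurable]: "D \<in> borel_measurable borel" unfolding D_def by measurable
  have "(\<integral>\<^sup>+x. ennreal \<bar>indicator \<Omega> (x + h) * v (x + h) - indicator \<Omega> x * v x\<bar> \<partial>lborel)
      \<le> (\<integral>\<^sup>+x. ennreal (D x) + ennreal (a x) \<partial>lborel)"
  proof (rule nn_integral_mono)
    fix x
    have "\<bar>indicator \<Omega> (x + h) * v (x + h) - indicator \<Omega> x * v x\<bar> = D x + a x" by (simp add: D_def)
    moreover have "ennreal (D x + a x) \<le> ennreal (D x) + ennreal (a x)"
      using variation_nonneg[of v h x]
      by (cases "0 \<le> D x") (auto simp: a_def ennreal_neg ennreal_leI)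
    ultimately show "ennreal \<bar>indicator \<Omega> (x + h) * v (x + h) - indicator \<Omega> x * v x\<bar> \<le> ennreal (D x) + ennreal (a x)"
      by simp
  qed
  also have "\<dots> = (\<integral>\<^sup>+x. ennreal (D x) \<partial>lborel) + (\<integral>\<^sup>+x. ennreal (a x) \<partial>lborel)"
    by (rule nn_integral_add) auto
  also have "(\<integral>\<^sup>+x. ennreal (D x) \<partial>lborel) \<le> ennreal (sweep_const TYPE('a) * norm h) * (\<integral>\<^sup>+x. ennreal (v x) \<partial>bd)"
  proof (rule nn_integral_le_of_superlevel_sets)
    show "sigma_finite_measure lborel" by (rule sigma_finite_lborel)
    show "sigma_finite_measure bd" by unfold_locales
    show "v \<in> borel_measurable bd" by (rule borel_measurable_boundary) measurable
    fix t :: real assume t: "t > 0"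
    define E where "E = {p \<in> frontier \<Omega>. t \<le> v p}"
    have "closed {p. t \<le> v p}"
      using smooth_continuous[OF v(1)] by (intro closed_Collect_le continuous_on_const) auto
    then have Es: "E \<in> sets borel" "E \<subseteq> frontier \<Omega>"
      unfolding E_def by (auto intro!: borel_closed simp: Collect_conj_eq)
    have Ee: "hausdorff_outer (DIM('a) - 1) E = ennreal (measure bd E)"
      using emeasure_boundary_measure[OF Es] bd.emeasure_eq_measure[of E] by simp
    have swm: "sweep E h \<in> sets lborel"
    proof -
      have "E = frontier \<Omega> \<inter> {p. t \<le> v p}" by (auto simp: E_def)
      then have "compact E" using compact_frontier_domain \<open>closed {p. t \<le> v p}\<close> by auto
      then show ?thesis using borel_compact[OF compact_sweep] by simp
    qed
    have "{x \<in> space lborel. t \<le> D x} \<subseteq> sweep E h"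
      using zero_extension_difference[OF v t, of _ h] by (auto simp: D_def a_def E_def)
    then have "emeasure lborel {x \<in> space lborel. t \<le> D x} \<le> emeasure lborel (sweep E h)"
      using swm by (rule emeasure_mono)
    also have "\<dots> \<le> ennreal (sweep_const TYPE('a) * norm h * measure bd E)"
      by (rule emeasure_sweep_le[OF eq_refl[OF Ee]]) simp
    also have "\<dots> = ennreal (sweep_const TYPE('a) * norm h) * emeasure bd {x \<in> space bd. t \<le> v x}"
      using sweep_const_pos[where 'a='a]
      by (simp add: bd.emeasure_eq_measure E_def ennreal_mult)
    finally show "emeasure lborel {x \<in> space lborel. t \<le> D x}
        \<le> ennreal (sweep_const TYPE('a) * norm h) * emeasure bd {x \<in> space bd. t \<le> v x}" .
  qed auto
  also have "(\<integral>\<^sup>+x. ennreal (v x) \<partial>bd) = ennreal (LINT x|bd. v x)"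
    by (rule nn_integral_eq_integral) (use v smooth_continuous integrable_bd_continuous in auto)
  also have "(\<integral>\<^sup>+x. ennreal (a x) \<partial>lborel) = ennreal (norm h * (LINT x|vol. norm (grad v x)))"
  proof -
    define G where "G y = ennreal (indicator \<Omega> y * norm (grad v y))" for y
    have [measurable]: "G \<in> borel_measurable borel" unfolding G_def by measurable
    have "(\<integral>\<^sup>+x. ennreal (a x) \<partial>lborel)
        = (\<integral>\<^sup>+x. \<integral>\<^sup>+s. ennreal (indicator {0..1} s * (indicator \<Omega> (x + s *\<^sub>R h) * norm (grad v (x + s *\<^sub>R h)) * norm h)) \<partial>lborel \<partial>lborel)"
      unfolding a_def variation_along_def
      by (intro nn_integral_cong nn_integral_eq_integral[symmetric] variation_integrable v) auto
    also have "\<dots> = (\<integral>\<^sup>+x. \<integral>\<^sup>+s. (indicator {0..1::real} s * ennreal (norm h)) * G (x + s *\<^sub>R h) \<partial>lborel \<partial>lborel)"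
      by (intro nn_integral_cong) (auto simp: G_def ennreal_mult indicator_def mult.commute)
    also have "\<dots> = (\<integral>\<^sup>+s. \<integral>\<^sup>+x. (indicator {0..1::real} s * ennreal (norm h)) * G (x + s *\<^sub>R h) \<partial>lborel \<partial>lborel)"
      by (rule lborel_pair.Fubini') measurable
    also have "\<dots> = (\<integral>\<^sup>+s. (indicator {0..1::real} s * ennreal (norm h)) * (\<integral>\<^sup>+x. G x \<partial>lborel) \<partial>lborel)"
      by (rule nn_integral_cong) (subst nn_integral_cmult, auto simp: nn_integral_lborel_shift)
    also have "\<dots> = ennreal (norm h) * (\<integral>\<^sup>+x. G x \<partial>lborel)"
      by (simp add: nn_integral_multc)
    also have "(\<integral>\<^sup>+x. G x \<partial>lborel) = ennreal (LINT x|vol. norm (grad v x))"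
      unfolding G_def using continuous_grad[OF v(1)]
      by (intro nn_integral_lborel_vol continuous_intros) auto
    finally show ?thesis by (simp add: ennreal_mult)
  qed
  finally have *: "(\<integral>\<^sup>+x. ennreal \<bar>indicator \<Omega> (x + h) * v (x + h) - indicator \<Omega> x * v x\<bar> \<partial>lborel)
      \<le> ennreal (sweep_const TYPE('a) * norm h) * ennreal (LINT x|bd. v x) + ennreal (norm h * (LINT x|vol. norm (grad v x)))"
    by (simp add: add_right_mono)
  have n: "0 \<le> (LINT x|bd. v x)" "0 \<le> sweep_const TYPE('a)"
    using v(2) sweep_const_pos[where 'a='a] by (auto intro: integral_nonneg_AE)
  have "ennreal (sweep_const TYPE('a) * norm h) * ennreal (LINT x|bd. v x) + ennreal (norm h * (LINT x|vol. norm (grad v x)))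
      = ennreal (norm h * ((LINT x|vol. norm (grad v x)) + sweep_const TYPE('a) * (LINT x|bd. v x)))"
    using n by (simp add: ennreal_mult[symmetric] ennreal_plus[symmetric] algebra_simps del: ennreal_plus)
  with * show ?thesis by simp
qed

subsection \<open>A Nash type inequality\<close>

text \<open>A bound for the total variation on the whole space of the zero extension of
  \<open>\<phi>\<^sup>2\<close>, up to the normalisation of the surface measure: the interior
  gradient plus the jump across the frontier.\<close>

definition total_variation_sq :: "('a \<Rightarrow> real) \<Rightarrow> real" where
  "total_variation_sq \<phi> = (LINT x|vol. norm (grad (\<lambda>x. (\<phi> x)\<^sup>2) x)) + sweep_const TYPE('a) * (LINT x|bd. (\<phi> x)\<^sup>2)"

lemma total_variation_sq_nonneg: "0 \<le> total_variation_sq \<phi>"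
  unfolding total_variation_sq_def using sweep_const_pos[where 'a='a]
  by (intro add_nonneg_nonneg mult_nonneg_nonneg integral_nonneg_AE) auto

text \<open>
  For nonnegative numbers, \<open>a\<^sup>2 \<le> \<bar>a\<^sup>2 - b\<^sup>2\<bar> + a * b\<close>. This is applied to the values of \<open>\<bar>\<phi>\<bar>\<close>, extended
  by zero, at two points of distance less than \<open>r\<close>, and averaged over all such pairs.
\<close>

lemma Nash_inequality:
  assumes \<phi>: "smooth \<phi>" and r: "r > 0"
  shows "(LINT x|vol. (\<phi> x)\<^sup>2) \<le> r * total_variation_sq \<phi> + (LINT x|vol. \<bar>\<phi> x\<bar>)\<^sup>2 / (unit_ball_vol (real DIM('a)) * r ^ DIM('a))"
proof -
  have [measurable]: "\<phi> \<in> borel_measurable borel" by (rule smooth_borel_measurable[OF \<phi>])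
  define V where "V = unit_ball_vol (real DIM('a)) * r ^ DIM('a)"
  have V: "V > 0" using r by (simp add: V_def)
  define u where "u x = indicator \<Omega> x * \<bar>\<phi> x\<bar>" for x
  define w where "w x = indicator \<Omega> x * (\<phi> x)\<^sup>2" for x
  have um [measurable]: "u \<in> borel_measurable borel" and wm [measurable]: "w \<in> borel_measurable borel"
    unfolding u_def w_def by measurable
  have u0: "0 \<le> u x" and w0: "0 \<le> w x" and wu: "w x = u x * u x" for x
    by (auto simp: u_def w_def indicator_def power2_eq_square abs_mult[symmetric])
  define I1 where "I1 = (LINT x|vol. \<bar>\<phi> x\<bar>)"
  define I2 where "I2 = (LINT x|vol. (\<phi> x)\<^sup>2)"
  have I: "0 \<le> I1" "0 \<le> I2" by (auto simp: I1_def I2_def)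
  have I1: "(\<integral>\<^sup>+x. ennreal (u x) \<partial>lborel) = ennreal I1"
    unfolding u_def I1_def using smooth_continuous[OF \<phi>]
    by (intro nn_integral_lborel_vol continuous_intros) auto
  have I2: "(\<integral>\<^sup>+x. ennreal (w x) \<partial>lborel) = ennreal I2"
    unfolding w_def I2_def using smooth_continuous[OF \<phi>]
    by (intro nn_integral_lborel_vol continuous_intros) auto
  define A where "A = total_variation_sq \<phi>"
  have A: "0 \<le> A" unfolding A_def by (rule total_variation_sq_nonneg)
  have tr: "(\<integral>\<^sup>+x. ennreal \<bar>w (x + h) - w x\<bar> \<partial>lborel) \<le> ennreal (norm h * A)" for h
    unfolding w_def A_def total_variation_sq_def
    by (rule nn_integral_translation_le) (use \<phi> in \<open>auto intro: smooth_power2\<close>)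
  have pt: "w x \<le> \<bar>w (x + h) - w x\<bar> + u x * u (x + h)" for x h
  proof -
    have "a * a \<le> \<bar>b * b - a * a\<bar> + a * b" if "0 \<le> a" "0 \<le> b" for a b :: real
    proof (cases "a \<le> b")
      case True
      then have "a * a \<le> a * b" using that by (intro mult_left_mono) auto
      then show ?thesis by linarith
    next
      case False
      then have "b * b \<le> a * b" using that by (intro mult_right_mono) auto
      then show ?thesis by linarith
    qed
    then show ?thesis unfolding wu using u0 by simp
  qed
  have [measurable]: "ball (0::'a) r \<in> sets borel" by (rule borel_open) simp
  have ball: "(\<integral>\<^sup>+h. indicator (ball (0::'a) r) h * c \<partial>lborel) = ennreal V * c" for c
    using r by (subst nn_integral_multc) (auto simp: emeasure_ball V_def intro!: borel_measurable_indicator borel_open)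
  have "ennreal V * ennreal I2 = (\<integral>\<^sup>+h. indicator (ball (0::'a) r) h * ennreal I2 \<partial>lborel)"
    by (rule ball[symmetric])
  \<comment> \<open>The product term is kept for all \<open>h\<close> and not only for those in the
    ball: over the whole space it factorises by Fubini into \<open>I1 * I1\<close>.\<close>
  also have "\<dots> \<le> (\<integral>\<^sup>+h. indicator (ball (0::'a) r) h * ennreal (r * A)
      + (\<integral>\<^sup>+x. ennreal (u x) * ennreal (u (x + h)) \<partial>lborel) \<partial>lborel)"
  proof (rule nn_integral_mono)
    fix h :: 'a
    show "indicator (ball 0 r) h * ennreal I2 \<le> indicator (ball 0 r) h * ennreal (r * A)
      + (\<integral>\<^sup>+x. ennreal (u x) * ennreal (u (x + h)) \<partial>lborel)"
    proof (cases "h \<in> ball 0 r")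
      case True
      have "ennreal I2 \<le> (\<integral>\<^sup>+x. ennreal \<bar>w (x + h) - w x\<bar> + ennreal (u x) * ennreal (u (x + h)) \<partial>lborel)"
        unfolding I2[symmetric]
      proof (rule nn_integral_mono)
        show "ennreal (w x) \<le> ennreal \<bar>w (x + h) - w x\<bar> + ennreal (u x) * ennreal (u (x + h))" for x
          using pt[of x h] u0 by (simp add: ennreal_mult[symmetric] ennreal_plus[symmetric] ennreal_leI del: ennreal_plus)
      qed
      also have "\<dots> = (\<integral>\<^sup>+x. ennreal \<bar>w (x + h) - w x\<bar> \<partial>lborel) + (\<integral>\<^sup>+x. ennreal (u x) * ennreal (u (x + h)) \<partial>lborel)"
        by (rule nn_integral_add) measurable
      also have "\<dots> \<le> ennreal (r * A) + (\<integral>\<^sup>+x. ennreal (u x) * ennreal (u (x + h)) \<partial>lborel)"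
        using True A by (intro add_right_mono order_trans[OF tr] ennreal_leI mult_right_mono) auto
      finally show ?thesis using True by simp
    qed simp
  qed
  also have "\<dots> = (\<integral>\<^sup>+h. indicator (ball (0::'a) r) h * ennreal (r * A) \<partial>lborel)
      + (\<integral>\<^sup>+h. (\<integral>\<^sup>+x. ennreal (u x) * ennreal (u (x + h)) \<partial>lborel) \<partial>lborel)"
    by (rule nn_integral_add) measurable
  also have "(\<integral>\<^sup>+h. indicator (ball (0::'a) r) h * ennreal (r * A) \<partial>lborel) = ennreal V * ennreal (r * A)"
    by (rule ball)
  also have "(\<integral>\<^sup>+h. (\<integral>\<^sup>+x. ennreal (u x) * ennreal (u (x + h)) \<partial>lborel) \<partial>lborel)
      = (\<integral>\<^sup>+x. (\<integral>\<^sup>+h. ennreal (u x) * ennreal (u (x + h)) \<partial>lborel) \<partial>lborel)"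
    by (rule lborel_pair.Fubini') measurable
  also have "\<dots> = (\<integral>\<^sup>+x. ennreal (u x) * ennreal I1 \<partial>lborel)"
  proof (rule nn_integral_cong)
    fix x
    have "(\<integral>\<^sup>+h. ennreal (u (h + x)) \<partial>lborel) = ennreal I1"
      unfolding I1[symmetric] by (rule nn_integral_lborel_shift) measurable
    then show "(\<integral>\<^sup>+h. ennreal (u x) * ennreal (u (x + h)) \<partial>lborel) = ennreal (u x) * ennreal I1"
      by (subst nn_integral_cmult) (auto simp: add.commute)
  qed
  also have "\<dots> = ennreal I1 * ennreal I1"
    by (subst nn_integral_multc) (auto simp: I1)
  finally have "ennreal (V * I2) \<le> ennreal (V * (r * A) + I1 * I1)"
    using V I A r by (simp add: ennreal_mult ennreal_plus)
  then have "V * I2 \<le> V * (r * A) + I1 * I1"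
    using V I A r by (subst (asm) ennreal_le_iff) auto
  then have "I2 \<le> r * A + I1\<^sup>2 / V"
    using V by (simp add: field_simps power2_eq_square)
  then show ?thesis by (simp add: I1_def I2_def A_def V_def)
qed

lemma integral_abs_sq_le:
  assumes "smooth \<phi>"
  shows "(LINT x|vol. \<bar>\<phi> x\<bar>)\<^sup>2 \<le> measure lebesgue \<Omega> * (LINT x|vol. (\<phi> x)\<^sup>2)"
  using Cauchy_Schwarz_L2_norm[OF L2_vol_continuous[OF smooth_continuous[OF assms]] vol.L2_const[of "1::real"]]
  by (simp add: space_restrict_space measure_restrict_space mult.commute)

text \<open>The Nash type inequality with \<open>r = 2 * \<rho>\<close>: the ball of radius
  \<open>2 * \<rho>\<close> has at least \<open>2 ^ d\<close> times the volume of
  \<open>\<Omega>\<close>, so by Cauchy-Schwarz the product term is at most half of the left side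
  and is absorbed.\<close>

lemma Poincare_inequality:
  assumes \<phi>: "smooth \<phi>" and \<rho>: "\<rho> > 0"
    and meas: "measure lebesgue \<Omega> \<le> unit_ball_vol (real DIM('a)) * \<rho> ^ DIM('a)"
  shows "(LINT x|vol. (\<phi> x)\<^sup>2) \<le> 4 * \<rho> * total_variation_sq \<phi>"
proof -
  define V where "V = unit_ball_vol (real DIM('a))"
  define I2 where "I2 = (LINT x|vol. (\<phi> x)\<^sup>2)"
  have V: "V > 0" by (simp add: V_def)
  have I2: "0 \<le> I2" by (simp add: I2_def)
  have "(LINT x|vol. \<bar>\<phi> x\<bar>)\<^sup>2 / (V * (2 * \<rho>) ^ DIM('a)) \<le> (V * \<rho> ^ DIM('a) * I2) / (V * (2 * \<rho>) ^ DIM('a))"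
    using integral_abs_sq_le[OF \<phi>] mult_right_mono[OF meas I2] V \<rho>
    by (intro divide_right_mono) (auto simp: V_def I2_def)
  also have "\<dots> = I2 / 2 ^ DIM('a)" using V \<rho> by (simp add: power_mult_distrib)
  also have "\<dots> \<le> I2 / 2"
  proof -
    have "(2::real) ^ 1 \<le> 2 ^ DIM('a)" by (rule power_increasing) (auto simp: Suc_leI)
    then show ?thesis using I2 by (intro divide_left_mono) auto
  qed
  finally have "(LINT x|vol. \<bar>\<phi> x\<bar>)\<^sup>2 / (V * (2 * \<rho>) ^ DIM('a)) \<le> I2 / 2" .
  moreover have "I2 \<le> (2 * \<rho>) * total_variation_sq \<phi> + (LINT x|vol. \<bar>\<phi> x\<bar>)\<^sup>2 / (V * (2 * \<rho>) ^ DIM('a))"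
    unfolding I2_def V_def by (rule Nash_inequality[OF \<phi>]) (use \<rho> in simp)
  ultimately have "I2 \<le> 4 * \<rho> * total_variation_sq \<phi>" by linarith
  then show ?thesis by (simp add: I2_def)
qed

text \<open>The gradient of the square is split by
  \<open>2 * p * q \<le> p\<^sup>2 / a + a * q\<^sup>2\<close>, with a free \<open>a\<close> to be
  tuned when terms are absorbed; \<open>a \<le> \<beta>\<close> bounds the boundary term by
  \<open>\<beta> / a\<close> times itself.\<close>

lemma total_variation_sq_le:
  assumes \<phi>: "smooth \<phi>" and a: "0 < a" "a \<le> \<beta>"
  shows "total_variation_sq \<phi> \<le> max 1 (sweep_const TYPE('a)) *
    (((LINT x|vol. (norm (grad \<phi> x))\<^sup>2) + \<beta> * (LINT x|bd. (\<phi> x)\<^sup>2)) / a + a * (LINT x|vol. (\<phi> x)\<^sup>2))"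
proof -
  define G where "G = (LINT x|vol. (norm (grad \<phi> x))\<^sup>2)"
  define B where "B = (LINT x|bd. (\<phi> x)\<^sup>2)"
  define I where "I = (LINT x|vol. (\<phi> x)\<^sup>2)"
  define K where "K = max 1 (sweep_const TYPE('a))"
  have n: "0 \<le> G" "0 \<le> B" "0 \<le> I" by (auto simp: G_def B_def I_def)
  note cont = smooth_continuous[OF \<phi>] continuous_grad[OF \<phi>]
  have "(LINT x|vol. norm (grad (\<lambda>x. (\<phi> x)\<^sup>2) x)) \<le> (LINT x|vol. (norm (grad \<phi> x))\<^sup>2 / a + a * (\<phi> x)\<^sup>2)"
  proof (rule integral_mono)
    show "integrable vol (\<lambda>x. norm (grad (\<lambda>x. (\<phi> x)\<^sup>2) x))"
      by (intro integrable_vol_continuous continuous_intros continuous_grad smooth_power2 \<phi>)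
    show "integrable vol (\<lambda>x. (norm (grad \<phi> x))\<^sup>2 / a + a * (\<phi> x)\<^sup>2)"
      by (intro integrable_vol_continuous continuous_intros cont) (use a in auto)
    fix x
    have "grad (\<lambda>x. (\<phi> x)\<^sup>2) x = (2 * \<phi> x) *\<^sub>R grad \<phi> x"
      using grad_mult[OF \<phi> \<phi>, of x] by (simp add: power2_eq_square scaleR_left_distrib[symmetric])
    then have "norm (grad (\<lambda>x. (\<phi> x)\<^sup>2) x) = 2 * (norm (grad \<phi> x) / sqrt a) * (sqrt a * \<bar>\<phi> x\<bar>)"
      using a by (simp add: abs_mult)
    also have "\<dots> \<le> (norm (grad \<phi> x) / sqrt a)\<^sup>2 + (sqrt a * \<bar>\<phi> x\<bar>)\<^sup>2"
      by (rule sum_squares_bound)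
    finally show "norm (grad (\<lambda>x. (\<phi> x)\<^sup>2) x) \<le> (norm (grad \<phi> x))\<^sup>2 / a + a * (\<phi> x)\<^sup>2"
      using a by (simp add: power_divide power_mult_distrib)
  qed
  also have "\<dots> = G / a + a * I"
    unfolding G_def I_def using cont a
    by (subst Bochner_Integration.integral_add)
      (auto intro!: integrable_vol_continuous continuous_intros)
  finally have 1: "(LINT x|vol. norm (grad (\<lambda>x. (\<phi> x)\<^sup>2) x)) \<le> 1 * (G / a + a * I)" by simp
  have "1 * (G / a + a * I) \<le> K * (G / a + a * I)"
    using n a by (intro mult_right_mono) (auto simp: K_def)
  moreover have "sweep_const TYPE('a) * B \<le> K * (\<beta> * B / a)"
  proof (rule mult_mono)
    show "B \<le> \<beta> * B / a" using n a mult_right_mono[OF a(2) n(2)] by (simp add: field_simps)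
  qed (use n in \<open>auto simp: K_def\<close>)
  moreover have "K * ((G + \<beta> * B) / a + a * I) = K * (G / a + a * I) + K * (\<beta> * B / a)"
    by (simp add: algebra_simps add_divide_distrib)
  ultimately have "(LINT x|vol. norm (grad (\<lambda>x. (\<phi> x)\<^sup>2) x)) + sweep_const TYPE('a) * B \<le> K * ((G + \<beta> * B) / a + a * I)"
    using 1 by linarith
  then show ?thesis
    unfolding total_variation_sq_def G_def B_def I_def K_def .
qed

end

section \<open>Lipschitz domains and the trace inequality\<close>

text \<open>Both interior points (with \<open>\<nu> = 0\<close>) and boundary points of a Lipschitz domain have this property.\<close>

definition inward_cone :: "'a::euclidean_space set \<Rightarrow> 'a \<Rightarrow> 'a \<Rightarrow> real \<Rightarrow> real \<Rightarrow> real \<Rightarrow> bool" where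
  "inward_cone \<Omega> p \<nu> c \<sigma> r \<longleftrightarrow> norm \<nu> \<le> 1 \<and> 0 < c \<and> c \<le> 1 \<and> 0 < \<sigma> \<and> 0 < r \<and>
     (\<forall>x\<in>closure \<Omega>. \<forall>y\<in>cball p r. \<forall>s. 0 < s \<and> s < \<sigma> \<and> dist y (x - s *\<^sub>R \<nu>) < c * s \<longrightarrow> y \<in> \<Omega>)"

lemma inward_coneD:
  assumes "inward_cone \<Omega> p \<nu> c \<sigma> r" "x \<in> closure \<Omega>" "dist p y \<le> r" "0 < s" "s < \<sigma>" "dist y (x - s *\<^sub>R \<nu>) < c * s"
  shows "y \<in> \<Omega>"
proof -
  have H: "\<forall>x\<in>closure \<Omega>. \<forall>y\<in>cball p r. \<forall>s. 0 < s \<and> s < \<sigma> \<and> dist y (x - s *\<^sub>R \<nu>) < c * s \<longrightarrow> y \<in> \<Omega>"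
    using assms(1) unfolding inward_cone_def by simp
  show ?thesis by (rule H[rule_format, of x y s]) (use assms(2-6) in auto)
qed

text \<open>The uniform cone property. In graph coordinates, moving by \<open>- s\<close> along
  \<open>\<nu>\<close> and by a perturbation \<open>w\<close> changes the height relative to the
  graph by at most \<open>(1 + 2 * L) * norm w - s\<close>, which is negative in the cone.\<close>

lemma lipschitz_boundary_inward_cone:
  fixes \<Omega> :: "'a::euclidean_space set"
  assumes op: "open \<Omega>" and lip: "lipschitz_boundary \<Omega>" and p: "p \<in> closure \<Omega>"
  shows "\<exists>\<nu> c \<sigma> r. inward_cone \<Omega> p \<nu> c \<sigma> r"
proof (cases "p \<in> \<Omega>")
  case True
  then obtain r where "r > 0" "cball p r \<subseteq> \<Omega>" using op by (meson open_contains_cball)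
  then have "inward_cone \<Omega> p 0 1 1 r" by (auto simp: inward_cone_def)
  then show ?thesis by blast
next
  case False
  then have "p \<in> frontier \<Omega>" using p op by (simp add: frontier_def interior_open)
  then obtain U \<nu> \<gamma> L where U: "open U" "p \<in> U" "norm \<nu> = 1" "L-lipschitz_on {y. y \<bullet> \<nu> = 0} \<gamma>"
    "\<Omega> \<inter> U = {x \<in> U. x \<bullet> \<nu> < \<gamma> (x - (x \<bullet> \<nu>) *\<^sub>R \<nu>)}"
    using lip[unfolded lipschitz_boundary_def, rule_format, OF \<open>p \<in> frontier \<Omega>\<close>] by blast
  obtain e where e: "e > 0" "ball p e \<subseteq> U" using U(1,2) by (meson open_contains_ball)
  have L: "L \<ge> 0" using U(4) by (rule lipschitz_on_nonneg)
  \<comment> \<open>A perturbation of unit length changes the height by at most 1 and the value of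
    \<open>\<gamma>\<close> by at most \<open>2 * L\<close>, the 2 being a crude bound for the
    projection onto the hyperplane.\<close>
  define c where "c = 1 / (1 + 2 * L)"
  have c: "0 < c" "c \<le> 1" "c * (1 + 2 * L) = 1" using L by (auto simp: c_def)
  have \<nu>\<nu>: "\<nu> \<bullet> \<nu> = 1" using U(3) by (simp add: dot_square_norm)
  have main: "y \<in> \<Omega>" if x: "x \<in> \<Omega>" and y: "dist p y \<le> e / 4" and s: "0 < s" "s < e / 4"
    and d: "dist y (x - s *\<^sub>R \<nu>) < c * s" for x y s
  proof -
    define w where "w = y - (x - s *\<^sub>R \<nu>)"
    have w: "norm w < c * s" using d by (simp add: w_def dist_norm)
    have "c * s \<le> 1 * s" using c s by (intro mult_right_mono) auto
    then have w2: "norm w < e / 4" using w s by linarith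
    have "x - p = (y - p) + (s *\<^sub>R \<nu> - w)" by (simp add: w_def)
    then have "norm (x - p) \<le> norm (y - p) + norm (s *\<^sub>R \<nu> - w)" by (metis norm_triangle_ineq)
    also have "norm (s *\<^sub>R \<nu> - w) \<le> s + norm w"
      using norm_triangle_ineq4[of "s *\<^sub>R \<nu>" w] s U(3) by simp
    finally have "norm (x - p) < e" using y s w2 e(1) by (simp add: dist_norm norm_minus_commute)
    then have xU: "x \<in> U" using e(2) by (auto simp: dist_norm norm_minus_commute)
    have yU: "y \<in> U" using e y by (auto intro!: subsetD[OF e(2)])
    define P where "P z = z - (z \<bullet> \<nu>) *\<^sub>R \<nu>" for z
    have P: "P z \<in> {y. y \<bullet> \<nu> = 0}" for z by (simp add: P_def inner_diff_left \<nu>\<nu>)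
    have "x \<bullet> \<nu> < \<gamma> (P x)" using x xU U(5) by (auto simp: P_def)
    moreover have "y \<bullet> \<nu> = x \<bullet> \<nu> - s + w \<bullet> \<nu>"
      by (simp add: w_def inner_diff_left \<nu>\<nu>)
    moreover have wn: "\<bar>w \<bullet> \<nu>\<bar> \<le> norm w" using Cauchy_Schwarz_ineq2[of w \<nu>] U(3) by simp
    moreover have "\<gamma> (P x) \<le> \<gamma> (P y) + 2 * L * norm w"
    proof -
      have "P x - P y = - (w - (w \<bullet> \<nu>) *\<^sub>R \<nu>)"
        by (simp add: P_def w_def inner_diff_left inner_add_left \<nu>\<nu> algebra_simps)
      then have "norm (P x - P y) \<le> norm w + norm ((w \<bullet> \<nu>) *\<^sub>R \<nu>)"
        by (metis norm_minus_cancel norm_triangle_ineq4)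
      also have "\<dots> \<le> 2 * norm w" using wn U(3) by simp
      finally have "L * dist (P x) (P y) \<le> L * (2 * norm w)"
        using L by (intro mult_left_mono) (auto simp: dist_norm)
      moreover have "dist (\<gamma> (P x)) (\<gamma> (P y)) \<le> L * dist (P x) (P y)"
        by (rule lipschitz_onD[OF U(4) P P])
      ultimately show ?thesis by (simp add: dist_real_def)
    qed
    ultimately have "y \<bullet> \<nu> < \<gamma> (P y) + (1 + 2 * L) * norm w - s"
      by (simp add: algebra_simps)
    also have "(1 + 2 * L) * norm w \<le> (1 + 2 * L) * (c * s)"
      using w L by (intro mult_left_mono) auto
    also have "(1 + 2 * L) * (c * s) = s" using c(3) by (metis mult.assoc mult.commute mult_1)
    finally have "y \<bullet> \<nu> < \<gamma> (P y)" by simp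
    then show ?thesis using yU U(5) by (auto simp: P_def)
  qed
  have "inward_cone \<Omega> p \<nu> c (e / 4) (e / 4)"
    unfolding inward_cone_def
  proof (intro conjI ballI allI impI)
    fix x y s assume x: "x \<in> closure \<Omega>" and y: "y \<in> cball p (e / 4)"
      and *: "0 < s \<and> s < e / 4 \<and> dist y (x - s *\<^sub>R \<nu>) < c * s"
    then have "0 < c * s - dist y (x - s *\<^sub>R \<nu>)" by simp
    \<comment> \<open>The cone inequality is strict, so a point of the closure can be replaced by a
      nearby point of \<open>\<Omega>\<close>.\<close>
    then obtain x' where x': "x' \<in> \<Omega>" "dist x' x < c * s - dist y (x - s *\<^sub>R \<nu>)"
      using x unfolding closure_approachable by blast
    have "dist y (x' - s *\<^sub>R \<nu>) \<le> dist y (x - s *\<^sub>R \<nu>) + dist (x - s *\<^sub>R \<nu>) (x' - s *\<^sub>R \<nu>)"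
      by (rule dist_triangle)
    then have "dist y (x' - s *\<^sub>R \<nu>) < c * s" using x'(2) by (simp add: dist_norm norm_minus_commute)
    then show "y \<in> \<Omega>" by (intro main[OF x'(1), of y s]) (use y * in auto)
  qed (use c e U in auto)
  then show ?thesis by blast
qed

section \<open>Boundary measure bounded by swept volume\<close>

lemma open_neighbourhood_borel [measurable]: "(\<Union>q\<in>E. ball q \<eta>) \<in> sets borel"
  by (intro borel_open open_UN) auto

text \<open>Within a window of length \<open>h\<close>, each line in direction \<open>\<nu>\<close>
  meets the neighbourhood \<open>N\<close> of \<open>E\<close> in length at most
  \<open>4 * \<eta> / c\<close>, and only lines starting in the neighbourhood \<open>S\<close> of
  the sweep meet it at all. Averaging the translates of \<open>N\<close> over \<open>s\<close> in
  \<open>{0..h}\<close> and exchanging integrals gives the factor \<open>1 / h\<close>.\<close>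

lemma emeasure_neighbourhood_le:
  fixes \<Omega> :: "'a::euclidean_space set"
  assumes cone: "inward_cone \<Omega> p \<nu> c \<sigma> r" and op: "open \<Omega>"
    and E: "E \<subseteq> frontier \<Omega>" "E \<subseteq> cball p r" and h: "0 < h" "h < \<sigma>" and \<eta>: "0 < \<eta>"
  shows "emeasure lborel (\<Union>q\<in>E. ball q \<eta>)
    \<le> ennreal (4 * \<eta> / (c * h)) * emeasure lborel (\<Union>q\<in>sweep E (h *\<^sub>R \<nu>). ball q \<eta>)"
proof -
  define N where "N = (\<Union>q\<in>E. ball q \<eta>)"
  define S where "S = (\<Union>q\<in>sweep E (h *\<^sub>R \<nu>). ball q \<eta>)"
  have [measurable]: "N \<in> sets borel" "S \<in> sets borel" unfolding N_def S_def by measurable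
  have c: "c > 0" using cone by (simp add: inward_cone_def)
  \<comment> \<open>Two points of \<open>N\<close> farther apart on such a line would put one
    frontier point into the inward cone of another, hence into the open set
    \<open>\<Omega>\<close>.\<close>
  have chord: "s2 - s1 < 2 * \<eta> / c"
    if s: "0 \<le> s1" "s1 < s2" "s2 \<le> h" and N: "y + s1 *\<^sub>R \<nu> \<in> N" "y + s2 *\<^sub>R \<nu> \<in> N" for y s1 s2
  proof (rule ccontr)
    assume "\<not> ?thesis"
    then have le: "2 * \<eta> \<le> c * (s2 - s1)" using c by (simp add: field_simps)
    obtain q1 q2 where q: "q1 \<in> E" "dist q1 (y + s1 *\<^sub>R \<nu>) < \<eta>" "q2 \<in> E" "dist q2 (y + s2 *\<^sub>R \<nu>) < \<eta>"
      using N by (auto simp: N_def)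
    have "dist q1 (q2 - (s2 - s1) *\<^sub>R \<nu>) = norm ((q1 - (y + s1 *\<^sub>R \<nu>)) - (q2 - (y + s2 *\<^sub>R \<nu>)))"
      by (simp add: dist_norm algebra_simps)
    then have "dist q1 (q2 - (s2 - s1) *\<^sub>R \<nu>) < 2 * \<eta>"
      using norm_triangle_ineq4[of "q1 - (y + s1 *\<^sub>R \<nu>)" "q2 - (y + s2 *\<^sub>R \<nu>)"] q(2,4)
      unfolding dist_norm by linarith
    then have "q1 \<in> \<Omega>"
      using E q s h le by (intro inward_coneD[OF cone, of q2 q1 "s2 - s1"]) (auto simp: frontier_def)
    then show False using E(1) q(1) op by (auto simp: frontier_def interior_open)
  qed
  have le: "(\<integral>\<^sup>+s. indicator {0..h} s * indicator N (y + s *\<^sub>R \<nu>) \<partial>lborel) \<le> ennreal (4 * \<eta> / c) * indicator S y" for y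
  proof (cases "\<exists>s\<in>{0..h}. y + s *\<^sub>R \<nu> \<in> N")
    case True
    then obtain s where s: "0 \<le> s" "s \<le> h" "y + s *\<^sub>R \<nu> \<in> N" by auto
    then obtain q where q: "q \<in> E" "dist q (y + s *\<^sub>R \<nu>) < \<eta>" by (auto simp: N_def)
    have "q - s *\<^sub>R \<nu> \<in> sweep E (h *\<^sub>R \<nu>)"
      unfolding sweep_def using s q h by (auto intro!: bexI[of _ "s / h"])
    moreover have "dist (q - s *\<^sub>R \<nu>) y < \<eta>" using q(2) by (simp add: dist_norm algebra_simps)
    ultimately have "y \<in> S" unfolding S_def by (metis UN_I mem_ball)
    have "(\<integral>\<^sup>+s. indicator {0..h} s * indicator N (y + s *\<^sub>R \<nu>) \<partial>lborel)
        \<le> (\<integral>\<^sup>+t. indicator {s - 2 * \<eta> / c..s + 2 * \<eta> / c} t \<partial>lborel)"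
    proof (rule nn_integral_mono)
      fix t
      have "0 < 2 * \<eta> / c" using \<eta> c by simp
      moreover have "0 \<le> t \<Longrightarrow> t \<le> h \<Longrightarrow> y + t *\<^sub>R \<nu> \<in> N \<Longrightarrow> t < s \<Longrightarrow> s - t < 2 * \<eta> / c"
        using chord[of t s y] s by simp
      moreover have "0 \<le> t \<Longrightarrow> t \<le> h \<Longrightarrow> y + t *\<^sub>R \<nu> \<in> N \<Longrightarrow> s < t \<Longrightarrow> t - s < 2 * \<eta> / c"
        using chord[of s t y] s by simp
      ultimately show "indicator {0..h} t * indicator N (y + t *\<^sub>R \<nu>)
          \<le> (indicator {s - 2 * \<eta> / c..s + 2 * \<eta> / c} t :: ennreal)"
        by (cases "t < s"; cases "s < t") (auto simp: indicator_def)
    qed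
    also have "\<dots> = ennreal (4 * \<eta> / c)" using \<eta> c by simp
    finally show ?thesis using \<open>y \<in> S\<close> by simp
  next
    case False
    then have "(\<integral>\<^sup>+s. indicator {0..h} s * indicator N (y + s *\<^sub>R \<nu>) \<partial>lborel) = (\<integral>\<^sup>+(s::real). 0 \<partial>lborel)"
      by (intro nn_integral_cong) (auto simp: indicator_def)
    then show ?thesis by simp
  qed
  have "ennreal h * emeasure lborel N = (\<integral>\<^sup>+s. indicator {0..h} s * emeasure lborel N \<partial>lborel)"
    using h by (subst nn_integral_multc) auto
  also have "\<dots> = (\<integral>\<^sup>+s. \<integral>\<^sup>+y. indicator {0..h} s * indicator N (y + s *\<^sub>R \<nu>) \<partial>lborel \<partial>lborel)"
  proof (rule nn_integral_cong)
    fix s :: real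
    show "indicator {0..h} s * emeasure lborel N = (\<integral>\<^sup>+y. indicator {0..h} s * indicator N (y + s *\<^sub>R \<nu>) \<partial>lborel)"
      by (subst nn_integral_cmult) (auto simp: nn_integral_lborel_shift)
  qed
  also have "\<dots> = (\<integral>\<^sup>+y. \<integral>\<^sup>+s. indicator {0..h} s * indicator N (y + s *\<^sub>R \<nu>) \<partial>lborel \<partial>lborel)"
    by (rule lborel_pair.Fubini') measurable
  also have "\<dots> \<le> (\<integral>\<^sup>+y. ennreal (4 * \<eta> / c) * indicator S y \<partial>lborel)"
    by (rule nn_integral_mono) (rule le)
  also have "\<dots> = ennreal (4 * \<eta> / c) * emeasure lborel S"
    by (subst nn_integral_cmult) auto
  finally have "ennreal (1 / h) * (ennreal h * emeasure lborel N) \<le> ennreal (1 / h) * (ennreal (4 * \<eta> / c) * emeasure lborel S)"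
    by (rule mult_left_mono) simp
  moreover have "ennreal (1 / h) * (ennreal h * emeasure lborel N) = emeasure lborel N"
    using h by (simp add: mult.assoc[symmetric] ennreal_mult[symmetric])
  moreover have "ennreal (1 / h) * (ennreal (4 * \<eta> / c) * emeasure lborel S) = ennreal (4 * \<eta> / (c * h)) * emeasure lborel S"
    using h c \<eta> by (subst mult.assoc[symmetric], subst ennreal_mult[symmetric]) (auto simp: field_simps)
  ultimately have "emeasure lborel N \<le> ennreal (4 * \<eta> / (c * h)) * emeasure lborel S" by simp
  then show ?thesis by (simp add: N_def S_def)
qed

text \<open>Outer regularity, and the positive distance of a compact set from the complement of an
  open superset.\<close>

lemma compact_neighbourhood_measure:
  fixes S :: "'a::euclidean_space set"
  assumes S: "compact S" and e: "e > 0"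
  shows "\<exists>d>0. \<forall>\<eta>. 0 < \<eta> \<and> \<eta> < d \<longrightarrow> emeasure lborel (\<Union>q\<in>S. ball q \<eta>) \<le> ennreal (measure lborel S + e)"
proof -
  have Ss: "S \<in> sets lebesgue" using borel_compact[OF S] by simp
  obtain U where U: "open U" "S \<subseteq> U" "U - S \<in> lmeasurable" "emeasure lebesgue (U - S) < ennreal e"
    using sets_lebesgue_outer_open[OF Ss e] .
  have "S \<inter> - U = {}" using U by blast
  then obtain d where d: "d > 0" "\<And>x y. x \<in> S \<Longrightarrow> y \<in> - U \<Longrightarrow> d \<le> dist x y"
    using separate_compact_closed[OF S, of "- U"] U(1) by (auto simp: closed_Compl)
  have Sb: "S \<in> sets borel" "U \<in> sets borel" using S U by (auto intro: borel_compact)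
  have fin: "emeasure lborel S = ennreal (measure lborel S)"
    using emeasure_bounded_finite[OF compact_imp_bounded[OF S]] by (intro emeasure_eq_ennreal_measure) auto
  have "emeasure lborel (\<Union>q\<in>S. ball q \<eta>) \<le> ennreal (measure lborel S + e)" if \<eta>: "0 < \<eta>" "\<eta> < d" for \<eta>
  proof -
    have "(\<Union>q\<in>S. ball q \<eta>) \<subseteq> S \<union> (U - S)" using d(2) \<eta> by force
    then have "emeasure lborel (\<Union>q\<in>S. ball q \<eta>) \<le> emeasure lborel (S \<union> (U - S))"
      using Sb by (intro emeasure_mono) auto
    also have "\<dots> \<le> emeasure lborel S + emeasure lborel (U - S)"
      using Sb by (intro emeasure_subadditive) auto
    also have "\<dots> \<le> ennreal (measure lborel S) + ennreal e"
      using U(4) Sb fin by (intro add_mono) auto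
    finally show ?thesis using e by (simp add: ennreal_plus)
  qed
  with d(1) show ?thesis by blast
qed

lemma ennreal_le_limit:
  assumes "\<And>t. t > 0 \<Longrightarrow> x \<le> ennreal (K * (m + t))"
  shows "x \<le> ennreal (K * m)"
proof -
  have "((\<lambda>t. K * (m + t)) \<longlongrightarrow> K * (m + 0)) (at_right 0)" by (intro tendsto_intros)
  then have "((\<lambda>t. ennreal (K * (m + t))) \<longlongrightarrow> ennreal (K * (m + 0))) (at_right 0)" by (rule tendsto_ennrealI)
  then have "x \<le> ennreal (K * (m + 0))"
    by (rule tendsto_lowerbound) (auto simp: eventually_at_filter assms)
  then show ?thesis by simp
qed

text \<open>A converse of \<open>emeasure_sweep_le\<close> for directions transversal to the
  boundary. Neighbourhood volumes are compared at all small scales \<open>\<eta>\<close>, which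
  bounds the Minkowski content of \<open>E\<close>. The constant degenerates with the opening
  \<open>c\<close> and the height \<open>h\<close> of the cone.\<close>

lemma hausdorff_le_sweep:
  fixes \<Omega> :: "'a::euclidean_space set"
  assumes cone: "inward_cone \<Omega> p \<nu> c \<sigma> r" and op: "open \<Omega>"
    and E: "compact E" "E \<subseteq> frontier \<Omega>" "E \<subseteq> cball p r" and h: "0 < h" "h < \<sigma>"
  shows "hausdorff_outer (DIM('a) - 1) E
    \<le> ennreal (minkowski_const TYPE('a) * (4 / (c * h)) * measure lborel (sweep E (h *\<^sub>R \<nu>)))"
proof (rule ennreal_le_limit)
  have c: "c > 0" using cone by (simp add: inward_cone_def)
  let ?S = "sweep E (h *\<^sub>R \<nu>)"
  fix t :: real assume t: "t > 0"
  obtain d where d: "d > 0" "\<And>\<eta>. 0 < \<eta> \<Longrightarrow> \<eta> < d \<Longrightarrow> emeasure lborel (\<Union>q\<in>?S. ball q \<eta>) \<le> ennreal (measure lborel ?S + t)"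
    using compact_neighbourhood_measure[OF compact_sweep[OF E(1)] t] by metis
  have "hausdorff_outer (DIM('a) - 1) E \<le> ennreal (minkowski_const TYPE('a) * (4 / (c * h) * (measure lborel ?S + t)))"
  proof (rule hausdorff_outer_le_minkowski[OF _ d(1)])
    show "0 \<le> 4 / (c * h) * (measure lborel ?S + t)" using c h t by simp
    fix \<eta> assume \<eta>: "0 < \<eta>" "\<eta> < d"
    have "emeasure lborel (\<Union>q\<in>E. ball q \<eta>) \<le> ennreal (4 * \<eta> / (c * h)) * emeasure lborel (\<Union>q\<in>?S. ball q \<eta>)"
      by (rule emeasure_neighbourhood_le[OF cone op E(2,3) h \<eta>(1)])
    also have "\<dots> \<le> ennreal (4 * \<eta> / (c * h)) * ennreal (measure lborel ?S + t)"
      by (rule mult_left_mono[OF d(2)[OF \<eta>]]) simp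
    also have "\<dots> = ennreal (4 / (c * h) * (measure lborel ?S + t) * \<eta>)"
      using \<eta> c h t by (subst ennreal_mult[symmetric]) (auto simp: field_simps)
    finally show "emeasure lborel (\<Union>q\<in>E. ball q \<eta>) \<le> ennreal (4 / (c * h) * (measure lborel ?S + t) * \<eta>)" .
  qed
  then show "hausdorff_outer (DIM('a) - 1) E \<le> ennreal (minkowski_const TYPE('a) * (4 / (c * h)) * (measure lborel ?S + t))"
    by (simp add: mult.assoc)
qed

locale lipschitz_dom =
  fixes \<Omega> :: "'a::euclidean_space set"
  assumes lipschitz: "lipschitz_domain \<Omega>"
begin

lemma op: "open \<Omega>" and bnd: "bounded \<Omega>"
  using lipschitz by (auto simp: lipschitz_domain_def)

lemma exists_cone: "p \<in> closure \<Omega> \<Longrightarrow> \<exists>\<nu> c \<sigma> r. inward_cone \<Omega> p \<nu> c \<sigma> r"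
  using lipschitz by (intro lipschitz_boundary_inward_cone) (auto simp: lipschitz_domain_def)

text \<open>Half of each radius is kept in reserve: segments of length at most
  \<open>r p / 2\<close> that start in the cover stay where the cone condition at \<open>p\<close>
  applies.\<close>

lemma frontier_finite_cover:
  "\<exists>P \<nu> c \<sigma> r. finite P \<and> (\<forall>p\<in>P. inward_cone \<Omega> p (\<nu> p) (c p) (\<sigma> p) (r p)) \<and>
    frontier \<Omega> \<subseteq> (\<Union>p\<in>P. cball p (r p / 2))"
proof -
  have "\<forall>p\<in>frontier \<Omega>. \<exists>\<nu> c \<sigma> r. inward_cone \<Omega> p \<nu> c \<sigma> r"
    using exists_cone by (auto simp: frontier_def)
  then obtain \<nu> c \<sigma> r where cone: "\<And>p. p \<in> frontier \<Omega> \<Longrightarrow> inward_cone \<Omega> p (\<nu> p) (c p) (\<sigma> p) (r p)"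
    by metis
  have "frontier \<Omega> \<subseteq> (\<Union>p\<in>frontier \<Omega>. ball p (r p / 2))"
    using cone by (auto simp: inward_cone_def)
  then obtain P where P: "P \<subseteq> frontier \<Omega>" "finite P" "frontier \<Omega> \<subseteq> (\<Union>p\<in>P. ball p (r p / 2))"
    by (rule compactE_image[OF compact_frontier_bounded[OF bnd], rotated]) auto
  have "frontier \<Omega> \<subseteq> (\<Union>p\<in>P. cball p (r p / 2))" using P(3) ball_subset_cball by blast
  then show ?thesis
    using P cone by (intro exI[of _ P] exI[of _ \<nu>] exI[of _ c] exI[of _ \<sigma>] exI[of _ r]) auto
qed

text \<open>Makes a Lipschitz domain an instance of \<open>finite_boundary\<close>, so that the
  translation estimates apply to it.\<close>

lemma frontier_hausdorff_finite: "hausdorff_outer (DIM('a) - 1) (frontier \<Omega>) < \<infinity>"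
proof -
  obtain P \<nu> c \<sigma> r where P: "finite P" "\<And>p. p \<in> P \<Longrightarrow> inward_cone \<Omega> p (\<nu> p) (c p) (\<sigma> p) (r p)"
    "frontier \<Omega> \<subseteq> (\<Union>p\<in>P. cball p (r p / 2))"
    using frontier_finite_cover by blast
  define E where "E p = frontier \<Omega> \<inter> cball p (r p / 2)" for p
  have comp: "compact (E p)" for p
    unfolding E_def using compact_frontier_bounded[OF bnd] by (intro compact_Int_closed) auto
  have fin: "emeasure surface_measure (E p) < \<infinity>" if "p \<in> P" for p
  proof -
    have pos: "0 < \<sigma> p" "0 < r p" using P(2)[OF that] by (auto simp: inward_cone_def)
    have "hausdorff_outer (DIM('a) - 1) (E p)
        \<le> ennreal (minkowski_const TYPE('a) * (4 / (c p * (\<sigma> p / 2))) * measure lborel (sweep (E p) ((\<sigma> p / 2) *\<^sub>R \<nu> p)))"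
      by (rule hausdorff_le_sweep[OF P(2)[OF that] op comp]) (use pos in \<open>auto simp: E_def\<close>)
    also have "\<dots> < \<infinity>" by simp
    finally show ?thesis using borel_compact[OF comp] by (simp add: emeasure_hausdorff)
  qed
  have "frontier \<Omega> = (\<Union>p\<in>P. E p)" using P(3) by (auto simp: E_def)
  then have "emeasure surface_measure (frontier \<Omega>) \<le> (\<Sum>p\<in>P. emeasure surface_measure (E p))"
    using borel_compact[OF comp] P(1) by (auto intro!: emeasure_subadditive_finite)
  also have "\<dots> < \<infinity>" using fin P(1) by auto
  finally show ?thesis by (simp add: emeasure_hausdorff borel_closed)
qed

sublocale finite_boundary \<Omega>
  by unfold_locales (rule op bnd frontier_hausdorff_finite)+

lemma integrable_segment:
  fixes F :: "'a \<Rightarrow> real" and a b :: real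
  assumes [measurable]: "F \<in> borel_measurable borel" and B: "\<And>y. \<bar>F y\<bar> \<le> B"
  shows "integrable lborel (\<lambda>s. indicator {a..b} s * F (x + s *\<^sub>R k))"
proof (rule integrableI_bounded_set[where A = "{a..b}" and B = B])
  show "AE s in lborel. s \<in> {a..b} \<longrightarrow> norm (indicator {a..b} s * F (x + s *\<^sub>R k)) \<le> B"
    using B by (intro AE_I2) auto
qed (auto simp: emeasure_lborel_Icc_eq)

text \<open>The integrand that dominates a boundary value of \<open>v\<close> when averaged along an
  inward segment of length at most \<open>h\<close>.\<close>

definition line_density :: "('a \<Rightarrow> real) \<Rightarrow> real \<Rightarrow> 'a \<Rightarrow> real" where
  "line_density v h y = indicator \<Omega> y * (v y + h * norm (grad v y))"

lemma line_density:
  assumes v: "smooth v" "\<And>x. 0 \<le> v x" and h: "0 \<le> h"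
  shows "line_density v h \<in> borel_measurable borel" "0 \<le> line_density v h y"
    "\<exists>B. \<forall>y. \<bar>line_density v h y\<bar> \<le> B"
    "(\<integral>\<^sup>+x. ennreal (line_density v h x) \<partial>lborel) = ennreal (LINT x|vol. v x + h * norm (grad v x))"
proof -
  have [measurable]: "grad v \<in> borel_measurable borel" "v \<in> borel_measurable borel"
    by (rule grad_borel_measurable[OF v(1)], rule smooth_borel_measurable[OF v(1)])
  show "line_density v h \<in> borel_measurable borel"
    unfolding line_density_def by measurable
  show "0 \<le> line_density v h y" for y
    unfolding line_density_def using v h by simp
  have c: "continuous_on UNIV (\<lambda>y. v y + h * norm (grad v y))"
    by (intro continuous_intros smooth_continuous[OF v(1)] continuous_grad[OF v(1)])
  obtain B where "B \<ge> 0" "\<And>x. x \<in> closure \<Omega> \<Longrightarrow> norm (v x + h * norm (grad v x)) \<le> B"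
    using continuous_bounded_on_closure[OF c] by metis
  then have "\<bar>line_density v h y\<bar> \<le> B" for y
    using closure_subset[of \<Omega>] by (auto simp: line_density_def indicator_def)
  then show "\<exists>B. \<forall>y. \<bar>line_density v h y\<bar> \<le> B" by blast
  show "(\<integral>\<^sup>+x. ennreal (line_density v h x) \<partial>lborel) = ennreal (LINT x|vol. v x + h * norm (grad v x))"
    unfolding line_density_def using v h by (intro nn_integral_lborel_vol c) auto
qed

text \<open>The value at \<open>q\<close> exceeds the value at any point of the segment by at most
  the variation along it; then the parameter is averaged over the unit interval. The inward cone
  keeps the segment, apart from \<open>q\<close>, inside \<open>\<Omega>\<close>.\<close>

lemma le_line_integral:
  assumes v: "smooth v" "\<And>x. 0 \<le> v x" and cone: "inward_cone \<Omega> p \<nu> c \<sigma> r" and h: "0 < h" "h < \<sigma>" "h \<le> r / 2"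
    and q: "q \<in> frontier \<Omega>" "q \<in> cball p (r / 2)"
  defines "k \<equiv> - (h *\<^sub>R \<nu>)"
  shows "v q \<le> (LINT s|lborel. indicator {0..1} s * line_density v h (q + s *\<^sub>R k))"
proof -
  have \<nu>: "norm \<nu> \<le> 1" "0 < c" using cone by (auto simp: inward_cone_def)
  have k: "norm k \<le> h" using \<nu> h by (simp add: k_def mult_left_le)
  have in\<Omega>: "q + s *\<^sub>R k \<in> \<Omega>" if s: "0 < s" "s \<le> 1" for s
  proof (rule inward_coneD[OF cone, of q _ "s * h"])
    have sh: "s * h \<le> h" using s h by (simp add: mult_left_le_one_le)
    show "0 < s * h" using s h by simp
    show "s * h < \<sigma>" using sh h(2) by linarith
    have "dist p (q + s *\<^sub>R k) \<le> dist p q + dist q (q + s *\<^sub>R k)" by (rule dist_triangle)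
    also have "dist q (q + s *\<^sub>R k) \<le> 1 * h"
      using s k by (simp add: dist_norm) (metis less_imp_le mult_mono mult_1 norm_ge_zero zero_le_one)
    finally show "dist p (q + s *\<^sub>R k) \<le> r" using q h by simp
    show "q \<in> closure \<Omega>" using q by (simp add: frontier_def)
    show "dist (q + s *\<^sub>R k) (q - (s * h) *\<^sub>R \<nu>) < c * (s * h)" using \<nu> s h by (simp add: k_def dist_norm)
  qed
  define Var where "Var = variation_along v k q"
  have pt: "v q \<le> v (q + s *\<^sub>R k) + Var" if s: "0 \<le> s" "s \<le> 1" for s
  proof -
    have "\<bar>v (q + s *\<^sub>R k) - v (q + 0 *\<^sub>R k)\<bar> \<le> Var"
      unfolding Var_def using s in\<Omega> by (intro segment_difference_le_variation v) auto
    then show ?thesis by simp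
  qed
  obtain B where B: "\<And>y. \<bar>line_density v 0 y\<bar> \<le> B" using line_density(3)[OF v, of 0] by auto
  note ld0 = line_density[OF v, of 0]
  obtain B' where B': "\<And>y. \<bar>line_density v h y\<bar> \<le> B'" using line_density(3)[OF v, of h] h by auto
  have i0: "integrable lborel (\<lambda>s. indicator {0..1} s * line_density v 0 (q + s *\<^sub>R k))"
    by (rule integrable_segment[OF _ B]) (use ld0 in auto)
  have i1: "integrable lborel (\<lambda>s. indicator {0..1} s * line_density v h (q + s *\<^sub>R k))"
    by (rule integrable_segment[OF _ B']) (use line_density[OF v, of h] h in auto)
  have iV: "integrable lborel (\<lambda>s::real. indicator {0..1} s * (indicator \<Omega> (q + s *\<^sub>R k) * norm (grad v (q + s *\<^sub>R k)) * norm k))"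
    by (rule variation_integrable[OF v(1)])
  have "v q = (LINT s|lborel. indicator {0..1::real} s * v q)" by simp
  also have "\<dots> \<le> (LINT s|lborel. indicator {0..1} s * line_density v 0 (q + s *\<^sub>R k) + indicator {0..1} s * Var)"
  proof (rule integral_mono_AE)
    have "AE s in lborel. s \<noteq> (0::real)" by (rule AE_lborel_singleton)
    then show "AE s in lborel. indicator {0..1} s * v q \<le> indicator {0..1} s * line_density v 0 (q + s *\<^sub>R k) + indicator {0..1} s * Var"
    proof eventually_elim
      case (elim s)
      then show ?case using pt[of s] in\<Omega>[of s] by (auto simp: indicator_def line_density_def)
    qed
  qed (use i0 in auto)
  also have "\<dots> = (LINT s|lborel. indicator {0..1} s * line_density v 0 (q + s *\<^sub>R k)) + Var"
    using i0 by (subst Bochner_Integration.integral_add) auto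
  also have "\<dots> = (LINT s|lborel. indicator {0..1} s * line_density v 0 (q + s *\<^sub>R k)
      + indicator {0..1} s * (indicator \<Omega> (q + s *\<^sub>R k) * norm (grad v (q + s *\<^sub>R k)) * norm k))"
    unfolding Var_def variation_along_def using i0 iV by (subst Bochner_Integration.integral_add) auto
  also have "\<dots> \<le> (LINT s|lborel. indicator {0..1} s * line_density v h (q + s *\<^sub>R k))"
  proof (rule integral_mono)
    show "indicator {0..1} s * line_density v 0 (q + s *\<^sub>R k)
      + indicator {0..1} s * (indicator \<Omega> (q + s *\<^sub>R k) * norm (grad v (q + s *\<^sub>R k)) * norm k)
      \<le> indicator {0..1} s * line_density v h (q + s *\<^sub>R k)" for s :: real
      using mult_right_mono[OF k, of "norm (grad v (q + s *\<^sub>R k))"]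
      by (auto simp: line_density_def indicator_def mult.commute)
  qed (use i0 i1 iV in auto)
  finally show ?thesis .
qed

text \<open>\<open>hausdorff_le_sweep\<close> is applied to the superlevel sets of \<open>v\<close>
  on a boundary patch. From a point of such a sweep, the line in direction \<open>k\<close> passes
  through a boundary point of high value, so the line integral \<open>g\<close> is high there;
  Fubini turns the integral of \<open>g\<close> into that of the line density.\<close>

lemma trace_inequality_local:
  assumes cone: "inward_cone \<Omega> p \<nu> c \<sigma> r"
  shows "\<exists>C\<ge>0. \<forall>v. smooth v \<longrightarrow> (\<forall>x. 0 \<le> v x) \<longrightarrow>
    (\<integral>\<^sup>+x. ennreal (v x) * indicator (frontier \<Omega> \<inter> cball p (r / 2)) x \<partial>surface_measure)
      \<le> ennreal (C * (LINT x|vol. v x + r * norm (grad v x)))"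
proof -
  define \<Gamma> where "\<Gamma> = frontier \<Omega> \<inter> cball p (r / 2)"
  have \<Gamma>c: "compact \<Gamma>"
    unfolding \<Gamma>_def using compact_frontier_bounded[OF bnd] by (intro compact_Int_closed) auto
  have \<Gamma>s: "\<Gamma> \<in> sets borel" by (rule borel_compact[OF \<Gamma>c])
  have pos: "0 < \<sigma>" "0 < r" "0 < c" using cone by (auto simp: inward_cone_def)
  define h where "h = min (\<sigma> / 2) (r / 2)"
  have h: "0 < h" "h < \<sigma>" "h \<le> r / 2" "h \<le> r" using pos by (auto simp: h_def)
  define k where "k = - (h *\<^sub>R \<nu>)"
  define K where "K = minkowski_const TYPE('a) * (4 / (c * h))"
  have K: "K > 0" using minkowski_const_pos[where 'a='a] pos h by (simp add: K_def)
  define M where "M = restrict_space surface_measure \<Gamma>"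
  have Mfin: "finite_measure M"
  proof
    have "emeasure M (space M) = hausdorff_outer (DIM('a) - 1) \<Gamma>"
      using \<Gamma>s by (simp add: M_def space_restrict_space emeasure_restrict_space emeasure_hausdorff)
    also have "\<dots> \<le> hausdorff_outer (DIM('a) - 1) (frontier \<Omega>)"
      unfolding hausdorff_outer_def by (intro SUP_mono) (auto intro!: hausdorff_pre_mono simp: \<Gamma>_def)
    finally show "emeasure M (space M) \<noteq> \<infinity>" using frontier_hausdorff_finite by auto
  qed
  have "(\<integral>\<^sup>+x. ennreal (v x) * indicator \<Gamma> x \<partial>surface_measure) \<le> ennreal (2 * K * (LINT x|vol. v x + r * norm (grad v x)))"
    if v: "smooth v" "\<And>x. 0 \<le> v x" for v
  proof -
    have [measurable]: "v \<in> borel_measurable borel" by (rule smooth_borel_measurable[OF v(1)])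
    have vM: "v \<in> borel_measurable M"
      unfolding M_def by (intro measurable_restrict_space1) (simp cong: measurable_cong_sets)
    note ld = line_density[OF v, of h]
    have [measurable]: "line_density v h \<in> borel_measurable borel" using ld h by simp
    obtain B where B: "\<And>y. \<bar>line_density v h y\<bar> \<le> B" using ld(3) h by auto
    have seg: "integrable lborel (\<lambda>s. indicator {a..b} s * line_density v h (x + s *\<^sub>R k))" for a b :: real and x
      by (rule integrable_segment[OF _ B]) measurable
    \<comment> \<open>The window is \<open>{-1..1}\<close> because a swept point \<open>x\<close> is
      \<open>q\<close> shifted by a fraction \<open>s1\<close> of \<open>k\<close>, so the segment
      starting at \<open>q\<close> occupies the parameters from \<open>- s1\<close> to
      \<open>1 - s1\<close>.\<close>
    define g where "g x = (LINT \<tau>|lborel. indicator {-1..1::real} \<tau> * line_density v h (x + \<tau> *\<^sub>R k))" for x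
    have gm [measurable]: "g \<in> borel_measurable borel"
      unfolding g_def by (rule lborel.borel_measurable_lebesgue_integral[where N = borel, simplified]) measurable
    have "(\<integral>\<^sup>+x. ennreal (v x) * indicator \<Gamma> x \<partial>surface_measure) = (\<integral>\<^sup>+x. ennreal (v x) \<partial>M)"
      using \<Gamma>s by (simp add: M_def nn_integral_restrict_space)
    also have "\<dots> \<le> ennreal K * (\<integral>\<^sup>+x. ennreal (g x) \<partial>lborel)"
    proof (rule nn_integral_le_of_superlevel_sets[OF _ vM sigma_finite_lborel])
      show "sigma_finite_measure M" using Mfin by (simp add: finite_measure_def)
      fix t :: real assume t: "t > 0"
      define E where "E = \<Gamma> \<inter> {q. t \<le> v q}"
      have "closed {q. t \<le> v q}"
        using smooth_continuous[OF v(1)] by (intro closed_Collect_le continuous_on_const) auto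
      then have Ec: "compact E" unfolding E_def using \<Gamma>c by auto
      have "{x \<in> space M. t \<le> v x} = E" using \<Gamma>s by (auto simp: M_def space_restrict_space E_def)
      then have "emeasure M {x \<in> space M. t \<le> v x} = hausdorff_outer (DIM('a) - 1) E"
        using \<Gamma>s borel_compact[OF Ec]
        by (simp add: M_def emeasure_restrict_space emeasure_hausdorff E_def)
      also have "\<dots> \<le> ennreal (K * measure lborel (sweep E (h *\<^sub>R \<nu>)))"
        unfolding K_def by (rule hausdorff_le_sweep[OF cone op Ec _ _ h(1,2)]) (use pos in \<open>auto simp: E_def \<Gamma>_def\<close>)
      also have "\<dots> = ennreal K * emeasure lborel (sweep E (h *\<^sub>R \<nu>))"
      proof -
        have "emeasure lborel (sweep E (h *\<^sub>R \<nu>)) < \<infinity>"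
          by (intro emeasure_bounded_finite compact_imp_bounded compact_sweep Ec)
        then show ?thesis using K by (subst emeasure_eq_ennreal_measure) (auto simp: ennreal_mult)
      qed
      also have "\<dots> \<le> ennreal K * emeasure lborel {x \<in> space lborel. t \<le> g x}"
      proof (intro mult_left_mono emeasure_mono subsetI)
        fix x assume "x \<in> sweep E (h *\<^sub>R \<nu>)"
        then obtain s1 where s1: "0 \<le> s1" "s1 \<le> 1" "x + s1 *\<^sub>R h *\<^sub>R \<nu> \<in> E" by (auto simp: sweep_def)
        define q where "q = x + s1 *\<^sub>R h *\<^sub>R \<nu>"
        have q: "q \<in> frontier \<Omega>" "q \<in> cball p (r / 2)" "t \<le> v q" using s1 by (auto simp: q_def E_def \<Gamma>_def)
        have "v q \<le> (LINT s|lborel. indicator {0..1} s * line_density v h (q + s *\<^sub>R k))"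
          unfolding k_def by (rule le_line_integral[OF v cone h(1-3) q(1,2)])
        also have "\<dots> = (LINT \<tau>|lborel. indicator {0..1} (\<tau> + s1) * line_density v h (q + (\<tau> + s1) *\<^sub>R k))"
          by (rule integral_lborel_shift[symmetric]) measurable
        also have "\<dots> = (LINT \<tau>|lborel. indicator {- s1..1 - s1} \<tau> * line_density v h (x + \<tau> *\<^sub>R k))"
        proof (rule Bochner_Integration.integral_cong[OF refl])
          fix \<tau>
          have "q + (\<tau> + s1) *\<^sub>R k = x + \<tau> *\<^sub>R k" by (simp add: q_def k_def algebra_simps)
          then show "indicator {0..1} (\<tau> + s1) * line_density v h (q + (\<tau> + s1) *\<^sub>R k)
            = indicator {- s1..1 - s1} \<tau> * line_density v h (x + \<tau> *\<^sub>R k)"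
            by (auto simp: indicator_def)
        qed
        also have "\<dots> \<le> g x"
          unfolding g_def
        proof (rule integral_mono[OF seg seg])
          show "indicator {- s1..1 - s1} \<tau> * line_density v h (x + \<tau> *\<^sub>R k) \<le> indicator {-1..1} \<tau> * line_density v h (x + \<tau> *\<^sub>R k)" for \<tau>
            using s1 ld(2) h by (auto simp: indicator_def)
        qed
        finally show "x \<in> {x \<in> space lborel. t \<le> g x}" using q by simp
      qed auto
      finally show "emeasure M {x \<in> space M. t \<le> v x} \<le> ennreal K * emeasure lborel {x \<in> space lborel. t \<le> g x}" .
    qed auto
    also have "(\<integral>\<^sup>+x. ennreal (g x) \<partial>lborel) = 2 * (\<integral>\<^sup>+x. ennreal (line_density v h x) \<partial>lborel)"
    proof -
      have "(\<integral>\<^sup>+x. ennreal (g x) \<partial>lborel)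
          = (\<integral>\<^sup>+x. \<integral>\<^sup>+\<tau>. ennreal (indicator {-1..1::real} \<tau> * line_density v h (x + \<tau> *\<^sub>R k)) \<partial>lborel \<partial>lborel)"
        unfolding g_def using ld(2) h by (intro nn_integral_cong nn_integral_eq_integral[symmetric] seg) auto
      also have "\<dots> = (\<integral>\<^sup>+x. \<integral>\<^sup>+\<tau>. indicator {-1..1::real} \<tau> * ennreal (line_density v h (x + \<tau> *\<^sub>R k)) \<partial>lborel \<partial>lborel)"
        by (intro nn_integral_cong) (auto simp: indicator_def)
      also have "\<dots> = (\<integral>\<^sup>+\<tau>. \<integral>\<^sup>+x. indicator {-1..1::real} \<tau> * ennreal (line_density v h (x + \<tau> *\<^sub>R k)) \<partial>lborel \<partial>lborel)"
        by (rule lborel_pair.Fubini') measurable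
      also have "\<dots> = (\<integral>\<^sup>+\<tau>. indicator {-1..1::real} \<tau> * (\<integral>\<^sup>+x. ennreal (line_density v h x) \<partial>lborel) \<partial>lborel)"
      proof (rule nn_integral_cong)
        fix \<tau> :: real
        have "(\<integral>\<^sup>+x. ennreal (line_density v h (x + \<tau> *\<^sub>R k)) \<partial>lborel) = (\<integral>\<^sup>+x. ennreal (line_density v h x) \<partial>lborel)"
          by (rule nn_integral_lborel_shift) measurable
        then show "(\<integral>\<^sup>+x. indicator {-1..1::real} \<tau> * ennreal (line_density v h (x + \<tau> *\<^sub>R k)) \<partial>lborel)
          = indicator {-1..1::real} \<tau> * (\<integral>\<^sup>+x. ennreal (line_density v h x) \<partial>lborel)"
          by (subst nn_integral_cmult) auto
      qed
      also have "\<dots> = 2 * (\<integral>\<^sup>+x. ennreal (line_density v h x) \<partial>lborel)"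
        by (subst nn_integral_multc) auto
      finally show ?thesis .
    qed
    also have "(\<integral>\<^sup>+x. ennreal (line_density v h x) \<partial>lborel) = ennreal (LINT x|vol. v x + h * norm (grad v x))"
      using ld(4) h by simp
    also have "\<dots> \<le> ennreal (LINT x|vol. v x + r * norm (grad v x))"
      using h v by (intro ennreal_leI integral_mono integrable_vol_continuous continuous_intros
          smooth_continuous continuous_grad mult_right_mono add_left_mono) auto
    finally have "(\<integral>\<^sup>+x. ennreal (v x) * indicator \<Gamma> x \<partial>surface_measure)
        \<le> ennreal K * (2 * ennreal (LINT x|vol. v x + r * norm (grad v x)))"
      by (simp add: mult_left_mono)
    also have "\<dots> = ennreal (2 * K * (LINT x|vol. v x + r * norm (grad v x)))"
    proof -
      have "0 \<le> (LINT x|vol. v x + r * norm (grad v x))" using v pos by (intro integral_nonneg_AE) auto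
      then show ?thesis using K by (simp add: ennreal_mult[symmetric] ennreal_numeral[symmetric] mult_ac del: ennreal_numeral)
    qed
    finally show ?thesis .
  qed
  then show ?thesis unfolding \<Gamma>_def using K by (intro exI[of _ "2 * K"]) auto
qed

text \<open>The local estimates for \<open>\<phi>\<^sup>2\<close> are summed over the cover, and the
  gradient of the square is split by the inequality of means. The constant depends on
  \<open>\<Omega>\<close>; it serves existence and uniqueness of traces, while the bounds uniform in
  \<open>\<Omega>\<close> rest on the translation estimate.\<close>

lemma trace_inequality:
  "\<exists>C\<ge>0. \<forall>\<phi>. smooth \<phi> \<longrightarrow> (LINT x|bd. (\<phi> x)\<^sup>2) \<le> C * ((LINT x|vol. (\<phi> x)\<^sup>2) + (LINT x|vol. (norm (grad \<phi> x))\<^sup>2))"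
proof -
  obtain P \<nu> c \<sigma> r where P: "finite P" "\<And>p. p \<in> P \<Longrightarrow> inward_cone \<Omega> p (\<nu> p) (c p) (\<sigma> p) (r p)"
    "frontier \<Omega> \<subseteq> (\<Union>p\<in>P. cball p (r p / 2))"
    using frontier_finite_cover by blast
  have "\<forall>p\<in>P. \<exists>C\<ge>0. \<forall>v. smooth v \<longrightarrow> (\<forall>x. 0 \<le> v x) \<longrightarrow>
    (\<integral>\<^sup>+x. ennreal (v x) * indicator (frontier \<Omega> \<inter> cball p (r p / 2)) x \<partial>surface_measure)
      \<le> ennreal (C * (LINT x|vol. v x + r p * norm (grad v x)))"
    using trace_inequality_local[OF P(2)] by blast
  from bchoice[OF this] obtain C where C0: "\<forall>p\<in>P. C p \<ge> 0 \<and> (\<forall>v. smooth v \<longrightarrow> (\<forall>x. 0 \<le> v x) \<longrightarrow>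
    (\<integral>\<^sup>+x. ennreal (v x) * indicator (frontier \<Omega> \<inter> cball p (r p / 2)) x \<partial>surface_measure)
      \<le> ennreal (C p * (LINT x|vol. v x + r p * norm (grad v x))))" ..
  have C: "p \<in> P \<Longrightarrow> C p \<ge> 0" "p \<in> P \<Longrightarrow> smooth v \<Longrightarrow> (\<And>x. 0 \<le> v x) \<Longrightarrow>
    (\<integral>\<^sup>+x. ennreal (v x) * indicator (frontier \<Omega> \<inter> cball p (r p / 2)) x \<partial>surface_measure)
      \<le> ennreal (C p * (LINT x|vol. v x + r p * norm (grad v x)))" for p v
    using C0 by auto
  define K where "K = (\<Sum>p\<in>P. C p * (1 + r p))"
  have r: "0 < r p" if "p \<in> P" for p using P(2)[OF that] by (simp add: inward_cone_def)
  have K: "0 \<le> K" unfolding K_def by (intro sum_nonneg mult_nonneg_nonneg C) (use r in \<open>auto simp: less_imp_le add_nonneg_nonneg\<close>)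
  have "(LINT x|bd. (\<phi> x)\<^sup>2) \<le> K * ((LINT x|vol. (\<phi> x)\<^sup>2) + (LINT x|vol. (norm (grad \<phi> x))\<^sup>2))" if \<phi>: "smooth \<phi>" for \<phi>
  proof -
    let ?v = "\<lambda>x. (\<phi> x)\<^sup>2"
    define I where "I = (LINT x|vol. (\<phi> x)\<^sup>2) + (LINT x|vol. (norm (grad \<phi> x))\<^sup>2)"
    have I: "0 \<le> I" by (simp add: I_def)
    have v: "smooth ?v" by (rule smooth_power2[OF \<phi>])
    have [measurable]: "\<phi> \<in> borel_measurable borel" by (rule smooth_borel_measurable[OF \<phi>])
    note cont = smooth_continuous[OF \<phi>] continuous_grad[OF \<phi>, of UNIV] continuous_grad[OF v, of UNIV]
    have le: "(LINT x|vol. ?v x + r p * norm (grad ?v x)) \<le> (1 + r p) * I" if p: "p \<in> P" for p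
    proof -
      have "(LINT x|vol. ?v x + r p * norm (grad ?v x)) \<le> (LINT x|vol. (1 + r p) * ((\<phi> x)\<^sup>2 + (norm (grad \<phi> x))\<^sup>2))"
      proof (rule integral_mono)
        fix x
        have "grad ?v x = (2 * \<phi> x) *\<^sub>R grad \<phi> x"
          using grad_mult[OF \<phi> \<phi>, of x] by (simp add: power2_eq_square scaleR_left_distrib[symmetric])
        then have "norm (grad ?v x) = 2 * \<bar>\<phi> x\<bar> * norm (grad \<phi> x)" by (simp add: abs_mult)
        also have "\<dots> \<le> (\<phi> x)\<^sup>2 + (norm (grad \<phi> x))\<^sup>2"
          using sum_squares_bound[of "\<bar>\<phi> x\<bar>" "norm (grad \<phi> x)"] by simp
        finally have "r p * norm (grad ?v x) \<le> r p * ((\<phi> x)\<^sup>2 + (norm (grad \<phi> x))\<^sup>2)"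
          using r[OF p] by (intro mult_left_mono) auto
        then show "?v x + r p * norm (grad ?v x) \<le> (1 + r p) * ((\<phi> x)\<^sup>2 + (norm (grad \<phi> x))\<^sup>2)"
          using zero_le_power2[of "norm (grad \<phi> x)"] by (simp only: distrib_right mult_1_left)
      qed (intro integrable_vol_continuous continuous_intros cont)+
      also have "\<dots> = (1 + r p) * I"
        unfolding I_def by (simp, subst Bochner_Integration.integral_add)
          (auto intro!: integrable_vol_continuous continuous_intros cont)
      finally show ?thesis .
    qed
    have "ennreal (LINT x|bd. (\<phi> x)\<^sup>2) = (\<integral>\<^sup>+x. ennreal (?v x) \<partial>bd)"
      by (rule nn_integral_eq_integral[symmetric]) (auto intro!: integrable_bd_continuous continuous_intros cont)
    also have "\<dots> = (\<integral>\<^sup>+x. ennreal (?v x) * indicator (frontier \<Omega>) x \<partial>surface_measure)"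
      by (simp add: boundary_measure_def nn_integral_restrict_space)
    also have "\<dots> \<le> (\<integral>\<^sup>+x. (\<Sum>p\<in>P. ennreal (?v x) * indicator (frontier \<Omega> \<inter> cball p (r p / 2)) x) \<partial>surface_measure)"
    proof (rule nn_integral_mono)
      fix x
      show "ennreal (?v x) * indicator (frontier \<Omega>) x \<le> (\<Sum>p\<in>P. ennreal (?v x) * indicator (frontier \<Omega> \<inter> cball p (r p / 2)) x)"
      proof (cases "x \<in> frontier \<Omega>")
        case True
        then obtain p where p: "p \<in> P" "x \<in> cball p (r p / 2)" using P(3) by blast
        have "ennreal (?v x) * indicator (frontier \<Omega>) x = ennreal (?v x) * indicator (frontier \<Omega> \<inter> cball p (r p / 2)) x"
          using True p by (simp add: indicator_def)
        also have "\<dots> \<le> (\<Sum>p\<in>P. ennreal (?v x) * indicator (frontier \<Omega> \<inter> cball p (r p / 2)) x)"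
          using p P(1) by (intro member_le_sum) auto
        finally show ?thesis .
      qed simp
    qed
    also have "\<dots> = (\<Sum>p\<in>P. \<integral>\<^sup>+x. ennreal (?v x) * indicator (frontier \<Omega> \<inter> cball p (r p / 2)) x \<partial>surface_measure)"
    proof (rule nn_integral_sum)
      fix p
      have [measurable]: "frontier \<Omega> \<inter> cball p (r p / 2) \<in> sets borel"
        by (intro sets.Int borel_closed) auto
      have "(\<lambda>x. ennreal (?v x) * indicator (frontier \<Omega> \<inter> cball p (r p / 2)) x) \<in> borel_measurable borel"
        by measurable
      then show "(\<lambda>x. ennreal (?v x) * indicator (frontier \<Omega> \<inter> cball p (r p / 2)) x) \<in> borel_measurable surface_measure"
        by (simp cong: measurable_cong_sets)
    qed
    also have "\<dots> \<le> (\<Sum>p\<in>P. ennreal (C p * ((1 + r p) * I)))"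
      using C le v by (intro sum_mono order_trans[OF C(2)] ennreal_leI mult_left_mono) auto
    also have "\<dots> = ennreal (\<Sum>p\<in>P. C p * ((1 + r p) * I))"
      using C(1) r I by (intro sum_ennreal) (auto intro!: mult_nonneg_nonneg simp: less_imp_le add_nonneg_nonneg)
    also have "(\<Sum>p\<in>P. C p * ((1 + r p) * I)) = K * I"
      by (simp add: K_def sum_distrib_right mult.assoc)
    finally show ?thesis using K I by (subst (asm) ennreal_le_iff) (auto simp: I_def)
  qed
  with K show ?thesis by blast
qed

end

section \<open>The Sobolev space of a Lipschitz domain\<close>

lemma integrable_compact_support:
  fixes k :: "'a::euclidean_space \<Rightarrow> 'b::euclidean_space"
  assumes c: "continuous_on UNIV k" and z: "\<And>x. norm x > R \<Longrightarrow> k x = 0"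
  shows "integrable lborel k"
proof -
  have "integrable lborel (\<lambda>x. indicator (cball 0 R) x *\<^sub>R k x)"
    by (rule borel_integrable_compact) (auto intro: continuous_on_subset[OF c])
  moreover have "(\<lambda>x. indicator (cball 0 R) x *\<^sub>R k x) = k"
    using z by (auto simp: fun_eq_iff indicator_def not_le)
  ultimately show ?thesis by simp
qed

text \<open>By translation invariance \<open>f (x + h) - f x\<close> has integral zero, and the
  uniform expansion compares it with \<open>grad f x \<bullet> h\<close>. Taking \<open>h\<close>
  parallel to the integral \<open>g\<close> of the gradient yields \<open>norm g \<le> e * m\<close>
  for every positive \<open>e\<close>.\<close>

lemma integral_grad_compact_support:
  fixes f :: "'a::euclidean_space \<Rightarrow> real"
  assumes f: "smooth f" and z: "\<And>x. norm x > R \<Longrightarrow> f x = 0"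
  shows "integrable lborel (grad f)" "(LINT x|lborel. grad f x) = 0"
proof -
  have [measurable]: "f \<in> borel_measurable borel" "grad f \<in> borel_measurable borel"
    using f by (auto intro: smooth_borel_measurable grad_borel_measurable)
  show gi: "integrable lborel (grad f)"
    by (rule integrable_compact_support[OF continuous_grad[OF f] grad_zero_outside[of R f, OF z]])
  have fi: "integrable lborel f"
    by (rule integrable_compact_support[OF smooth_continuous[OF f] z])
  define g where "g = (LINT x|lborel. grad f x)"
  define m where "m = measure lborel (cball (0::'a) (\<bar>R\<bar> + 1))"
  have fin: "emeasure lborel (cball (0::'a) (\<bar>R\<bar> + 1)) < \<infinity>"
    by (rule emeasure_bounded_finite) simp
  have bound: "norm g \<le> e * m" if e: "e > 0" for e
  proof (cases "g = 0")
    case False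
    obtain d where d: "d > 0" "\<And>x h. norm h < d \<Longrightarrow> \<bar>f (x + h) - f x - grad f x \<bullet> h\<bar> \<le> e * norm h"
      using smooth_taylor_uniform[OF f z e] by metis
    \<comment> \<open>Gives \<open>h\<close> the length \<open>min d 1 / 2\<close>: below
      \<open>d\<close> for the expansion, and at most 1 so that everything is supported in the ball
      of radius \<open>\<bar>R\<bar> + 1\<close>.\<close>
    define t where "t = min d 1 / (2 * norm g)"
    define h where "h = t *\<^sub>R g"
    have t: "t > 0" using d(1) False by (simp add: t_def)
    have nh: "norm h = min d 1 / 2" using False d(1) by (simp add: h_def t_def)
    have h: "norm h < d" "norm h \<le> 1" using d(1) by (auto simp: nh)
    have i: "integrable lborel (\<lambda>x. f (x + h) - f x - grad f x \<bullet> h)"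
      by (intro Bochner_Integration.integrable_diff integrable_lborel_shift fi integrable_inner_left gi)
    have "(LINT x|lborel. f (x + h) - f x - grad f x \<bullet> h) = - (g \<bullet> h)"
      using integrable_lborel_shift[OF fi, of h] fi gi integral_lborel_shift[of f h] by (simp add: g_def)
    then have "\<bar>g \<bullet> h\<bar> = \<bar>LINT x|lborel. f (x + h) - f x - grad f x \<bullet> h\<bar>" by simp
    also have "\<dots> \<le> (LINT x|lborel. indicator (cball (0::'a) (\<bar>R\<bar> + 1)) x * (e * norm h))"
    proof -
      have "norm (LINT x|lborel. f (x + h) - f x - grad f x \<bullet> h) \<le> (LINT x|lborel. indicator (cball (0::'a) (\<bar>R\<bar> + 1)) x * (e * norm h))"
      proof (rule Bochner_Integration.integral_norm_bound_integral[OF i])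
        show "integrable lborel (\<lambda>x::'a. indicator (cball 0 (\<bar>R\<bar> + 1)) x * (e * norm h))"
          using fin by (intro integrable_mult_left integrable_real_indicator) auto
        fix x
        show "norm (f (x + h) - f x - grad f x \<bullet> h) \<le> indicator (cball 0 (\<bar>R\<bar> + 1)) x * (e * norm h)"
        proof (cases "x \<in> cball 0 (\<bar>R\<bar> + 1)")
          case False
          then have "norm x > R" "norm (x + h) > R"
            using norm_triangle_ineq2[of x "- h"] h(2) by auto
          then show ?thesis using z grad_zero_outside[of R f x, OF z] e by simp
        qed (use d(2)[OF h(1)] in simp)
      qed
      then show ?thesis by simp
    qed
    also have "\<dots> = m * (e * norm h)" using fin by (simp add: m_def)
    finally have "norm g * norm h \<le> m * (e * norm h)"
      using t by (simp add: h_def dot_square_norm power2_eq_square abs_mult mult_ac)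
    then have "(norm g) * norm h \<le> (e * m) * norm h" by (simp add: mult_ac)
    moreover have "norm h > 0" using t False by (simp add: h_def)
    ultimately show ?thesis by (rule mult_right_le_imp_le)
  qed (use e in \<open>auto simp: m_def\<close>)
  have "((\<lambda>e. e * m) \<longlongrightarrow> 0 * m) (at_right 0)" by (intro tendsto_intros)
  then have "norm g \<le> 0 * m"
    by (rule tendsto_lowerbound) (auto simp: eventually_at_filter bound)
  then show "(LINT x|lborel. grad f x) = 0" by (simp add: g_def)
qed

lemma test_functionD:
  assumes "test_function \<Omega> \<phi>"
  shows "smooth \<phi>" "\<exists>R. \<forall>x. norm x > R \<longrightarrow> \<phi> x = 0" "x \<notin> \<Omega> \<Longrightarrow> \<phi> x = 0" "x \<notin> \<Omega> \<Longrightarrow> grad \<phi> x = 0"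
proof -
  define S where "S = closure {x. \<phi> x \<noteq> 0}"
  have S: "compact S" "S \<subseteq> \<Omega>" "smooth \<phi>" using assms by (auto simp: test_function_def S_def)
  have z: "\<phi> x = 0" if "x \<notin> S" for x using that closure_subset[of "{x. \<phi> x \<noteq> 0}"] by (auto simp: S_def)
  show "smooth \<phi>" by fact
  obtain B where "\<And>x. x \<in> S \<Longrightarrow> norm x \<le> B" using compact_imp_bounded[OF S(1)] by (auto simp: bounded_iff)
  then have "\<forall>x. norm x > B \<longrightarrow> \<phi> x = 0" using z by (meson not_less)
  then show "\<exists>R. \<forall>x. norm x > R \<longrightarrow> \<phi> x = 0" by blast
  show "\<phi> x = 0" if "x \<notin> \<Omega>" using that S z by auto
  show "grad \<phi> x = 0" if "x \<notin> \<Omega>"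
    by (rule grad_zero_on_open[of "- S" x \<phi> 0]) (use that S z compact_imp_closed[OF S(1)] in auto)
qed

context finite_boundary
begin

lemma set_integral_vol: "(LINT x:\<Omega>|lebesgue. f x) = (LINT x|vol. f x)"
  for f :: "'a \<Rightarrow> 'b::{banach, second_countable_topology}"
  by (simp add: set_lebesgue_integral_def integral_restrict_space)

lemma set_integral_bd: "(LINT x:frontier \<Omega>|surface_measure. f x) = (LINT x|bd. f x)"
  for f :: "'a \<Rightarrow> 'b::{banach, second_countable_topology}"
  by (simp add: set_lebesgue_integral_def integral_restrict_space boundary_measure_def)

lemma square_integrable_vol: "square_integrable lebesgue \<Omega> f \<longleftrightarrow> L2 vol f"
  unfolding square_integrable_def L2_def set_borel_measurable_def set_integrable_def
  by (simp add: borel_measurable_restrict_space_iff integrable_restrict_space)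

lemma square_integrable_bd: "square_integrable surface_measure (frontier \<Omega>) f \<longleftrightarrow> L2 bd f"
  unfolding square_integrable_def L2_def set_borel_measurable_def set_integrable_def boundary_measure_def
  by (simp add: borel_measurable_restrict_space_iff integrable_restrict_space)

lemma has_weak_gradient_vol: "has_weak_gradient \<Omega> u g \<longleftrightarrow>
    L2 vol g \<and> (\<forall>\<phi>. test_function \<Omega> \<phi> \<longrightarrow> (LINT x|vol. u x *\<^sub>R grad \<phi> x) = - (LINT x|vol. \<phi> x *\<^sub>R g x))"
  unfolding has_weak_gradient_def square_integrable_vol set_integral_vol ..

lemma integral_vol_lborel:
  fixes K :: "'a \<Rightarrow> 'b::{banach, second_countable_topology}"
  assumes [measurable]: "K \<in> borel_measurable borel"
  shows "(LINT x|vol. K x) = (LINT x|lborel. indicator \<Omega> x *\<^sub>R K x)"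
  by (simp add: integral_restrict_space, rule integral_completion) measurable

lemma integrable_vol_lborel:
  fixes K :: "'a \<Rightarrow> 'b::{banach, second_countable_topology}"
  assumes [measurable]: "K \<in> borel_measurable borel"
  shows "integrable vol K \<longleftrightarrow> integrable lborel (\<lambda>x. indicator \<Omega> x *\<^sub>R K x)"
  by (simp add: integrable_restrict_space, rule integrable_completion) measurable

text \<open>Convolutions and Fubini are carried out for \<open>lborel\<close>, so Lebesgue
  measurable functions are replaced, component by component, by Borel functions vanishing off
  \<open>\<Omega>\<close>.\<close>

lemma borel_representative:
  fixes f :: "'a \<Rightarrow> 'b::euclidean_space"
  assumes f: "f \<in> borel_measurable vol"
  obtains F where "F \<in> borel_measurable borel" "\<And>x. x \<notin> \<Omega> \<Longrightarrow> F x = 0" "AE x in vol. F x = f x"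
proof -
  define k where "k x = indicator \<Omega> x *\<^sub>R f x" for x
  have k: "k \<in> borel_measurable lebesgue"
    unfolding k_def using f by (simp add: borel_measurable_restrict_space_iff)
  have "\<forall>b\<in>Basis. \<exists>G. G \<in> borel_measurable lborel \<and> (AE x in lborel. k x \<bullet> b = G x)"
  proof
    fix b :: 'b
    have "(\<lambda>x. k x \<bullet> b) \<in> borel_measurable (completion lborel)" using k by measurable
    from completion_ex_borel_measurable_real[OF this]
    show "\<exists>G. G \<in> borel_measurable lborel \<and> (AE x in lborel. k x \<bullet> b = G x)" by blast
  qed
  from bchoice[OF this] obtain G where G: "\<forall>b\<in>Basis. G b \<in> borel_measurable lborel \<and> (AE x in lborel. k x \<bullet> b = G b x)" ..
  define F where "F x = indicator \<Omega> x *\<^sub>R (\<Sum>b\<in>Basis. G b x *\<^sub>R b)" for x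
  have G1: "G b \<in> borel_measurable borel" if "b \<in> Basis" for b using G that by simp
  have Fm: "F \<in> borel_measurable borel"
    unfolding F_def by (intro borel_measurable_scaleR borel_measurable_sum borel_measurable_indicator G1) auto
  have "AE x in lborel. \<forall>b\<in>Basis. k x \<bullet> b = G b x"
    using G by (subst AE_finite_all) auto
  then have "AE x in lebesgue. \<forall>b\<in>Basis. k x \<bullet> b = G b x" by (rule AE_completion)
  then have "AE x in vol. F x = f x"
    unfolding AE_restrict_space_iff[of \<Omega> lebesgue, simplified]
  proof eventually_elim
    case (elim x)
    show ?case
    proof
      assume x: "x \<in> \<Omega>"
      have "F x = (\<Sum>b\<in>Basis. (f x \<bullet> b) *\<^sub>R b)"
        unfolding F_def using elim x by (auto simp: k_def intro!: sum.cong)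
      then show "F x = f x" by (simp add: euclidean_representation)
    qed
  qed
  then show ?thesis using that[OF Fm] by (simp add: F_def)
qed

lemma L2_cong_AE:
  assumes "L2 M f" "g \<in> borel_measurable M" "AE x in M. g x = f x"
  shows "L2 M g"
proof -
  have [measurable]: "f \<in> borel_measurable M" "g \<in> borel_measurable M" using assms by (auto simp: L2_def)
  have "integrable M (\<lambda>x. (norm (g x))\<^sup>2) \<longleftrightarrow> integrable M (\<lambda>x. (norm (f x))\<^sup>2)"
    by (rule integrable_cong_AE) (use assms(3) in \<open>auto elim: eventually_mono\<close>)
  then show ?thesis using assms by (simp add: L2_def)
qed

lemma L2_vol_imp_lborel:
  fixes F :: "'a \<Rightarrow> 'b::euclidean_space"
  assumes F: "F \<in> borel_measurable borel" "\<And>x. x \<notin> \<Omega> \<Longrightarrow> F x = 0" and L: "L2 vol F"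
  shows "L2 lborel F" "integrable lborel F"
proof -
  have [measurable]: "F \<in> borel_measurable borel" by fact
  have "integrable vol (\<lambda>x. (norm (F x))\<^sup>2)" by (rule L2_integrable_sq[OF L])
  then have "integrable lborel (\<lambda>x. indicator \<Omega> x *\<^sub>R (norm (F x))\<^sup>2)"
    by (subst (asm) integrable_vol_lborel) auto
  moreover have "(\<lambda>x. indicator \<Omega> x *\<^sub>R (norm (F x))\<^sup>2) = (\<lambda>x. (norm (F x))\<^sup>2)"
    using F(2) by (auto simp: indicator_def fun_eq_iff)
  ultimately show "L2 lborel F" by (simp add: L2_def)
  have "integrable vol F" by (rule vol.L2_integrable[OF L])
  then have "integrable lborel (\<lambda>x. indicator \<Omega> x *\<^sub>R F x)"
    by (subst (asm) integrable_vol_lborel) auto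
  moreover have "(\<lambda>x. indicator \<Omega> x *\<^sub>R F x) = F"
    using F(2) by (auto simp: indicator_def fun_eq_iff)
  ultimately show "integrable lborel F" by simp
qed

text \<open>The product of \<open>\<phi>\<close> with a test function has compact support, so its
  gradient has integral zero.\<close>

lemma smooth_has_weak_gradient:
  assumes \<phi>: "smooth \<phi>"
  shows "has_weak_gradient \<Omega> \<phi> (grad \<phi>)"
  unfolding has_weak_gradient_vol
proof (intro conjI allI impI)
  show "L2 vol (grad \<phi>)" by (rule L2_vol_continuous[OF continuous_grad[OF \<phi>]])
  fix \<psi> assume \<psi>: "test_function \<Omega> \<psi>"
  note t = test_functionD[OF \<psi>]
  obtain R where R: "\<And>x. norm x > R \<Longrightarrow> \<psi> x = 0" using t(2) by blast
  have [measurable]: "\<phi> \<in> borel_measurable borel" "grad \<phi> \<in> borel_measurable borel"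
    "\<psi> \<in> borel_measurable borel" "grad \<psi> \<in> borel_measurable borel"
    using \<phi> t(1) by (auto intro: smooth_borel_measurable grad_borel_measurable)
  have s: "smooth (\<lambda>x. \<phi> x * \<psi> x)" by (rule smooth_mult[OF \<phi> t(1)])
  have c1: "integrable vol (\<lambda>x. \<phi> x *\<^sub>R grad \<psi> x)" and c2: "integrable vol (\<lambda>x. \<psi> x *\<^sub>R grad \<phi> x)"
    by (intro integrable_vol_continuous continuous_intros smooth_continuous continuous_grad \<phi> t(1))+
  have "(LINT x|vol. \<phi> x *\<^sub>R grad \<psi> x) + (LINT x|vol. \<psi> x *\<^sub>R grad \<phi> x) = (LINT x|vol. \<phi> x *\<^sub>R grad \<psi> x + \<psi> x *\<^sub>R grad \<phi> x)"
    using c1 c2 by simp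
  also have "\<dots> = (LINT x|lborel. indicator \<Omega> x *\<^sub>R (\<phi> x *\<^sub>R grad \<psi> x + \<psi> x *\<^sub>R grad \<phi> x))"
    by (rule integral_vol_lborel) measurable
  also have "\<dots> = (LINT x|lborel. grad (\<lambda>x. \<phi> x * \<psi> x) x)"
  proof (rule Bochner_Integration.integral_cong[OF refl])
    fix x
    show "indicator \<Omega> x *\<^sub>R (\<phi> x *\<^sub>R grad \<psi> x + \<psi> x *\<^sub>R grad \<phi> x) = grad (\<lambda>x. \<phi> x * \<psi> x) x"
      unfolding grad_mult[OF \<phi> t(1)] using t(3,4)[of x] by (cases "x \<in> \<Omega>") auto
  qed
  also have "\<dots> = 0"
    by (rule integral_grad_compact_support(2)[OF s, of R]) (use R in auto)
  finally show "(LINT x|vol. \<phi> x *\<^sub>R grad \<psi> x) = - (LINT x|vol. \<psi> x *\<^sub>R grad \<phi> x)"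
    by (simp add: eq_neg_iff_add_eq_0)
qed

end

section \<open>Density of functions smooth up to the boundary\<close>

context lipschitz_dom
begin

text \<open>Mollification with an inward shift. The average at \<open>x\<close> samples the ball of
  radius \<open>\<delta>\<close> about \<open>x - s *\<^sub>R \<nu>\<close>, whose part in
  \<open>cball p r\<close> lies in \<open>\<Omega>\<close> for every \<open>x\<close> in
  \<open>\<Omega>\<close>. Multiplied by \<open>\<zeta>\<close>, the kernel is therefore a test
  function, and the weak gradient identity applies. The clause about vanishing \<open>U\<close>
  serves the uniqueness of weak gradients.\<close>

lemma local_smoothing:
  fixes U :: "'a \<Rightarrow> real" and \<Gamma> :: "'a \<Rightarrow> 'a"
  assumes cone: "inward_cone \<Omega> p \<nu> c \<sigma> r"
    and Um: "U \<in> borel_measurable borel" "L2 vol U" "\<And>x. x \<notin> \<Omega> \<Longrightarrow> U x = 0"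
    and \<Gamma>m: "\<Gamma> \<in> borel_measurable borel" "L2 vol \<Gamma>" "\<And>x. x \<notin> \<Omega> \<Longrightarrow> \<Gamma> x = 0"
    and weak: "\<And>\<phi>. test_function \<Omega> \<phi> \<Longrightarrow> (LINT x|lborel. U x *\<^sub>R grad \<phi> x) = - (LINT x|lborel. \<phi> x *\<^sub>R \<Gamma> x)"
    and \<zeta>: "smooth \<zeta>" "\<And>x. norm (x - p) \<ge> r \<Longrightarrow> \<zeta> x = 0"
    and e: "e > 0"
  shows "\<exists>\<psi>. smooth \<psi> \<and> (LINT x|vol. (\<psi> x - \<zeta> x * U x)\<^sup>2) \<le> e \<and>
      (LINT x|vol. (norm (grad \<psi> x - (\<zeta> x *\<^sub>R \<Gamma> x + U x *\<^sub>R grad \<zeta> x)))\<^sup>2) \<le> e \<and>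
      ((AE x in lborel. U x = 0) \<longrightarrow> (\<forall>x. \<psi> x = 0))"
proof -
  have UL: "L2 lborel U" "integrable lborel U" using L2_vol_imp_lborel[OF Um(1,3,2)] by auto
  have \<Gamma>L: "L2 lborel \<Gamma>" "integrable lborel \<Gamma>" using L2_vol_imp_lborel[OF \<Gamma>m(1,3,2)] by auto
  have pos: "0 < \<sigma>" "0 < r" "0 < c" "c \<le> 1" "norm \<nu> \<le> 1" using cone by (auto simp: inward_cone_def)
  have \<zeta>z: "\<zeta> x = 0" if "norm x > norm p + r" for x
    using that norm_triangle_ineq2[of x p] by (intro \<zeta>(2)) simp
  obtain B1 where B1: "0 \<le> B1" "\<forall>x. norm (\<zeta> x) \<le> B1"
    using bounded_compact_support[OF smooth_continuous[OF \<zeta>(1)] \<zeta>z] by blast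
  obtain B2 where B2: "0 \<le> B2" "\<forall>x. norm (grad \<zeta> x) \<le> B2"
    using bounded_compact_support[OF continuous_grad[OF \<zeta>(1)] grad_zero_outside[of "norm p + r" \<zeta>, OF \<zeta>z]] by blast
  have [measurable]: "U \<in> borel_measurable borel" "\<Gamma> \<in> borel_measurable borel" by fact+
  have [measurable]: "\<zeta> \<in> borel_measurable borel" "grad \<zeta> \<in> borel_measurable borel"
    using \<zeta>(1) by (auto intro: smooth_borel_measurable grad_borel_measurable)
  define F where "F x = \<zeta> x * U x" for x
  define G where "G x = \<zeta> x *\<^sub>R \<Gamma> x + U x *\<^sub>R grad \<zeta> x" for x
  have [measurable]: "F \<in> borel_measurable borel" "G \<in> borel_measurable borel"
    unfolding F_def G_def by measurable
  have FL: "L2 lborel F"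
    by (rule L2_bound[OF L2_mult_left[OF UL(1), of B1]])
      (use B1 in \<open>auto simp: F_def abs_mult intro!: mult_right_mono\<close>)
  have FI: "integrable lborel F"
    using integrable_bounded_mult[OF UL(2), of \<zeta> B1] B1 by (simp add: F_def[abs_def])
  have g1: "L2 lborel (\<lambda>x. \<zeta> x *\<^sub>R \<Gamma> x)"
    by (rule L2_bound[OF L2_scaleR_left[OF \<Gamma>L(1), of B1]]) (use B1 in \<open>auto intro!: mult_right_mono\<close>)
  have g2: "L2 lborel (\<lambda>x. U x *\<^sub>R grad \<zeta> x)"
    by (rule L2_bound[OF L2_mult_left[OF UL(1), of B2]])
      (use B2 in \<open>auto simp: abs_mult mult.commute[of _ B2] mult.commute[of _ "norm (grad _ _)"] intro!: mult_right_mono\<close>)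
  have g1i: "integrable lborel (\<lambda>x. \<zeta> x *\<^sub>R \<Gamma> x)"
    using integrable_bounded_mult[OF \<Gamma>L(2), of \<zeta> B1] B1 by simp
  have g2i: "integrable lborel (\<lambda>x. U x *\<^sub>R grad \<zeta> x)"
    using integrable_mult_bounded[OF UL(2), of "grad \<zeta>" B2] B2 by simp
  have GL: "L2 lborel G" and GI: "integrable lborel G"
    unfolding G_def using g1 g2 g1i g2i by (auto intro: L2_add)
  obtain R0 where R0: "\<And>x. x \<in> \<Omega> \<Longrightarrow> norm x \<le> R0" using bnd by (auto simp: bounded_iff)
  have zz: "F x = 0" "G x = 0" if "norm x > R0" for x
    using R0[of x] that Um(3) \<Gamma>m(3) by (force simp: F_def G_def)+
  have tF: "translation_continuous F" and tG: "translation_continuous G"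
    using L2_translation_continuous[OF FL zz(1)] L2_translation_continuous[OF GL zz(2)] by auto
  obtain d1 where d1: "d1 > 0" "\<forall>h. norm h < d1 \<longrightarrow> translation_dist F h < e"
    using tF e unfolding translation_continuous_def by blast
  obtain d2 where d2: "d2 > 0" "\<forall>h. norm h < d2 \<longrightarrow> translation_dist G h < e"
    using tG e unfolding translation_continuous_def by blast
  define d where "d = min d1 d2"
  have d: "d > 0" "\<And>h. norm h < d \<Longrightarrow> translation_dist F h \<le> e" "\<And>h. norm h < d \<Longrightarrow> translation_dist G h \<le> e"
    using d1 d2 by (auto simp: d_def less_imp_le)
  \<comment> \<open>Keeps the shift below the height of the cone and, since
    \<open>\<delta> < s\<close>, within the range \<open>d\<close> in which translations move
    \<open>F\<close> and \<open>G\<close> little.\<close>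
  define s where "s = min (\<sigma> / 2) (d / 2)"
  have s: "s > 0" "s < \<sigma>" "2 * s \<le> d" using pos d(1) by (auto simp: s_def)
  define \<delta> where "\<delta> = c * s / 2"
  have \<delta>: "\<delta> > 0" "\<delta> < c * s" using pos s by (auto simp: \<delta>_def)
  define a where "a = s *\<^sub>R \<nu>"
  have "c * s \<le> 1 * s" using pos s by (intro mult_right_mono) auto
  moreover have "norm a \<le> s" using pos s by (simp add: a_def mult_left_le)
  ultimately have \<delta>a: "\<delta> + norm a \<le> d" using s \<delta> by linarith
  obtain \<eta> :: "'a \<Rightarrow> real" where \<eta>: "smooth \<eta>" "\<And>x. 0 \<le> \<eta> x" "\<And>x. norm x \<ge> \<delta> \<Longrightarrow> \<eta> x = 0"
    "integrable lborel \<eta>" "(LINT x|lborel. \<eta> x) = 1"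
    using exists_mollifier[OF \<delta>(1)] by blast
  have \<eta>z: "\<eta> x = 0" if "norm x > \<delta>" for x using \<eta>(3) that by simp
  obtain B where B: "0 \<le> B" "\<forall>x. norm (\<eta> x) \<le> B"
    using bounded_compact_support[OF smooth_continuous[OF \<eta>(1)] \<eta>z] by blast
  obtain B' where B': "0 \<le> B'" "\<forall>x. norm (grad \<eta> x) \<le> B'"
    using bounded_compact_support[OF continuous_grad[OF \<eta>(1)] grad_zero_outside[of \<delta> \<eta>, OF \<eta>z]] by blast
  have \<eta>B: "\<eta> x \<le> B" for x using B(2) \<eta>(2) by (metis real_norm_def abs_of_nonneg)
  have [measurable]: "\<eta> \<in> borel_measurable borel" "grad \<eta> \<in> borel_measurable borel"
    using \<eta>(1) by (auto intro: smooth_borel_measurable grad_borel_measurable)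
  define \<eta>' where "\<eta>' z = \<eta> (1 *\<^sub>R z + (- a))" for z
  have \<eta>': "smooth \<eta>'" unfolding \<eta>'_def by (rule smooth_affine[OF \<eta>(1)])
  have \<eta>'z: "\<eta>' z = 0" if "norm z > \<delta> + norm a" for z
    using that norm_triangle_ineq2[of z a] by (simp add: \<eta>'_def \<eta>z)
  define \<psi> where "\<psi> = convolution F \<eta>'"
  have \<psi>: "smooth \<psi>" unfolding \<psi>_def by (rule smooth_convolution[OF FI \<eta>' \<eta>'z])
  have \<psi>eq: "\<psi> x = (LINT y|lborel. \<eta> (x - a - y) *\<^sub>R F y)" for x
    unfolding \<psi>_def convolution_def \<eta>'_def by (simp add: algebra_simps)
  define H where "H x = (LINT y|lborel. \<eta> (x - a - y) *\<^sub>R G y)" for x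
  \<comment> \<open>The derivative falls on the kernel and is moved to \<open>U\<close> by testing
    with \<open>\<theta>\<close>; the product rule term with \<open>grad \<zeta>\<close> completes
    the integrand to \<open>G\<close>.\<close>
  have gradeq: "grad \<psi> x = H x" if x: "x \<in> \<Omega>" for x
  proof -
    define w where "w = x - a"
    define \<theta> where "\<theta> y = \<zeta> y * \<eta> ((-1) *\<^sub>R y + w)" for y
    have \<theta>s: "smooth \<theta>" unfolding \<theta>_def by (intro smooth_mult \<zeta> smooth_affine \<eta>)
    have "test_function \<Omega> \<theta>"
      unfolding test_function_def
    proof (intro conjI \<theta>s)
      \<comment> \<open>Two cutoffs confine the support: \<open>\<zeta>\<close> to the ball about
        \<open>p\<close>, and the kernel to the ball about the shifted point
        \<open>w\<close>.\<close>
      have "{y. \<theta> y \<noteq> 0} \<subseteq> cball p r \<inter> cball w \<delta>"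
        using \<zeta>(2) \<eta>(3) by (force simp: \<theta>_def dist_norm norm_minus_commute not_le[symmetric])
      then have sub: "closure {y. \<theta> y \<noteq> 0} \<subseteq> cball p r \<inter> cball w \<delta>"
        by (rule closure_minimal) auto
      then have "bounded (closure {y. \<theta> y \<noteq> 0})" by (meson bounded_cball bounded_subset le_inf_iff)
      then show "compact (closure {y. \<theta> y \<noteq> 0})" by (simp add: compact_eq_bounded_closed)
      have "y \<in> \<Omega>" if "y \<in> cball p r \<inter> cball w \<delta>" for y
      proof (rule inward_coneD[OF cone, of x y s])
        show "dist y (x - s *\<^sub>R \<nu>) < c * s" using that \<delta> by (simp add: w_def a_def dist_commute)
      qed (use x closure_subset that s in auto)
      then show "closure {y. \<theta> y \<noteq> 0} \<subseteq> \<Omega>" using sub by blast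
    qed
    then have eq: "(LINT y|lborel. U y *\<^sub>R grad \<theta> y) = - (LINT y|lborel. \<theta> y *\<^sub>R \<Gamma> y)" by (rule weak)
    have gt: "grad \<theta> y = \<eta> (w - y) *\<^sub>R grad \<zeta> y - \<zeta> y *\<^sub>R grad \<eta> (w - y)" for y
      unfolding \<theta>_def using grad_mult[OF \<zeta>(1) smooth_affine[OF \<eta>(1), of "-1" w], of y] grad_affine[OF \<eta>(1), of "-1" w y]
      by simp
    have i1: "integrable lborel (\<lambda>y. F y *\<^sub>R grad \<eta> (w - y))"
      by (rule integrable_mult_bounded[OF FI, of _ B']) (use B' in auto)
    have i2: "integrable lborel (\<lambda>y. \<eta> (w - y) *\<^sub>R (U y *\<^sub>R grad \<zeta> y))"
      by (rule integrable_bounded_mult[OF g2i, of _ B]) (use B in auto)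
    have i3: "integrable lborel (\<lambda>y. \<eta> (w - y) *\<^sub>R (\<zeta> y *\<^sub>R \<Gamma> y))"
      by (rule integrable_bounded_mult[OF g1i, of _ B]) (use B in auto)
    have "(LINT y|lborel. U y *\<^sub>R grad \<theta> y) = (LINT y|lborel. \<eta> (w - y) *\<^sub>R (U y *\<^sub>R grad \<zeta> y) - F y *\<^sub>R grad \<eta> (w - y))"
      by (rule Bochner_Integration.integral_cong[OF refl]) (simp add: gt F_def algebra_simps)
    also have "\<dots> = (LINT y|lborel. \<eta> (w - y) *\<^sub>R (U y *\<^sub>R grad \<zeta> y)) - (LINT y|lborel. F y *\<^sub>R grad \<eta> (w - y))"
      by (rule Bochner_Integration.integral_diff[OF i2 i1])
    finally have "- (LINT y|lborel. \<theta> y *\<^sub>R \<Gamma> y)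
        = (LINT y|lborel. \<eta> (w - y) *\<^sub>R (U y *\<^sub>R grad \<zeta> y)) - (LINT y|lborel. F y *\<^sub>R grad \<eta> (w - y))"
      unfolding eq .
    moreover have "b = a + t" if "- t = a - b" for a b t :: 'a
    proof -
      have "b = a - (a - b)" by simp
      also have "\<dots> = a + t" unfolding that[symmetric] by simp
      finally show ?thesis .
    qed
    ultimately have "(LINT y|lborel. F y *\<^sub>R grad \<eta> (w - y))
        = (LINT y|lborel. \<eta> (w - y) *\<^sub>R (U y *\<^sub>R grad \<zeta> y)) + (LINT y|lborel. \<theta> y *\<^sub>R \<Gamma> y)"
      by blast
    also have "(LINT y|lborel. \<theta> y *\<^sub>R \<Gamma> y) = (LINT y|lborel. \<eta> (w - y) *\<^sub>R (\<zeta> y *\<^sub>R \<Gamma> y))"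
      by (rule Bochner_Integration.integral_cong[OF refl]) (simp add: \<theta>_def mult.commute)
    also have "(LINT y|lborel. \<eta> (w - y) *\<^sub>R (U y *\<^sub>R grad \<zeta> y)) + (LINT y|lborel. \<eta> (w - y) *\<^sub>R (\<zeta> y *\<^sub>R \<Gamma> y))
        = (LINT y|lborel. \<eta> (w - y) *\<^sub>R (U y *\<^sub>R grad \<zeta> y) + \<eta> (w - y) *\<^sub>R (\<zeta> y *\<^sub>R \<Gamma> y))"
      by (rule Bochner_Integration.integral_add[OF i2 i3, symmetric])
    also have "\<dots> = H x"
      unfolding H_def w_def[symmetric]
      by (rule Bochner_Integration.integral_cong[OF refl]) (simp add: G_def scaleR_add_right add.commute)
    finally have "(LINT y|lborel. F y *\<^sub>R grad \<eta> (w - y)) = H x" .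
    moreover have "grad \<psi> x = (LINT y|lborel. F y *\<^sub>R grad \<eta>' (x - y))"
      unfolding \<psi>_def by (rule grad_convolution[OF FI \<eta>' \<eta>'z])
    moreover have "grad \<eta>' (x - y) = grad \<eta> (w - y)" for y
      unfolding \<eta>'_def grad_affine[OF \<eta>(1)] by (simp add: w_def algebra_simps)
    ultimately show ?thesis by simp
  qed
  have m1: "L2 lborel (\<lambda>x. \<psi> x - F x)" "(LINT x|lborel. (norm (\<psi> x - F x))\<^sup>2) \<le> e"
    using mollify_L2[OF FL FI \<eta>(4,2,5) \<eta>B \<eta>(3) \<delta>a d(2)] e by (auto simp: \<psi>eq)
  have m2: "L2 lborel (\<lambda>x. H x - G x)" "(LINT x|lborel. (norm (H x - G x))\<^sup>2) \<le> e"
    using mollify_L2[OF GL GI \<eta>(4,2,5) \<eta>B \<eta>(3) \<delta>a d(3)] e by (auto simp: H_def)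
  have [measurable]: "\<psi> \<in> borel_measurable borel" "grad \<psi> \<in> borel_measurable borel"
    using \<psi> by (auto intro: smooth_borel_measurable grad_borel_measurable)
  have "(LINT x|vol. (\<psi> x - \<zeta> x * U x)\<^sup>2) = (LINT x|lborel. indicator \<Omega> x *\<^sub>R (\<psi> x - F x)\<^sup>2)"
    unfolding F_def[symmetric] by (rule integral_vol_lborel) measurable
  also have "\<dots> \<le> (LINT x|lborel. (norm (\<psi> x - F x))\<^sup>2)"
    using integrable_mult_indicator[of \<Omega> lborel "\<lambda>x. (\<psi> x - F x)\<^sup>2"] L2_integrable_sq_real[OF m1(1)]
    by (intro integral_mono) (auto simp: indicator_def)
  finally have r1: "(LINT x|vol. (\<psi> x - \<zeta> x * U x)\<^sup>2) \<le> e" using m1(2) by simp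
  have "(LINT x|vol. (norm (grad \<psi> x - (\<zeta> x *\<^sub>R \<Gamma> x + U x *\<^sub>R grad \<zeta> x)))\<^sup>2)
      = (LINT x|lborel. indicator \<Omega> x *\<^sub>R (norm (grad \<psi> x - G x))\<^sup>2)"
    unfolding G_def[symmetric] by (rule integral_vol_lborel) measurable
  also have "\<dots> = (LINT x|lborel. indicator \<Omega> x *\<^sub>R (norm (H x - G x))\<^sup>2)"
    by (rule Bochner_Integration.integral_cong[OF refl]) (auto simp: indicator_def gradeq)
  also have "\<dots> \<le> (LINT x|lborel. (norm (H x - G x))\<^sup>2)"
    using integrable_mult_indicator[of \<Omega> lborel "\<lambda>x. (norm (H x - G x))\<^sup>2"] L2_integrable_sq[OF m2(1)]
    by (intro integral_mono) (auto simp: indicator_def)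
  finally have r2: "(LINT x|vol. (norm (grad \<psi> x - (\<zeta> x *\<^sub>R \<Gamma> x + U x *\<^sub>R grad \<zeta> x)))\<^sup>2) \<le> e"
    using m2(2) by simp
  have r3: "\<psi> x = 0" if "AE x in lborel. U x = 0" for x
  proof -
    have "(LINT y|lborel. \<eta> (x - a - y) *\<^sub>R F y) = (LINT y|(lborel::'a measure). 0)"
      by (rule integral_cong_AE) (use that in \<open>auto simp: F_def elim: eventually_mono\<close>)
    then show ?thesis by (simp add: \<psi>eq)
  qed
  show ?thesis using \<psi> r1 r2 r3 by blast
qed

end

lemma L2_bounded_mult:
  assumes "L2 M f" "g \<in> borel_measurable M" "\<And>x. x \<in> space M \<Longrightarrow> norm (g x) \<le> B * norm (f x)"
  shows "L2 M g"
proof (rule L2_bound[OF L2_scaleR_left[OF L2_norm[OF assms(1)], of B] assms(2)])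
  fix x assume "x \<in> space M"
  then have "norm (g x) \<le> B * norm (f x)" by (rule assms(3))
  also have "\<dots> \<le> \<bar>B\<bar> * norm (f x)" by (intro mult_right_mono) auto
  finally show "norm (g x) \<le> norm (B *\<^sub>R norm (f x))" by (simp add: abs_mult)
qed

lemma norm_sum_sq_le: "finite I \<Longrightarrow> (norm (\<Sum>i\<in>I. f i))\<^sup>2 \<le> real (card I) * (\<Sum>i\<in>I. (norm (f i))\<^sup>2)"
  using sum_squared_le_sum_of_squares[of "\<lambda>i. norm (f i)" I]
  by (simp add: mult.commute order_trans[OF power_mono[OF norm_sum]])

lemma L2_norm_sum_sq_le:
  fixes A :: "'a \<Rightarrow> 'b::euclidean_space"
  assumes P: "finite P" and A: "L2 M A" "\<And>x. x \<in> space M \<Longrightarrow> A x = (\<Sum>p\<in>P. k p x)"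
    and k: "\<And>p. p \<in> P \<Longrightarrow> L2 M (k p)" "\<And>p. p \<in> P \<Longrightarrow> (LINT x|M. (norm (k p x))\<^sup>2) \<le> e"
  shows "(LINT x|M. (norm (A x))\<^sup>2) \<le> real (card P) * real (card P) * e"
proof -
  have "(LINT x|M. (norm (A x))\<^sup>2) \<le> (LINT x|M. real (card P) * (\<Sum>p\<in>P. (norm (k p x))\<^sup>2))"
  proof (rule integral_mono)
    show "(norm (A x))\<^sup>2 \<le> real (card P) * (\<Sum>p\<in>P. (norm (k p x))\<^sup>2)" if "x \<in> space M" for x
      using A(2)[OF that] norm_sum_sq_le[OF P(1), of "\<lambda>p. k p x"] by simp
  qed (use A k in \<open>auto intro!: L2_integrable_sq\<close>)
  also have "\<dots> = real (card P) * (\<Sum>p\<in>P. LINT x|M. (norm (k p x))\<^sup>2)"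
    using k(1) by (simp add: Bochner_Integration.integral_sum L2_integrable_sq)
  also have "\<dots> \<le> real (card P) * (\<Sum>p\<in>P. e)"
    using k(2) by (intro mult_left_mono sum_mono) auto
  finally show ?thesis by simp
qed

lemma L2_AE_zero:
  assumes "L2 M f" "(LINT x|M. (norm (f x))\<^sup>2) = 0"
  shows "AE x in M. f x = 0"
proof -
  have "AE x in M. (norm (f x))\<^sup>2 = 0"
    using assms integral_nonneg_eq_0_iff_AE[OF L2_integrable_sq[OF assms(1)]] by auto
  then show ?thesis by eventually_elim simp
qed

lemma L2_lim_unique:
  assumes f: "L2_lim M f g" "L2_lim M f' g'" and "(\<lambda>n. LINT x|M. (norm (f n x - f' n x))\<^sup>2) \<longlonglongrightarrow> 0"
  shows "AE x in M. g x = g' x"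
proof -
  have L: "L2 M (f n)" "L2 M g" "L2 M (f' n)" "L2 M g'" for n using f by (auto simp: L2_lim_def)
  let ?I = "\<lambda>a b. LINT x|M. (norm (a x - b x))\<^sup>2"
  have sym: "?I a b = ?I b a" for a b :: "'a \<Rightarrow> 'b" by (simp add: norm_minus_commute)
  have "?I g g' \<le> 2 * ?I (f n) g + 2 * (2 * ?I (f n) (f' n) + 2 * ?I (f' n) g')" for n
  proof -
    have "?I g g' \<le> 2 * ?I g (f n) + 2 * ?I (f n) g'" by (rule L2_dist_triangle) (use L in auto)
    moreover have "?I (f n) g' \<le> 2 * ?I (f n) (f' n) + 2 * ?I (f' n) g'" by (rule L2_dist_triangle) (use L in auto)
    moreover have "p \<le> 2 * q' + 2 * (2 * s + 2 * t)" if "p \<le> 2 * q + 2 * r" "r \<le> 2 * s + 2 * t" "q = q'"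
      for p q q' r s t :: real using that by (simp add: algebra_simps)
    ultimately show ?thesis using sym[of g "f n"] by blast
  qed
  moreover have "(\<lambda>n. 2 * ?I (f n) g + 2 * (2 * ?I (f n) (f' n) + 2 * ?I (f' n) g')) \<longlonglongrightarrow> 2 * 0 + 2 * (2 * 0 + 2 * 0)"
    using assms by (intro tendsto_intros) (auto simp: L2_lim_def)
  ultimately have "?I g g' \<le> 2 * 0 + 2 * (2 * 0 + 2 * 0)"
    by (intro LIMSEQ_le_const) auto
  then have "?I g g' = 0" by (intro antisym) auto
  then have "AE x in M. g x - g' x = 0" by (intro L2_AE_zero L2_diff L)
  then show ?thesis by simp
qed

lemma L2_lim_cong_AE:
  assumes f: "L2_lim M f g" and h: "h \<in> borel_measurable M" "AE x in M. h x = g x"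
  shows "L2_lim M f h"
proof -
  have L: "L2 M (f n)" "L2 M g" for n using f by (auto simp: L2_lim_def)
  have Lh: "L2 M h"
  proof -
    have "integrable M (\<lambda>x. (norm (h x))\<^sup>2) \<longleftrightarrow> integrable M (\<lambda>x. (norm (g x))\<^sup>2)"
      by (rule integrable_cong_AE) (use h L in \<open>auto simp: L2_def elim: eventually_mono\<close>)
    then show ?thesis using L(2) h(1) by (simp add: L2_def)
  qed
  have "(LINT x|M. (norm (f n x - h x))\<^sup>2) = (LINT x|M. (norm (f n x - g x))\<^sup>2)" for n
    by (rule integral_cong_AE) (use h L L2_measurable[OF L(1)] L2_measurable[OF L(2)] in \<open>auto elim: eventually_mono\<close>)
  then show ?thesis using f L Lh by (simp add: L2_lim_def)
qed

context lipschitz_dom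
begin

lemma L2_vol_mult_continuous:
  fixes k :: "'a \<Rightarrow> real" and f :: "'a \<Rightarrow> 'b::euclidean_space"
  assumes k: "continuous_on UNIV k" and f: "L2 vol f"
  shows "L2 vol (\<lambda>x. k x *\<^sub>R f x)"
proof -
  obtain B where B: "B \<ge> 0" "\<And>x. x \<in> closure \<Omega> \<Longrightarrow> norm (k x) \<le> B"
    using continuous_bounded_on_closure[OF k] by blast
  have [measurable]: "k \<in> borel_measurable vol" "f \<in> borel_measurable vol"
    using k f by (auto intro: measurable_vol borel_measurable_continuous_onI L2_measurable)
  show ?thesis
    by (rule L2_bounded_mult[OF f, of _ B])
      (use B(2) closure_subset[of \<Omega>] in \<open>auto simp: space_restrict_space intro!: mult_right_mono\<close>)
qed

lemma L2_vol_mult_continuous':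
  fixes k :: "'a \<Rightarrow> 'b::euclidean_space" and f :: "'a \<Rightarrow> real"
  assumes k: "continuous_on UNIV k" and f: "L2 vol f"
  shows "L2 vol (\<lambda>x. f x *\<^sub>R k x)"
proof -
  obtain B where B: "B \<ge> 0" "\<And>x. x \<in> closure \<Omega> \<Longrightarrow> norm (k x) \<le> B"
    using continuous_bounded_on_closure[OF k] by blast
  have [measurable]: "k \<in> borel_measurable vol" "f \<in> borel_measurable vol"
    using k f by (auto intro: measurable_vol borel_measurable_continuous_onI L2_measurable)
  have "norm (f x *\<^sub>R k x) \<le> B * norm (f x)" if "x \<in> \<Omega>" for x
    using B(2)[of x] that closure_subset[of \<Omega>] by (auto simp: mult.commute[of B] intro!: mult_left_mono)
  then show ?thesis
    by (intro L2_bounded_mult[OF f, of _ B]) (auto simp: space_restrict_space)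
qed

text \<open>The local approximations are added over a partition of unity on the compact closure,
  interior and boundary points being treated alike by means of \<open>inward_cone\<close>.\<close>

lemma smooth_dense:
  assumes u: "L2 vol u" and g: "has_weak_gradient \<Omega> u g" and e: "e > 0"
  shows "\<exists>\<psi>. smooth \<psi> \<and> (LINT x|vol. (\<psi> x - u x)\<^sup>2) < e \<and> (LINT x|vol. (norm (grad \<psi> x - g x))\<^sup>2) < e \<and>
    ((AE x in vol. u x = 0) \<longrightarrow> (\<forall>x. \<psi> x = 0))"
proof -
  have gL: "L2 vol g" and gw: "\<And>\<phi>. test_function \<Omega> \<phi> \<Longrightarrow> (LINT x|vol. u x *\<^sub>R grad \<phi> x) = - (LINT x|vol. \<phi> x *\<^sub>R g x)"
    using g by (auto simp: has_weak_gradient_vol)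
  obtain U where U: "U \<in> borel_measurable borel" "\<And>x. x \<notin> \<Omega> \<Longrightarrow> U x = 0" "AE x in vol. U x = u x"
    using borel_representative[OF L2_measurable[OF u]] by blast
  obtain \<Gamma> where \<Gamma>: "\<Gamma> \<in> borel_measurable borel" "\<And>x. x \<notin> \<Omega> \<Longrightarrow> \<Gamma> x = 0" "AE x in vol. \<Gamma> x = g x"
    using borel_representative[OF L2_measurable[OF gL]] by blast
  have [measurable]: "U \<in> borel_measurable borel" "\<Gamma> \<in> borel_measurable borel" by fact+
  have Uv [measurable]: "U \<in> borel_measurable vol" and \<Gamma>v [measurable]: "\<Gamma> \<in> borel_measurable vol"
    using U(1) \<Gamma>(1) by (auto intro: measurable_vol)
  have [measurable]: "u \<in> borel_measurable vol" "g \<in> borel_measurable vol"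
    using u gL by (auto intro: L2_measurable)
  have UL: "L2 vol U" by (rule L2_cong_AE[OF u Uv U(3)])
  have \<Gamma>L: "L2 vol \<Gamma>" by (rule L2_cong_AE[OF gL \<Gamma>v \<Gamma>(3)])
  have weak: "(LINT x|lborel. U x *\<^sub>R grad \<phi> x) = - (LINT x|lborel. \<phi> x *\<^sub>R \<Gamma> x)" if \<phi>: "test_function \<Omega> \<phi>" for \<phi>
  proof -
    have s: "smooth \<phi>" using test_functionD(1)[OF \<phi>] .
    have [measurable]: "\<phi> \<in> borel_measurable borel" "grad \<phi> \<in> borel_measurable borel"
      using s by (auto intro: smooth_borel_measurable grad_borel_measurable)
    have [measurable]: "\<phi> \<in> borel_measurable vol" "grad \<phi> \<in> borel_measurable vol"
      by (rule measurable_vol, measurable)+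
    have "(LINT x|lborel. U x *\<^sub>R grad \<phi> x) = (LINT x|lborel. indicator \<Omega> x *\<^sub>R (U x *\<^sub>R grad \<phi> x))"
      by (rule Bochner_Integration.integral_cong[OF refl]) (use U(2) in \<open>auto simp: indicator_def\<close>)
    also have "\<dots> = (LINT x|vol. U x *\<^sub>R grad \<phi> x)" by (rule integral_vol_lborel[symmetric]) measurable
    also have "\<dots> = (LINT x|vol. u x *\<^sub>R grad \<phi> x)"
      by (rule integral_cong_AE) (use U(3) in \<open>auto elim: eventually_mono\<close>)
    also have "\<dots> = - (LINT x|vol. \<phi> x *\<^sub>R g x)" by (rule gw[OF \<phi>])
    also have "(LINT x|vol. \<phi> x *\<^sub>R g x) = (LINT x|vol. \<phi> x *\<^sub>R \<Gamma> x)"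
      by (rule integral_cong_AE) (use \<Gamma>(3) in \<open>auto elim: eventually_mono\<close>)
    also have "\<dots> = (LINT x|lborel. indicator \<Omega> x *\<^sub>R (\<phi> x *\<^sub>R \<Gamma> x))" by (rule integral_vol_lborel) measurable
    also have "\<dots> = (LINT x|lborel. \<phi> x *\<^sub>R \<Gamma> x)"
      by (rule Bochner_Integration.integral_cong[OF refl]) (use \<Gamma>(2) in \<open>auto simp: indicator_def\<close>)
    finally show ?thesis .
  qed
  have "\<forall>p\<in>closure \<Omega>. \<exists>r. 0 < r \<and> (\<exists>\<nu> c \<sigma>. inward_cone \<Omega> p \<nu> c \<sigma> r)"
  proof
    fix p assume "p \<in> closure \<Omega>"
    then obtain \<nu> c \<sigma> r where "inward_cone \<Omega> p \<nu> c \<sigma> r" using exists_cone by blast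
    then show "\<exists>r. 0 < r \<and> (\<exists>\<nu> c \<sigma>. inward_cone \<Omega> p \<nu> c \<sigma> r)"
      by (intro exI[of _ r]) (auto simp: inward_cone_def)
  qed
  from bchoice[OF this] obtain r where r: "\<forall>p\<in>closure \<Omega>. 0 < r p \<and> (\<exists>\<nu> c \<sigma>. inward_cone \<Omega> p \<nu> c \<sigma> (r p))" ..
  have "compact (closure \<Omega>)" using bnd by (simp add: compact_closure)
  from exists_partition_of_unity[OF this, of r] r
  obtain P \<zeta> where P: "finite P" "P \<subseteq> closure \<Omega>"
    "\<forall>p\<in>P. smooth (\<zeta> p) \<and> (\<forall>x. norm (x - p) \<ge> r p \<longrightarrow> \<zeta> p x = 0)" "\<forall>x\<in>closure \<Omega>. (\<Sum>p\<in>P. \<zeta> p x) = 1"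
    by blast
  define N where "N = real (card P)"
  have N: "N \<ge> 0" by (simp add: N_def)
  \<comment> \<open>The square of a sum of \<open>N\<close> terms costs a factor \<open>N\<close>,
    and summing the \<open>N\<close> integrals another one.\<close>
  define e' where "e' = e / (2 * (N * N + 1))"
  have e': "e' > 0" using e N by (simp add: e'_def add_nonneg_pos)
  have "\<forall>p\<in>P. \<exists>\<psi>. smooth \<psi> \<and> (LINT x|vol. (\<psi> x - \<zeta> p x * U x)\<^sup>2) \<le> e' \<and>
      (LINT x|vol. (norm (grad \<psi> x - (\<zeta> p x *\<^sub>R \<Gamma> x + U x *\<^sub>R grad (\<zeta> p) x)))\<^sup>2) \<le> e' \<and>
      ((AE x in lborel. U x = 0) \<longrightarrow> (\<forall>x. \<psi> x = 0))"
  proof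
    fix p assume p: "p \<in> P"
    then obtain \<nu> c \<sigma> where cone: "inward_cone \<Omega> p \<nu> c \<sigma> (r p)" using r P(2) by blast
    show "\<exists>\<psi>. smooth \<psi> \<and> (LINT x|vol. (\<psi> x - \<zeta> p x * U x)\<^sup>2) \<le> e' \<and>
      (LINT x|vol. (norm (grad \<psi> x - (\<zeta> p x *\<^sub>R \<Gamma> x + U x *\<^sub>R grad (\<zeta> p) x)))\<^sup>2) \<le> e' \<and>
      ((AE x in lborel. U x = 0) \<longrightarrow> (\<forall>x. \<psi> x = 0))"
      by (rule local_smoothing[OF cone U(1) UL U(2) \<Gamma>(1) \<Gamma>L \<Gamma>(2) weak _ _ e']) (use P(3) p in auto)
  qed
  from bchoice[OF this] obtain \<psi> where \<psi>: "\<forall>p\<in>P. smooth (\<psi> p) \<and> (LINT x|vol. (\<psi> p x - \<zeta> p x * U x)\<^sup>2) \<le> e' \<and>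
      (LINT x|vol. (norm (grad (\<psi> p) x - (\<zeta> p x *\<^sub>R \<Gamma> x + U x *\<^sub>R grad (\<zeta> p) x)))\<^sup>2) \<le> e' \<and>
      ((AE x in lborel. U x = 0) \<longrightarrow> (\<forall>x. \<psi> p x = 0))" ..
  define \<Psi> where "\<Psi> x = (\<Sum>p\<in>P. \<psi> p x)" for x
  have \<Psi>: "smooth \<Psi>" unfolding \<Psi>_def using \<psi> by (intro smooth_sum) auto
  have grad\<Psi>: "grad \<Psi> x = (\<Sum>p\<in>P. grad (\<psi> p) x)" for x
    unfolding \<Psi>_def using \<psi> by (intro grad_sum) auto
  have sum1: "(\<Sum>p\<in>P. \<zeta> p x) = 1" if "x \<in> \<Omega>" for x using P(4) that closure_subset by blast
  \<comment> \<open>The functions \<open>\<zeta> p\<close> sum to 1 on the open set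
    \<open>\<Omega>\<close>, so their gradients cancel; this removes the terms
    \<open>U x *\<^sub>R grad (\<zeta> p) x\<close> from the sum of the local gradients.\<close>
  have sum0: "(\<Sum>p\<in>P. grad (\<zeta> p) x) = 0" if "x \<in> \<Omega>" for x
  proof -
    have "(\<Sum>p\<in>P. grad (\<zeta> p) x) = grad (\<lambda>x. \<Sum>p\<in>P. \<zeta> p x) x" using P(3) by (intro grad_sum[symmetric]) auto
    also have "\<dots> = 0" by (rule grad_zero_on_open[OF op that sum1])
    finally show ?thesis .
  qed
  have L1: "L2 vol (\<lambda>x. \<psi> p x - \<zeta> p x * U x)" if "p \<in> P" for p
  proof -
    have "L2 vol (\<lambda>x. \<zeta> p x *\<^sub>R U x)"
      using P(3) that UL by (intro L2_vol_mult_continuous) (auto intro: smooth_continuous)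
    then have "L2 vol (\<lambda>x. \<zeta> p x * U x)" by simp
    then show ?thesis using \<psi> that by (intro L2_diff[OF L2_vol_continuous]) (auto intro: smooth_continuous)
  qed
  have L2: "L2 vol (\<lambda>x. grad (\<psi> p) x - (\<zeta> p x *\<^sub>R \<Gamma> x + U x *\<^sub>R grad (\<zeta> p) x))" if "p \<in> P" for p
    using \<psi> P(3) that UL \<Gamma>L
    by (intro L2_diff[OF L2_vol_continuous L2_add[OF L2_vol_mult_continuous L2_vol_mult_continuous']])
      (auto intro: smooth_continuous continuous_grad)
  have small: "N * N * e' < e"
  proof -
    have "N * N * e' < (2 * (N * N + 1)) * e'"
      using e' N by (intro mult_strict_right_mono) (auto simp: add_nonneg_pos)
    also have "\<dots> = e" using N by (simp add: e'_def field_simps add_nonneg_eq_0_iff)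
    finally show ?thesis .
  qed
  have r1: "(LINT x|vol. (norm (\<Psi> x - U x))\<^sup>2) \<le> N * N * e'"
    unfolding N_def
  proof (rule L2_norm_sum_sq_le[OF P(1), where k = "\<lambda>p x. \<psi> p x - \<zeta> p x * U x"])
    show "L2 vol (\<lambda>x. \<Psi> x - U x)" by (intro L2_diff UL L2_vol_continuous smooth_continuous \<Psi>)
    show "\<Psi> x - U x = (\<Sum>p\<in>P. \<psi> p x - \<zeta> p x * U x)" if "x \<in> space vol" for x
      using sum1[of x] that by (simp add: \<Psi>_def space_restrict_space sum_subtractf sum_distrib_right[symmetric])
  qed (use L1 \<psi> in auto)
  have r2: "(LINT x|vol. (norm (grad \<Psi> x - \<Gamma> x))\<^sup>2) \<le> N * N * e'"
    unfolding N_def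
  proof (rule L2_norm_sum_sq_le[OF P(1), where k = "\<lambda>p x. grad (\<psi> p) x - (\<zeta> p x *\<^sub>R \<Gamma> x + U x *\<^sub>R grad (\<zeta> p) x)"])
    show "L2 vol (\<lambda>x. grad \<Psi> x - \<Gamma> x)" by (intro L2_diff \<Gamma>L L2_vol_continuous continuous_grad \<Psi>)
    show "grad \<Psi> x - \<Gamma> x = (\<Sum>p\<in>P. grad (\<psi> p) x - (\<zeta> p x *\<^sub>R \<Gamma> x + U x *\<^sub>R grad (\<zeta> p) x))" if "x \<in> space vol" for x
      using sum1[of x] sum0[of x] that
      by (simp add: grad\<Psi> space_restrict_space sum_subtractf sum.distrib scaleR_left.sum[symmetric] scaleR_right.sum[symmetric])
  qed (use L2 \<psi> in auto)
  have \<Psi>v [measurable]: "\<Psi> \<in> borel_measurable vol" "grad \<Psi> \<in> borel_measurable vol"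
    using \<Psi> by (auto intro: measurable_vol smooth_borel_measurable grad_borel_measurable)
  have "(LINT x|vol. (\<Psi> x - u x)\<^sup>2) = (LINT x|vol. (norm (\<Psi> x - U x))\<^sup>2)"
    by (rule integral_cong_AE) (use U(3) in \<open>auto elim: eventually_mono\<close>)
  moreover have "(LINT x|vol. (norm (grad \<Psi> x - g x))\<^sup>2) = (LINT x|vol. (norm (grad \<Psi> x - \<Gamma> x))\<^sup>2)"
    by (rule integral_cong_AE) (use \<Gamma>(3) in \<open>auto elim: eventually_mono\<close>)
  moreover have "\<Psi> x = 0" if "AE x in vol. u x = 0" for x
  proof -
    have "AE x in vol. U x = 0" using that U(3) by eventually_elim simp
    then have "AE x in lebesgue. x \<in> \<Omega> \<longrightarrow> U x = 0" by (simp add: AE_restrict_space_iff)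
    then have "AE x in lebesgue. U x = 0" by eventually_elim (use U(2) in blast)
    then have "AE x in lborel. U x = 0" by (subst (asm) AE_completion_iff) auto
    then show ?thesis using \<psi> by (simp add: \<Psi>_def)
  qed
  ultimately show ?thesis using \<Psi> r1 r2 small by (intro exI[of _ \<Psi>]) auto
qed

text \<open>The difference of two weak gradients is a weak gradient of the zero function. The
  approximants of the zero function are identically zero, so that difference has arbitrarily small
  norm.\<close>

lemma weak_gradient_unique:
  assumes u: "L2 vol u" and g: "has_weak_gradient \<Omega> u g" "has_weak_gradient \<Omega> u g'"
  shows "AE x in vol. g x = g' x"
proof -
  have L: "L2 vol g" "L2 vol g'" using g by (auto simp: has_weak_gradient_vol)
  define k where "k x = g x - g' x" for x
  have kL: "L2 vol k" unfolding k_def by (rule L2_diff[OF L])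
  have "has_weak_gradient \<Omega> (\<lambda>_. 0) k"
    unfolding has_weak_gradient_vol
  proof (intro conjI kL allI impI)
    fix \<phi> assume \<phi>: "test_function \<Omega> \<phi>"
    have "(LINT x|vol. \<phi> x *\<^sub>R g x) = (LINT x|vol. \<phi> x *\<^sub>R g' x)"
      using g \<phi> unfolding has_weak_gradient_vol by (metis neg_equal_iff_equal)
    moreover have "L2 vol \<phi>" by (intro L2_vol_continuous smooth_continuous test_functionD(1)[OF \<phi>])
    ultimately show "(LINT x|vol. 0 *\<^sub>R grad \<phi> x) = - (LINT x|vol. \<phi> x *\<^sub>R k x)"
      using L by (simp add: k_def scaleR_diff_right L2_integrable_scaleR)
  qed
  moreover have "L2 vol (\<lambda>_. 0 :: real)" by (rule vol.L2_const)
  ultimately have e: "(LINT x|vol. (norm (k x))\<^sup>2) < e" if epos: "e > 0" for e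
  proof -
    obtain \<psi> where "smooth \<psi>" "(LINT x|vol. (norm (grad \<psi> x - k x))\<^sup>2) < e" "\<forall>x. \<psi> x = 0"
      using smooth_dense[OF \<open>L2 vol (\<lambda>_. 0 :: real)\<close> \<open>has_weak_gradient \<Omega> (\<lambda>_. 0) k\<close> epos] by auto
    moreover from this(3) have "\<psi> = (\<lambda>_. 0)" by auto
    ultimately show ?thesis by simp
  qed
  have "(LINT x|vol. (norm (k x))\<^sup>2) \<le> 0"
  proof (rule field_le_epsilon)
    fix d :: real assume "0 < d"
    then have "(LINT x|vol. (norm (k x))\<^sup>2) < d" by (rule e)
    then show "(LINT x|vol. (norm (k x))\<^sup>2) \<le> 0 + d" by linarith
  qed
  then have "(LINT x|vol. (norm (k x))\<^sup>2) = 0" by (intro antisym) auto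
  from L2_AE_zero[OF kL this] show ?thesis by (simp add: k_def)
qed

subsection \<open>Traces\<close>

text \<open>The approximation behind \<open>is_trace\<close>, with gradient \<open>g\<close> and
  trace \<open>t\<close> as parameters, so that limits can be constructed before they are related to
  the choices made by \<open>weak_grad\<close> and \<open>boundary_trace\<close>.\<close>

definition H1_lim :: "(nat \<Rightarrow> 'a \<Rightarrow> real) \<Rightarrow> ('a \<Rightarrow> real) \<Rightarrow> ('a \<Rightarrow> 'a) \<Rightarrow> ('a \<Rightarrow> real) \<Rightarrow> bool" where
  "H1_lim \<phi> u g t \<longleftrightarrow> (\<forall>n. smooth (\<phi> n)) \<and> L2_lim vol \<phi> u \<and> L2_lim vol (\<lambda>n. grad (\<phi> n)) g \<and> L2_lim bd \<phi> t"

lemma H1_iff: "u \<in> H1 \<Omega> \<longleftrightarrow> L2 vol u \<and> (\<exists>g. has_weak_gradient \<Omega> u g)"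
  by (simp add: H1_def square_integrable_vol)

lemma H1_weak_grad:
  assumes "u \<in> H1 \<Omega>"
  shows "L2 vol u" "has_weak_gradient \<Omega> u (weak_grad \<Omega> u)" "L2 vol (weak_grad \<Omega> u)"
proof -
  show "L2 vol u" using assms by (simp add: H1_iff)
  show *: "has_weak_gradient \<Omega> u (weak_grad \<Omega> u)"
    using assms unfolding H1_iff weak_grad_def by (metis someI_ex)
  show "L2 vol (weak_grad \<Omega> u)" using * by (simp add: has_weak_gradient_vol)
qed

text \<open>The trace inequality for differences makes the boundary values of the approximants a
  Cauchy sequence; completeness supplies the trace.\<close>

lemma exists_H1_lim:
  assumes u: "L2 vol u" and g: "has_weak_gradient \<Omega> u g"
  shows "\<exists>\<phi> t. H1_lim \<phi> u g t"
proof -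
  have gL: "L2 vol g" using g by (simp add: has_weak_gradient_vol)
  have "\<forall>n::nat. \<exists>\<psi>. smooth \<psi> \<and> (LINT x|vol. (\<psi> x - u x)\<^sup>2) < inverse (real (Suc n)) \<and>
      (LINT x|vol. (norm (grad \<psi> x - g x))\<^sup>2) < inverse (real (Suc n))"
  proof
    fix n :: nat
    have "inverse (real (Suc n)) > 0" by simp
    from smooth_dense[OF u g this]
    show "\<exists>\<psi>. smooth \<psi> \<and> (LINT x|vol. (\<psi> x - u x)\<^sup>2) < inverse (real (Suc n)) \<and>
      (LINT x|vol. (norm (grad \<psi> x - g x))\<^sup>2) < inverse (real (Suc n))" by blast
  qed
  from choice[OF this] obtain \<phi> where \<phi>: "\<forall>n. smooth (\<phi> n) \<and> (LINT x|vol. (\<phi> n x - u x)\<^sup>2) < inverse (real (Suc n)) \<and>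
      (LINT x|vol. (norm (grad (\<phi> n) x - g x))\<^sup>2) < inverse (real (Suc n))" ..
  have s: "smooth (\<phi> n)" for n using \<phi> by simp
  have Lv: "L2 vol (\<phi> n)" "L2 vol (grad (\<phi> n))" "L2 bd (\<phi> n)" for n
    using s by (auto intro: L2_vol_continuous L2_bd_continuous smooth_continuous continuous_grad)
  have l1: "(\<lambda>n. LINT x|vol. (norm (\<phi> n x - u x))\<^sup>2) \<longlonglongrightarrow> 0"
    by (rule tendsto_sandwich[OF _ _ tendsto_const LIMSEQ_inverse_real_of_nat])
      (use \<phi> in \<open>auto simp: less_imp_le\<close>)
  have l2: "(\<lambda>n. LINT x|vol. (norm (grad (\<phi> n) x - g x))\<^sup>2) \<longlonglongrightarrow> 0"
    by (rule tendsto_sandwich[OF _ _ tendsto_const LIMSEQ_inverse_real_of_nat])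
      (use \<phi> in \<open>auto simp: less_imp_le\<close>)
  obtain C where C: "C \<ge> 0" "\<And>\<phi>. smooth \<phi> \<Longrightarrow> (LINT x|bd. (\<phi> x)\<^sup>2) \<le> C * ((LINT x|vol. (\<phi> x)\<^sup>2) + (LINT x|vol. (norm (grad \<phi> x))\<^sup>2))"
    using trace_inequality by blast
  have "\<exists>t. L2_lim bd \<phi> t"
  proof (rule bd.L2_complete[OF Lv(3)])
    fix e :: real assume "e > 0"
    \<comment> \<open>Each of the two squared distances between approximants is at most
      \<open>4 * e'\<close>, whence the factor 8.\<close>
    define e' where "e' = e / (8 * (C + 1))"
    have e': "e' > 0" using \<open>e > 0\<close> C(1) by (simp add: e'_def)
    obtain N1 where N1: "\<And>n. n \<ge> N1 \<Longrightarrow> (LINT x|vol. (norm (\<phi> n x - u x))\<^sup>2) < e'"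
      using order_tendstoD(2)[OF l1 e'] by (auto simp: eventually_sequentially)
    obtain N2 where N2: "\<And>n. n \<ge> N2 \<Longrightarrow> (LINT x|vol. (norm (grad (\<phi> n) x - g x))\<^sup>2) < e'"
      using order_tendstoD(2)[OF l2 e'] by (auto simp: eventually_sequentially)
    have "(LINT x|bd. (norm (\<phi> m x - \<phi> n x))\<^sup>2) < e" if mn: "m \<ge> max N1 N2" "n \<ge> max N1 N2" for m n
    proof -
      have "(LINT x|vol. (norm (\<phi> m x - \<phi> n x))\<^sup>2)
          \<le> 2 * (LINT x|vol. (norm (\<phi> m x - u x))\<^sup>2) + 2 * (LINT x|vol. (norm (u x - \<phi> n x))\<^sup>2)"
        by (rule L2_dist_triangle[OF Lv(1) u Lv(1)])
      then have a: "(LINT x|vol. (\<phi> m x - \<phi> n x)\<^sup>2) \<le> 4 * e'"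
        using N1[of m] N1[of n] mn by (simp add: power2_commute[of "u _"])
      have "(LINT x|vol. (norm (grad (\<phi> m) x - grad (\<phi> n) x))\<^sup>2)
          \<le> 2 * (LINT x|vol. (norm (grad (\<phi> m) x - g x))\<^sup>2) + 2 * (LINT x|vol. (norm (g x - grad (\<phi> n) x))\<^sup>2)"
        by (rule L2_dist_triangle[OF Lv(2) gL Lv(2)])
      then have b: "(LINT x|vol. (norm (grad (\<phi> m) x - grad (\<phi> n) x))\<^sup>2) \<le> 4 * e'"
        using N2[of m] N2[of n] mn by (simp add: norm_minus_commute[of "g _"])
      have "(LINT x|bd. (\<phi> m x - \<phi> n x)\<^sup>2)
          \<le> C * ((LINT x|vol. (\<phi> m x - \<phi> n x)\<^sup>2) + (LINT x|vol. (norm (grad (\<lambda>x. \<phi> m x - \<phi> n x) x))\<^sup>2))"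
        by (rule C(2)[OF smooth_diff[OF s s]])
      also have "\<dots> \<le> C * (4 * e' + 4 * e')"
        using a b C(1) by (intro mult_left_mono add_mono) (auto simp: grad_diff[OF s s])
      also have "\<dots> < (C + 1) * (8 * e')" using e' by (simp add: algebra_simps)
      also have "\<dots> = e" using C(1) by (simp add: e'_def field_simps)
      finally show ?thesis by simp
    qed
    then show "\<exists>N. \<forall>m\<ge>N. \<forall>n\<ge>N. (LINT x|bd. (norm (\<phi> m x - \<phi> n x))\<^sup>2) < e" by blast
  qed
  then obtain t where "L2_lim bd \<phi> t" by blast
  then have "H1_lim \<phi> u g t"
    using s l1 l2 Lv u gL by (auto simp: H1_lim_def L2_lim_def)
  then show ?thesis by blast
qed

text \<open>Again the trace inequality, now for the difference of the two approximating
  sequences.\<close>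

lemma H1_lim_trace_unique:
  assumes a: "H1_lim \<phi> u g t" and b: "H1_lim \<phi>' u g t'"
  shows "AE x in bd. t x = t' x"
proof (rule L2_lim_unique)
  show "L2_lim bd \<phi> t" "L2_lim bd \<phi>' t'" using a b by (auto simp: H1_lim_def)
  have s: "smooth (\<phi> n)" "smooth (\<phi>' n)" for n using a b by (auto simp: H1_lim_def)
  have l: "L2_lim vol \<phi> u" "L2_lim vol \<phi>' u" "L2_lim vol (\<lambda>n. grad (\<phi> n)) g" "L2_lim vol (\<lambda>n. grad (\<phi>' n)) g"
    using a b by (auto simp: H1_lim_def)
  obtain C where C: "C \<ge> 0" "\<And>\<phi>. smooth \<phi> \<Longrightarrow> (LINT x|bd. (\<phi> x)\<^sup>2) \<le> C * ((LINT x|vol. (\<phi> x)\<^sup>2) + (LINT x|vol. (norm (grad \<phi> x))\<^sup>2))"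
    using trace_inequality by blast
  have d: "(\<lambda>n. LINT x|vol. (norm (f n x - f' n x))\<^sup>2) \<longlonglongrightarrow> 0" if "L2_lim vol f k" "L2_lim vol f' k"
    for f f' :: "nat \<Rightarrow> 'a \<Rightarrow> 'c::euclidean_space" and k
  proof (rule tendsto_sandwich[OF _ _ tendsto_const])
    show "\<forall>\<^sub>F n in sequentially. (LINT x|vol. (norm (f n x - f' n x))\<^sup>2)
        \<le> 2 * (LINT x|vol. (norm (f n x - k x))\<^sup>2) + 2 * (LINT x|vol. (norm (k x - f' n x))\<^sup>2)"
      by (intro always_eventually allI L2_dist_triangle) (use that in \<open>auto simp: L2_lim_def\<close>)
    have "(\<lambda>n. 2 * (LINT x|vol. (norm (f n x - k x))\<^sup>2) + 2 * (LINT x|vol. (norm (f' n x - k x))\<^sup>2)) \<longlonglongrightarrow> 2 * 0 + 2 * 0"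
      using that by (intro tendsto_intros) (auto simp: L2_lim_def)
    then show "(\<lambda>n. 2 * (LINT x|vol. (norm (f n x - k x))\<^sup>2) + 2 * (LINT x|vol. (norm (k x - f' n x))\<^sup>2)) \<longlonglongrightarrow> 0"
      by (simp add: norm_minus_commute[of "k _"])
  qed simp
  show "(\<lambda>n. LINT x|bd. (norm (\<phi> n x - \<phi>' n x))\<^sup>2) \<longlonglongrightarrow> 0"
  proof (rule tendsto_sandwich[OF _ _ tendsto_const])
    show "\<forall>\<^sub>F n in sequentially. (LINT x|bd. (norm (\<phi> n x - \<phi>' n x))\<^sup>2) \<le>
        C * ((LINT x|vol. (norm (\<phi> n x - \<phi>' n x))\<^sup>2) + (LINT x|vol. (norm (grad (\<phi> n) x - grad (\<phi>' n) x))\<^sup>2))"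
      using C(2)[OF smooth_diff[OF s(1) s(2)]] by (intro always_eventually allI) (simp add: grad_diff s)
    have "(\<lambda>n. C * ((LINT x|vol. (norm (\<phi> n x - \<phi>' n x))\<^sup>2) + (LINT x|vol. (norm (grad (\<phi> n) x - grad (\<phi>' n) x))\<^sup>2)))
        \<longlonglongrightarrow> C * (0 + 0)"
      by (intro tendsto_mult tendsto_const tendsto_add d[OF l(1,2)] d[OF l(3,4)])
    then show "(\<lambda>n. C * ((LINT x|vol. (norm (\<phi> n x - \<phi>' n x))\<^sup>2) + (LINT x|vol. (norm (grad (\<phi> n) x - grad (\<phi>' n) x))\<^sup>2)))
        \<longlonglongrightarrow> 0" by simp
  qed simp
qed

text \<open>\<open>is_trace\<close> has a single integral of a sum; for square integrable terms it
  splits into two nonnegative integrals, and the sum tends to zero only if both do.\<close>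

lemma is_trace_iff:
  assumes u: "u \<in> H1 \<Omega>"
  shows "is_trace \<Omega> u t \<longleftrightarrow> (\<exists>\<phi>. H1_lim \<phi> u (weak_grad \<Omega> u) t)"
proof -
  let ?g = "weak_grad \<Omega> u"
  note uL = H1_weak_grad[OF u]
  have *: "((\<lambda>n. LINT x|vol. (\<phi> n x - u x)\<^sup>2 + (norm (grad (\<phi> n) x - ?g x))\<^sup>2) \<longlonglongrightarrow> 0) \<longleftrightarrow>
      L2_lim vol \<phi> u \<and> L2_lim vol (\<lambda>n. grad (\<phi> n)) ?g"
    if s: "\<And>n. smooth (\<phi> n)" for \<phi> :: "nat \<Rightarrow> 'a \<Rightarrow> real"
  proof -
    have Lv: "L2 vol (\<phi> n)" "L2 vol (grad (\<phi> n))" for n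
      using s by (auto intro: L2_vol_continuous smooth_continuous continuous_grad)
    let ?a = "\<lambda>n. LINT x|vol. (norm (\<phi> n x - u x))\<^sup>2"
    let ?b = "\<lambda>n. LINT x|vol. (norm (grad (\<phi> n) x - ?g x))\<^sup>2"
    have eq: "(LINT x|vol. (\<phi> n x - u x)\<^sup>2 + (norm (grad (\<phi> n) x - ?g x))\<^sup>2) = ?a n + ?b n" for n
      using L2_integrable_sq[OF L2_diff[OF Lv(1) uL(1)]] L2_integrable_sq[OF L2_diff[OF Lv(2) uL(3)]] by simp
    have "(\<lambda>n. ?a n + ?b n) \<longlonglongrightarrow> 0 \<longleftrightarrow> ?a \<longlonglongrightarrow> 0 \<and> ?b \<longlonglongrightarrow> 0"
    proof
      assume l: "(\<lambda>n. ?a n + ?b n) \<longlonglongrightarrow> 0"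
      have "?a \<longlonglongrightarrow> 0" by (rule tendsto_sandwich[OF _ _ tendsto_const l]) auto
      moreover have "?b \<longlonglongrightarrow> 0" by (rule tendsto_sandwich[OF _ _ tendsto_const l]) auto
      ultimately show "?a \<longlonglongrightarrow> 0 \<and> ?b \<longlonglongrightarrow> 0" ..
    next
      assume "?a \<longlonglongrightarrow> 0 \<and> ?b \<longlonglongrightarrow> 0"
      then have "(\<lambda>n. ?a n + ?b n) \<longlonglongrightarrow> 0 + 0" by (intro tendsto_add) auto
      then show "(\<lambda>n. ?a n + ?b n) \<longlonglongrightarrow> 0" by simp
    qed
    then show ?thesis using Lv uL unfolding eq by (auto simp: L2_lim_def)
  qed
  have **: "L2 bd t \<and> ((\<lambda>n. LINT x|bd. (\<phi> n x - t x)\<^sup>2) \<longlonglongrightarrow> 0) \<longleftrightarrow> L2_lim bd \<phi> t"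
    if s: "\<And>n. smooth (\<phi> n)" for \<phi> :: "nat \<Rightarrow> 'a \<Rightarrow> real"
    using s by (auto simp: L2_lim_def intro: L2_bd_continuous smooth_continuous)
  show ?thesis
    unfolding is_trace_def square_integrable_bd set_integral_vol set_integral_bd H1_lim_def
    using * ** by (auto simp: L2_lim_def) blast+
qed

lemma boundary_trace_H1_lim:
  assumes u: "u \<in> H1 \<Omega>"
  shows "\<exists>\<phi>. H1_lim \<phi> u (weak_grad \<Omega> u) (boundary_trace \<Omega> u)"
proof -
  have "\<exists>t. is_trace \<Omega> u t"
    using exists_H1_lim[OF H1_weak_grad(1,2)[OF u]] is_trace_iff[OF u] by blast
  then have "is_trace \<Omega> u (boundary_trace \<Omega> u)" unfolding boundary_trace_def by (rule someI_ex)
  then show ?thesis using is_trace_iff[OF u] by blast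
qed

text \<open>Whatever \<open>SOME\<close> selects as weak gradient and trace agrees almost everywhere
  with a known limit, so the choices do not affect integrals.\<close>

lemma H1_lim_weak_grad_trace:
  assumes l: "H1_lim \<phi> u g t" and g: "has_weak_gradient \<Omega> u g"
  shows "u \<in> H1 \<Omega>" "AE x in vol. weak_grad \<Omega> u x = g x" "AE x in bd. boundary_trace \<Omega> u x = t x"
proof -
  have uL: "L2 vol u" using l by (auto simp: H1_lim_def L2_lim_def)
  show u: "u \<in> H1 \<Omega>" using uL g by (auto simp: H1_iff)
  note w = H1_weak_grad[OF u]
  show ae: "AE x in vol. weak_grad \<Omega> u x = g x" by (rule weak_gradient_unique[OF uL w(2) g])
  have "L2_lim vol (\<lambda>n. grad (\<phi> n)) (weak_grad \<Omega> u)"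
    by (rule L2_lim_cong_AE[OF _ L2_measurable[OF w(3)] ae]) (use l in \<open>simp add: H1_lim_def\<close>)
  then have "H1_lim \<phi> u (weak_grad \<Omega> u) t" using l by (simp add: H1_lim_def)
  moreover obtain \<phi>' where "H1_lim \<phi>' u (weak_grad \<Omega> u) (boundary_trace \<Omega> u)"
    using boundary_trace_H1_lim[OF u] by blast
  ultimately show "AE x in bd. boundary_trace \<Omega> u x = t x" using H1_lim_trace_unique by blast
qed

lemma smooth_H1:
  assumes "smooth \<phi>"
  shows "\<phi> \<in> H1 \<Omega>" "AE x in vol. weak_grad \<Omega> \<phi> x = grad \<phi> x" "AE x in bd. boundary_trace \<Omega> \<phi> x = \<phi> x"
proof -
  have "H1_lim (\<lambda>_. \<phi>) \<phi> (grad \<phi>) \<phi>"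
    unfolding H1_lim_def using assms
    by (auto intro!: L2_lim_const L2_vol_continuous L2_bd_continuous smooth_continuous continuous_grad)
  from H1_lim_weak_grad_trace[OF this smooth_has_weak_gradient[OF assms]]
  show "\<phi> \<in> H1 \<Omega>" "AE x in vol. weak_grad \<Omega> \<phi> x = grad \<phi> x" "AE x in bd. boundary_trace \<Omega> \<phi> x = \<phi> x" by auto
qed

end

section \<open>The Robin eigenvalue and torsion\<close>

definition variation_const :: "'a::euclidean_space itself \<Rightarrow> real" where
  "variation_const _ = max 1 (sweep_const TYPE('a))"

lemma variation_const_ge_1: "1 \<le> variation_const TYPE('a::euclidean_space)"
  by (simp add: variation_const_def)

context lipschitz_dom
begin

text \<open>The Robin form with classical gradients and boundary values, free of the choices in
  \<open>weak_grad\<close> and \<open>boundary_trace\<close>; it is meant for smooth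
  arguments.\<close>

definition energy :: "real \<Rightarrow> ('a \<Rightarrow> real) \<Rightarrow> ('a \<Rightarrow> real) \<Rightarrow> real" where
  "energy \<beta> \<phi> \<psi> = (LINT x|vol. grad \<phi> x \<bullet> grad \<psi> x) + \<beta> * (LINT x|bd. \<phi> x * \<psi> x)"

lemma energy_self: "energy \<beta> \<phi> \<phi> = (LINT x|vol. (norm (grad \<phi> x))\<^sup>2) + \<beta> * (LINT x|bd. (\<phi> x)\<^sup>2)"
  by (simp add: energy_def dot_square_norm power2_eq_square)

lemma energy_nonneg: "0 \<le> \<beta> \<Longrightarrow> 0 \<le> energy \<beta> \<phi> \<phi>"
  unfolding energy_self by simp

lemma energy_add_scale:
  assumes \<phi>: "smooth \<phi>" and \<psi>: "smooth \<psi>"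
  shows "energy \<beta> (\<lambda>x. \<phi> x + s * \<psi> x) (\<lambda>x. \<phi> x + s * \<psi> x)
    = energy \<beta> \<phi> \<phi> + 2 * energy \<beta> \<phi> \<psi> * s + energy \<beta> \<psi> \<psi> * s\<^sup>2"
proof -
  have g: "grad (\<lambda>x. \<phi> x + s * \<psi> x) x = grad \<phi> x + s *\<^sub>R grad \<psi> x" for x
    by (simp add: grad_add[OF \<phi> smooth_mult[OF smooth_const \<psi>]] grad_cmult[OF \<psi>])
  note c = continuous_grad[OF \<phi>, of UNIV] continuous_grad[OF \<psi>, of UNIV] smooth_continuous[OF \<phi>] smooth_continuous[OF \<psi>]
  have i: "integrable vol (\<lambda>x. grad \<phi> x \<bullet> grad \<phi> x)" "integrable vol (\<lambda>x. grad \<phi> x \<bullet> grad \<psi> x)"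
    "integrable vol (\<lambda>x. grad \<psi> x \<bullet> grad \<psi> x)"
    by (intro integrable_vol_continuous continuous_intros c)+
  have j: "integrable bd (\<lambda>x. \<phi> x * \<phi> x)" "integrable bd (\<lambda>x. \<phi> x * \<psi> x)" "integrable bd (\<lambda>x. \<psi> x * \<psi> x)"
    by (intro integrable_bd_continuous continuous_intros c)+
  have 1: "(LINT x|vol. grad (\<lambda>x. \<phi> x + s * \<psi> x) x \<bullet> grad (\<lambda>x. \<phi> x + s * \<psi> x) x)
      = (LINT x|vol. grad \<phi> x \<bullet> grad \<phi> x) + (2 * s) * (LINT x|vol. grad \<phi> x \<bullet> grad \<psi> x) + s\<^sup>2 * (LINT x|vol. grad \<psi> x \<bullet> grad \<psi> x)"
  proof -
    have "(LINT x|vol. grad (\<lambda>x. \<phi> x + s * \<psi> x) x \<bullet> grad (\<lambda>x. \<phi> x + s * \<psi> x) x)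
        = (LINT x|vol. grad \<phi> x \<bullet> grad \<phi> x + (2 * s) * (grad \<phi> x \<bullet> grad \<psi> x) + s\<^sup>2 * (grad \<psi> x \<bullet> grad \<psi> x))"
      by (rule Bochner_Integration.integral_cong[OF refl])
        (simp add: g inner_add_left inner_add_right inner_commute power2_eq_square algebra_simps)
    then show ?thesis using i by simp
  qed
  have 2: "(LINT x|bd. (\<phi> x + s * \<psi> x) * (\<phi> x + s * \<psi> x))
      = (LINT x|bd. \<phi> x * \<phi> x) + (2 * s) * (LINT x|bd. \<phi> x * \<psi> x) + s\<^sup>2 * (LINT x|bd. \<psi> x * \<psi> x)"
  proof -
    have "(LINT x|bd. (\<phi> x + s * \<psi> x) * (\<phi> x + s * \<psi> x))
        = (LINT x|bd. \<phi> x * \<phi> x + (2 * s) * (\<phi> x * \<psi> x) + s\<^sup>2 * (\<psi> x * \<psi> x))"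
      by (rule Bochner_Integration.integral_cong[OF refl]) (simp add: power2_eq_square algebra_simps)
    then show ?thesis using j by simp
  qed
  show ?thesis unfolding energy_def 1 2 by (simp add: algebra_simps)
qed

lemma robin_form_vol: "robin_form \<beta> \<Omega> u v = (LINT x|vol. weak_grad \<Omega> u x \<bullet> weak_grad \<Omega> v x)
    + \<beta> * (LINT x|bd. boundary_trace \<Omega> u x * boundary_trace \<Omega> v x)"
  unfolding robin_form_def set_integral_vol set_integral_bd ..

abbreviation approximates :: "(nat \<Rightarrow> 'a \<Rightarrow> real) \<Rightarrow> ('a \<Rightarrow> real) \<Rightarrow> bool" where
  "approximates \<phi> u \<equiv> H1_lim \<phi> u (weak_grad \<Omega> u) (boundary_trace \<Omega> u)"

lemma H1_lim_approximates:
  assumes l: "H1_lim \<phi> u g t" and g: "has_weak_gradient \<Omega> u g"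
  shows "approximates \<phi> u"
proof -
  note w = H1_lim_weak_grad_trace[OF l g]
  obtain \<phi>' where "approximates \<phi>' u" using boundary_trace_H1_lim[OF w(1)] by blast
  then have m: "weak_grad \<Omega> u \<in> borel_measurable vol" "boundary_trace \<Omega> u \<in> borel_measurable bd"
    by (auto simp: H1_lim_def L2_lim_def L2_def)
  show ?thesis
    using l L2_lim_cong_AE[OF _ m(1) w(2), of "\<lambda>n. grad (\<phi> n)"] L2_lim_cong_AE[OF _ m(2) w(3), of \<phi>]
    by (simp add: H1_lim_def)
qed

lemma smooth_approximates:
  assumes "smooth \<phi>"
  shows "approximates (\<lambda>_. \<phi>) \<phi>"
proof (rule H1_lim_approximates[OF _ smooth_has_weak_gradient[OF assms]])
  show "H1_lim (\<lambda>_. \<phi>) \<phi> (grad \<phi>) \<phi>"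
    unfolding H1_lim_def using assms
    by (auto intro!: L2_lim_const L2_vol_continuous L2_bd_continuous smooth_continuous continuous_grad)
qed

lemma energy_tendsto:
  assumes "approximates \<phi> u" "approximates \<psi> v"
  shows "(\<lambda>n. energy \<beta> (\<phi> n) (\<psi> n)) \<longlonglongrightarrow> robin_form \<beta> \<Omega> u v"
  unfolding energy_def robin_form_vol
  using assms L2_lim_inner[of vol "\<lambda>n. grad (\<phi> n)" "weak_grad \<Omega> u" "\<lambda>n. grad (\<psi> n)" "weak_grad \<Omega> v"]
    L2_lim_inner[of bd \<phi> "boundary_trace \<Omega> u" \<psi> "boundary_trace \<Omega> v"]
  by (intro tendsto_intros) (auto simp: H1_lim_def)

lemma robin_form_tendsto:
  assumes w: "approximates \<phi> w" and v: "approximates \<psi> v"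
  shows "(\<lambda>n. robin_form \<beta> \<Omega> w (\<psi> n)) \<longlonglongrightarrow> robin_form \<beta> \<Omega> w v"
proof -
  have wL: "L2 vol (weak_grad \<Omega> w)" "L2 bd (boundary_trace \<Omega> w)"
    using w by (auto simp: H1_lim_def L2_lim_def)
  have lim: "(\<lambda>n. (LINT x|vol. weak_grad \<Omega> w x \<bullet> grad (\<psi> n) x) + \<beta> * (LINT x|bd. boundary_trace \<Omega> w x * \<psi> n x))
      \<longlonglongrightarrow> robin_form \<beta> \<Omega> w v" if v: "approximates \<psi> v" for \<psi> v
    unfolding robin_form_vol
    using v L2_lim_inner[OF L2_lim_const[OF wL(1)], of "\<lambda>n. grad (\<psi> n)" "weak_grad \<Omega> v"]
      L2_lim_inner[OF L2_lim_const[OF wL(2)], of \<psi> "boundary_trace \<Omega> v"]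
    by (intro tendsto_intros) (auto simp: H1_lim_def)
  \<comment> \<open>A smooth function is approximated by its own constant sequence, which identifies
    the chosen gradient and trace under the integrals.\<close>
  have "robin_form \<beta> \<Omega> w (\<psi> n) = (LINT x|vol. weak_grad \<Omega> w x \<bullet> grad (\<psi> n) x) + \<beta> * (LINT x|bd. boundary_trace \<Omega> w x * \<psi> n x)" for n
  proof -
    have "smooth (\<psi> n)" using v by (simp add: H1_lim_def)
    from lim[OF smooth_approximates[OF this]] show ?thesis by (simp add: LIMSEQ_const_iff)
  qed
  with lim[OF v] show ?thesis by simp
qed

lemma robin_form_smooth:
  assumes "smooth \<phi>" "smooth \<psi>"
  shows "robin_form \<beta> \<Omega> \<phi> \<psi> = energy \<beta> \<phi> \<psi>"
  using energy_tendsto[OF smooth_approximates[OF assms(1)] smooth_approximates[OF assms(2)], of \<beta>]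
  by (simp add: LIMSEQ_const_iff)

text \<open>The condition on \<open>a\<close> makes the contribution of \<open>a * I\<close> to the
  variation bound at most half of \<open>I\<close>, so it is absorbed. The constant depends on
  \<open>\<Omega>\<close> only through its measure, as a uniform bound for the eigenvalue
  requires.\<close>

lemma coercive:
  assumes \<beta>: "0 < a" "a \<le> \<beta>" and \<rho>: "\<rho> > 0" "measure lebesgue \<Omega> \<le> unit_ball_vol (real DIM('a)) * \<rho> ^ DIM('a)"
    and a: "8 * \<rho> * variation_const TYPE('a) * a \<le> 1" and \<phi>: "smooth \<phi>"
  shows "(LINT x|vol. (\<phi> x)\<^sup>2) \<le> 8 * \<rho> * variation_const TYPE('a) / a * energy \<beta> \<phi> \<phi>"
proof -
  define I where "I = (LINT x|vol. (\<phi> x)\<^sup>2)"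
  define E where "E = energy \<beta> \<phi> \<phi>"
  have I: "0 \<le> I" by (simp add: I_def)
  have "I \<le> 4 * \<rho> * total_variation_sq \<phi>" unfolding I_def by (rule Poincare_inequality[OF \<phi> \<rho>])
  also have "\<dots> \<le> 4 * \<rho> * (variation_const TYPE('a) * (E / a + a * I))"
    using total_variation_sq_le[OF \<phi> \<beta>] \<rho>(1)
    by (intro mult_left_mono) (auto simp: E_def I_def energy_self variation_const_def)
  also have "\<dots> = 4 * \<rho> * variation_const TYPE('a) / a * E + (8 * \<rho> * variation_const TYPE('a) * a) * I / 2"
    by (simp add: algebra_simps)
  also have "(8 * \<rho> * variation_const TYPE('a) * a) * I / 2 \<le> I / 2"
    using mult_right_mono[OF a I] by (simp add: mult_ac)
  finally have "I \<le> 2 * (4 * \<rho> * variation_const TYPE('a) / a * E)" by simp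
  then show ?thesis by (simp add: I_def E_def)
qed

lemma coercive_exists:
  assumes "0 < \<beta>"
  shows "\<exists>C\<ge>0. \<forall>\<phi>. smooth \<phi> \<longrightarrow> (LINT x|vol. (\<phi> x)\<^sup>2) \<le> C * energy \<beta> \<phi> \<phi>"
proof -
  define V where "V = unit_ball_vol (real DIM('a))"
  have V: "V > 0" by (simp add: V_def)
  \<comment> \<open>At least 1, so that \<open>\<rho> \<le> \<rho> ^ d\<close>.\<close>
  define \<rho> where "\<rho> = max 1 (measure lebesgue \<Omega> / V)"
  have \<rho>: "\<rho> \<ge> 1" "measure lebesgue \<Omega> / V \<le> \<rho>" by (auto simp: \<rho>_def)
  have "\<rho> ^ 1 \<le> \<rho> ^ DIM('a)" using \<rho>(1) by (intro power_increasing) (auto simp: Suc_leI)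
  then have "measure lebesgue \<Omega> / V \<le> \<rho> ^ DIM('a)" using \<rho>(2) by simp
  then have m: "measure lebesgue \<Omega> \<le> V * \<rho> ^ DIM('a)" using V by (simp add: field_simps)
  have vc: "variation_const TYPE('a) \<ge> 1" by (simp add: variation_const_def)
  define a where "a = min \<beta> (1 / (8 * \<rho> * variation_const TYPE('a)))"
  have a: "0 < a" "a \<le> \<beta>" using assms \<rho> vc by (auto simp: a_def)
  have "8 * \<rho> * variation_const TYPE('a) * a \<le> 8 * \<rho> * variation_const TYPE('a) * (1 / (8 * \<rho> * variation_const TYPE('a)))"
    using \<rho> vc by (intro mult_left_mono) (auto simp: a_def)
  also have "\<dots> = 1" using \<rho> vc by simp
  finally have "8 * \<rho> * variation_const TYPE('a) * a \<le> 1" .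
  from coercive[OF a _ m[unfolded V_def] this] \<rho>
  have "\<forall>\<phi>. smooth \<phi> \<longrightarrow> (LINT x|vol. (\<phi> x)\<^sup>2) \<le> 8 * \<rho> * variation_const TYPE('a) / a * energy \<beta> \<phi> \<phi>" by auto
  moreover have "8 * \<rho> * variation_const TYPE('a) / a \<ge> 0" using \<rho> vc a by auto
  ultimately show ?thesis by blast
qed

subsection \<open>Existence of the torsion function\<close>

lemma integral_sq_le_energy:
  assumes "0 \<le> C" "\<And>\<phi>. smooth \<phi> \<Longrightarrow> (LINT x|vol. (\<phi> x)\<^sup>2) \<le> C * energy \<beta> \<phi> \<phi>" "smooth \<phi>"
  shows "(LINT x|vol. \<phi> x)\<^sup>2 \<le> measure lebesgue \<Omega> * C * energy \<beta> \<phi> \<phi>"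
proof -
  have "\<bar>LINT x|vol. \<phi> x\<bar> \<le> (LINT x|vol. \<bar>\<phi> x\<bar>)" by (rule integral_abs_bound)
  then have "(LINT x|vol. \<phi> x)\<^sup>2 \<le> (LINT x|vol. \<bar>\<phi> x\<bar>)\<^sup>2"
    by (metis abs_ge_zero power2_abs power_mono)
  also have "\<dots> \<le> measure lebesgue \<Omega> * (LINT x|vol. (\<phi> x)\<^sup>2)" by (rule integral_abs_sq_le[OF assms(3)])
  also have "\<dots> \<le> measure lebesgue \<Omega> * (C * energy \<beta> \<phi> \<phi>)"
    by (intro mult_left_mono assms) auto
  finally show ?thesis by (simp add: mult.assoc)
qed

text \<open>Direct method: \<open>J \<phi> = E \<phi> - 2 * l \<phi>\<close> is minimised over
  smooth functions. A minimising sequence is Cauchy in energy, hence by coercivity it converges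
  together with its gradients and boundary values, and the limit satisfies the weak
  equation.\<close>

lemma torsion_function_exists:
  assumes \<beta>: "0 < \<beta>"
  shows "\<exists>w. robin_torsion_function \<beta> \<Omega> w"
proof -
  obtain C where C: "C \<ge> 0" "\<And>\<phi>. smooth \<phi> \<Longrightarrow> (LINT x|vol. (\<phi> x)\<^sup>2) \<le> C * energy \<beta> \<phi> \<phi>"
    using coercive_exists[OF \<beta>] by blast
  define m where "m = measure lebesgue \<Omega> * C"
  have m: "m \<ge> 0" using C(1) by (simp add: m_def)
  define E where "E \<phi> = energy \<beta> \<phi> \<phi>" for \<phi>
  have E0: "0 \<le> E \<phi>" for \<phi> unfolding E_def using \<beta> by (intro energy_nonneg) simp
  define l where "l \<phi> = (LINT x|vol. \<phi> x)" for \<phi> :: "'a \<Rightarrow> real"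
  have l: "(l \<phi>)\<^sup>2 \<le> m * E \<phi>" if "smooth \<phi>" for \<phi>
    unfolding l_def m_def E_def using integral_sq_le_energy[OF C that] by simp
  define J where "J \<phi> = E \<phi> - 2 * l \<phi>" for \<phi>
  \<comment> \<open>From \<open>(l \<phi>)\<^sup>2 \<le> m * E \<phi>\<close> and the inequality of
    means, \<open>2 * l \<phi> \<le> E \<phi> + m\<close>.\<close>
  have Jb: "- m \<le> J \<phi>" if "smooth \<phi>" for \<phi>
  proof -
    have "(2 * l \<phi>)\<^sup>2 \<le> 4 * (m * E \<phi>)" using l[OF that] by (simp add: power_mult_distrib)
    also have "\<dots> \<le> (E \<phi> + m)\<^sup>2" using zero_le_power2[of "E \<phi> - m"] by (simp add: power2_eq_square algebra_simps)
    finally have "2 * l \<phi> \<le> E \<phi> + m" by (rule power2_le_imp_le) (use E0[of \<phi>] m in simp)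
    then show ?thesis by (simp add: J_def)
  qed
  define jmin where "jmin = Inf (J ` {\<phi>. smooth \<phi>})"
  have bb: "bdd_below (J ` {\<phi>. smooth \<phi>})" by (rule bdd_belowI2[where m = "- m"]) (use Jb in auto)
  have infle: "jmin \<le> J \<phi>" if "smooth \<phi>" for \<phi>
    unfolding jmin_def using that bb by (intro cInf_lower) auto
  have "\<forall>n::nat. \<exists>\<phi>. smooth \<phi> \<and> J \<phi> < jmin + inverse (real (Suc n))"
  proof
    fix n :: nat
    have "Inf (J ` {\<phi>. smooth \<phi>}) < jmin + inverse (real (Suc n))" by (simp add: jmin_def)
    moreover have "J (\<lambda>_. 0) \<in> J ` {\<phi>. smooth \<phi>}" by (intro imageI) (simp add: smooth_const)
    then have "J ` {\<phi>. smooth \<phi>} \<noteq> {}" by blast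
    ultimately obtain y where "y \<in> J ` {\<phi>. smooth \<phi>}" "y < jmin + inverse (real (Suc n))"
      by (meson cInf_lessD)
    then show "\<exists>\<phi>. smooth \<phi> \<and> J \<phi> < jmin + inverse (real (Suc n))" by blast
  qed
  from choice[OF this] obtain \<phi> where \<phi>: "\<forall>n. smooth (\<phi> n) \<and> J (\<phi> n) < jmin + inverse (real (Suc n))" ..
  have s: "smooth (\<phi> n)" for n using \<phi> by simp
  define \<epsilon> where "\<epsilon> n = inverse (real (Suc n))" for n :: nat
  have \<epsilon>0: "0 < \<epsilon> n" for n by (simp add: \<epsilon>_def)
  have Jadd: "J (\<lambda>x. \<phi> n x + s * \<psi> x) = J (\<phi> n) + 2 * (energy \<beta> (\<phi> n) \<psi> - l \<psi>) * s + E \<psi> * s\<^sup>2" if \<psi>: "smooth \<psi>" for n \<psi> s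
  proof -
    have "integrable vol (\<phi> n)" "integrable vol \<psi>" using \<psi> s by (auto intro: integrable_vol_continuous smooth_continuous)
    then have "l (\<lambda>x. \<phi> n x + s * \<psi> x) = l (\<phi> n) + s * l \<psi>" unfolding l_def by simp
    then show ?thesis unfolding J_def E_def by (simp add: energy_add_scale[OF \<open>smooth (\<phi> n)\<close> \<psi>] algebra_simps)
  qed
  \<comment> \<open>An almost minimiser almost satisfies the equation: \<open>J\<close> along the
    line through \<open>\<phi> n\<close> in direction \<open>\<psi>\<close> is a quadratic
    polynomial that stays above \<open>jmin\<close>, and its constant term exceeds
    \<open>jmin\<close> by less than \<open>\<epsilon> n\<close>.\<close>
  have a: "(energy \<beta> (\<phi> n) \<psi> - l \<psi>)\<^sup>2 \<le> \<epsilon> n * E \<psi>" if \<psi>: "smooth \<psi>" for n \<psi>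
  proof (rule quadratic_nonneg_discriminant)
    fix t
    have "smooth (\<lambda>x. \<phi> n x + t * \<psi> x)" by (intro smooth_add smooth_mult smooth_const s \<psi>)
    from infle[OF this] show "0 \<le> \<epsilon> n + 2 * (energy \<beta> (\<phi> n) \<psi> - l \<psi>) * t + E \<psi> * t\<^sup>2"
      using \<phi>[rule_format, of n] unfolding Jadd[OF \<psi>] \<epsilon>_def by linarith
  qed (rule E0)
  \<comment> \<open>Expansion of \<open>J\<close> about \<open>\<phi> n\<close>, evaluated at
    \<open>\<phi> k\<close>; the linear term is absorbed into half the energy of the
    difference.\<close>
  have Ecauchy: "E (\<lambda>x. \<phi> k x - \<phi> n x) \<le> 2 * \<epsilon> k + 4 * \<epsilon> n" for k n
  proof -
    define \<psi> where "\<psi> x = \<phi> k x - \<phi> n x" for x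
    have \<psi>: "smooth \<psi>" unfolding \<psi>_def by (intro smooth_diff s)
    define b where "b = energy \<beta> (\<phi> n) \<psi> - l \<psi>"
    have "J (\<phi> k) = J (\<lambda>x. \<phi> n x + 1 * \<psi> x)" by (simp add: \<psi>_def)
    also have "\<dots> = J (\<phi> n) + 2 * b + E \<psi>" unfolding Jadd[OF \<psi>] by (simp add: b_def)
    finally have "E \<psi> = J (\<phi> k) - J (\<phi> n) - 2 * b" by simp
    moreover have "J (\<phi> k) < jmin + \<epsilon> k" "jmin \<le> J (\<phi> n)" using \<phi> infle s by (auto simp: \<epsilon>_def)
    moreover have "2 * \<bar>b\<bar> \<le> E \<psi> / 2 + 2 * \<epsilon> n"
    proof (rule power2_le_imp_le)
      have "(2 * \<bar>b\<bar>)\<^sup>2 \<le> 4 * (\<epsilon> n * E \<psi>)" using a[OF \<psi>, of n] by (simp add: b_def power_mult_distrib)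
      also have "\<dots> \<le> (E \<psi> / 2 + 2 * \<epsilon> n)\<^sup>2"
        using zero_le_power2[of "E \<psi> / 2 - 2 * \<epsilon> n"] by (simp add: power2_eq_square algebra_simps)
      finally show "(2 * \<bar>b\<bar>)\<^sup>2 \<le> (E \<psi> / 2 + 2 * \<epsilon> n)\<^sup>2" .
    qed (use E0[of \<psi>] \<epsilon>0[of n] in auto)
    ultimately show ?thesis unfolding \<psi>_def[symmetric] by linarith
  qed
  have Esmall: "\<exists>N. \<forall>k\<ge>N. \<forall>n\<ge>N. E (\<lambda>x. \<phi> k x - \<phi> n x) < e" if "e > 0" for e
  proof -
    have "e / 6 > 0" using that by simp
    then obtain N where "inverse (real (Suc N)) < e / 6" using reals_Archimedean by blast
    moreover have "\<epsilon> n \<le> \<epsilon> N" if "n \<ge> N" for n using that by (simp add: \<epsilon>_def field_simps)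
    ultimately have small: "\<epsilon> n < e / 6" if "n \<ge> N" for n using that unfolding \<epsilon>_def by (meson order_le_less_trans)
    have "E (\<lambda>x. \<phi> k x - \<phi> n x) < e" if "k \<ge> N" "n \<ge> N" for k n
      using Ecauchy[of k n] small[OF that(1)] small[OF that(2)] by linarith
    then show ?thesis by blast
  qed
  have Cauchy: "\<exists>N. \<forall>k\<ge>N. \<forall>n\<ge>N. F k n < e" if "e > 0" "K > 0" and F: "\<And>k n. F k n \<le> K * E (\<lambda>x. \<phi> k x - \<phi> n x)"
    for e K :: real and F :: "nat \<Rightarrow> nat \<Rightarrow> real"
  proof -
    have "e / K > 0" using that by simp
    from Esmall[OF this] obtain N where N: "\<forall>k\<ge>N. \<forall>n\<ge>N. E (\<lambda>x. \<phi> k x - \<phi> n x) < e / K" ..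
    have "F k n < e" if "k \<ge> N" "n \<ge> N" for k n
    proof -
      have "K * E (\<lambda>x. \<phi> k x - \<phi> n x) < e" using N that \<open>K > 0\<close> by (simp add: field_simps)
      then show ?thesis using F[of k n] by simp
    qed
    then show ?thesis by blast
  qed
  have Lv: "L2 vol (\<phi> n)" "L2 vol (grad (\<phi> n))" "L2 bd (\<phi> n)" for n
    using s by (auto intro: L2_vol_continuous L2_bd_continuous smooth_continuous continuous_grad)
  have sd: "smooth (\<lambda>x. \<phi> k x - \<phi> n x)" for k n by (intro smooth_diff s)
  have "\<exists>w. L2_lim vol \<phi> w"
  proof (rule vol.L2_complete[OF Lv(1)], rule Cauchy[where K = "C + 1"])
    fix k n
    have "(LINT x|vol. (\<phi> k x - \<phi> n x)\<^sup>2) \<le> C * E (\<lambda>x. \<phi> k x - \<phi> n x)" using C(2)[OF sd] by (simp add: E_def)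
    also have "\<dots> \<le> (C + 1) * E (\<lambda>x. \<phi> k x - \<phi> n x)" using E0 by (intro mult_right_mono) auto
    finally show "(LINT x|vol. (norm (\<phi> k x - \<phi> n x))\<^sup>2) \<le> (C + 1) * E (\<lambda>x. \<phi> k x - \<phi> n x)" by simp
  qed (use C(1) in auto)
  then obtain w where w: "L2_lim vol \<phi> w" ..
  have "\<exists>g. L2_lim vol (\<lambda>n. grad (\<phi> n)) g"
  proof (rule vol.L2_complete[OF Lv(2)], rule Cauchy[where K = 1])
    fix k n
    show "(LINT x|vol. (norm (grad (\<phi> k) x - grad (\<phi> n) x))\<^sup>2) \<le> 1 * E (\<lambda>x. \<phi> k x - \<phi> n x)"
      using \<beta> by (simp add: E_def energy_self grad_diff[OF s s])
  qed auto
  then obtain g where g: "L2_lim vol (\<lambda>n. grad (\<phi> n)) g" ..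
  have "\<exists>t. L2_lim bd \<phi> t"
  proof (rule bd.L2_complete[OF Lv(3)], rule Cauchy[where K = "1 / \<beta>"])
    fix k n
    have "\<beta> * (LINT x|bd. (\<phi> k x - \<phi> n x)\<^sup>2) \<le> E (\<lambda>x. \<phi> k x - \<phi> n x)"
      by (simp add: E_def energy_self)
    then show "(LINT x|bd. (norm (\<phi> k x - \<phi> n x))\<^sup>2) \<le> 1 / \<beta> * E (\<lambda>x. \<phi> k x - \<phi> n x)"
      using \<beta> by (simp add: field_simps)
  qed (use \<beta> in auto)
  then obtain t where t: "L2_lim bd \<phi> t" ..
  have wg: "has_weak_gradient \<Omega> w g"
    unfolding has_weak_gradient_vol
  proof (intro conjI allI impI)
    show "L2 vol g" using g by (simp add: L2_lim_def)
    fix \<theta> assume \<theta>: "test_function \<Omega> \<theta>"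
    have \<theta>L: "L2 vol \<theta>" "L2 vol (grad \<theta>)"
      using test_functionD(1)[OF \<theta>] by (auto intro: L2_vol_continuous smooth_continuous continuous_grad)
    have "(\<lambda>n. LINT x|vol. \<phi> n x *\<^sub>R grad \<theta> x) \<longlonglongrightarrow> (LINT x|vol. w x *\<^sub>R grad \<theta> x)"
      by (rule L2_lim_scaleR[OF w \<theta>L(2)])
    moreover have "(\<lambda>n. LINT x|vol. \<phi> n x *\<^sub>R grad \<theta> x) = (\<lambda>n. - (LINT x|vol. \<theta> x *\<^sub>R grad (\<phi> n) x))"
      using smooth_has_weak_gradient[OF s] \<theta> by (auto simp: has_weak_gradient_vol)
    moreover have "(\<lambda>n. - (LINT x|vol. \<theta> x *\<^sub>R grad (\<phi> n) x)) \<longlonglongrightarrow> - (LINT x|vol. \<theta> x *\<^sub>R g x)"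
      by (intro tendsto_minus L2_lim_scaleR2[OF g \<theta>L(1)])
    ultimately show "(LINT x|vol. w x *\<^sub>R grad \<theta> x) = - (LINT x|vol. \<theta> x *\<^sub>R g x)"
      using LIMSEQ_unique by simp
  qed
  have hl: "H1_lim \<phi> w g t" using s w g t by (simp add: H1_lim_def)
  have ap: "approximates \<phi> w" by (rule H1_lim_approximates[OF hl wg])
  have wH: "w \<in> H1 \<Omega>" by (rule H1_lim_weak_grad_trace(1)[OF hl wg])
  \<comment> \<open>The defect in the equation tends to zero with \<open>\<epsilon> n\<close>; this
    settles smooth test functions, and density then reaches all of \<open>H1\<close>.\<close>
  have eqs: "robin_form \<beta> \<Omega> w \<psi> = l \<psi>" if \<psi>: "smooth \<psi>" for \<psi>
  proof -
    have "(\<lambda>n. energy \<beta> (\<phi> n) \<psi>) \<longlonglongrightarrow> robin_form \<beta> \<Omega> w \<psi>"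
      by (rule energy_tendsto[OF ap smooth_approximates[OF \<psi>]])
    moreover have "(\<lambda>n. energy \<beta> (\<phi> n) \<psi> - l \<psi>) \<longlonglongrightarrow> 0"
    proof (rule tendsto_zero_of_sq_le[OF a[OF \<psi>]])
      have "\<epsilon> \<longlonglongrightarrow> 0" unfolding \<epsilon>_def by (rule LIMSEQ_inverse_real_of_nat)
      then have "(\<lambda>n. \<epsilon> n * E \<psi>) \<longlonglongrightarrow> 0 * E \<psi>" by (intro tendsto_intros)
      then show "(\<lambda>n. \<epsilon> n * E \<psi>) \<longlonglongrightarrow> 0" by simp
    qed
    then have "(\<lambda>n. energy \<beta> (\<phi> n) \<psi>) \<longlonglongrightarrow> l \<psi>" by (simp add: LIM_zero_iff)
    ultimately show ?thesis by (rule LIMSEQ_unique)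
  qed
  have "robin_form \<beta> \<Omega> w v = (LINT x:\<Omega>|lebesgue. v x)" if v: "v \<in> H1 \<Omega>" for v
  proof -
    obtain \<psi> where \<psi>: "approximates \<psi> v" using boundary_trace_H1_lim[OF v] by blast
    have "(\<lambda>n. robin_form \<beta> \<Omega> w (\<psi> n)) \<longlonglongrightarrow> robin_form \<beta> \<Omega> w v" by (rule robin_form_tendsto[OF ap \<psi>])
    moreover have "robin_form \<beta> \<Omega> w (\<psi> n) = l (\<psi> n)" for n using \<psi> eqs by (simp add: H1_lim_def)
    moreover have "(\<lambda>n. l (\<psi> n)) \<longlonglongrightarrow> (LINT x|vol. v x)"
      unfolding l_def using \<psi> by (intro vol.L2_lim_integral) (simp add: H1_lim_def)
    ultimately show ?thesis unfolding set_integral_vol using LIMSEQ_unique by simp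
  qed
  with wH show ?thesis unfolding robin_torsion_function_def by blast
qed

section \<open>Torsional rigidity as an optimal constant\<close>

definition torsion_function :: "real \<Rightarrow> 'a \<Rightarrow> real" where
  "torsion_function \<beta> = (SOME w. robin_torsion_function \<beta> \<Omega> w)"

lemma torsion_function:
  assumes "0 < \<beta>"
  shows "torsion_function \<beta> \<in> H1 \<Omega>"
    "v \<in> H1 \<Omega> \<Longrightarrow> robin_form \<beta> \<Omega> (torsion_function \<beta>) v = (LINT x|vol. v x)"
    "robin_torsion \<beta> \<Omega> = (LINT x|vol. torsion_function \<beta> x)"
    "robin_torsion \<beta> \<Omega> = robin_form \<beta> \<Omega> (torsion_function \<beta>) (torsion_function \<beta>)"
proof -
  have *: "robin_torsion_function \<beta> \<Omega> (torsion_function \<beta>)"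
    unfolding torsion_function_def using torsion_function_exists[OF assms] by (rule someI_ex)
  show 1: "torsion_function \<beta> \<in> H1 \<Omega>" using * by (simp add: robin_torsion_function_def)
  show 2: "robin_form \<beta> \<Omega> (torsion_function \<beta>) v = (LINT x|vol. v x)" if "v \<in> H1 \<Omega>" for v
    using * that by (simp add: robin_torsion_function_def set_integral_vol)
  show 3: "robin_torsion \<beta> \<Omega> = (LINT x|vol. torsion_function \<beta> x)"
    by (simp add: robin_torsion_def torsion_function_def set_integral_vol)
  show "robin_torsion \<beta> \<Omega> = robin_form \<beta> \<Omega> (torsion_function \<beta>) (torsion_function \<beta>)"
    using 2[OF 1] 3 by simp
qed

text \<open>Cauchy-Schwarz for the Robin form between the torsion function and
  \<open>\<phi>\<close>: by the weak equation the mixed term is the integral of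
  \<open>\<phi>\<close>, and the form of the torsion function with itself is the torsion. The
  quadratic is nonnegative as a limit of energies of smooth functions.\<close>

lemma torsion_lower:
  assumes \<beta>: "0 < \<beta>" and \<phi>: "smooth \<phi>"
  shows "(LINT x|vol. \<phi> x)\<^sup>2 \<le> robin_torsion \<beta> \<Omega> * energy \<beta> \<phi> \<phi>"
proof (rule quadratic_nonneg_discriminant)
  note t = torsion_function[OF \<beta>]
  obtain w where w: "approximates w (torsion_function \<beta>)" using boundary_trace_H1_lim[OF t(1)] by blast
  fix s
  have lim: "(\<lambda>n. energy \<beta> (w n) (w n) + 2 * energy \<beta> (w n) \<phi> * s + energy \<beta> \<phi> \<phi> * s\<^sup>2)
      \<longlonglongrightarrow> robin_form \<beta> \<Omega> (torsion_function \<beta>) (torsion_function \<beta>) + 2 * robin_form \<beta> \<Omega> (torsion_function \<beta>) \<phi> * s + energy \<beta> \<phi> \<phi> * s\<^sup>2"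
    by (intro tendsto_intros energy_tendsto w smooth_approximates[OF \<phi>])
  have nn: "0 \<le> energy \<beta> (w n) (w n) + 2 * energy \<beta> (w n) \<phi> * s + energy \<beta> \<phi> \<phi> * s\<^sup>2" for n
    using energy_add_scale[OF _ \<phi>, of "w n" \<beta> s] w \<beta> energy_nonneg[of \<beta> "\<lambda>x. w n x + s * \<phi> x"]
    by (simp add: H1_lim_def)
  have "0 \<le> robin_form \<beta> \<Omega> (torsion_function \<beta>) (torsion_function \<beta>) + 2 * robin_form \<beta> \<Omega> (torsion_function \<beta>) \<phi> * s + energy \<beta> \<phi> \<phi> * s\<^sup>2"
    by (rule LIMSEQ_le_const[OF lim]) (use nn in blast)
  then show "0 \<le> robin_torsion \<beta> \<Omega> + 2 * (LINT x|vol. \<phi> x) * s + energy \<beta> \<phi> \<phi> * s\<^sup>2"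
    using t(2)[OF smooth_H1(1)[OF \<phi>]] t(4) by simp
qed (use \<beta> in \<open>auto intro: energy_nonneg\<close>)

lemma torsion_nonneg:
  assumes \<beta>: "0 < \<beta>"
  shows "0 \<le> robin_torsion \<beta> \<Omega>"
proof -
  note t = torsion_function[OF \<beta>]
  obtain w where w: "approximates w (torsion_function \<beta>)" using boundary_trace_H1_lim[OF t(1)] by blast
  have "(\<lambda>n. energy \<beta> (w n) (w n)) \<longlonglongrightarrow> robin_torsion \<beta> \<Omega>" unfolding t(4) by (rule energy_tendsto[OF w w])
  then show ?thesis by (rule LIMSEQ_le_const) (use \<beta> in \<open>auto intro!: exI[of _ 0] energy_nonneg\<close>)
qed

text \<open>Applied in the limit to the torsion function, the assumed inequality reads
  \<open>T\<^sup>2 \<le> K * T\<close>.\<close>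

lemma torsion_upper:
  assumes \<beta>: "0 < \<beta>" and K: "0 \<le> K" "\<And>\<phi>. smooth \<phi> \<Longrightarrow> (LINT x|vol. \<phi> x)\<^sup>2 \<le> K * energy \<beta> \<phi> \<phi>"
  shows "robin_torsion \<beta> \<Omega> \<le> K"
proof -
  note t = torsion_function[OF \<beta>]
  obtain w where w: "approximates w (torsion_function \<beta>)" using boundary_trace_H1_lim[OF t(1)] by blast
  have "(\<lambda>n. (LINT x|vol. w n x)\<^sup>2) \<longlonglongrightarrow> (robin_torsion \<beta> \<Omega>)\<^sup>2"
    unfolding t(3) using w by (intro tendsto_intros vol.L2_lim_integral) (simp add: H1_lim_def)
  moreover have "(\<lambda>n. K * energy \<beta> (w n) (w n)) \<longlonglongrightarrow> K * robin_torsion \<beta> \<Omega>"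
    unfolding t(4) by (intro tendsto_intros energy_tendsto[OF w w])
  ultimately have "(robin_torsion \<beta> \<Omega>)\<^sup>2 \<le> K * robin_torsion \<beta> \<Omega>"
    by (rule LIMSEQ_le) (use K(2) w in \<open>auto simp: H1_lim_def\<close>)
  then show ?thesis
    using torsion_nonneg[OF \<beta>] K(1) by (cases "robin_torsion \<beta> \<Omega> = 0") (auto simp: power2_eq_square)
qed

text \<open>The functions \<open>sqrt (\<phi>\<^sup>2 + \<epsilon>\<^sup>2)\<close> are smooth approximations of \<open>\<bar>\<phi>\<bar>\<close> with no larger gradient.\<close>

lemma torsion_lower_abs:
  assumes \<beta>: "0 < \<beta>" and \<phi>: "smooth \<phi>"
  shows "(LINT x|vol. \<bar>\<phi> x\<bar>)\<^sup>2 \<le> robin_torsion \<beta> \<Omega> * energy \<beta> \<phi> \<phi>"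
proof -
  define T where "T = robin_torsion \<beta> \<Omega>"
  have T: "0 \<le> T" unfolding T_def by (rule torsion_nonneg[OF \<beta>])
  \<comment> \<open>The total boundary measure: replacing \<open>\<bar>\<phi>\<bar>\<close> by
    \<open>sqrt (\<phi>\<^sup>2 + \<epsilon>\<^sup>2)\<close> adds at most
    \<open>\<beta> * \<epsilon>\<^sup>2 * M\<close> to the energy.\<close>
  define M where "M = (LINT x|bd. (1::real))"
  have le: "(LINT x|vol. \<bar>\<phi> x\<bar>)\<^sup>2 \<le> T * (energy \<beta> \<phi> \<phi> + \<beta> * (\<epsilon>\<^sup>2 * M))" if \<epsilon>: "\<epsilon> > 0" for \<epsilon>
  proof -
    define \<psi> where "\<psi> x = sqrt ((\<phi> x)\<^sup>2 + \<epsilon>\<^sup>2)" for x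
    have pos: "(\<phi> x)\<^sup>2 + \<epsilon>\<^sup>2 > 0" for x using \<epsilon> by (simp add: add_nonneg_pos)
    have s2: "smooth (\<lambda>x. (\<phi> x)\<^sup>2 + \<epsilon>\<^sup>2)" by (intro smooth_add smooth_power2 \<phi> smooth_const)
    have \<psi>: "smooth \<psi>" unfolding \<psi>_def by (rule smooth_sqrt[OF s2 pos])
    have \<psi>ge: "\<bar>\<phi> x\<bar> \<le> \<psi> x" for x unfolding \<psi>_def by (rule real_le_rsqrt) simp
    have \<psi>sq: "(\<psi> x)\<^sup>2 = (\<phi> x)\<^sup>2 + \<epsilon>\<^sup>2" for x unfolding \<psi>_def using pos[of x] by simp
    have \<psi>pos: "\<psi> x > 0" for x unfolding \<psi>_def using pos[of x] by simp
    have g: "norm (grad \<psi> x) \<le> norm (grad \<phi> x)" for x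
    proof -
      have "((\<lambda>y. sqrt (y\<^sup>2 + \<epsilon>\<^sup>2)) has_real_derivative (\<phi> x / \<psi> x)) (at (\<phi> x))"
        unfolding \<psi>_def using pos[of x] by (auto intro!: derivative_eq_intros simp: divide_simps)
      from grad_compose_real[OF \<phi> this]
      have "grad (\<lambda>x. sqrt ((\<phi> x)\<^sup>2 + \<epsilon>\<^sup>2)) x = (\<phi> x / \<psi> x) *\<^sub>R grad \<phi> x" .
      moreover have "grad \<psi> x = grad (\<lambda>x. sqrt ((\<phi> x)\<^sup>2 + \<epsilon>\<^sup>2)) x"
        by (rule arg_cong[where f = "\<lambda>f. grad f x"]) (auto simp: \<psi>_def)
      ultimately have "grad \<psi> x = (\<phi> x / \<psi> x) *\<^sub>R grad \<phi> x" by simp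
      moreover have "\<bar>\<phi> x / \<psi> x\<bar> * norm (grad \<phi> x) \<le> 1 * norm (grad \<phi> x)"
        using \<psi>ge[of x] \<psi>pos[of x] by (intro mult_right_mono) (auto simp: abs_divide)
      ultimately show ?thesis by simp
    qed
    note c = smooth_continuous[OF \<phi>] smooth_continuous[OF \<psi>] continuous_grad[OF \<phi>, of UNIV] continuous_grad[OF \<psi>, of UNIV]
    have "(LINT x|vol. (norm (grad \<psi> x))\<^sup>2) \<le> (LINT x|vol. (norm (grad \<phi> x))\<^sup>2)"
      using g by (intro integral_mono integrable_vol_continuous continuous_intros c power_mono) auto
    moreover have "(LINT x|bd. (\<psi> x)\<^sup>2) = (LINT x|bd. (\<phi> x)\<^sup>2) + \<epsilon>\<^sup>2 * M"
    proof -
      have i: "integrable bd (\<lambda>x. (\<phi> x)\<^sup>2)" by (intro integrable_bd_continuous continuous_intros c)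
      show ?thesis unfolding \<psi>sq M_def using i by (subst Bochner_Integration.integral_add) auto
    qed
    ultimately have "energy \<beta> \<psi> \<psi> \<le> energy \<beta> \<phi> \<phi> + \<beta> * (\<epsilon>\<^sup>2 * M)"
      unfolding energy_self using \<beta> by (simp add: algebra_simps)
    then have "T * energy \<beta> \<psi> \<psi> \<le> T * (energy \<beta> \<phi> \<phi> + \<beta> * (\<epsilon>\<^sup>2 * M))" using T by (rule mult_left_mono)
    moreover have "(LINT x|vol. \<psi> x)\<^sup>2 \<le> T * energy \<beta> \<psi> \<psi>" unfolding T_def by (rule torsion_lower[OF \<beta> \<psi>])
    moreover have "(LINT x|vol. \<bar>\<phi> x\<bar>)\<^sup>2 \<le> (LINT x|vol. \<psi> x)\<^sup>2"
      using \<psi>ge by (intro power_mono integral_mono integrable_vol_continuous continuous_intros c) auto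
    ultimately show ?thesis by linarith
  qed
  have "((\<lambda>\<epsilon>. T * (energy \<beta> \<phi> \<phi> + \<beta> * (\<epsilon>\<^sup>2 * M))) \<longlongrightarrow> T * (energy \<beta> \<phi> \<phi> + \<beta> * (0\<^sup>2 * M))) (at_right 0)"
    by (intro tendsto_intros)
  then have "(LINT x|vol. \<bar>\<phi> x\<bar>)\<^sup>2 \<le> T * (energy \<beta> \<phi> \<phi> + \<beta> * (0\<^sup>2 * M))"
    by (rule tendsto_lowerbound) (auto simp: eventually_at_filter le)
  then show ?thesis by (simp add: T_def)
qed

subsection \<open>The eigenvalue\<close>

lemma robin_form_nonneg: "0 \<le> \<beta> \<Longrightarrow> 0 \<le> robin_form \<beta> \<Omega> u u"
  unfolding robin_form_vol by (intro add_nonneg_nonneg mult_nonneg_nonneg integral_nonneg_AE) auto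

definition quotients :: "real \<Rightarrow> real set" where
  "quotients \<beta> = {robin_form \<beta> \<Omega> u u / (LINT x:\<Omega>|lebesgue. (u x)\<^sup>2) | u. u \<in> H1 \<Omega> \<and> \<not> (AE x\<in>\<Omega> in lebesgue. u x = 0)}"

lemma eigenvalue_quotients: "robin_eigenvalue \<beta> \<Omega> = Inf (quotients \<beta>)"
  by (simp add: robin_eigenvalue_def quotients_def)

lemma quotients_bdd: "0 \<le> \<beta> \<Longrightarrow> bdd_below (quotients \<beta>)"
  by (rule bdd_belowI[of _ 0])
    (auto simp: quotients_def set_integral_vol intro!: divide_nonneg_nonneg robin_form_nonneg)

lemma nonzero_iff:
  fixes u :: "'a \<Rightarrow> real"
  assumes "L2 vol u"
  shows "(AE x\<in>\<Omega> in lebesgue. u x = 0) \<longleftrightarrow> (LINT x|vol. (u x)\<^sup>2) = 0"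
proof -
  have "(AE x\<in>\<Omega> in lebesgue. u x = 0) \<longleftrightarrow> (AE x in vol. u x = 0)"
    by (simp add: AE_restrict_space_iff)
  also have "\<dots> \<longleftrightarrow> (LINT x|vol. (u x)\<^sup>2) = 0"
    using integral_nonneg_eq_0_iff_AE[OF L2_integrable_sq_real[OF assms]] by auto
  finally show ?thesis .
qed

lemma eigenvalue_upper:
  assumes \<beta>: "0 \<le> \<beta>" and \<phi>: "smooth \<phi>" "(LINT x|vol. (\<phi> x)\<^sup>2) > 0"
  shows "robin_eigenvalue \<beta> \<Omega> \<le> energy \<beta> \<phi> \<phi> / (LINT x|vol. (\<phi> x)\<^sup>2)"
proof -
  have L: "L2 vol \<phi>" by (rule L2_vol_continuous[OF smooth_continuous[OF \<phi>(1)]])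
  have "energy \<beta> \<phi> \<phi> / (LINT x|vol. (\<phi> x)\<^sup>2) \<in> quotients \<beta>"
    unfolding quotients_def
    using nonzero_iff[OF L] \<phi>(2) smooth_H1(1)[OF \<phi>(1)] robin_form_smooth[OF \<phi>(1) \<phi>(1), of \<beta>]
    by (auto simp: set_integral_vol intro!: exI[of _ \<phi>])
  then show ?thesis unfolding eigenvalue_quotients by (intro cInf_lower quotients_bdd[OF \<beta>])
qed

lemma quotients_nonempty:
  assumes "measure lebesgue \<Omega> > 0"
  shows "quotients \<beta> \<noteq> {}"
proof -
  have L: "L2 vol (\<lambda>_. 1::real)" by (rule vol.L2_const)
  have "(LINT x|vol. (1::real)\<^sup>2) \<noteq> 0" using assms by (simp add: space_restrict_space measure_restrict_space)
  then show ?thesis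
    unfolding quotients_def using nonzero_iff[OF L] smooth_H1(1)[OF smooth_const[of 1]] by blast
qed

text \<open>Density passes the inequality from smooth functions to \<open>H1\<close>. Read
  contrapositively, this yields smooth functions whose Rayleigh quotient lies below any given number
  above the eigenvalue.\<close>

lemma eigenvalue_lower:
  assumes m: "measure lebesgue \<Omega> > 0"
    and le: "\<And>\<phi>. smooth \<phi> \<Longrightarrow> L * (LINT x|vol. (\<phi> x)\<^sup>2) \<le> energy \<beta> \<phi> \<phi>"
  shows "L \<le> robin_eigenvalue \<beta> \<Omega>"
  unfolding eigenvalue_quotients
proof (rule cInf_greatest[OF quotients_nonempty[OF m]])
  fix y assume "y \<in> quotients \<beta>"
  then obtain u where u: "u \<in> H1 \<Omega>" "\<not> (AE x\<in>\<Omega> in lebesgue. u x = 0)"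
    "y = robin_form \<beta> \<Omega> u u / (LINT x|vol. (u x)\<^sup>2)"
    by (auto simp: quotients_def set_integral_vol)
  have "(LINT x|vol. (u x)\<^sup>2) \<noteq> 0" using u(2) nonzero_iff[OF H1_weak_grad(1)[OF u(1)]] by simp
  moreover have "(LINT x|vol. (u x)\<^sup>2) \<ge> 0" by simp
  ultimately have pos: "(LINT x|vol. (u x)\<^sup>2) > 0" by linarith
  obtain \<phi> where \<phi>: "approximates \<phi> u" using boundary_trace_H1_lim[OF u(1)] by blast
  have "(\<lambda>n. L * (LINT x|vol. (norm (\<phi> n x))\<^sup>2)) \<longlonglongrightarrow> L * (LINT x|vol. (norm (u x))\<^sup>2)"
    using \<phi> by (intro tendsto_intros L2_lim_sq) (simp add: H1_lim_def)
  moreover have "(\<lambda>n. energy \<beta> (\<phi> n) (\<phi> n)) \<longlonglongrightarrow> robin_form \<beta> \<Omega> u u" by (rule energy_tendsto[OF \<phi> \<phi>])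
  ultimately have "L * (LINT x|vol. (norm (u x))\<^sup>2) \<le> robin_form \<beta> \<Omega> u u"
    by (rule LIMSEQ_le) (use le \<phi> in \<open>auto simp: H1_lim_def\<close>)
  then show "L \<le> y" using pos u(3) by (simp add: pos_le_divide_eq)
qed

lemma eigenvalue_nonneg:
  assumes "measure lebesgue \<Omega> > 0" "0 \<le> \<beta>"
  shows "0 \<le> robin_eigenvalue \<beta> \<Omega>"
  by (rule eigenvalue_lower[OF assms(1)]) (use assms(2) in \<open>auto intro: energy_nonneg\<close>)

end

section \<open>The lower bound\<close>

lemma exists_ball_radius:
  assumes "0 < m"
  shows "\<exists>\<rho>>0. unit_ball_vol (real DIM('a::euclidean_space)) * \<rho> ^ DIM('a) = m"
proof -
  define V where "V = unit_ball_vol (real DIM('a))"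
  have V: "V > 0" by (simp add: V_def)
  have "root DIM('a) (m / V) > 0" "V * root DIM('a) (m / V) ^ DIM('a) = m"
    using assms V by (auto simp: real_root_pow_pos)
  then show ?thesis unfolding V_def by blast
qed

lemma product_lower_bound:
  fixes \<beta> :: real
  assumes \<beta>: "0 < \<beta>" and q: "0 < q" "q \<le> 1 / (real DIM('a::euclidean_space) + 1)"
  shows "\<exists>c>0. \<forall>\<Omega>::'a set. lipschitz_domain \<Omega> \<longrightarrow> measure lebesgue \<Omega> = 1 \<longrightarrow>
    c \<le> robin_eigenvalue \<beta> \<Omega> * robin_torsion \<beta> \<Omega> powr q"
proof -
  define d where "d = DIM('a)"
  define V where "V = unit_ball_vol (real DIM('a))"
  have V: "V > 0" by (simp add: V_def)
  obtain \<rho> where \<rho>: "\<rho> > 0" "V * \<rho> ^ DIM('a) = 1" using exists_ball_radius[where 'a='a, of 1] by (auto simp: V_def)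
  \<comment> \<open>\<open>K\<close> and \<open>a\<close> below satisfy the absorption condition of
    \<open>coercive\<close> simultaneously for all sets of measure one.\<close>
  define K where "K = variation_const TYPE('a)"
  have K: "K \<ge> 1" unfolding K_def by (rule variation_const_ge_1)
  define a where "a = min \<beta> (1 / (8 * \<rho> * K))"
  have a: "0 < a" "a \<le> \<beta>" using \<beta> \<rho> K by (auto simp: a_def)
  have a1: "8 * \<rho> * K * a \<le> 1"
  proof -
    have "8 * \<rho> * K * a \<le> 8 * \<rho> * K * (1 / (8 * \<rho> * K))"
      using \<rho> K by (intro mult_left_mono) (auto simp: a_def)
    then show ?thesis using \<rho> K by simp
  qed
  \<comment> \<open>The inverse of the coercivity constant, hence a lower bound for the eigenvalue
    of every set of measure one.\<close>
  define \<Lambda> where "\<Lambda> = a / (8 * \<rho> * K)"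
  have \<Lambda>: "\<Lambda> > 0" using a \<rho> K by (simp add: \<Lambda>_def)
  \<comment> \<open>With \<open>E < 2 * \<kappa> * I\<close> and
    \<open>1 \<le> \<kappa> / \<Lambda>\<close>, the variation bound
    \<open>K * (E / \<beta> + \<beta> * I)\<close> is at most
    \<open>K' * \<kappa> * I\<close>.\<close>
  define K' where "K' = K * (2 / \<beta> + \<beta> / \<Lambda>)"
  have K': "K' > 0" using K \<beta> \<Lambda> by (simp add: K'_def add_pos_pos)
  \<comment> \<open>The inequality \<open>V * r ^ d \<le> 4 * T * \<kappa>\<close> with
    \<open>r = 1 / (2 * K' * \<kappa>)\<close> becomes
    \<open>c1 / \<kappa> ^ (d + 1) \<le> T\<close>.\<close>
  define c1 where "c1 = V / (4 * (2 * K') ^ d)"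
  have c1: "c1 > 0" using V K' by (simp add: c1_def)
  \<comment> \<open>The power of \<open>\<kappa>\<close> left over in
    \<open>\<kappa> * T powr q\<close>. It is nonnegative precisely when
    \<open>q \<le> 1 / (d + 1)\<close>, and then \<open>\<Lambda> \<le> \<kappa>\<close> bounds it
    from below.\<close>
  define s where "s = 1 - q * (real d + 1)"
  have s: "s \<ge> 0" using q by (simp add: s_def d_def field_simps)
  have "c1 powr q * \<Lambda> powr s \<le> robin_eigenvalue \<beta> \<Omega> * robin_torsion \<beta> \<Omega> powr q"
    if lip: "lipschitz_domain \<Omega>" and m: "measure lebesgue \<Omega> = 1" for \<Omega> :: "'a set"
  proof -
    interpret lipschitz_dom \<Omega> by unfold_locales (rule lip)
    define \<kappa> where "\<kappa> = robin_eigenvalue \<beta> \<Omega>"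
    define T where "T = robin_torsion \<beta> \<Omega>"
    have mpos: "measure lebesgue \<Omega> > 0" using m by simp
    have "\<Lambda> \<le> \<kappa>"
      unfolding \<kappa>_def
    proof (rule eigenvalue_lower[OF mpos])
      fix \<phi> :: "'a \<Rightarrow> real" assume \<phi>: "smooth \<phi>"
      have "(LINT x|vol. (\<phi> x)\<^sup>2) \<le> 8 * \<rho> * K / a * energy \<beta> \<phi> \<phi>"
        unfolding K_def by (rule coercive[OF a \<rho>(1) _ _ \<phi>]) (use \<rho> m a1 in \<open>auto simp: V_def K_def\<close>)
      then have "\<Lambda> * (LINT x|vol. (\<phi> x)\<^sup>2) \<le> \<Lambda> * (8 * \<rho> * K / a * energy \<beta> \<phi> \<phi>)"
        using \<Lambda> by (intro mult_left_mono) auto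
      also have "\<dots> = energy \<beta> \<phi> \<phi>" using a \<rho> K by (simp add: \<Lambda>_def)
      finally show "\<Lambda> * (LINT x|vol. (\<phi> x)\<^sup>2) \<le> energy \<beta> \<phi> \<phi>" .
    qed
    then have \<kappa>: "\<kappa> > 0" "\<Lambda> \<le> \<kappa>" using \<Lambda> by auto
    \<comment> \<open>As \<open>2 * \<kappa>\<close> exceeds the eigenvalue, the hypothesis of
      \<open>eigenvalue_lower\<close> must fail for some smooth \<open>\<phi>\<close>.\<close>
    have "\<not> 2 * \<kappa> \<le> \<kappa>" using \<kappa> by simp
    then obtain \<phi> where \<phi>: "smooth \<phi>" "energy \<beta> \<phi> \<phi> < (2 * \<kappa>) * (LINT x|vol. (\<phi> x)\<^sup>2)"
      using eigenvalue_lower[OF mpos, of "2 * \<kappa>" \<beta>] unfolding \<kappa>_def by (meson not_le)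
    define I where "I = (LINT x|vol. (\<phi> x)\<^sup>2)"
    define I1 where "I1 = (LINT x|vol. \<bar>\<phi> x\<bar>)"
    define E where "E = energy \<beta> \<phi> \<phi>"
    have E: "0 \<le> E" "E < 2 * \<kappa> * I" unfolding E_def using \<phi>(2) \<beta> energy_nonneg[of \<beta> \<phi>] by (auto simp: I_def)
    have I: "I > 0"
    proof -
      have "0 < 2 * \<kappa> * I" using E by linarith
      then show ?thesis using \<kappa> by (simp add: zero_less_mult_iff)
    qed
    \<comment> \<open>Makes \<open>r\<close> times the variation bound
      \<open>K' * \<kappa> * I\<close> equal to \<open>I / 2\<close>, which is absorbed.\<close>
    define r where "r = 1 / (2 * (K' * \<kappa>))"
    have r: "r > 0" using K' \<kappa> by (simp add: r_def)
    have "total_variation_sq \<phi> \<le> K * (E / \<beta> + \<beta> * I)"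
      using total_variation_sq_le[OF \<phi>(1) \<beta> order_refl]
      by (simp add: K_def variation_const_def E_def I_def energy_self)
    also have "\<dots> \<le> K' * \<kappa> * I"
    proof -
      have "E / \<beta> \<le> 2 * \<kappa> * I / \<beta>" using E \<beta> by (intro divide_right_mono) auto
      moreover have "\<beta> * I \<le> \<beta> * I * (\<kappa> / \<Lambda>)"
        using mult_left_mono[of 1 "\<kappa> / \<Lambda>" "\<beta> * I"] \<kappa> \<Lambda> \<beta> I by simp
      ultimately have "K * (E / \<beta> + \<beta> * I) \<le> K * (2 * \<kappa> * I / \<beta> + \<beta> * I * (\<kappa> / \<Lambda>))"
        using K by (intro mult_left_mono) auto
      also have "\<dots> = K' * \<kappa> * I" using \<beta> \<Lambda> by (simp add: K'_def field_simps)
      finally show ?thesis .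
    qed
    finally have "r * total_variation_sq \<phi> \<le> r * (K' * \<kappa> * I)" using r by (intro mult_left_mono) auto
    also have "\<dots> = I / 2" using K' \<kappa> by (simp add: r_def)
    finally have "I \<le> I / 2 + I1\<^sup>2 / (V * r ^ d)"
      using Nash_inequality[OF \<phi>(1) r] by (simp add: I_def I1_def V_def d_def)
    then have "I / 2 \<le> I1\<^sup>2 / (V * r ^ d)" by linarith
    then have "V * r ^ d * (I / 2) \<le> I1\<^sup>2" using V r by (simp add: field_simps)
    also have "\<dots> \<le> T * E" unfolding I1_def T_def E_def by (rule torsion_lower_abs[OF \<beta> \<phi>(1)])
    also have "\<dots> \<le> T * (2 * \<kappa> * I)"
      using E torsion_nonneg[OF \<beta>] by (intro mult_left_mono) (auto simp: T_def)
    finally have "(V * r ^ d) * (I / 2) \<le> (4 * T * \<kappa>) * (I / 2)" by (simp add: mult_ac)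
    then have "V * r ^ d \<le> 4 * T * \<kappa>" using I by (subst (asm) mult_le_cancel_right) auto
    then have Tge: "c1 / \<kappa> ^ Suc d \<le> T"
      using \<kappa> K' by (simp add: c1_def r_def power_divide power_mult_distrib field_simps)
    have "c1 powr q * \<Lambda> powr s \<le> c1 powr q * \<kappa> powr s"
      using \<kappa> \<Lambda> s by (intro mult_left_mono powr_mono2) auto
    also have "\<dots> = \<kappa> * (c1 / \<kappa> ^ Suc d) powr q"
    proof -
      have "(c1 / \<kappa> ^ Suc d) powr q = c1 powr q / (\<kappa> powr (real d + 1)) powr q"
      proof -
        have "\<kappa> ^ Suc d = \<kappa> powr (real d + 1)"
          using \<kappa> powr_realpow[of \<kappa> "Suc d"] by (simp add: add.commute)
        then show ?thesis using \<kappa> c1 by (simp only: powr_divide)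
      qed
      also have "(\<kappa> powr (real d + 1)) powr q = \<kappa> powr (1 - s)"
        by (simp add: powr_powr s_def mult.commute)
      finally have "\<kappa> * (c1 / \<kappa> ^ Suc d) powr q = c1 powr q * (\<kappa> powr 1 / \<kappa> powr (1 - s))"
        using \<kappa> by simp
      also have "\<kappa> powr 1 / \<kappa> powr (1 - s) = \<kappa> powr s" by (simp only: powr_diff[symmetric]) simp
      finally show ?thesis by simp
    qed
    also have "\<dots> \<le> \<kappa> * T powr q"
      using \<kappa> Tge c1 q by (intro mult_left_mono powr_mono2) auto
    finally show ?thesis by (simp add: \<kappa>_def T_def)
  qed
  moreover have "c1 powr q * \<Lambda> powr s > 0" using c1 \<Lambda> by simp
  ultimately show ?thesis by blast
qed

section \<open>Unions of balls\<close>

text \<open>In the direction of the outward radius \<open>\<nu>\<close> at \<open>p\<close>, the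
  ball lies locally below the graph of a spherical cap over the orthogonal hyperplane.\<close>

lemma lipschitz_boundary_ball:
  fixes c :: "'a::euclidean_space"
  assumes r: "r > 0"
  shows "lipschitz_boundary (ball c r)"
  unfolding lipschitz_boundary_def
proof
  fix p assume "p \<in> frontier (ball c r)"
  then have p: "norm (p - c) = r" using r by (simp add: frontier_ball dist_norm norm_minus_commute)
  define \<nu> where "\<nu> = (1 / r) *\<^sub>R (p - c)"
  have \<nu>: "norm \<nu> = 1" using p r by (simp add: \<nu>_def)
  have \<nu>\<nu>: "\<nu> \<bullet> \<nu> = 1" using \<nu> by (simp add: dot_square_norm)
  have pc: "p - c = r *\<^sub>R \<nu>" using r by (simp add: \<nu>_def)
  define P where "P x = x - (x \<bullet> \<nu>) *\<^sub>R \<nu>" for x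
  \<comment> \<open>The slope of the cap is unbounded towards the equator; truncating the distance
    from the projected centre at \<open>r / 2\<close> gives a function that is Lipschitz on the
    whole hyperplane and unchanged near \<open>p\<close>.\<close>
  define t where "t y = min (norm (y - P c)) (r / 2)" for y
  define \<gamma> where "\<gamma> y = c \<bullet> \<nu> + sqrt (r\<^sup>2 - (t y)\<^sup>2)" for y
  have t: "0 \<le> t y" "t y \<le> r / 2" "(t y)\<^sup>2 \<le> r\<^sup>2 / 4" for y
  proof -
    show "0 \<le> t y" "t y \<le> r / 2" using r by (auto simp: t_def)
    then have "(t y)\<^sup>2 \<le> (r / 2)\<^sup>2" by (intro power_mono)
    then show "(t y)\<^sup>2 \<le> r\<^sup>2 / 4" by (simp add: power_divide)
  qed
  have sq: "r / 2 \<le> sqrt (r\<^sup>2 - (t y)\<^sup>2)" for y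
  proof (rule real_le_rsqrt)
    have "(r / 2)\<^sup>2 = r\<^sup>2 / 4" by (simp add: power_divide)
    then show "(r / 2)\<^sup>2 \<le> r\<^sup>2 - (t y)\<^sup>2"
      using t(3)[of y] zero_le_power2[of r] by linarith
  qed
  have lip: "1-lipschitz_on {y. y \<bullet> \<nu> = 0} \<gamma>"
  proof (rule lipschitz_onI)
    fix y z
    define A where "A = sqrt (r\<^sup>2 - (t y)\<^sup>2)"
    define B where "B = sqrt (r\<^sup>2 - (t z)\<^sup>2)"
    have AB: "r / 2 \<le> A" "r / 2 \<le> B" unfolding A_def B_def by (rule sq)+
    have "A\<^sup>2 = r\<^sup>2 - (t y)\<^sup>2" "B\<^sup>2 = r\<^sup>2 - (t z)\<^sup>2"
    proof -
      have "(t y)\<^sup>2 \<le> r\<^sup>2" "(t z)\<^sup>2 \<le> r\<^sup>2"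
        using t(3)[of y] t(3)[of z] zero_le_power2[of r] by linarith+
      then show "A\<^sup>2 = r\<^sup>2 - (t y)\<^sup>2" "B\<^sup>2 = r\<^sup>2 - (t z)\<^sup>2"
        unfolding A_def B_def by (auto simp: real_sqrt_pow2)
    qed
    \<comment> \<open>Since \<open>A + B \<ge> r\<close> while \<open>t z + t y \<le> r\<close>,
      this identity gives the Lipschitz constant 1.\<close>
    then have "(A - B) * (A + B) = (t z - t y) * (t z + t y)" by (simp add: power2_eq_square algebra_simps)
    then have "\<bar>A - B\<bar> * (A + B) = \<bar>t z - t y\<bar> * (t z + t y)"
    proof -
      have "\<bar>A + B\<bar> = A + B" "\<bar>t z + t y\<bar> = t z + t y" using AB r t(1)[of y] t(1)[of z] by auto
      then show ?thesis using \<open>(A - B) * (A + B) = (t z - t y) * (t z + t y)\<close> by (metis abs_mult)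
    qed
    also have "\<dots> \<le> \<bar>t z - t y\<bar> * r" using t(2)[of y] t(2)[of z] by (intro mult_left_mono) auto
    finally have "\<bar>A - B\<bar> * r \<le> \<bar>t z - t y\<bar> * r"
      using AB mult_left_mono[of r "A + B" "\<bar>A - B\<bar>"] by linarith
    then have "\<bar>A - B\<bar> \<le> \<bar>t z - t y\<bar>" using r by simp
    also have "\<dots> \<le> \<bar>norm (z - P c) - norm (y - P c)\<bar>" by (simp add: t_def min_def)
    also have "\<dots> \<le> norm ((z - P c) - (y - P c))" by (rule norm_triangle_ineq3)
    finally show "dist (\<gamma> y) (\<gamma> z) \<le> 1 * dist y z"
      by (simp add: \<gamma>_def A_def B_def dist_norm norm_minus_commute)
  qed simp
  \<comment> \<open>In this neighbourhood the height \<open>h\<close> above the centre is positive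
    and the horizontal part \<open>w\<close> is shorter than \<open>r / 2\<close>, so the truncation
    is inactive and membership in the ball can be solved for the height.\<close>
  have "ball c r \<inter> ball p (r / 2) = {x \<in> ball p (r / 2). x \<bullet> \<nu> < \<gamma> (x - (x \<bullet> \<nu>) *\<^sub>R \<nu>)}"
  proof (intro set_eqI)
    fix x
    have "x \<in> ball c r \<longleftrightarrow> x \<bullet> \<nu> < \<gamma> (P x)" if x: "x \<in> ball p (r / 2)"
    proof -
      define h where "h = (x - c) \<bullet> \<nu>"
      define w where "w = P x - P c"
      have xp: "norm (x - p) < r / 2" using x by (simp add: dist_norm norm_minus_commute)
      have xc: "x - c = w + h *\<^sub>R \<nu>"
        by (simp add: w_def h_def P_def inner_diff_left algebra_simps)
      have w\<nu>: "w \<bullet> \<nu> = 0" by (simp add: w_def P_def inner_diff_left \<nu>\<nu>)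
      have "(x - p) \<bullet> \<nu> = h - r"
      proof -
        have "(x - p) \<bullet> \<nu> = (x - c) \<bullet> \<nu> - (p - c) \<bullet> \<nu>" by (simp add: inner_diff_left)
        then show ?thesis unfolding pc h_def by (simp add: \<nu>\<nu>)
      qed
      moreover have "\<bar>(x - p) \<bullet> \<nu>\<bar> \<le> norm (x - p)" using Cauchy_Schwarz_ineq2[of "x - p" \<nu>] \<nu> by simp
      ultimately have h: "h > 0" using xp by linarith
      have "x - p = w + (h - r) *\<^sub>R \<nu>"
      proof -
        have "x - p = (x - c) - (p - c)" by simp
        then show ?thesis unfolding xc pc by (simp add: algebra_simps)
      qed
      then have "(norm (x - p))\<^sup>2 = (norm w)\<^sup>2 + (h - r)\<^sup>2"
        by (simp only: power2_norm_eq_inner inner_add_left inner_add_right inner_scaleR_left inner_scaleR_right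
            w\<nu> \<nu>\<nu> inner_commute[of \<nu> w]) (simp add: power2_eq_square)
      then have "(norm w)\<^sup>2 \<le> (norm (x - p))\<^sup>2" by simp
      then have "norm w \<le> norm (x - p)" by (rule power2_le_imp_le) simp
      then have tw: "t (P x) = norm w" using xp by (simp add: t_def w_def)
      have "(norm (x - c))\<^sup>2 = (norm w)\<^sup>2 + h\<^sup>2"
        unfolding xc
        by (simp only: power2_norm_eq_inner inner_add_left inner_add_right inner_scaleR_left inner_scaleR_right
            w\<nu> \<nu>\<nu> inner_commute[of \<nu> w]) (simp add: power2_eq_square)
      moreover have "norm (x - c) < r \<longleftrightarrow> (norm (x - c))\<^sup>2 < r\<^sup>2"
        using r by (meson less_imp_le norm_ge_zero power2_less_imp_less power_strict_mono zero_less_numeral)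
      ultimately have "x \<in> ball c r \<longleftrightarrow> h\<^sup>2 < r\<^sup>2 - (norm w)\<^sup>2"
        by (auto simp: dist_norm norm_minus_commute)
      also have "\<dots> \<longleftrightarrow> h < sqrt (r\<^sup>2 - (norm w)\<^sup>2)"
        using h real_sqrt_less_iff[of "h\<^sup>2" "r\<^sup>2 - (norm w)\<^sup>2"] by simp
      also have "\<dots> \<longleftrightarrow> x \<bullet> \<nu> < \<gamma> (P x)"
        by (auto simp: \<gamma>_def tw h_def inner_diff_left)
      finally show ?thesis .
    qed
    then show "x \<in> ball c r \<inter> ball p (r / 2) \<longleftrightarrow> x \<in> {x \<in> ball p (r / 2). x \<bullet> \<nu> < \<gamma> (x - (x \<bullet> \<nu>) *\<^sub>R \<nu>)}"
      unfolding P_def by blast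
  qed
  then show "\<exists>U \<nu> \<gamma> L. open U \<and> p \<in> U \<and> norm \<nu> = 1 \<and> L-lipschitz_on {y. y \<bullet> \<nu> = 0} \<gamma> \<and>
      ball c r \<inter> U = {x \<in> U. x \<bullet> \<nu> < \<gamma> (x - (x \<bullet> \<nu>) *\<^sub>R \<nu>)}"
    using \<nu> lip r by (intro exI[of _ "ball p (r / 2)"] exI[of _ \<nu>] exI[of _ \<gamma>] exI[of _ 1]) auto
qed

lemma lipschitz_domain_ball: "r > 0 \<Longrightarrow> lipschitz_domain (ball c r)"
  by (simp add: lipschitz_domain_def lipschitz_boundary_ball)

text \<open>Disjointness is required of the closed balls: the union of two tangent open balls is not
  a Lipschitz subgraph near the point of contact.\<close>

locale separated_balls =
  fixes I :: "'i set" and c :: "'i \<Rightarrow> 'a::euclidean_space" and r :: "'i \<Rightarrow> real"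
  assumes finite_index: "finite I" and radius_pos: "\<And>i. i \<in> I \<Longrightarrow> 0 < r i"
    and separated: "\<And>i j. i \<in> I \<Longrightarrow> j \<in> I \<Longrightarrow> i \<noteq> j \<Longrightarrow> cball (c i) (r i) \<inter> cball (c j) (r j) = {}"
begin

definition balls :: "'a set" where "balls = (\<Union>i\<in>I. ball (c i) (r i))"

lemma balls_disjoint:
  assumes "i \<in> I" "j \<in> I" "x \<in> cball (c i) (r i)" "x \<in> cball (c j) (r j)"
  shows "i = j"
  using separated[OF assms(1,2)] assms(3,4) by blast

lemma open_balls: "open balls" unfolding balls_def by auto

lemma closure_balls: "closure balls = (\<Union>i\<in>I. cball (c i) (r i))"
proof -
  have "closure balls = (\<Union>i\<in>I. closure (ball (c i) (r i)))"
    unfolding balls_def using finite_index by (induction I rule: finite_induct) auto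
  also have "\<dots> = (\<Union>i\<in>I. cball (c i) (r i))"
    using radius_pos by (intro SUP_cong refl closure_ball)
  finally show ?thesis .
qed

lemma frontier_balls: "frontier balls = (\<Union>i\<in>I. frontier (ball (c i) (r i)))"
proof -
  have "frontier balls = closure balls - balls"
    using open_balls by (simp add: frontier_def interior_open)
  also have "\<dots> = (\<Union>i\<in>I. cball (c i) (r i) - ball (c i) (r i))"
  proof (intro equalityI subsetI)
    fix x assume "x \<in> (\<Union>i\<in>I. cball (c i) (r i) - ball (c i) (r i))"
    then obtain i where i: "i \<in> I" "x \<in> cball (c i) (r i)" "x \<notin> ball (c i) (r i)" by blast
    have "x \<notin> balls"
    proof
      assume "x \<in> balls"
      then obtain j where j: "j \<in> I" "x \<in> ball (c j) (r j)" by (auto simp: balls_def)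
      then have "i = j" using balls_disjoint[OF i(1) j(1) i(2)] ball_subset_cball by blast
      then show False using i j by simp
    qed
    then show "x \<in> closure balls - balls" using i unfolding closure_balls by blast
  next
    fix x assume x: "x \<in> closure balls - balls"
    then obtain i where i: "i \<in> I" "x \<in> cball (c i) (r i)" unfolding closure_balls by blast
    have "x \<notin> ball (c i) (r i)" using x i(1) by (auto simp: balls_def)
    then show "x \<in> (\<Union>i\<in>I. cball (c i) (r i) - ball (c i) (r i))" using i by blast
  qed
  also have "\<dots> = (\<Union>i\<in>I. frontier (ball (c i) (r i)))"
  proof (intro SUP_cong refl)
    fix i assume "i \<in> I"
    then show "cball (c i) (r i) - ball (c i) (r i) = frontier (ball (c i) (r i))"
      using radius_pos by (simp add: frontier_def interior_open)
  qed
  finally show ?thesis .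
qed

lemma lipschitz_balls: "lipschitz_domain balls"
  unfolding lipschitz_domain_def
proof (intro conjI open_balls)
  show "bounded balls" unfolding balls_def using finite_index by auto
  show "lipschitz_boundary balls"
    unfolding lipschitz_boundary_def
  proof
    fix p assume "p \<in> frontier balls"
    then obtain i where i: "i \<in> I" "p \<in> frontier (ball (c i) (r i))" using frontier_balls by auto
    then have pc: "p \<in> cball (c i) (r i)" using radius_pos[OF i(1)] by (auto simp: frontier_ball)
    obtain U \<nu> \<gamma> L where U: "open U" "p \<in> U" "norm \<nu> = 1" "L-lipschitz_on {y. y \<bullet> \<nu> = 0} \<gamma>"
      "ball (c i) (r i) \<inter> U = {x \<in> U. x \<bullet> \<nu> < \<gamma> (x - (x \<bullet> \<nu>) *\<^sub>R \<nu>)}"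
      using lipschitz_boundary_ball[OF radius_pos[OF i(1)], of "c i", unfolded lipschitz_boundary_def, rule_format, OF i(2)]
      by blast
    \<comment> \<open>Removing the other closed balls from the chart leaves an open neighbourhood
      that sees only ball \<open>i\<close>.\<close>
    define W where "W = U - (\<Union>j\<in>I - {i}. cball (c j) (r j))"
    have W: "open W" unfolding W_def using U(1) finite_index by (intro open_Diff closed_UN) auto
    have pW: "p \<in> W" unfolding W_def using U(2) balls_disjoint[OF i(1) _ pc] by blast
    have "balls \<inter> W = ball (c i) (r i) \<inter> W"
    proof (intro equalityI subsetI)
      fix x assume "x \<in> balls \<inter> W"
      then obtain j where "j \<in> I" "x \<in> ball (c j) (r j)" "x \<in> W" by (auto simp: balls_def)
      moreover then have "j = i" unfolding W_def using ball_subset_cball by blast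
      ultimately show "x \<in> ball (c i) (r i) \<inter> W" by blast
    qed (use i in \<open>auto simp: balls_def\<close>)
    also have "\<dots> = {x \<in> W. x \<bullet> \<nu> < \<gamma> (x - (x \<bullet> \<nu>) *\<^sub>R \<nu>)}"
    proof -
      have "W \<subseteq> U" by (auto simp: W_def)
      then have "ball (c i) (r i) \<inter> W = (ball (c i) (r i) \<inter> U) \<inter> W" by blast
      also have "\<dots> = {x \<in> W. x \<bullet> \<nu> < \<gamma> (x - (x \<bullet> \<nu>) *\<^sub>R \<nu>)}" unfolding U(5) using \<open>W \<subseteq> U\<close> by blast
      finally show ?thesis .
    qed
    finally show "\<exists>U \<nu> \<gamma> L. open U \<and> p \<in> U \<and> norm \<nu> = 1 \<and> L-lipschitz_on {y. y \<bullet> \<nu> = 0} \<gamma> \<and>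
        balls \<inter> U = {x \<in> U. x \<bullet> \<nu> < \<gamma> (x - (x \<bullet> \<nu>) *\<^sub>R \<nu>)}"
      using W pW U(3,4) by (intro exI[of _ W] exI[of _ \<nu>] exI[of _ \<gamma>] exI[of _ L]) auto
  qed
qed

sublocale lipschitz_dom balls by unfold_locales (rule lipschitz_balls)

end

section \<open>Measure of spheres and a smooth cutoff\<close>

lemma measure_ball_lebesgue:
  fixes c :: "'a::euclidean_space"
  assumes "0 \<le> r"
  shows "measure lebesgue (ball c r) = unit_ball_vol (real DIM('a)) * r ^ DIM('a)"
  using content_ball[OF assms, of c] by simp

lemma square_le_of_abs_le: "\<bar>x\<bar> \<le> y \<Longrightarrow> x\<^sup>2 \<le> y\<^sup>2" for x y :: real
  using power_mono[of "\<bar>x\<bar>" y 2] by simp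

lemma set_integrable_boundary:
  "set_integrable surface_measure (frontier \<Omega>) f \<longleftrightarrow> integrable (boundary_measure \<Omega>) f"
  for f :: "'a::euclidean_space \<Rightarrow> 'b::{banach, second_countable_topology}"
  by (simp add: set_integrable_def boundary_measure_def integrable_restrict_space)

lemma set_integral_boundary:
  "(LINT x:frontier \<Omega>|surface_measure. f x) = (LINT x|boundary_measure \<Omega>. f x)"
  for f :: "'a::euclidean_space \<Rightarrow> 'b::{banach, second_countable_topology}"
  by (simp add: set_lebesgue_integral_def boundary_measure_def integral_restrict_space)

lemma power_diff_le:
  fixes x y :: real
  assumes "0 \<le> y" "y \<le> x"
  shows "x ^ n - y ^ n \<le> real n * x ^ (n - 1) * (x - y)"
proof -
  have "y ^ (n - Suc i) * x ^ i \<le> x ^ (n - 1)" if "i < n" for i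
  proof -
    have "y ^ (n - Suc i) * x ^ i \<le> x ^ (n - Suc i) * x ^ i"
      using assms by (intro mult_right_mono power_mono) auto
    also have "\<dots> = x ^ (n - 1)" using that by (simp add: power_add[symmetric])
    finally show ?thesis .
  qed
  then have "(\<Sum>i<n. y ^ (n - Suc i) * x ^ i) \<le> real n * x ^ (n - 1)"
    using sum_bounded_above[of "{..<n}" "\<lambda>i. y ^ (n - Suc i) * x ^ i"] by simp
  then have "(x - y) * (\<Sum>i<n. y ^ (n - Suc i) * x ^ i) \<le> (x - y) * (real n * x ^ (n - 1))"
    using assms by (intro mult_left_mono) auto
  then show ?thesis by (simp add: power_diff_sumr2 mult_ac)
qed

text \<open>An upper bound for the area of the unit sphere, from the volume of a shell: for
  \<open>\<eta> < R\<close>, the difference of \<open>(R + \<eta>) ^ d\<close> and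
  \<open>(R - \<eta>) ^ d\<close> is at most
  \<open>2 * \<eta> * d * (2 * R) ^ (d - 1)\<close>.\<close>

definition sphere_const :: "'a::euclidean_space itself \<Rightarrow> real" where
  "sphere_const _ = minkowski_const TYPE('a) *
     (2 * unit_ball_vol (real DIM('a)) * real DIM('a) * 2 ^ (DIM('a) - 1))"

lemma sphere_const_pos: "0 < sphere_const TYPE('a::euclidean_space)"
  using minkowski_const_pos[where 'a='a] by (simp add: sphere_const_def)

lemma hausdorff_sphere:
  fixes c :: "'a::euclidean_space"
  assumes R: "0 < R"
  shows "hausdorff_outer (DIM('a) - 1) (sphere c R) \<le> ennreal (sphere_const TYPE('a) * R ^ (DIM('a) - 1))"
proof -
  define d where "d = DIM('a)"
  define V where "V = unit_ball_vol (real d)"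
  have V: "V > 0" by (simp add: V_def)
  define B where "B = 2 * V * real d * (2 * R) ^ (d - 1)"
  have "hausdorff_outer (DIM('a) - 1) (sphere c R) \<le> ennreal (minkowski_const TYPE('a) * B)"
  proof (rule hausdorff_outer_le_minkowski[OF _ R])
    show "0 \<le> B" using R V by (simp add: B_def)
    fix \<eta> :: real assume \<eta>: "0 < \<eta>" "\<eta> < R"
    have "(\<Union>p\<in>sphere c R. ball p \<eta>) \<subseteq> cball c (R + \<eta>) - ball c (R - \<eta>)"
    proof
      fix x assume "x \<in> (\<Union>p\<in>sphere c R. ball p \<eta>)"
      then obtain p where "dist c p = R" "dist p x < \<eta>" by auto
      then show "x \<in> cball c (R + \<eta>) - ball c (R - \<eta>)"
        using dist_triangle[of c x p] dist_triangle[of c p x] by (auto simp: dist_commute)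
    qed
    then have "emeasure lborel (\<Union>p\<in>sphere c R. ball p \<eta>) \<le> emeasure lborel (cball c (R + \<eta>) - ball c (R - \<eta>))"
      by (rule emeasure_mono) simp
    also have "\<dots> = emeasure lborel (cball c (R + \<eta>)) - emeasure lborel (ball c (R - \<eta>))"
      using \<eta> emeasure_bounded_finite[OF bounded_ball, of c "R - \<eta>"] by (intro emeasure_Diff) auto
    also have "\<dots> = ennreal (V * (R + \<eta>) ^ d - V * (R - \<eta>) ^ d)"
      using \<eta> V by (simp add: emeasure_cball emeasure_ball ennreal_minus V_def d_def)
    also have "\<dots> \<le> ennreal (B * \<eta>)"
    proof (rule ennreal_leI)
      have "(R + \<eta>) ^ d - (R - \<eta>) ^ d \<le> real d * (R + \<eta>) ^ (d - 1) * ((R + \<eta>) - (R - \<eta>))"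
        using \<eta> by (intro power_diff_le) auto
      also have "\<dots> \<le> real d * (2 * R) ^ (d - 1) * (2 * \<eta>)"
        using \<eta> by (intro mult_mono power_mono) auto
      finally have "V * ((R + \<eta>) ^ d - (R - \<eta>) ^ d) \<le> V * (real d * (2 * R) ^ (d - 1) * (2 * \<eta>))"
        using V by (intro mult_left_mono) auto
      then show "V * (R + \<eta>) ^ d - V * (R - \<eta>) ^ d \<le> B * \<eta>"
        by (simp add: B_def algebra_simps)
    qed
    finally show "emeasure lborel (\<Union>p\<in>sphere c R. ball p \<eta>) \<le> ennreal (B * \<eta>)" .
  qed
  also have "minkowski_const TYPE('a) * B = sphere_const TYPE('a) * R ^ (DIM('a) - 1)"
    by (simp add: sphere_const_def B_def V_def d_def power_mult_distrib mult_ac)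
  finally show ?thesis .
qed

lemma exists_smooth_cutoff:
  "\<exists>\<psi>::'a::euclidean_space \<Rightarrow> real. smooth \<psi> \<and> (\<forall>x. norm x \<le> 1 \<longrightarrow> \<psi> x = 1) \<and> (\<forall>x. 2 \<le> norm x \<longrightarrow> \<psi> x = 0)"
proof -
  \<comment> \<open>\<open>f\<close> vanishes outside the ball of radius 2 and \<open>g\<close> on
    the unit ball, never both at once, so \<open>f / (f + g)\<close> is a smooth cutoff.\<close>
  define f g :: "'a \<Rightarrow> real" where "f x = bump (4 - (norm x)\<^sup>2)" and "g x = bump ((norm x)\<^sup>2 - 1)" for x
  have n: "smooth (\<lambda>x::'a. (norm x)\<^sup>2)" using smooth_norm_sq[of "0::'a"] by simp
  have f: "smooth f" and g: "smooth g"
    unfolding f_def g_def by (intro smooth_bump smooth_diff smooth_const n)+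
  have pos: "f x + g x > 0" for x
  proof (cases "(norm x)\<^sup>2 < 4")
    case True
    then show ?thesis unfolding f_def g_def by (intro add_pos_nonneg bump_pos bump_nonneg) auto
  next
    case False
    then show ?thesis unfolding f_def g_def by (intro add_nonneg_pos bump_pos bump_nonneg) auto
  qed
  define \<psi> where "\<psi> x = f x * (1 / (f x + g x))" for x
  have "smooth \<psi>" unfolding \<psi>_def by (intro smooth_mult smooth_inverse smooth_add f g pos)
  moreover have "\<psi> x = 1" if "norm x \<le> 1" for x
  proof -
    have "(norm x)\<^sup>2 \<le> 1" using power_mono[OF that, of 2] by simp
    then have "g x = 0" by (simp add: g_def bump_nonpos)
    then show ?thesis using pos[of x] by (simp add: \<psi>_def)
  qed
  moreover have "\<psi> x = 0" if "2 \<le> norm x" for x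
  proof -
    have "4 \<le> (norm x)\<^sup>2" using power_mono[OF that, of 2] by simp
    then show ?thesis by (simp add: \<psi>_def f_def bump_nonpos)
  qed
  ultimately show ?thesis by blast
qed

section \<open>Integrals, torsion and eigenvalue of a union of balls\<close>

context separated_balls
begin

lemma ball_domain: "i \<in> I \<Longrightarrow> lipschitz_dom (ball (c i) (r i))"
  by (simp add: lipschitz_dom_def lipschitz_domain_ball radius_pos)

lemma integral_vol_balls:
  fixes f :: "'a \<Rightarrow> real"
  assumes f: "continuous_on UNIV f"
  shows "(LINT x|lebesgue_on balls. f x) = (\<Sum>i\<in>I. LINT x|lebesgue_on (ball (c i) (r i)). f x)"
proof -
  have disj: "disjoint_family_on (\<lambda>i. ball (c i) (r i)) I"
    unfolding disjoint_family_on_def using separated ball_subset_cball by blast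
  have si: "set_integrable lebesgue (ball (c i) (r i)) f" if "i \<in> I" for i
  proof -
    interpret b: lipschitz_dom "ball (c i) (r i)" by (rule ball_domain[OF that])
    show ?thesis
      using b.integrable_vol_continuous[OF f] by (simp add: set_integrable_def integrable_restrict_space)
  qed
  have "(LINT x|lebesgue_on balls. f x) = (LINT x:balls|lebesgue. f x)" by (rule set_integral_vol[symmetric])
  also have "\<dots> = (\<Sum>i\<in>I. LINT x:ball (c i) (r i)|lebesgue. f x)"
    unfolding balls_def using finite_index disj si by (rule set_integral_finite_Union) auto
  also have "\<dots> = (\<Sum>i\<in>I. LINT x|lebesgue_on (ball (c i) (r i)). f x)"
    by (intro sum.cong refl) (simp add: set_lebesgue_integral_def integral_restrict_space)
  finally show ?thesis .
qed

lemma integral_bd_balls: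
  fixes f :: "'a \<Rightarrow> real"
  assumes f: "continuous_on UNIV f"
  shows "(LINT x|boundary_measure balls. f x) = (\<Sum>i\<in>I. LINT x|boundary_measure (ball (c i) (r i)). f x)"
proof -
  have disj: "disjoint_family_on (\<lambda>i. frontier (ball (c i) (r i))) I"
    unfolding disjoint_family_on_def
  proof (intro ballI impI)
    fix i j assume "i \<in> I" "j \<in> I" "i \<noteq> j"
    moreover have "frontier (ball (c l) (r l)) \<subseteq> cball (c l) (r l)" if "l \<in> I" for l
      using closure_ball[OF radius_pos[OF that]] by (auto simp: frontier_def)
    ultimately show "frontier (ball (c i) (r i)) \<inter> frontier (ball (c j) (r j)) = {}"
      using separated[of i j] by blast
  qed
  have si: "set_integrable surface_measure (frontier (ball (c i) (r i))) f" if "i \<in> I" for i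
  proof -
    interpret b: lipschitz_dom "ball (c i) (r i)" by (rule ball_domain[OF that])
    show ?thesis unfolding set_integrable_boundary by (rule b.integrable_bd_continuous[OF f])
  qed
  have "(LINT x|boundary_measure balls. f x) = (LINT x:frontier balls|surface_measure. f x)"
    by (rule set_integral_boundary[symmetric])
  also have "\<dots> = (\<Sum>i\<in>I. LINT x:frontier (ball (c i) (r i))|surface_measure. f x)"
    unfolding frontier_balls using finite_index disj si
    by (rule set_integral_finite_Union) (simp_all only: sets_hausdorff borel_closed[OF frontier_closed])
  also have "\<dots> = (\<Sum>i\<in>I. LINT x|boundary_measure (ball (c i) (r i)). f x)"
    by (simp only: set_integral_boundary)
  finally show ?thesis .
qed

lemma measure_balls: "measure lebesgue balls = (\<Sum>i\<in>I. unit_ball_vol (real DIM('a)) * r i ^ DIM('a))"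
proof -
  have "measure lebesgue balls = (LINT x|lebesgue_on balls. 1)"
    using open_balls by (simp add: space_restrict_space measure_restrict_space)
  also have "\<dots> = (\<Sum>i\<in>I. LINT x|lebesgue_on (ball (c i) (r i)). 1)"
    by (rule integral_vol_balls) simp
  also have "\<dots> = (\<Sum>i\<in>I. measure lebesgue (ball (c i) (r i)))"
    by (simp add: space_restrict_space measure_restrict_space)
  also have "\<dots> = (\<Sum>i\<in>I. unit_ball_vol (real DIM('a)) * r i ^ DIM('a))"
    by (intro sum.cong refl measure_ball_lebesgue less_imp_le radius_pos)
  finally show ?thesis .
qed

lemma energy_balls:
  assumes \<phi>: "smooth \<phi>"
  shows "energy \<beta> \<phi> \<phi> = (\<Sum>i\<in>I. lipschitz_dom.energy (ball (c i) (r i)) \<beta> \<phi> \<phi>)"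
proof -
  have "energy \<beta> \<phi> \<phi> = (\<Sum>i\<in>I. (LINT x|lebesgue_on (ball (c i) (r i)). (norm (grad \<phi> x))\<^sup>2) +
      \<beta> * (LINT x|boundary_measure (ball (c i) (r i)). (\<phi> x)\<^sup>2))"
    unfolding energy_self sum.distrib sum_distrib_left[symmetric]
    by (intro arg_cong2[of _ _ _ _ "(+)"] arg_cong2[of _ _ _ _ "(*)"] refl integral_vol_balls integral_bd_balls
        continuous_intros continuous_grad smooth_continuous \<phi>)
  also have "\<dots> = (\<Sum>i\<in>I. lipschitz_dom.energy (ball (c i) (r i)) \<beta> \<phi> \<phi>)"
    by (intro sum.cong refl) (simp add: lipschitz_dom.energy_self[OF ball_domain])
  finally show ?thesis .
qed

text \<open>\<open>coercive\<close> on each ball bounds its share of the integral by the square root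
  of \<open>K i * E i\<close>, and Cauchy-Schwarz for sums adds the constants \<open>K i\<close>.
  Working ball by ball is essential: each then contributes order \<open>r i ^ (d + 1)\<close>,
  whereas the constant for the whole union would see only the total volume.\<close>

lemma torsion_balls_le:
  assumes \<beta>: "0 < \<beta>" and small: "\<And>i. i \<in> I \<Longrightarrow> 8 * r i * variation_const TYPE('a) * \<beta> \<le> 1"
  shows "robin_torsion \<beta> balls \<le>
    (\<Sum>i\<in>I. unit_ball_vol (real DIM('a)) * r i ^ DIM('a) * (8 * r i * variation_const TYPE('a) / \<beta>))"
proof -
  define K where "K i = unit_ball_vol (real DIM('a)) * r i ^ DIM('a) * (8 * r i * variation_const TYPE('a) / \<beta>)" for i
  have Kn: "0 \<le> K i" if "i \<in> I" for i
    using radius_pos[OF that] \<beta> variation_const_ge_1[where 'a='a] by (simp add: K_def)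
  have "robin_torsion \<beta> balls \<le> (\<Sum>i\<in>I. K i)"
  proof (rule torsion_upper[OF \<beta>])
    show "0 \<le> (\<Sum>i\<in>I. K i)" by (intro sum_nonneg Kn)
    fix \<phi> :: "'a \<Rightarrow> real" assume \<phi>: "smooth \<phi>"
    define E where "E i = lipschitz_dom.energy (ball (c i) (r i)) \<beta> \<phi> \<phi>" for i
    define X where "X i = (LINT x|lebesgue_on (ball (c i) (r i)). \<phi> x)" for i
    have E: "0 \<le> E i" if "i \<in> I" for i
      unfolding E_def using lipschitz_dom.energy_nonneg[OF ball_domain[OF that]] \<beta> by simp
    have X: "\<bar>X i\<bar> \<le> sqrt (K i) * sqrt (E i)" if i: "i \<in> I" for i
    proof -
      interpret b: lipschitz_dom "ball (c i) (r i)" by (rule ball_domain[OF i])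
      define J where "J = (LINT x|lebesgue_on (ball (c i) (r i)). (\<phi> x)\<^sup>2)"
      have m: "measure lebesgue (ball (c i) (r i)) = unit_ball_vol (real DIM('a)) * r i ^ DIM('a)"
        by (intro measure_ball_lebesgue less_imp_le radius_pos i)
      have "\<bar>X i\<bar> \<le> (LINT x|lebesgue_on (ball (c i) (r i)). \<bar>\<phi> x\<bar>)"
        unfolding X_def by (rule integral_abs_bound)
      then have "(X i)\<^sup>2 \<le> (LINT x|lebesgue_on (ball (c i) (r i)). \<bar>\<phi> x\<bar>)\<^sup>2"
        by (rule square_le_of_abs_le)
      also have "\<dots> \<le> measure lebesgue (ball (c i) (r i)) * J"
        unfolding J_def by (rule b.integral_abs_sq_le[OF \<phi>])
      also have "\<dots> \<le> measure lebesgue (ball (c i) (r i)) * (8 * r i * variation_const TYPE('a) / \<beta> * E i)"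
        unfolding J_def E_def using b.coercive[OF \<beta> order_refl radius_pos[OF i] _ small[OF i] \<phi>] m radius_pos[OF i]
        by (intro mult_left_mono) (auto simp del: measure_completion)
      also have "\<dots> = K i * E i" unfolding m K_def by simp
      finally have "sqrt ((X i)\<^sup>2) \<le> sqrt (K i * E i)" by (rule real_sqrt_le_mono)
      then show ?thesis by (simp add: real_sqrt_mult)
    qed
    have "\<bar>\<Sum>i\<in>I. X i\<bar> \<le> (\<Sum>i\<in>I. sqrt (K i) * sqrt (E i))"
      by (rule order_trans[OF sum_abs]) (intro sum_mono X)
    then have "(\<Sum>i\<in>I. X i)\<^sup>2 \<le> (\<Sum>i\<in>I. sqrt (K i) * sqrt (E i))\<^sup>2"
      by (rule square_le_of_abs_le)
    also have "\<dots> \<le> (\<Sum>i\<in>I. (sqrt (K i))\<^sup>2) * (\<Sum>i\<in>I. (sqrt (E i))\<^sup>2)"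
      by (rule Cauchy_Schwarz_ineq_sum)
    also have "\<dots> = (\<Sum>i\<in>I. K i) * (\<Sum>i\<in>I. E i)"
      using Kn E by simp
    finally show "(LINT x|vol. \<phi> x)\<^sup>2 \<le> (\<Sum>i\<in>I. K i) * energy \<beta> \<phi> \<phi>"
      by (simp add: integral_vol_balls smooth_continuous \<phi> energy_balls X_def E_def)
  qed
  then show ?thesis by (simp only: K_def)
qed

text \<open>A trial function equal to 1 on ball \<open>k\<close> and 0 on the other balls has no
  gradient on the union, so its quotient is \<open>\<beta>\<close> times surface over volume of ball
  \<open>k\<close>.\<close>

lemma eigenvalue_balls_le:
  assumes \<beta>: "0 \<le> \<beta>" and k: "k \<in> I" "cball (c k) (r k) \<subseteq> cball 0 1"
    and out: "\<And>i. i \<in> I \<Longrightarrow> i \<noteq> k \<Longrightarrow> cball (c i) (r i) \<inter> ball 0 2 = {}"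
  shows "robin_eigenvalue \<beta> balls \<le> \<beta> * sphere_const TYPE('a) / (unit_ball_vol (real DIM('a)) * r k)"
proof -
  define d where "d = DIM('a)"
  define V where "V = unit_ball_vol (real d)"
  have V: "V > 0" by (simp add: V_def)
  have rk: "r k > 0" by (rule radius_pos[OF k(1)])
  obtain \<psi> :: "'a \<Rightarrow> real" where \<psi>: "smooth \<psi>" "\<And>x. norm x \<le> 1 \<Longrightarrow> \<psi> x = 1" "\<And>x. 2 \<le> norm x \<Longrightarrow> \<psi> x = 0"
    using exists_smooth_cutoff[where 'a='a] by blast
  have val: "\<psi> x = (if i = k then 1 else 0)" if "i \<in> I" "x \<in> cball (c i) (r i)" for i x
  proof (cases "i = k")
    case True
    then have "norm x \<le> 1" using that k by auto
    then show ?thesis using True \<psi>(2) by simp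
  next
    case False
    then have "x \<notin> ball 0 2" using out[OF that(1) False] that(2) by blast
    then have "2 \<le> norm x" by simp
    then show ?thesis using False \<psi>(3) by simp
  qed
  have g: "grad \<psi> x = 0" if "i \<in> I" "x \<in> ball (c i) (r i)" for i x
    using val[OF that(1)] ball_subset_cball by (intro grad_zero_on_open[OF open_ball that(2)]) blast
  have "(LINT x|vol. (\<psi> x)\<^sup>2) = (\<Sum>i\<in>I. LINT x|lebesgue_on (ball (c i) (r i)). (\<psi> x)\<^sup>2)"
    by (intro integral_vol_balls continuous_intros smooth_continuous \<psi>(1))
  also have "\<dots> = (\<Sum>i\<in>I. if i = k then V * r k ^ d else 0)"
  proof (intro sum.cong refl)
    fix i assume i: "i \<in> I"
    have "(LINT x|lebesgue_on (ball (c i) (r i)). (\<psi> x)\<^sup>2) =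
        (LINT x|lebesgue_on (ball (c i) (r i)). (if i = k then 1 else 0))"
      using val[OF i] by (intro Bochner_Integration.integral_cong) (auto simp: space_restrict_space)
    also have "\<dots> = (if i = k then measure lebesgue (ball (c i) (r i)) else 0)"
      by (simp add: space_restrict_space measure_restrict_space)
    finally show "(LINT x|lebesgue_on (ball (c i) (r i)). (\<psi> x)\<^sup>2) = (if i = k then V * r k ^ d else 0)"
      using measure_ball_lebesgue[of "r k" "c k"] rk by (auto simp: V_def d_def)
  qed
  also have "\<dots> = V * r k ^ d" using k(1) finite_index by simp
  finally have norm_\<psi>: "(LINT x|vol. (\<psi> x)\<^sup>2) = V * r k ^ d" .
  have bdk: "(LINT x|boundary_measure (ball (c k) (r k)). 1) \<le> sphere_const TYPE('a) * r k ^ (d - 1)"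
  proof -
    have "emeasure (boundary_measure (ball (c k) (r k))) (frontier (ball (c k) (r k))) \<le>
        ennreal (sphere_const TYPE('a) * r k ^ (d - 1))"
      using hausdorff_sphere[OF rk, of "c k"] rk
      by (subst emeasure_boundary_measure) (auto simp: d_def frontier_ball)
    then have "measure (boundary_measure (ball (c k) (r k))) (frontier (ball (c k) (r k))) \<le>
        sphere_const TYPE('a) * r k ^ (d - 1)"
      unfolding measure_def using rk sphere_const_pos[where 'a='a] by (intro enn2real_leI) auto
    then show ?thesis by simp
  qed
  have "energy \<beta> \<psi> \<psi> = (\<Sum>i\<in>I. lipschitz_dom.energy (ball (c i) (r i)) \<beta> \<psi> \<psi>)"
    by (rule energy_balls[OF \<psi>(1)])
  also have "\<dots> = (\<Sum>i\<in>I. if i = k then \<beta> * (LINT x|boundary_measure (ball (c k) (r k)). 1) else 0)"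
  proof (intro sum.cong refl)
    fix i assume i: "i \<in> I"
    interpret b: lipschitz_dom "ball (c i) (r i)" by (rule ball_domain[OF i])
    have "(LINT x|lebesgue_on (ball (c i) (r i)). (norm (grad \<psi> x))\<^sup>2) = (LINT x|lebesgue_on (ball (c i) (r i)). 0)"
      using g[OF i] by (intro Bochner_Integration.integral_cong) (auto simp: space_restrict_space)
    moreover have "(LINT x|boundary_measure (ball (c i) (r i)). (\<psi> x)\<^sup>2) =
        (LINT x|boundary_measure (ball (c i) (r i)). (if i = k then 1 else 0))"
      using val[OF i] radius_pos[OF i] by (intro Bochner_Integration.integral_cong) (auto simp: frontier_ball)
    ultimately show "b.energy \<beta> \<psi> \<psi> = (if i = k then \<beta> * (LINT x|boundary_measure (ball (c k) (r k)). 1) else 0)"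
      by (simp add: b.energy_self)
  qed
  also have "\<dots> = \<beta> * (LINT x|boundary_measure (ball (c k) (r k)). 1)" using k(1) finite_index by simp
  also have "\<dots> \<le> \<beta> * (sphere_const TYPE('a) * r k ^ (d - 1))" by (rule mult_left_mono[OF bdk \<beta>])
  finally have "energy \<beta> \<psi> \<psi> / (V * r k ^ d) \<le> \<beta> * (sphere_const TYPE('a) * r k ^ (d - 1)) / (V * r k ^ d)"
    using V rk by (intro divide_right_mono) auto
  also have "\<dots> = \<beta> * sphere_const TYPE('a) / (V * r k)"
  proof -
    have "r k ^ d = r k ^ (d - 1) * r k" 
      unfolding d_def using power_minus_mult[OF DIM_positive[where 'a='a], of "r k"] by simp
    then show ?thesis using rk by simp
  qed
  finally have "energy \<beta> \<psi> \<psi> / (V * r k ^ d) \<le> \<beta> * sphere_const TYPE('a) / (V * r k)" .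
  moreover have "robin_eigenvalue \<beta> balls \<le> energy \<beta> \<psi> \<psi> / (V * r k ^ d)"
    using eigenvalue_upper[OF \<beta> \<psi>(1)] V rk unfolding norm_\<psi> by simp
  ultimately show ?thesis by (simp add: V_def d_def)
qed

end

section \<open>Vanishing of the infimum\<close>

text \<open>The ball of radius \<open>R\<close> fixes the order of both quantities; the missing
  volume is supplied by balls so small that their total torsion is of no larger order.\<close>

lemma exists_domain_small_torsion:
  assumes \<beta>: "0 < \<beta>" and R: "0 < R" "R \<le> 1" "8 * R * variation_const TYPE('a::euclidean_space) * \<beta> \<le> 1"
    and vol: "unit_ball_vol (real DIM('a)) * R ^ DIM('a) < 1"
  shows "\<exists>\<Omega>::'a set. lipschitz_domain \<Omega> \<and> measure lebesgue \<Omega> = 1 \<and>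
    robin_eigenvalue \<beta> \<Omega> \<le> \<beta> * sphere_const TYPE('a) / (unit_ball_vol (real DIM('a)) * R) \<and>
    robin_torsion \<beta> \<Omega> \<le>
      8 * variation_const TYPE('a) / \<beta> * (unit_ball_vol (real DIM('a)) + 1) * R ^ Suc DIM('a)"
proof -
  define d where "d = DIM('a)"
  define V where "V = unit_ball_vol (real d)"
  have V: "V > 0" by (simp add: V_def)
  define K where "K = variation_const TYPE('a)"
  have K: "K \<ge> 1" unfolding K_def by (rule variation_const_ge_1)
  define m where "m = 1 - V * R ^ d"
  have m: "0 < m" "m \<le> 1" using vol V R by (auto simp: m_def V_def d_def)
  \<comment> \<open>Small balls of radius \<open>\<epsilon>\<close> and total volume
    \<open>m \<le> 1\<close> have torsion of order at most \<open>\<epsilon>\<close>, so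
    \<open>\<epsilon> \<le> R ^ (d + 1)\<close> matches the torsion bound of the large ball.\<close>
  define \<delta> where "\<delta> = R ^ Suc d"
  have \<delta>: "0 < \<delta>" "\<delta> \<le> R"
    using R power_le_one[of R d] by (auto simp: \<delta>_def mult_left_le)
  \<comment> \<open>Enough balls that a volume of \<open>m / N\<close> each forces the radius below
    \<open>\<delta>\<close>.\<close>
  obtain N :: nat where N: "m / (V * \<delta> ^ d) < real N" using reals_Archimedean2 by blast
  have Npos: "0 < real N"
    using N m V \<delta> by (intro le_less_trans[OF _ N]) auto
  obtain \<epsilon> where \<epsilon>: "\<epsilon> > 0" "V * \<epsilon> ^ d = m / real N"
    using exists_ball_radius[where 'a='a, of "m / real N"] m Npos by (auto simp: V_def d_def)
  have "V * \<epsilon> ^ d \<le> V * \<delta> ^ d"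
    unfolding \<epsilon> using N Npos V \<delta> by (simp add: field_simps)
  then have "\<epsilon> ^ d \<le> \<delta> ^ d" using V by simp
  then have "\<epsilon> \<le> \<delta>"
    using \<epsilon> \<delta> DIM_positive[where 'a='a] by (simp add: d_def power_mono_iff)
  then have \<epsilon>R: "\<epsilon> \<le> R" using \<delta> by simp
  obtain b :: 'a where b: "b \<in> Basis" using nonempty_Basis by blast
  \<comment> \<open>All radii are at most 1, so centres at mutual distance at least 4 separate the
    closed balls, and those with \<open>i > 0\<close> avoid the ball of radius 2 outside which the
    cutoff vanishes.\<close>
  define c where "c i = (4 * real i) *\<^sub>R b" for i :: nat
  define r where "r i = (if i = 0 then R else \<epsilon>)" for i :: nat
  have r: "0 < r i" "r i \<le> R" "r i \<le> 1" for i using R \<epsilon> \<epsilon>R by (auto simp: r_def)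
  interpret B: separated_balls "{..N}" c r
  proof
    fix i j :: nat assume "i \<noteq> j"
    then have ij: "\<bar>real i - real j\<bar> \<ge> 1" by linarith
    have "dist (c i) (c j) = norm ((4 * (real i - real j)) *\<^sub>R b)"
      by (simp add: c_def dist_norm algebra_simps)
    also have "\<dots> = 4 * \<bar>real i - real j\<bar>" unfolding norm_scaleR abs_mult using b by simp
    finally have "dist (c i) (c j) > r i + r j" using ij r(3)[of i] r(3)[of j] by (simp add: field_simps)
    then show "cball (c i) (r i) \<inter> cball (c j) (r j) = {}"
      by (intro disjoint_cballI) simp
  qed (use r in auto)
  have split: "(\<Sum>i\<le>N. f (r i)) = f R + real N * f \<epsilon>" for f :: "real \<Rightarrow> real"
  proof -
    have "(\<Sum>i\<le>N. f (r i)) = f (r 0) + (\<Sum>i\<in>{1..N}. f (r i))"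
      by (simp add: atMost_atLeast0 sum.atLeast_Suc_atMost)
    also have "(\<Sum>i\<in>{1..N}. f (r i)) = (\<Sum>i\<in>{1..N}. f \<epsilon>)" by (intro sum.cong) (auto simp: r_def)
    finally show ?thesis by (simp add: r_def)
  qed
  have N\<epsilon>: "real N * (V * \<epsilon> ^ d) = m" using \<epsilon> Npos by simp
  have "measure lebesgue B.balls = (\<Sum>i\<le>N. V * r i ^ d)"
    unfolding V_def d_def by (rule B.measure_balls)
  also have "\<dots> = 1" using N\<epsilon> by (subst split[of "\<lambda>r. V * r ^ d"]) (simp add: m_def)
  finally have M: "measure lebesgue B.balls = 1" .
  have L: "robin_eigenvalue \<beta> B.balls \<le> \<beta> * sphere_const TYPE('a) / (V * R)"
  proof -
    have "robin_eigenvalue \<beta> B.balls \<le> \<beta> * sphere_const TYPE('a) / (V * r 0)"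
      unfolding V_def d_def
    proof (rule B.eigenvalue_balls_le)
      show "cball (c 0) (r 0) \<subseteq> cball 0 1" using R by (auto simp: c_def r_def)
      show "cball (c i) (r i) \<inter> ball 0 2 = {}" if "i \<noteq> 0" for i
      proof (rule ccontr)
        assume "\<not> ?thesis"
        then obtain x where x: "dist (c i) x \<le> r i" "norm x < 2" by auto
        have "norm (c i) = 4 * real i" using b by (simp add: c_def)
        moreover have "norm (c i) \<le> dist (c i) x + norm x"
          using norm_triangle_ineq[of "c i - x" x] by (simp add: dist_norm)
        ultimately show False using x r(3)[of i] that by linarith
      qed
    qed (use \<beta> in auto)
    then show ?thesis by (simp add: r_def)
  qed
  have "robin_torsion \<beta> B.balls \<le> (\<Sum>i\<le>N. V * r i ^ d * (8 * r i * K / \<beta>))"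
    unfolding V_def d_def K_def
  proof (rule B.torsion_balls_le[OF \<beta>])
    fix i
    have "8 * r i * K * \<beta> \<le> 8 * R * K * \<beta>"
      using r[of i] K \<beta> by (intro mult_right_mono mult_left_mono) auto
    then show "8 * r i * variation_const TYPE('a) * \<beta> \<le> 1" using R(3) by (simp add: K_def)
  qed
  also have "\<dots> = V * R ^ d * (8 * R * K / \<beta>) + real N * (V * \<epsilon> ^ d) * (8 * \<epsilon> * K / \<beta>)"
    by (subst split[of "\<lambda>r. V * r ^ d * (8 * r * K / \<beta>)"]) simp
  also have "\<dots> \<le> V * R ^ d * (8 * R * K / \<beta>) + 1 * (8 * \<delta> * K / \<beta>)"
    unfolding N\<epsilon> using m \<epsilon> \<open>\<epsilon> \<le> \<delta>\<close> K \<beta>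
    by (intro add_left_mono mult_mono divide_right_mono) auto
  also have "\<dots> = 8 * K / \<beta> * (V + 1) * R ^ Suc d"
    by (simp add: \<delta>_def algebra_simps add_divide_distrib)
  finally have "robin_torsion \<beta> B.balls \<le> 8 * K / \<beta> * (V + 1) * R ^ Suc d" .
  then show ?thesis using B.lipschitz_balls M L unfolding V_def d_def K_def by blast
qed

lemma product_small:
  fixes \<beta> :: real
  assumes \<beta>: "0 < \<beta>" and q: "q > 1 / (real DIM('a::euclidean_space) + 1)" and e: "0 < e"
  shows "\<exists>\<Omega>::'a set. lipschitz_domain \<Omega> \<and> measure lebesgue \<Omega> = 1 \<and>
    robin_eigenvalue \<beta> \<Omega> * robin_torsion \<beta> \<Omega> powr q < e"
proof -
  define d where "d = DIM('a)"
  define V where "V = unit_ball_vol (real d)"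
  have V: "V > 0" by (simp add: V_def)
  define K where "K = variation_const TYPE('a)"
  have K: "K \<ge> 1" unfolding K_def by (rule variation_const_ge_1)
  define C1 where "C1 = \<beta> * sphere_const TYPE('a) / V"
  define C2 where "C2 = 8 * K / \<beta> * (V + 1)"
  have C1: "C1 > 0" using \<beta> V sphere_const_pos[where 'a='a] by (simp add: C1_def)
  have C2: "C2 > 0" using \<beta> V K by (simp add: C2_def)
  define C where "C = C1 * C2 powr q"
  have C: "C > 0" using C1 C2 by (simp add: C_def)
  \<comment> \<open>The eigenvalue contributes \<open>1 / R\<close> and the torsion
    \<open>R powr ((d + 1) * q)\<close>, so the product is at most \<open>C * R powr s\<close>, with
    \<open>s > 0\<close> exactly for \<open>q\<close> above the threshold.\<close>
  define s where "s = (real d + 1) * q - 1"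
  have s: "s > 0" using q by (simp add: s_def d_def field_simps)
  have q0: "q > 0" by (rule le_less_trans[OF _ q]) simp
  \<comment> \<open>In order: the large ball fits into the unit ball, the smallness condition of the
    torsion bound holds, the volume of the large ball is at most 1/2, and
    \<open>C * R powr s \<le> e / 2\<close>.\<close>
  define R where "R = Min {1, 1 / (8 * K * \<beta>), 1 / (2 * V), (e / (2 * C)) powr (1 / s)}"
  have R: "0 < R" using \<beta> K V C e by (simp add: R_def)
  have Rle: "R \<le> 1" "R \<le> 1 / (8 * K * \<beta>)" "R \<le> 1 / (2 * V)" "R \<le> (e / (2 * C)) powr (1 / s)"
    unfolding R_def by (rule Min_le; simp)+
  have R1: "8 * R * K * \<beta> \<le> 1" using Rle(2) \<beta> K by (simp add: field_simps)
  have "R ^ d \<le> R ^ 1" using R Rle(1) DIM_positive[where 'a='a] by (intro power_decreasing) (auto simp: d_def)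
  then have "V * R ^ d \<le> V * (1 / (2 * V))" using Rle(3) V by (intro mult_left_mono) auto
  then have R2: "V * R ^ d < 1" using V by simp
  obtain \<Omega> :: "'a set" where \<Omega>: "lipschitz_domain \<Omega>" "measure lebesgue \<Omega> = 1"
    "robin_eigenvalue \<beta> \<Omega> \<le> \<beta> * sphere_const TYPE('a) / (V * R)"
    "robin_torsion \<beta> \<Omega> \<le> C2 * R ^ Suc d"
    using exists_domain_small_torsion[where 'a='a, OF \<beta> R Rle(1)] R1 R2
    unfolding C2_def V_def d_def K_def by blast
  interpret lipschitz_dom \<Omega> by unfold_locales (rule \<Omega>(1))
  have "robin_eigenvalue \<beta> \<Omega> * robin_torsion \<beta> \<Omega> powr q \<le> (C1 / R) * (C2 * R ^ Suc d) powr q"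
  proof (intro mult_mono powr_mono2)
    show "robin_eigenvalue \<beta> \<Omega> \<le> C1 / R" using \<Omega>(3) by (simp add: C1_def)
    show "0 \<le> C1 / R" using C1 R by simp
  qed (use \<Omega>(4) q0 torsion_nonneg[OF \<beta>] in auto)
  also have "\<dots> = C * R powr s"
  proof -
    have "R ^ Suc d = R powr (real d + 1)" using powr_realpow[OF R, of "Suc d"] by (simp add: add.commute)
    then have "(C2 * R ^ Suc d) powr q = C2 powr q * R powr (s + 1)"
      using C2 R by (simp add: powr_mult powr_powr s_def)
    also have "R powr (s + 1) = R powr s * R" using R by (simp add: powr_add)
    finally show ?thesis using R by (simp add: C_def)
  qed
  also have "\<dots> \<le> C * ((e / (2 * C)) powr (1 / s)) powr s"
    using Rle(4) R s C by (intro mult_left_mono powr_mono2) auto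
  also have "\<dots> = e / 2" using s C e by (simp add: powr_powr)
  also have "\<dots> < e" using e by simp
  finally show ?thesis using \<Omega>(1,2) by blast
qed

text \<open>Provides nonemptiness of the set of products; without it a lower bound for its elements
  would say nothing about \<open>Inf\<close>.\<close>

lemma exists_admissible_domain:
  "\<exists>\<Omega>::'a::euclidean_space set. lipschitz_domain \<Omega> \<and> measure lebesgue \<Omega> = 1"
proof -
  obtain \<rho> where "\<rho> > 0" "unit_ball_vol (real DIM('a)) * \<rho> ^ DIM('a) = 1"
    using exists_ball_radius[where 'a='a, of 1] by auto
  then show ?thesis
    using lipschitz_domain_ball[of \<rho> "0::'a"] measure_ball_lebesgue[of \<rho> "0::'a"] by auto
qed

lemma robin_product_inf_pos:
  assumes "0 < \<beta>" "0 < q" "q \<le> 1 / (real DIM('a::euclidean_space) + 1)"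
  shows "robin_product_inf TYPE('a) \<beta> q > 0"
proof -
  obtain k where k: "k > 0" "\<And>\<Omega>::'a set. lipschitz_domain \<Omega> \<Longrightarrow> measure lebesgue \<Omega> = 1 \<Longrightarrow>
      k \<le> robin_eigenvalue \<beta> \<Omega> * robin_torsion \<beta> \<Omega> powr q"
    using product_lower_bound[OF assms] by blast
  have "k \<le> robin_product_inf TYPE('a) \<beta> q"
    unfolding robin_product_inf_def
    by (rule cInf_greatest) (use k(2) exists_admissible_domain[where 'a='a] in auto)
  then show ?thesis using k(1) by simp
qed

lemma robin_product_inf_eq_0:
  assumes \<beta>: "0 < \<beta>" and q: "q > 1 / (real DIM('a::euclidean_space) + 1)"
  shows "robin_product_inf TYPE('a) \<beta> q = 0"
proof (rule antisym)
  define S where "S = {robin_eigenvalue \<beta> \<Omega> * robin_torsion \<beta> \<Omega> powr q | \<Omega> :: 'a set.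
      lipschitz_domain \<Omega> \<and> measure lebesgue \<Omega> = 1}"
  have nonneg: "0 \<le> x" if "x \<in> S" for x
  proof -
    obtain \<Omega> :: "'a set" where \<Omega>: "x = robin_eigenvalue \<beta> \<Omega> * robin_torsion \<beta> \<Omega> powr q"
      "lipschitz_domain \<Omega>" "measure lebesgue \<Omega> = 1"
      using \<open>x \<in> S\<close> unfolding S_def by blast
    interpret lipschitz_dom \<Omega> by unfold_locales (rule \<Omega>(2))
    show ?thesis using eigenvalue_nonneg[of \<beta>] \<Omega>(1,3) \<beta> by simp
  qed
  show "0 \<le> robin_product_inf TYPE('a) \<beta> q"
    unfolding robin_product_inf_def S_def[symmetric]
    by (rule cInf_greatest) (use nonneg exists_admissible_domain[where 'a='a] in \<open>auto simp: S_def\<close>)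
  show "robin_product_inf TYPE('a) \<beta> q \<le> 0"
  proof (rule field_le_epsilon)
    fix e :: real assume "0 < e"
    then obtain x where x: "x \<in> S" "x < e" using product_small[OF \<beta> q] unfolding S_def by blast
    \<comment> \<open>On the reals, \<open>Inf\<close> is known to be a lower bound only for sets
      bounded below; nonnegativity of the products provides this.\<close>
    have "bdd_below S" using nonneg by (rule bdd_belowI)
    then have "Inf S \<le> x" using x(1) by (intro cInf_lower)
    then show "robin_product_inf TYPE('a) \<beta> q \<le> 0 + e"
      unfolding robin_product_inf_def S_def[symmetric] using x(2) by simp
  qed
qed

theorem theorem4p1:
  fixes \<beta> :: real
  assumes "0 < \<beta>"
  shows "(\<forall>q. q > 1 / (real CARD('d::finite) + 1) \<longrightarrow>
             robin_product_inf TYPE(real ^ 'd) \<beta> q = 0) \<and>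
         (\<forall>q. 0 < q \<and> q \<le> 1 / (real CARD('d) + 1) \<longrightarrow>
             robin_product_inf TYPE(real ^ 'd) \<beta> q > 0)"
  using robin_product_inf_eq_0[OF assms, where 'a = "real ^ 'd"]
    robin_product_inf_pos[OF assms, where 'a = "real ^ 'd"] by simp

end
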